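(* Let $X\subset\mathbb{P}^n$, $n\ge 2$, be a smooth quadric hypersurface over $k$ with a generically free action of a finite group $G$. Let $G_2\subseteq G$ be a $2$-Sylow subgroup. Then the $G$-action on $X$ is stably linearizable if and only if the $G_2$-action on $X$ is stably linearizable.
   Context: The base field $k$ is algebraically closed of characteristic zero. Finite groups acting on a quadric hypersurface $X\subset \mathbb{P}^n$ are taken to act regularly, through subgroups of $\mathsf{PGL}_{n+1}$ preserving $X$. For a finite group $G$, a smooth variety $X$ over $k$ with a generically free regular action of $G$ is called linearizable if there is a $G$-equivariant birational map $\mathbb{P}(V)\dashrightarrow X$ for some linear representation $V$ of $G$. It is called stably linearizable if $X\times\mathbb{P}^m$, with trivial action on the second factor, is linearizable for some $m$. *)

theory Defs
  imports
    "HOL-Analysis.Abstract_Topology"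
    "HOL-Library.Poly_Mapping"
    "HOL-Computational_Algebra.Polynomial"
    "HOL-Algebra.Coset"
    "HOL-Algebra.Group_Action"
    "Jordan_Normal_Form.Matrix"
begin

section \<open>Polynomials in several variables\<close>

text \<open>A monomial is a finitely supported exponent function on the variables
  \<open>x\<^sub>0, x\<^sub>1, \<dots>\<close>; a polynomial is a finitely supported coefficient function
  on monomials.\<close>

type_synonym 'k mpoly = "(nat \<Rightarrow>\<^sub>0 nat) \<Rightarrow>\<^sub>0 'k"

definition eval_mpoly :: "'k::comm_ring_1 mpoly \<Rightarrow> 'k vec \<Rightarrow> 'k" where
  "eval_mpoly p v =
    (\<Sum>m\<in>Poly_Mapping.keys p. Poly_Mapping.lookup p m *
      (\<Prod>i\<in>Poly_Mapping.keys m. (v $ i) ^ Poly_Mapping.lookup m i))"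

text \<open>Homogeneous of degree \<open>d\<close> in \<open>x\<^sub>0, \<dots>, x\<^sub>n\<close>; the zero polynomial is included.\<close>

definition homogeneous :: "nat \<Rightarrow> nat \<Rightarrow> 'k::comm_ring_1 mpoly \<Rightarrow> bool" where
  "homogeneous n d p \<longleftrightarrow>
    (\<forall>m\<in>Poly_Mapping.keys p. Poly_Mapping.keys m \<subseteq> {..n} \<and>
      (\<Sum>i\<in>Poly_Mapping.keys m. Poly_Mapping.lookup m i) = d)"

definition partial_deriv :: "nat \<Rightarrow> 'k::comm_ring_1 mpoly \<Rightarrow> 'k mpoly" where
  "partial_deriv i p =
    (\<Sum>m\<in>Poly_Mapping.keys p.
      Poly_Mapping.single (m - Poly_Mapping.single i 1)
        (of_nat (Poly_Mapping.lookup m i) * Poly_Mapping.lookup p m))"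

section \<open>Spaces with functions\<close>

text \<open>Varieties are treated as spaces with functions: a topological space together with the set
  \<open>regular X U\<close> of regular functions on each open \<open>U\<close>. Functions are total, and only their
  values on \<open>U\<close> matter.\<close>

record ('p, 'k) fun_space =
  topol :: "'p topology"
  regular :: "'p set \<Rightarrow> ('p \<Rightarrow> 'k) set"

definition open_subspace :: "('p, 'k) fun_space \<Rightarrow> 'p set \<Rightarrow> ('p, 'k) fun_space" where
  "open_subspace X U =
    \<lparr>topol = subtopology (topol X) U,
     regular = (\<lambda>W. if openin (subtopology (topol X) U) W then regular X W else {})\<rparr>"

definition morphism ::
  "('p, 'k) fun_space \<Rightarrow> ('q, 'k) fun_space \<Rightarrow> ('p \<Rightarrow> 'q) \<Rightarrow> bool" where
  "morphism X Y f \<longleftrightarrow> continuous_map (topol X) (topol Y) f \<and>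
    (\<forall>V h. openin (topol Y) V \<and> h \<in> regular Y V \<longrightarrow>
      h \<circ> f \<in> regular X {x \<in> topspace (topol X). f x \<in> V})"

definition dense_open :: "('p, 'k) fun_space \<Rightarrow> 'p set \<Rightarrow> bool" where
  "dense_open X U \<longleftrightarrow> openin (topol X) U \<and> (topol X) closure_of U = topspace (topol X)"

text \<open>Products of varieties as in Springer's \<open>Linear Algebraic Groups\<close>, 1.5: the topology of
  \<open>X \<times> Y\<close> has the nonvanishing loci of the functions \<open>\<Sum>\<^sub>i f\<^sub>i(x) g\<^sub>i(y)\<close> as a basis (so it is
  not the product topology), and regular functions are locally quotients of such functions.\<close>

definition tensor_functions ::
  "('p, 'k::field) fun_space \<Rightarrow> ('q, 'k) fun_space \<Rightarrow> 'p set \<Rightarrow> 'q set \<Rightarrow> ('p \<times> 'q \<Rightarrow> 'k) set" where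
  "tensor_functions X Y U V =
    {(\<lambda>(x, y). \<Sum>i<r. f i x * g i y) | (r::nat) f g.
      \<forall>i<r. f i \<in> regular X U \<and> g i \<in> regular Y V}"

definition product_topol ::
  "('p, 'k::field) fun_space \<Rightarrow> ('q, 'k) fun_space \<Rightarrow> ('p \<times> 'q) topology" where
  "product_topol X Y = topology_generated_by
    {{z \<in> U \<times> V. h z \<noteq> 0} | U V h.
      openin (topol X) U \<and> openin (topol Y) V \<and> h \<in> tensor_functions X Y U V}"

definition product_space ::
  "('p, 'k::field) fun_space \<Rightarrow> ('q, 'k) fun_space \<Rightarrow> ('p \<times> 'q, 'k) fun_space" where
  "product_space X Y =
    \<lparr>topol = product_topol X Y,
     regular = (\<lambda>W. {f. openin (product_topol X Y) W \<and>
       (\<forall>z\<in>W. \<exists>N U V g h. openin (product_topol X Y) N \<and> z \<in> N \<and> N \<subseteq> W \<and>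
          openin (topol X) U \<and> openin (topol Y) V \<and> N \<subseteq> U \<times> V \<and>
          g \<in> tensor_functions X Y U V \<and> h \<in> tensor_functions X Y U V \<and>
          (\<forall>w\<in>N. h w \<noteq> 0 \<and> f w = g w / h w))})\<rparr>"

section \<open>Projective varieties\<close>

text \<open>A point of \<open>\<P>\<^sup>n\<close> is the set of its homogeneous coordinate vectors, i.e. a line in
  \<open>k\<^sup>n\<^sup>+\<^sup>1\<close> without the origin.\<close>

definition proj_points :: "nat \<Rightarrow> 'k::field vec set set" where
  "proj_points n =
    {{c \<cdot>\<^sub>v v | c. c \<noteq> 0} | v. v \<in> carrier_vec (n + 1) \<and> v \<noteq> 0\<^sub>v (n + 1)}"

definition zariski :: "nat \<Rightarrow> 'k::field vec set topology" where
  "zariski n = topology_generated_by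
    {{p \<in> proj_points n. \<forall>v\<in>p. eval_mpoly h v \<noteq> 0} | h d. homogeneous n d h}"

text \<open>The structure induced on a subset of \<open>\<P>\<^sup>n\<close>: regular functions are locally quotients of
  homogeneous polynomials of the same degree.\<close>

definition proj_variety :: "nat \<Rightarrow> 'k::field vec set set \<Rightarrow> ('k vec set, 'k) fun_space" where
  "proj_variety n X =
    \<lparr>topol = subtopology (zariski n) X,
     regular = (\<lambda>U. {f. openin (subtopology (zariski n) X) U \<and>
       (\<forall>p\<in>U. \<exists>W d g h. openin (subtopology (zariski n) X) W \<and> p \<in> W \<and> W \<subseteq> U \<and>
          homogeneous n d g \<and> homogeneous n d h \<and>
          (\<forall>x\<in>W. \<forall>v\<in>x. eval_mpoly h v \<noteq> 0 \<and> f x = eval_mpoly g v / eval_mpoly h v))})\<rparr>"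

definition proj_space :: "nat \<Rightarrow> ('k::field vec set, 'k) fun_space" where
  "proj_space n = proj_variety n (proj_points n)"

text \<open>Smoothness is the Jacobian criterion for the scheme defined by \<open>q\<close>; in particular double
  hyperplanes are excluded.\<close>

definition smooth_quadric_hypersurface :: "nat \<Rightarrow> 'k::field vec set set \<Rightarrow> bool" where
  "smooth_quadric_hypersurface n X \<longleftrightarrow>
    (\<exists>q. q \<noteq> 0 \<and> homogeneous n 2 q \<and>
      X = {p \<in> proj_points n. \<forall>v\<in>p. eval_mpoly q v = 0} \<and>
      (\<forall>p\<in>X. \<forall>v\<in>p. \<exists>i\<le>n. eval_mpoly (partial_deriv i q) v \<noteq> 0))"

section \<open>Group actions\<close>

definition GL :: "nat \<Rightarrow> 'k::field mat monoid" where
  "GL N = units_of (ring_mat TYPE('k) N ())"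

definition scalars :: "nat \<Rightarrow> 'k::field mat set" where
  "scalars N = {c \<cdot>\<^sub>m 1\<^sub>m N | c. c \<noteq> 0}"

definition PGL :: "nat \<Rightarrow> 'k::field mat set monoid" where
  "PGL N = GL N Mod scalars N"

text \<open>Elements of \<open>PGL\<close> are cosets and points are sets of coordinate vectors, so the class of
  \<open>A\<close> sends the class of \<open>v\<close> to the set of all products of representatives, which is the class
  of \<open>A v\<close>.\<close>

definition pgl_act :: "'k::field mat set \<Rightarrow> 'k vec set \<Rightarrow> 'k vec set" where
  "pgl_act C p = {A *\<^sub>v v | A v. A \<in> C \<and> v \<in> p}"

definition proj_action ::
  "('g, 'a) monoid_scheme \<Rightarrow> nat \<Rightarrow> 'k::field vec set set \<Rightarrow> ('g \<Rightarrow> 'k mat set) \<Rightarrow> bool" where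
  "proj_action G n X \<rho> \<longleftrightarrow>
    \<rho> \<in> hom G (PGL (n + 1)) \<and> (\<forall>g\<in>carrier G. pgl_act (\<rho> g) ` X = X)"

definition generically_free ::
  "('g, 'a) monoid_scheme \<Rightarrow> ('p, 'k) fun_space \<Rightarrow> ('g \<Rightarrow> 'p \<Rightarrow> 'p) \<Rightarrow> bool" where
  "generically_free G X \<phi> \<longleftrightarrow>
    (\<exists>U. dense_open X U \<and> (\<forall>x\<in>U. stabilizer G \<phi> x = {\<one>\<^bsub>G\<^esub>}))"

definition sylow_subgroup :: "nat \<Rightarrow> 'g set \<Rightarrow> ('g, 'a) monoid_scheme \<Rightarrow> bool" where
  "sylow_subgroup p H G \<longleftrightarrow> subgroup H G \<and> card H = p ^ multiplicity p (order G)"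

section \<open>Birational maps and linearizability\<close>

text \<open>A rational map is represented by a pair \<open>(U, f)\<close>; two such pairs represent the same map
  if the functions agree where both are defined.\<close>

definition rational_map ::
  "('p, 'k) fun_space \<Rightarrow> ('q, 'k) fun_space \<Rightarrow> 'p set \<Rightarrow> ('p \<Rightarrow> 'q) \<Rightarrow> bool" where
  "rational_map X Y U f \<longleftrightarrow> dense_open X U \<and> morphism (open_subspace X U) Y f"

text \<open>The composition \<open>(V, g) \<circ> (U, f)\<close> is defined as a rational map and equals the identity.\<close>

definition rational_left_inverse ::
  "('p, 'k) fun_space \<Rightarrow> 'p set \<Rightarrow> ('p \<Rightarrow> 'q) \<Rightarrow> 'q set \<Rightarrow> ('q \<Rightarrow> 'p) \<Rightarrow> bool" where
  "rational_left_inverse X U f V g \<longleftrightarrow>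
    dense_open X {x \<in> U. f x \<in> V} \<and> (\<forall>x\<in>U. f x \<in> V \<longrightarrow> g (f x) = x)"

definition birational_map ::
  "('p, 'k) fun_space \<Rightarrow> ('q, 'k) fun_space \<Rightarrow> 'p set \<Rightarrow> ('p \<Rightarrow> 'q) \<Rightarrow> bool" where
  "birational_map X Y U f \<longleftrightarrow> rational_map X Y U f \<and>
    (\<exists>V g. rational_map Y X V g \<and>
      rational_left_inverse X U f V g \<and> rational_left_inverse Y V g U f)"

definition rationally_equivariant ::
  "('g, 'a) monoid_scheme \<Rightarrow> ('g \<Rightarrow> 'p \<Rightarrow> 'p) \<Rightarrow> ('g \<Rightarrow> 'q \<Rightarrow> 'q) \<Rightarrow> 'p set \<Rightarrow> ('p \<Rightarrow> 'q) \<Rightarrow> bool"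
  where
  "rationally_equivariant G \<phi> \<psi> U f \<longleftrightarrow>
    (\<forall>g\<in>carrier G. \<forall>x\<in>U. \<phi> g x \<in> U \<longrightarrow> f (\<phi> g x) = \<psi> g (f x))"

text \<open>The representation \<open>V\<close> is given in coordinates as \<open>\<sigma> : G \<rightarrow> GL\<^sub>r\<^sub>+\<^sub>1(k)\<close>, so that
  \<open>\<P>(V) = \<P>\<^sup>r\<close>.\<close>

definition linearizable ::
  "('g, 'a) monoid_scheme \<Rightarrow> ('p, 'k::field) fun_space \<Rightarrow> ('g \<Rightarrow> 'p \<Rightarrow> 'p) \<Rightarrow> bool" where
  "linearizable G X \<phi> \<longleftrightarrow>
    (\<exists>r (\<sigma> :: 'g \<Rightarrow> 'k mat) U f. \<sigma> \<in> hom G (GL (r + 1)) \<and>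
      birational_map (proj_space r) X U f \<and>
      rationally_equivariant G (\<lambda>g p. (\<lambda>v. \<sigma> g *\<^sub>v v) ` p) \<phi> U f)"

definition stably_linearizable ::
  "('g, 'a) monoid_scheme \<Rightarrow> ('p, 'k::field) fun_space \<Rightarrow> ('g \<Rightarrow> 'p \<Rightarrow> 'p) \<Rightarrow> bool" where
  "stably_linearizable G X \<phi> \<longleftrightarrow>
    (\<exists>m. linearizable G (product_space X (proj_space m)) (\<lambda>g (x, y). (\<phi> g x, y)))"

end

theory Submission
  imports
    Defs
    "Jordan_Normal_Form.Char_Poly"
    "HOL-Algebra.Left_Coset"
begin

text \<open>The nontrivial direction is an equivariant form of Springer's theorem that a quadratic form with
  a zero over an extension of odd degree has a zero over the ground field. Lift the action to
  isometries of the quadratic form (up to sign), and let \<open>W = k\<^sup>G\<close> be the regular representation.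
  If \<open>X \<times> \<P>\<^sup>m\<close> is \<open>G\<^sub>2\<close>-equivariantly birational to \<open>\<P>(V)\<close>, then composing a \<open>G\<^sub>2\<close>-equivariant polynomial
  map \<open>W \<rightarrow> V\<close> with \<open>\<P>(V) \<rightarrow> X \<times> \<P>\<^sup>m \<rightarrow> X\<close> gives a zero of the form over \<open>k(W)\<close> that is
  \<open>G\<^sub>2\<close>-invariant up to scalars. Springer's descent, carried out with invariant polynomials, turns it
  into a \<open>G\<close>-invariant zero because \<open>G\<^sub>2\<close> has odd index, that is, into a \<open>G\<close>-equivariant rational
  map \<open>Z\<close> from \<open>W\<close> to \<open>X\<close>. Stereographic projection from \<open>Z(w)\<close> and an equivariant frame of
  \<open>k\<^sup>d\<close> over \<open>W\<close> identify \<open>W \<times> X\<close> birationally with \<open>W \<times> k\<^sup>n\<^sup>-\<^sup>1\<close>, where \<open>G\<close> acts trivially on \<open>k\<^sup>n\<^sup>-\<^sup>1\<close>. As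
  \<open>G\<close> acts generically freely on \<open>X\<close>, the no-name lemma identifies \<open>W \<times> X\<close> with \<open>X \<times> k\<^sup>N\<close>, \<open>N = |G|\<close>,
  with trivial action on \<open>k\<^sup>N\<close>. Hence \<open>X \<times> \<P>\<^sup>N\<close> is linearizable.\<close>

hide_const (open) module.smult
no_notation subset_mset (infix "<#" 50)

section \<open>Descent along odd extensions\<close>

text \<open>The descent never passes to the fixed field of \<open>k(W)\<close>. It stays over
  \<open>k(W)\<close> with its semilinear action of \<open>G\<close> and treats a zero as a
  projective point, so every invariance holds up to scalars. The obstacle is that \<open>G\<close>
  acts through \<open>PGL\<close>: its lifts to isometries multiply only up to sign, so
  \<open>k^d\<close> need not be a representation of \<open>G\<close>. The sign is removed in three
  places. Among the translates of a zero along the cosets it disappears on dividing by a product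
  over all cosets, because their number is odd; the odd index thus serves both this and the parity
  in Springer's argument. In the frame of \<open>k^d\<close> it is absorbed by the scalar
  \<open>Lam\<close>, whose failure to be a cocycle is the same sign. In the frame for
  \<open>W\<close> it is invisible because the separating forms have even degree. Birationality is
  shown by explicit mutually inverse formulas on explicit open sets; these are dense by
  irreducibility, which comes from joining points by rational curves.\<close>

definition qf :: "nat \<Rightarrow> (nat \<Rightarrow> nat \<Rightarrow> 'r::comm_ring_1) \<Rightarrow> (nat \<Rightarrow> 'r) \<Rightarrow> 'r" where
  "qf d Q x = (\<Sum>i<d. \<Sum>j<d. Q i j * x i * x j)"

text \<open>Vectors and matrices are plain functions on \<open>nat\<close> with an explicit size
  \<open>d\<close>, over any commutative ring, so that the same formulas serve over
  \<open>k\<close>, over polynomial functions, over their fraction field and over polynomials in one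
  variable.\<close>

definition mv :: "nat \<Rightarrow> (nat \<Rightarrow> nat \<Rightarrow> 'r::comm_ring_1) \<Rightarrow> (nat \<Rightarrow> 'r) \<Rightarrow> nat \<Rightarrow> 'r" where
  "mv d A x i = (\<Sum>j<d. A i j * x j)"

text \<open>The matrix identity A^T Q A = Q, required for indices below \<open>d\<close>
  only.\<close>

definition isometry :: "nat \<Rightarrow> (nat \<Rightarrow> nat \<Rightarrow> 'r::comm_ring_1) \<Rightarrow> (nat \<Rightarrow> nat \<Rightarrow> 'r) \<Rightarrow> bool" where
  "isometry d Q A \<longleftrightarrow> (\<forall>k<d. \<forall>l<d. (\<Sum>i<d. \<Sum>j<d. Q i j * A i k * A j l) = Q k l)"

lemma mult_sum_mult_sum:
  fixes q :: "'r::comm_ring_1"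
  shows "q * sum f A * sum g B = (\<Sum>k\<in>A. \<Sum>l\<in>B. q * f k * g l)"
  by (subst sum_distrib_left, rule sum_product)

lemma qf_mv: "qf d Q (mv d A x) = qf d (\<lambda>k l. \<Sum>i<d. \<Sum>j<d. Q i j * A i k * A j l) x"
proof -
  have "qf d Q (mv d A x) = (\<Sum>i<d. \<Sum>j<d. \<Sum>k<d. \<Sum>l<d. Q i j * A i k * A j l * x k * x l)"
    unfolding qf_def mv_def mult_sum_mult_sum
    by (rule sum.cong[OF refl], rule sum.cong[OF refl], rule sum.cong[OF refl], rule sum.cong[OF refl]) (simp add: mult_ac)
  also have "\<dots> = (\<Sum>k<d. \<Sum>l<d. \<Sum>i<d. \<Sum>j<d. Q i j * A i k * A j l * x k * x l)"
  proof -
    have "(\<Sum>i<d. \<Sum>j<d. \<Sum>k<d. \<Sum>l<d. F i j k l) = (\<Sum>k<d. \<Sum>l<d. \<Sum>i<d. \<Sum>j<d. F i j k l)" for F :: "nat \<Rightarrow> nat \<Rightarrow> nat \<Rightarrow> nat \<Rightarrow> 'a"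
    proof -
      have "(\<Sum>i<d. \<Sum>j<d. \<Sum>k<d. \<Sum>l<d. F i j k l) = (\<Sum>i<d. \<Sum>k<d. \<Sum>j<d. \<Sum>l<d. F i j k l)"
        by (rule sum.cong[OF refl], rule sum.swap)
      also have "\<dots> = (\<Sum>k<d. \<Sum>i<d. \<Sum>j<d. \<Sum>l<d. F i j k l)"
        by (rule sum.swap)
      also have "\<dots> = (\<Sum>k<d. \<Sum>i<d. \<Sum>l<d. \<Sum>j<d. F i j k l)"
        by (rule sum.cong[OF refl], rule sum.cong[OF refl], rule sum.swap)
      also have "\<dots> = (\<Sum>k<d. \<Sum>l<d. \<Sum>i<d. \<Sum>j<d. F i j k l)"
        by (rule sum.cong[OF refl], rule sum.swap)
      finally show ?thesis .
    qed
    then show ?thesis .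
  qed
  finally show ?thesis unfolding qf_def by (simp only: sum_distrib_right)
qed

lemma qf_isometry:
  assumes "isometry d Q A"
  shows "qf d Q (mv d A x) = qf d Q x"
  unfolding qf_mv using assms by (simp add: qf_def isometry_def)

lemma mv_mv:
  "mv d A (mv d B x) i = (\<Sum>l<d. (\<Sum>j<d. A i j * B j l) * x l)"
  unfolding mv_def sum_distrib_left sum_distrib_right by (subst sum.swap) (simp add: mult_ac)

lemma qf_scale: "qf d Q (\<lambda>i. c * x i) = c ^ 2 * qf d Q x"
  by (simp add: qf_def sum_distrib_left power2_eq_square mult_ac)

lemma qf_cong: "(\<And>i. i < d \<Longrightarrow> x i = y i) \<Longrightarrow> qf d Q x = qf d Q y"
  by (simp add: qf_def)

lemma mv_cong: "(\<And>i. i < d \<Longrightarrow> x i = y i) \<Longrightarrow> mv d A x = mv d A y"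
  by (simp add: mv_def fun_eq_iff)

lemma mv_scale: "mv d A (\<lambda>i. c * x i) i = c * mv d A x i"
  by (simp add: mv_def sum_distrib_left mult_ac)

lemma (in comm_ring_hom) qf_hom: "hom (qf d Q x) = qf d (\<lambda>i j. hom (Q i j)) (\<lambda>i. hom (x i))"
  by (simp add: qf_def hom_sum hom_mult)

lemma (in comm_ring_hom) isometry_hom:
  "isometry d Q A \<Longrightarrow> isometry d (\<lambda>i j. hom (Q i j)) (\<lambda>i j. hom (A i j))"
  unfolding isometry_def by (simp flip: hom_mult hom_sum)

lemma dvd_qf_diff:
  assumes "\<And>i. i < d \<Longrightarrow> p dvd x i - y i"
  shows "p dvd qf d Q x - qf d Q y"
proof -
  have *: "p dvd Q i j * x i * x j - Q i j * y i * y j" if "i < d" "j < d" for i j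
  proof -
    have "Q i j * x i * x j - Q i j * y i * y j = Q i j * x i * (x j - y j) + Q i j * y j * (x i - y i)"
      by (simp add: algebra_simps)
    then show ?thesis
      using assms that by (metis dvd_add dvd_mult)
  qed
  show ?thesis
    unfolding qf_def sum_subtractf[symmetric] by (intro dvd_sum) (auto intro: *)
qed

text \<open>An element of least degree in the ideal generated by the \<open>x i\<close> divides each
  of them, since remainders stay in the ideal. It is made monic so that later it is fixed exactly
  and not just up to a unit.\<close>

lemma poly_bezout_family:
  fixes x :: "nat \<Rightarrow> 'l::field poly"
  assumes "\<exists>i<d. x i \<noteq> 0"
  obtains g u where "lead_coeff g = 1" "\<And>i. i < d \<Longrightarrow> g dvd x i" "g = (\<Sum>i<d. u i * x i)"
proof -
  define I where "I = {(\<Sum>i<d. u i * x i) | u. True}"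
  have x_in: "x i \<in> I" if "i < d" for i
  proof -
    have "(\<Sum>j<d. (if j = i then 1 else 0) * x j) = x i"
      using that by (simp add: if_distrib[of "\<lambda>a. a * _"] cong: if_cong)
    then show ?thesis
      unfolding I_def mem_Collect_eq by (intro exI[of _ "\<lambda>j. if j = i then 1 else 0"]) simp
  qed
  obtain g0 where g0: "g0 \<in> I" "g0 \<noteq> 0" and min: "\<And>h. h \<in> I \<Longrightarrow> h \<noteq> 0 \<Longrightarrow> degree g0 \<le> degree h"
  proof -
    obtain i where "i < d" "x i \<noteq> 0" using assms by auto
    then have "x i \<in> I \<and> x i \<noteq> 0" using x_in by simp
    from ex_has_least_nat[of "\<lambda>h. h \<in> I \<and> h \<noteq> 0", OF this, of degree] that show thesis by metis
  qed
  obtain u0 where u0: "g0 = (\<Sum>i<d. u0 i * x i)" using g0 by (auto simp: I_def)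
  have dvd: "g0 dvd x i" if "i < d" for i
  proof -
    have "x i mod g0 \<in> I"
    proof -
      obtain v where v: "x i = (\<Sum>j<d. v j * x j)" using x_in[OF \<open>i < d\<close>] unfolding I_def by blast
      have "x i mod g0 = x i - (x i div g0) * g0" by (simp add: minus_div_mult_eq_mod)
      also have "\<dots> = (\<Sum>j<d. v j * x j) - (x i div g0) * (\<Sum>j<d. u0 j * x j)"
        by (simp only: u0[symmetric] v[symmetric])
      also have "\<dots> = (\<Sum>j<d. (v j - (x i div g0) * u0 j) * x j)"
        by (simp add: sum_distrib_left sum_subtractf algebra_simps)
      finally show ?thesis unfolding I_def mem_Collect_eq by (intro exI[of _ "\<lambda>j. v j - (x i div g0) * u0 j"]) simp
    qed
    then have "x i mod g0 = 0"
      using min[of "x i mod g0"] degree_mod_less[of g0 "x i"] g0(2) by (meson leD)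
    then show ?thesis by auto
  qed
  define c where "c = inverse (lead_coeff g0)"
  have c: "c \<noteq> 0" using g0 by (simp add: c_def)
  show ?thesis
  proof (rule that[of "smult c g0" "\<lambda>i. smult c (u0 i)"])
    show "lead_coeff (smult c g0) = 1" using g0 by (simp add: c_def)
    show "smult c g0 dvd x i" if "i < d" for i using dvd[OF that] c by (simp add: smult_dvd)
    show "smult c g0 = (\<Sum>i<d. smult c (u0 i) * x i)"
      using arg_cong[OF u0, of "smult c"] by (simp add: smult_sum2)
  qed
qed

lemma poly_vec_degree:
  fixes x :: "nat \<Rightarrow> 'l::field poly"
  assumes "\<exists>i<d. x i \<noteq> 0"
  obtains e where "\<And>i. i < d \<Longrightarrow> degree (x i) \<le> e" "\<exists>i<d. coeff (x i) e \<noteq> 0"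
proof -
  define D where "D = (\<lambda>i. degree (x i)) ` {i. i < d \<and> x i \<noteq> 0}"
  have D: "finite D" "D \<noteq> {}" using assms by (auto simp: D_def)
  obtain k where k: "k < d" "x k \<noteq> 0" "Max D = degree (x k)"
    using Max_in[OF D] by (auto simp: D_def)
  show thesis
  proof (rule that[of "Max D"])
    show "degree (x i) \<le> Max D" if "i < d" for i
    proof (cases "x i = 0")
      case False
      then show ?thesis using that D by (intro Max_ge) (auto simp: D_def)
    qed simp
    show "\<exists>i<d. coeff (x i) (Max D) \<noteq> 0" using k by (intro exI[of _ k]) auto
  qed
qed

text \<open>If the vector of coefficients in degree \<open>e\<close> is not a zero of the form, then
  the form at \<open>x\<close> has the even degree \<open>2 * e\<close>. This is the source of the
  parity in Springer's argument.\<close>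

lemma poly_qf_degree:
  fixes x :: "nat \<Rightarrow> 'l::field poly"
  assumes "\<And>i. i < d \<Longrightarrow> degree (x i) \<le> e"
  shows "degree (qf d (\<lambda>i j. [:Q i j:]) x) \<le> 2 * e"
    and "coeff (qf d (\<lambda>i j. [:Q i j:]) x) (2 * e) = qf d Q (\<lambda>i. coeff (x i) e)"
proof -
  have c: "degree ([:Q i j:] * x i * x j) \<le> 2 * e"
      "coeff ([:Q i j:] * x i * x j) (2 * e) = Q i j * coeff (x i) e * coeff (x j) e"
    if ij: "i < d" "j < d" for i j
  proof -
    have "degree (x i * x j) \<le> 2 * e"
      using degree_mult_le[of "x i" "x j"] assms[OF ij(1)] assms[OF ij(2)] by linarith
    then show "degree ([:Q i j:] * x i * x j) \<le> 2 * e"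
      using degree_smult_le[of "Q i j" "x i * x j"] by (simp add: mult.assoc)
    have "coeff (x i * x j) (2 * e) = coeff (x i) e * coeff (x j) e"
    proof (cases "degree (x i) = e \<and> degree (x j) = e")
      case True
      then show ?thesis using coeff_mult_degree_sum[of "x i" "x j"] by (simp add: mult_2)
    next
      case False
      then have "degree (x i) < e \<or> degree (x j) < e" using assms[OF ij(1)] assms[OF ij(2)] by linarith
      moreover have "degree (x i * x j) < 2 * e" if "degree (x i) < e \<or> degree (x j) < e"
        using that degree_mult_le[of "x i" "x j"] assms[OF ij(1)] assms[OF ij(2)] by linarith
      ultimately show ?thesis by (auto simp: coeff_eq_0)
    qed
    then show "coeff ([:Q i j:] * x i * x j) (2 * e) = Q i j * coeff (x i) e * coeff (x j) e"
      by (simp add: mult.assoc)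
  qed
  show "degree (qf d (\<lambda>i j. [:Q i j:]) x) \<le> 2 * e"
    unfolding qf_def by (intro degree_sum_le finite_lessThan) (simp_all only: c lessThan_iff)
  show "coeff (qf d (\<lambda>i j. [:Q i j:]) x) (2 * e) = qf d Q (\<lambda>i. coeff (x i) e)"
    unfolding qf_def coeff_sum by (rule sum.cong[OF refl], rule sum.cong[OF refl]) (simp only: c lessThan_iff)
qed

text \<open>\<open>S\<close> is a bare set because Springer's descent treats its elements one at a
  time; the group law enters in \<open>twisted_action\<close>.\<close>

locale isometric_action =
  fixes S :: "'g set" and \<phi> :: "'g \<Rightarrow> 'l::field \<Rightarrow> 'l" and d :: nat
    and Q :: "nat \<Rightarrow> nat \<Rightarrow> 'l" and A :: "'g \<Rightarrow> nat \<Rightarrow> nat \<Rightarrow> 'l"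
  assumes field_hom: "g \<in> S \<Longrightarrow> field_hom (\<phi> g)"
    and Q_fixed: "g \<in> S \<Longrightarrow> \<phi> g (Q i j) = Q i j"
    and isometry: "g \<in> S \<Longrightarrow> isometry d Q (A g)"
begin

abbreviation "qp \<equiv> qf d (\<lambda>i j. [:Q i j:])"
abbreviation "Ap g \<equiv> (\<lambda>i j. [:A g i j:])"
abbreviation "\<phi>p g \<equiv> map_poly (\<phi> g)"

text \<open>Invariance up to scalars, that is, invariance of the projective point with these homogeneous
  coordinates over \<open>L(t)\<close> and over \<open>L\<close>.\<close>

definition pinv :: "(nat \<Rightarrow> 'l poly) \<Rightarrow> bool" where
  "pinv x \<longleftrightarrow> (\<forall>g\<in>S. \<exists>c. c \<noteq> 0 \<and> (\<forall>i<d. mv d (Ap g) (\<lambda>j. \<phi>p g (x j)) i = smult c (x i)))"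

definition cinv :: "(nat \<Rightarrow> 'l) \<Rightarrow> bool" where
  "cinv x \<longleftrightarrow> (\<forall>g\<in>S. \<exists>c. c \<noteq> 0 \<and> (\<forall>i<d. mv d (A g) (\<lambda>j. \<phi> g (x j)) i = c * x i))"

lemma poly_hom:
  assumes "g \<in> S" shows "map_poly_inj_idom_hom (\<phi> g)"
proof -
  interpret field_hom "\<phi> g" using assms by (rule field_hom)
  show ?thesis ..
qed

text \<open>\<open>Q\<close> is fixed by \<open>\<phi> g\<close> and preserved by
  \<open>A g\<close>, so only the scalar of \<open>x\<close> survives, squared. Cofactors of an
  invariant divisor of \<open>qp x\<close> inherit this behaviour.\<close>

lemma qp_invariant:
  assumes "g \<in> S" "\<And>i. i < d \<Longrightarrow> mv d (Ap g) (\<lambda>j. \<phi>p g (x j)) i = smult c (x i)"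
  shows "\<phi>p g (qp x) = smult (c ^ 2) (qp x)"
proof -
  interpret base: field_hom "\<phi> g" using assms(1) by (rule field_hom)
  interpret map_poly_inj_idom_hom "\<phi> g" ..
  interpret pc: comm_ring_hom "\<lambda>a::'l. [:a:]" by unfold_locales (auto simp: one_pCons)
  have iso: "isometry d (\<lambda>i j. [:Q i j:]) (Ap g)"
    using isometry[OF assms(1)] by (rule pc.isometry_hom)
  have "\<phi>p g (qp x) = qf d (\<lambda>i j. \<phi>p g [:Q i j:]) (\<lambda>i. \<phi>p g (x i))"
    by (rule qf_hom)
  also have "\<dots> = qp (\<lambda>i. \<phi>p g (x i))"
  proof -
    have "\<phi>p g [:Q i j:] = [:Q i j:]" for i j
      using Q_fixed[OF assms(1)] by (simp add: base.map_poly_pCons_hom)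
    then show ?thesis by (simp only:)
  qed
  also have "\<dots> = qp (mv d (Ap g) (\<lambda>i. \<phi>p g (x i)))"
    using qf_isometry[OF iso] by simp
  also have "\<dots> = qp (\<lambda>i. [:c:] * x i)"
    by (rule qf_cong) (use assms(2) in simp)
  also have "\<dots> = smult (c ^ 2) (qp x)"
    unfolding qf_scale by (simp add: power2_eq_square)
  finally show ?thesis .
qed

text \<open>\<open>\<phi>p g\<close> fixes \<open>p\<close> and does not raise degrees, so it
  carries remainders modulo \<open>p\<close> to remainders.\<close>

lemma pinv_mod:
  assumes "pinv x" "\<And>g. g \<in> S \<Longrightarrow> \<phi>p g p = p"
  shows "pinv (\<lambda>i. x i mod p)"
  unfolding pinv_def
proof
  fix g assume g: "g \<in> S"
  interpret base: field_hom "\<phi> g" using g by (rule field_hom)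
  interpret map_poly_inj_idom_hom "\<phi> g" ..
  obtain c where c: "c \<noteq> 0" "\<And>i. i < d \<Longrightarrow> mv d (Ap g) (\<lambda>j. \<phi>p g (x j)) i = smult c (x i)"
    using assms(1) g unfolding pinv_def by blast
  have mod_sum: "(\<Sum>j<k. f j) mod p = (\<Sum>j<k. f j mod p)" for k and f :: "nat \<Rightarrow> 'l poly"
    by (induction k) (simp_all add: poly_mod_add_left)
  have "mv d (Ap g) (\<lambda>j. \<phi>p g (x j mod p)) i = smult c (x i mod p)" if "i < d" for i
  proof -
    have "\<phi>p g (x j mod p) = \<phi>p g (x j) mod p" for j
    proof -
      have "\<phi>p g (x j) = \<phi>p g (x j div p * p + x j mod p)" by simp
      also have "\<dots> = \<phi>p g (x j div p) * p + \<phi>p g (x j mod p)"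
        unfolding hom_add hom_mult assms(2)[OF g] ..
      finally have e: "\<phi>p g (x j) mod p = \<phi>p g (x j mod p) mod p" by simp
      show ?thesis
      proof (cases "x j mod p = 0")
        case False
        then have "p = 0 \<or> degree (x j mod p) < degree p"
          using degree_mod_less[of p "x j"] by blast
        then have "\<phi>p g (x j mod p) mod p = \<phi>p g (x j mod p)"
          by (auto simp: mod_poly_less)
        then show ?thesis using e by simp
      qed (use e in simp)
    qed
    then have "mv d (Ap g) (\<lambda>j. \<phi>p g (x j mod p)) i = mv d (Ap g) (\<lambda>j. \<phi>p g (x j)) i mod p"
      unfolding mv_def mod_sum by (simp add: mod_smult_left)
    then show ?thesis using c(2)[OF that] by (simp add: mod_smult_left)
  qed
  then show "\<exists>c. c \<noteq> 0 \<and> (\<forall>i<d. mv d (Ap g) (\<lambda>j. \<phi>p g (x j mod p)) i = smult c (x i mod p))"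
    using c by blast
qed

text \<open>\<open>\<phi>p g h\<close> divides every \<open>h * y i\<close>, hence also
  \<open>h\<close> by the Bezout relation. Both are monic of the same degree, so \<open>h\<close> is
  fixed and can be cancelled.\<close>

lemma pinv_primitive_part:
  assumes x: "pinv (\<lambda>i. h * y i)" and h: "lead_coeff h = 1" "h = (\<Sum>i<d. u i * (h * y i))"
  shows "pinv y"
  unfolding pinv_def
proof
  fix g assume g: "g \<in> S"
  interpret base: field_hom "\<phi> g" using g by (rule field_hom)
  interpret map_poly_inj_idom_hom "\<phi> g" ..
  obtain c where c: "c \<noteq> 0" "\<And>i. i < d \<Longrightarrow> mv d (Ap g) (\<lambda>j. \<phi>p g (h * y j)) i = smult c (h * y i)"
    using x g unfolding pinv_def by blast
  have e: "\<phi>p g h * mv d (Ap g) (\<lambda>j. \<phi>p g (y j)) i = smult c (h * y i)" if "i < d" for i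
    using c(2)[OF that] unfolding hom_mult by (simp add: mv_def sum_distrib_left mult_ac)
  have "\<phi>p g h dvd h * y i" if "i < d" for i
    using e[OF that] c(1) by (metis dvd_smult_cancel dvd_triv_left)
  then have "\<phi>p g h dvd (\<Sum>i<d. u i * (h * y i))"
    by (intro dvd_sum) auto
  then have "\<phi>p g h dvd h" using h(2) by simp
  then obtain k where k: "h = \<phi>p g h * k" ..
  have h0: "h \<noteq> 0" using h(1) by auto
  have lead: "degree (\<phi>p g h) = degree h" "lead_coeff (\<phi>p g h) = 1"
    using h(1) by simp_all
  have "k \<noteq> 0" "\<phi>p g h \<noteq> 0" using k h0 by auto
  then have "degree h = degree h + degree k"
    using k lead(1) by (metis degree_mult_eq)
  moreover have "lead_coeff k = 1"
    using k lead(2) h(1) by (metis lead_coeff_mult mult_1)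
  ultimately have "k = 1"
    by (metis add_cancel_right_right degree_0_id one_pCons)
  then have inv: "\<phi>p g h = h" using k by simp
  have "mv d (Ap g) (\<lambda>j. \<phi>p g (y j)) i = smult c (y i)" if "i < d" for i
  proof -
    have "h * mv d (Ap g) (\<lambda>j. \<phi>p g (y j)) i = h * smult c (y i)"
      using e[OF that] inv by simp
    then show ?thesis using h0 by (metis mult_left_cancel)
  qed
  then show "\<exists>c. c \<noteq> 0 \<and> (\<forall>i<d. mv d (Ap g) (\<lambda>j. \<phi>p g (y j)) i = smult c (y i))"
    using c(1) by blast
qed

text \<open>The scalar in \<open>pinv\<close> is a constant of the field, so it survives the
  comparison of coefficients.\<close>

lemma cinv_coeff:
  assumes "pinv x"
  shows "cinv (\<lambda>i. coeff (x i) e)"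
  unfolding cinv_def
proof
  fix g assume g: "g \<in> S"
  interpret base: field_hom "\<phi> g" using g by (rule field_hom)
  obtain c where c: "c \<noteq> 0" "\<And>i. i < d \<Longrightarrow> mv d (Ap g) (\<lambda>j. \<phi>p g (x j)) i = smult c (x i)"
    using assms g unfolding pinv_def by blast
  have "mv d (A g) (\<lambda>j. \<phi> g (coeff (x j) e)) i = c * coeff (x i) e" if "i < d" for i
    using arg_cong[OF c(2)[OF that], of "\<lambda>p. coeff p e"] by (simp add: mv_def coeff_sum)
  then show "\<exists>c. c \<noteq> 0 \<and> (\<forall>i<d. mv d (A g) (\<lambda>j. \<phi> g (coeff (x j) e)) i = c * coeff (x i) e)"
    using c(1) by blast
qed

text \<open>Replace \<open>x\<close> by a coprime representative \<open>y\<close> of degree less than \<open>degree p\<close>. Either the leading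
  coefficients of \<open>y\<close> form a zero of the form, or \<open>q(y) = p r\<close> has even degree, and the cofactor \<open>r\<close> is again of
  odd degree, smaller than that of \<open>p\<close>, and invariant up to scalars.\<close>

lemma springer_descent:
  assumes "lead_coeff p = 1" "odd (degree p)" "\<And>g. g \<in> S \<Longrightarrow> \<phi>p g p = p"
    and "pinv x" "p dvd qp x" "a * p + (\<Sum>i<d. u i * x i) = 1"
  shows "\<exists>y. (\<exists>i<d. y i \<noteq> 0) \<and> cinv y \<and> qf d Q y = 0"
  using assms
proof (induction "degree p" arbitrary: p x a u rule: less_induct)
  case less
  note p = less.prems
  define x1 where "x1 i = x i mod p" for i
  have x1: "pinv x1" unfolding x1_def using p(4,3) by (rule pinv_mod)
  have x1x: "x i = p * (x i div p) + x1 i" for i by (simp add: x1_def)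
  have p_x1: "p dvd qp x1"
  proof -
    have "p dvd qp x - qp x1" by (rule dvd_qf_diff) (simp add: x1_def)
    from dvd_diff[OF p(5) this] show ?thesis by simp
  qed
  \<comment> \<open>Coprimality survives the reduction: the multiples of \<open>p\<close> move into
    the coefficient of \<open>p\<close>.\<close>
  have bez: "(a + (\<Sum>i<d. u i * (x i div p))) * p + (\<Sum>i<d. u i * x1 i) = 1"
  proof -
    have "(\<Sum>i<d. u i * x i) = (\<Sum>i<d. u i * (x i div p)) * p + (\<Sum>i<d. u i * x1 i)"
      unfolding sum_distrib_right sum.distrib[symmetric]
      by (rule sum.cong[OF refl]) (subst x1x, simp add: algebra_simps)
    with p(6) show ?thesis by (simp add: algebra_simps)
  qed
  have deg_pos: "degree p > 0" using p(2) by (cases "degree p") auto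
  have "\<exists>i<d. x1 i \<noteq> 0"
  proof (rule ccontr)
    assume "\<not> ?thesis"
    then have "(\<Sum>i<d. u i * x1 i) = 0" by simp
    then have "(a + (\<Sum>i<d. u i * (x i div p))) * p = 1" using bez by simp
    then have "p dvd 1" by (metis dvd_triv_right)
    then show False using deg_pos by (simp add: poly_dvd_1)
  qed
  from poly_bezout_family[OF this] obtain h v where h: "lead_coeff h = 1"
      "\<And>i. i < d \<Longrightarrow> h dvd x1 i" "h = (\<Sum>i<d. v i * x1 i)" by blast
  define y where "y i = x1 i div h" for i
  have hy: "x1 i = h * y i" if "i < d" for i using h(2)[OF that] by (simp add: y_def)
  have h0: "h \<noteq> 0" using h(1) by auto
  have "pinv (\<lambda>i. h * y i)"
  proof -
    have "mv d B (\<lambda>j. f (x1 j)) = mv d B (\<lambda>j. f (h * y j))" for B and f :: "'l poly \<Rightarrow> 'l poly"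
      by (rule mv_cong) (simp add: hy)
    then show ?thesis using x1 hy unfolding pinv_def by simp
  qed
  moreover have h_eq: "h = (\<Sum>i<d. v i * (h * y i))" using h(3) hy by simp
  ultimately have y: "pinv y" using pinv_primitive_part[OF _ h(1) h_eq] by simp
  have vy: "(\<Sum>i<d. v i * y i) = 1"
  proof -
    have "h * (\<Sum>i<d. v i * y i) = h * 1"
      using h_eq by (simp add: sum_distrib_left mult_ac)
    then show ?thesis using h0 by (metis mult_left_cancel)
  qed
  have p_y: "p dvd qp y"
  proof -
    \<comment> \<open>By \<open>b\<close>, \<open>h\<close> is invertible modulo \<open>p\<close>
      with inverse \<open>t\<close>, so the factor \<open>h ^ 2\<close> of \<open>qp x1\<close> can
      be cancelled.\<close>
    define s where "s = a + (\<Sum>i<d. u i * (x i div p))"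
    define t where "t = (\<Sum>i<d. u i * y i)"
    have b: "s * p + h * t = 1"
      using bez hy by (simp add: s_def t_def sum_distrib_left mult_ac)
    have "qp x1 = qp (\<lambda>i. h * y i)" by (rule qf_cong) (rule hy)
    then have "p dvd h ^ 2 * qp y" using p_x1 by (simp add: qf_scale)
    then have "p dvd t ^ 2 * (h ^ 2 * qp y)" by (rule dvd_mult)
    moreover have "qp y = t ^ 2 * (h ^ 2 * qp y) + p * (s * (1 + h * t) * qp y)"
    proof -
      have "1 - (h * t) ^ 2 = p * (s * (1 + h * t))"
      proof -
        have "1 - (h * t) ^ 2 = (1 - h * t) * (1 + h * t)" by (simp add: power2_eq_square algebra_simps)
        also have "1 - h * t = s * p" using b by (simp add: algebra_simps)
        finally show ?thesis by (simp add: mult_ac)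
      qed
      then have "(1 - (h * t) ^ 2) * qp y = p * (s * (1 + h * t)) * qp y" by simp
      then show ?thesis by (simp add: algebra_simps power_mult_distrib)
    qed
    ultimately show ?thesis by (metis dvd_add dvd_triv_left)
  qed
  have "\<exists>i<d. y i \<noteq> 0"
    using vy by (metis (no_types, lifting) lessThan_iff mult_zero_right sum.neutral zero_neq_one)
  then obtain e where e: "\<And>i. i < d \<Longrightarrow> degree (y i) \<le> e" "\<exists>i<d. coeff (y i) e \<noteq> 0"
    using poly_vec_degree by blast
  have e_lt: "e < degree p"
  proof -
    obtain k where k: "k < d" "coeff (y k) e \<noteq> 0" using e(2) by blast
    then have "y k \<noteq> 0" by auto
    then have "degree (y k) \<le> degree (x1 k)" using hy[OF k(1)] h0 by (simp add: degree_mult_eq)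
    moreover have "degree (x1 k) < degree p" using deg_pos unfolding x1_def
      by (metis degree_0 degree_mod_less less_nat_zero_code)
    ultimately show ?thesis using k(2) le_degree by fastforce
  qed
  show ?case
  proof (cases "qf d Q (\<lambda>i. coeff (y i) e) = 0")
    case True
    then show ?thesis
      using e(2) cinv_coeff[OF y, of e] by (intro exI[of _ "\<lambda>i. coeff (y i) e"]) simp
  next
    case False
    note deg = poly_qf_degree[where Q = Q, OF e(1), simplified]
    have degq: "degree (qp y) = 2 * e"
      using False poly_qf_degree[where Q = Q and x = y and e = e and d = d] e(1) by (metis le_antisym le_degree)
    obtain r where r: "qp y = p * r" using p_y by blast
    have q0: "qp y \<noteq> 0" using False poly_qf_degree(2)[where Q = Q and x = y and e = e and d = d] e(1) by auto
    then have r0: "r \<noteq> 0" and p0: "p \<noteq> 0" using r by auto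
    \<comment> \<open>As \<open>degree p\<close> is odd and \<open>2 * e\<close> is even and less
      than \<open>2 * degree p\<close>, the cofactor \<open>r\<close> has odd degree, smaller than
      that of \<open>p\<close>.\<close>
    have deg_r: "degree p + degree r = 2 * e" using degq r r0 p0 by (simp add: degree_mult_eq)
    \<comment> \<open>Once \<open>r\<close> is monic, invariance up to a scalar becomes invariance,
      as the induction hypothesis requires.\<close>
    define r' where "r' = smult (inverse (lead_coeff r)) r"
    have "\<exists>y. (\<exists>i<d. y i \<noteq> 0) \<and> cinv y \<and> qf d Q y = 0"
    \<comment> \<open>The coefficient of \<open>r'\<close> in the new Bezout relation is
      \<open>0\<close>, because \<open>vy\<close> already expresses 1 through the
      \<open>y i\<close>.\<close>
    proof (rule less.hyps[of r' y 0 v])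
      show "degree r' < degree p" using deg_r e_lt r0 by (simp add: r'_def)
      show "lead_coeff r' = 1" using r0 by (simp add: r'_def)
      show "odd (degree r')" using deg_r p(2) r0 by (simp add: r'_def) presburger
      show "pinv y" by (rule y)
      show "r' dvd qp y" using r r0 by (simp add: r'_def smult_dvd)
      show "0 * r' + (\<Sum>i<d. v i * y i) = 1" using vy by simp
      fix g assume g: "g \<in> S"
      interpret base: field_hom "\<phi> g" using g by (rule field_hom)
      interpret map_poly_inj_idom_hom "\<phi> g" ..
      obtain c where c: "c \<noteq> 0" "\<And>i. i < d \<Longrightarrow> mv d (Ap g) (\<lambda>j. \<phi>p g (y j)) i = smult c (y i)"
        using y g unfolding pinv_def by blast
      from qp_invariant[OF g this(2)] have "p * \<phi>p g r = p * smult (c ^ 2) r"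
        unfolding r hom_mult p(3)[OF g] by simp
      then have *: "\<phi>p g r = smult (c ^ 2) r" using p0 by (metis mult_left_cancel)
      then have "\<phi> g (lead_coeff r) = c ^ 2 * lead_coeff r"
        by (metis base.degree_map_poly_hom base.coeff_map_poly_hom coeff_smult)
      moreover have "inverse (c ^ 2 * lead_coeff r) * c ^ 2 = inverse (lead_coeff r)"
        using c(1) r0 by (simp add: field_simps)
      ultimately show "\<phi>p g r' = r'"
        unfolding r'_def base.map_poly_hom_smult base.hom_inverse * smult_smult by (simp only:)
    qed
    then show ?thesis .
  qed
qed

end

section \<open>Descent along subgroups of odd index\<close>

lemma poly_prod_linear_dvd:
  fixes p :: "'l::field poly"
  assumes "finite B" "inj_on \<theta> B" "\<And>c. c \<in> B \<Longrightarrow> poly p (\<theta> c) = 0"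
  shows "(\<Prod>c\<in>B. [:- \<theta> c, 1:]) dvd p"
  using assms
proof (induction B arbitrary: p rule: finite_induct)
  case (insert c B)
  have "[:- \<theta> c, 1:] dvd p" using insert.prems(2)[of c] by (simp add: poly_eq_0_iff_dvd)
  then obtain q where q: "p = [:- \<theta> c, 1:] * q" ..
  have "poly q (\<theta> b) = 0" if "b \<in> B" for b
  proof -
    have "\<theta> b \<noteq> \<theta> c" using insert.prems(1) insert.hyps(2) that by (auto simp: inj_on_def)
    moreover have "poly p (\<theta> b) = 0" using insert.prems(2) that by simp
    ultimately show ?thesis by (simp add: q)
  qed
  then have "(\<Prod>c\<in>B. [:- \<theta> c, 1:]) dvd q"
    using insert.prems(1) by (intro insert.IH) (auto simp: inj_on_def)
  then show ?case
    unfolding q prod.insert[OF insert.hyps] by (rule mult_dvd_mono[OF dvd_refl])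
qed simp

lemma degree_prod_linear:
  fixes \<theta> :: "'c \<Rightarrow> 'l::field"
  shows "lead_coeff (\<Prod>c\<in>B. [:- \<theta> c, 1:]) = 1"
    and "degree (\<Prod>c\<in>B. [:- \<theta> c, 1:]) = card B"
proof -
  show "lead_coeff (\<Prod>c\<in>B. [:- \<theta> c, 1:]) = 1" by (simp add: lead_coeff_prod)
  show "degree (\<Prod>c\<in>B. [:- \<theta> c, 1:]) = card B"
    by (induction B rule: infinite_finite_induct) (simp_all add: degree_mult_eq del: mult_pCons_left)
qed

text \<open>The Lagrange sum: \<open>P c\<close> vanishes at every node other than
  \<open>\<theta> c\<close>. It is used below both to separate cosets and to isolate the unit of the
  group.\<close>

lemma poly_interpolation_ex:
  fixes \<theta> :: "'c \<Rightarrow> 'l::field"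
  assumes "finite B" "inj_on \<theta> B"
  obtains u where "\<And>c. c \<in> B \<Longrightarrow> poly u (\<theta> c) = v c"
proof
  define P where "P c = (\<Prod>b\<in>B - {c}. [:- \<theta> b, 1:])" for c
  have P: "poly (P c) (\<theta> c) \<noteq> 0" if "c \<in> B" for c
    using assms that by (auto simp: P_def poly_prod prod_zero_iff inj_on_def)
  have P0: "poly (P c) (\<theta> b) = 0" if "b \<in> B" "b \<noteq> c" for b c
    using assms(1) that by (auto simp: P_def poly_prod prod_zero_iff)
  fix c assume c: "c \<in> B"
  have "poly (\<Sum>b\<in>B. smult (v b / poly (P b) (\<theta> b)) (P b)) (\<theta> c)
      = (\<Sum>b\<in>B. if b = c then v c else 0)"
    unfolding poly_sum by (rule sum.cong[OF refl]) (use P P0 c in auto)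
  then show "poly (\<Sum>b\<in>B. smult (v b / poly (P b) (\<theta> b)) (P b)) (\<theta> c) = v c"
    using c assms(1) by simp
qed

text \<open>The matrices lift a projective action to isometries, so they multiply only up to a sign,
  which depends on the two group elements but not on the matrix entry.\<close>

locale twisted_action = group G + isometric_action "carrier G" \<phi> d Q A
  for G (structure) and \<phi> :: "'g \<Rightarrow> 'l::field \<Rightarrow> 'l" and d :: nat
    and Q :: "nat \<Rightarrow> nat \<Rightarrow> 'l" and A :: "'g \<Rightarrow> nat \<Rightarrow> nat \<Rightarrow> 'l" +
  assumes fin: "finite (carrier G)"
    and \<phi>_mult: "g \<in> carrier G \<Longrightarrow> h \<in> carrier G \<Longrightarrow> \<phi> (g \<otimes> h) a = \<phi> g (\<phi> h a)"
    and A_fixed: "g \<in> carrier G \<Longrightarrow> h \<in> carrier G \<Longrightarrow> \<phi> g (A h i j) = A h i j"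
    and A_mult: "g \<in> carrier G \<Longrightarrow> h \<in> carrier G \<Longrightarrow>
      \<exists>\<epsilon>\<in>{1,-1}. \<forall>i<d. \<forall>l<d. (\<Sum>j<d. A g i j * A h j l) = \<epsilon> * A (g \<otimes> h) i l"
    and A_one: "i < d \<Longrightarrow> l < d \<Longrightarrow> A \<one> i l = (if i = l then 1 else 0)"
begin

definition act :: "'g \<Rightarrow> (nat \<Rightarrow> 'l) \<Rightarrow> nat \<Rightarrow> 'l" where
  "act g x = mv d (A g) (\<lambda>j. \<phi> g (x j))"

lemma \<phi>_one: "\<phi> \<one> a = a"
proof -
  interpret field_hom "\<phi> \<one>" by (rule field_hom) simp
  have "\<phi> \<one> (\<phi> \<one> a) = \<phi> \<one> a" using \<phi>_mult[of \<one> \<one> a] by simp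
  then show ?thesis using injectivity by blast
qed

lemma act_one: "i < d \<Longrightarrow> act \<one> x i = x i"
proof -
  assume i: "i < d"
  have "act \<one> x i = (\<Sum>j<d. if i = j then x j else 0)"
    unfolding act_def mv_def by (rule sum.cong[OF refl]) (use i A_one \<phi>_one in simp)
  then show ?thesis using i by simp
qed

lemma act_cong: "(\<And>i. i < d \<Longrightarrow> x i = y i) \<Longrightarrow> act g x = act g y"
  unfolding act_def by (rule mv_cong) simp

lemma act_scale:
  assumes "g \<in> carrier G" shows "act g (\<lambda>i. c * x i) i = \<phi> g c * act g x i"
proof -
  interpret field_hom "\<phi> g" using assms by (rule field_hom)
  show ?thesis unfolding act_def hom_mult by (rule mv_scale)
qed

lemma act_act:
  assumes g: "g \<in> carrier G" and h: "h \<in> carrier G"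
  obtains \<epsilon> where "\<epsilon> = 1 \<or> \<epsilon> = -1" "\<And>x i. i < d \<Longrightarrow> act g (act h x) i = \<epsilon> * act (g \<otimes> h) x i"
proof -
  interpret field_hom "\<phi> g" using g by (rule field_hom)
  obtain \<epsilon> where \<epsilon>: "\<epsilon> \<in> {1,-1}" "\<And>i l. i < d \<Longrightarrow> l < d \<Longrightarrow> (\<Sum>j<d. A g i j * A h j l) = \<epsilon> * A (g \<otimes> h) i l"
    using A_mult[OF g h] by blast
  have "act g (act h x) i = \<epsilon> * act (g \<otimes> h) x i" if i: "i < d" for x i
  proof -
    have "act g (act h x) i = (\<Sum>j<d. \<Sum>l<d. A g i j * A h j l * \<phi> (g \<otimes> h) (x l))"
      unfolding act_def mv_def hom_sum hom_mult sum_distrib_left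
      by (simp add: A_fixed g h \<phi>_mult mult_ac)
    also have "\<dots> = (\<Sum>l<d. (\<Sum>j<d. A g i j * A h j l) * \<phi> (g \<otimes> h) (x l))"
      unfolding sum_distrib_right by (rule sum.swap)
    also have "\<dots> = (\<Sum>l<d. \<epsilon> * A (g \<otimes> h) i l * \<phi> (g \<otimes> h) (x l))"
      using \<epsilon>(2)[OF i] by simp
    finally show ?thesis unfolding act_def mv_def sum_distrib_left by (simp add: mult_ac)
  qed
  then show thesis using that \<epsilon>(1) by blast
qed

lemma qf_act:
  assumes "g \<in> carrier G" shows "qf d Q (act g x) = \<phi> g (qf d Q x)"
proof -
  interpret field_hom "\<phi> g" using assms by (rule field_hom)
  show ?thesis unfolding act_def qf_isometry[OF isometry[OF assms]] qf_hom
    using Q_fixed[OF assms] by simp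
qed

lemma act_nonzero:
  assumes g: "g \<in> carrier G" and x: "\<exists>i<d. x i \<noteq> 0"
  shows "\<exists>i<d. act g x i \<noteq> 0"
proof (rule ccontr)
  assume *: "\<not> ?thesis"
  interpret field_hom "\<phi> (inv g)" using g by (intro field_hom) simp
  obtain \<epsilon> where \<epsilon>: "\<epsilon> = 1 \<or> \<epsilon> = -1"
      "\<And>x i. i < d \<Longrightarrow> act (inv g) (act g x) i = \<epsilon> * act (inv g \<otimes> g) x i"
    using act_act[of "inv g" g] g by auto
  have "act (inv g) (act g x) i = 0" for i
    using * by (simp add: act_def mv_def)
  then have "x i = 0" if "i < d" for i
    using \<epsilon>(1) \<epsilon>(2)[OF that, of x] act_one[OF that] g by auto
  then show False using x by auto
qed

text \<open>The translates of \<open>y\<close> along the cosets of \<open>H\<close>, rescaled by a Hilbert 90 argument, are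
  interpolated at the sums of \<open>X\<close> over the cosets, which \<open>G\<close> permutes in the same way. The result is a zero of the form modulo the
  product \<open>p\<close> of the linear factors, whose degree is the index of \<open>H\<close>.\<close>

lemma odd_index_descent:
  assumes H: "subgroup H G" and oddH: "odd (card (lcosets H))"
    and y: "\<exists>i<d. y i \<noteq> 0" "qf d Q y = 0"
    and y_inv: "\<And>h. h \<in> H \<Longrightarrow> \<exists>c. c \<noteq> 0 \<and> (\<forall>i<d. act h y i = c * y i)"
    and X: "\<And>g h. g \<in> carrier G \<Longrightarrow> h \<in> carrier G \<Longrightarrow> \<phi> g (X h) = X (g \<otimes> h)"
    and X_inj: "inj_on (sum X) (Pow (carrier G))"
  shows "\<exists>y. (\<exists>i<d. y i \<noteq> 0) \<and> cinv y \<and> qf d Q y = 0"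
proof -
  note hsub = subgroup.subset[OF H]
  define C where "C = lcosets H"
  have C_carrier: "c \<subseteq> carrier G" if "c \<in> C" for c
    using that lcosets_subset_PowG[OF H] by (auto simp: C_def)
  have C_fin: "finite C"
    using lcosets_subset_PowG[OF H] fin unfolding C_def by (meson finite_Pow_iff finite_subset)
  have C_ex: "\<exists>g\<in>carrier G. c = g <# H" if "c \<in> C" for c
    using that by (auto simp: C_def LCOSETS_def)
  have T_in: "g <# c \<in> C" if "g \<in> carrier G" "c \<in> C" for g c
    using C_ex[OF that(2)] that(1) hsub by (auto simp: C_def LCOSETS_def lcos_m_assoc)
  have T_mult: "g <# (h <# c) = (g \<otimes> h) <# c" if "g \<in> carrier G" "h \<in> carrier G" "c \<in> C" for g h c
    using lcos_m_assoc C_carrier that by auto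
  have T_one: "\<one> <# c = c" if "c \<in> C" for c
    using lcos_mult_one C_carrier that by auto
  have T_bij: "bij_betw (\<lambda>c. g <# c) C C" if g: "g \<in> carrier G" for g
    by (rule bij_betw_byWitness[of _ "\<lambda>c. inv g <# c"]) (use g T_mult T_one T_in in auto)
  have H_in: "H \<in> C" using lcos_mult_one[OF hsub] by (auto simp: C_def LCOSETS_def)
  have mem_coset: "c = g <# H" if "g \<in> c" "c \<in> C" for g c
    using C_ex[OF that(2)] that(1) l_repr_independence H by metis
  have T_image: "g <# c = (\<lambda>k. g \<otimes> k) ` c" for g c
    by (auto simp: l_coset_def)
  have coset_nonempty: "\<exists>g. g \<in> c" if "c \<in> C" for c
    using C_ex[OF that] lcos_self[OF _ H] by blast

  define r where "r c = (SOME g. g \<in> c)" for c :: "'g set"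
  have r_in: "r c \<in> c" if "c \<in> C" for c
    unfolding r_def using coset_nonempty[OF that] by (rule someI_ex)
  have r_car: "r c \<in> carrier G" if "c \<in> C" for c using r_in[OF that] C_carrier[OF that] by blast
  \<comment> \<open>The translate of \<open>y\<close> along the coset \<open>c\<close>, through an
    arbitrary representative; another representative changes it by a scalar only.\<close>
  define yc where "yc c = act (r c) y" for c
  have yc_nz: "\<exists>i<d. yc c i \<noteq> 0" if "c \<in> C" for c
    unfolding yc_def using r_car[OF that] y(1) by (rule act_nonzero)
  have yc_q: "qf d Q (yc c) = 0" if "c \<in> C" for c
  proof -
    interpret field_hom "\<phi> (r c)" using r_car[OF that] by (rule field_hom)
    show ?thesis unfolding yc_def qf_act[OF r_car[OF that]] y(2) by simp
  qed
  \<comment> \<open>\<open>g \<otimes> r c\<close> and \<open>r (g <# c)\<close> lie in the same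
    coset, so they differ by an element of \<open>H\<close>, which acts on \<open>y\<close> through
    a scalar.\<close>
  have ex_lam: "\<exists>l. l \<noteq> 0 \<and> (\<forall>i<d. act g (yc c) i = l * yc (g <# c) i)"
    if g: "g \<in> carrier G" and c: "c \<in> C" for g c
  proof -
    have rg: "g \<otimes> r c \<in> g <# c" using r_in[OF c] by (auto simp: T_image)
    define r' where "r' = r (g <# c)"
    have r': "r' \<in> g <# c" "r' \<in> carrier G"
      using r_in r_car T_in[OF g c] by (auto simp: r'_def)
    have "g <# c = r' <# H" using mem_coset r'(1) T_in[OF g c] by simp
    with rg obtain h where h: "h \<in> H" "g \<otimes> r c = r' \<otimes> h" by (auto simp: l_coset_def)
    have hc: "h \<in> carrier G" using h(1) hsub by auto
    obtain e1 where e1: "e1 = 1 \<or> e1 = -1" "\<And>x i. i < d \<Longrightarrow> act g (act (r c) x) i = e1 * act (g \<otimes> r c) x i"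
      using act_act[OF g r_car[OF c]] by blast
    obtain e2 where e2: "e2 = 1 \<or> e2 = -1" "\<And>x i. i < d \<Longrightarrow> act r' (act h x) i = e2 * act (r' \<otimes> h) x i"
      using act_act[OF r'(2) hc] by blast
    obtain k where k: "k \<noteq> 0" "\<And>i. i < d \<Longrightarrow> act h y i = k * y i" using y_inv[OF h(1)] by blast
    interpret rh: field_hom "\<phi> r'" using r'(2) by (rule field_hom)
    have "act g (yc c) i = (e1 * e2 * \<phi> r' k) * yc (g <# c) i" if i: "i < d" for i
    proof -
      have "act g (yc c) i = e1 * act (r' \<otimes> h) y i" unfolding yc_def using e1(2)[OF i] h(2) by simp
      also have "act (r' \<otimes> h) y i = e2 * act r' (act h y) i" using e2(1) e2(2)[OF i, of y] by auto
      also have "act r' (act h y) = act r' (\<lambda>i. k * y i)" by (rule act_cong) (rule k(2))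
      also have "act r' (\<lambda>i. k * y i) i = \<phi> r' k * act r' y i" by (rule act_scale[OF r'(2)])
      finally show ?thesis by (simp add: yc_def r'_def mult_ac)
    qed
    moreover have "e1 * e2 * \<phi> r' k \<noteq> 0" using e1(1) e2(1) k(1) by auto
    ultimately show ?thesis by blast
  qed
  define lam where "lam g c = (SOME l. l \<noteq> 0 \<and> (\<forall>i<d. act g (yc c) i = l * yc (g <# c) i))" for g c
  have lam: "lam g c \<noteq> 0" "\<And>i. i < d \<Longrightarrow> act g (yc c) i = lam g c * yc (g <# c) i"
    if "g \<in> carrier G" "c \<in> C" for g c
    using someI_ex[OF ex_lam[OF that]] unfolding lam_def by blast+
  \<comment> \<open>The scalars obey the cocycle rule up to a sign, and the sign is the same for all
    cosets.\<close>
  have lam_mult: "\<exists>\<epsilon>. (\<epsilon> = 1 \<or> \<epsilon> = -1) \<and> (\<forall>c\<in>C. \<phi> g (lam h c) * lam g (h <# c) = \<epsilon> * lam (g \<otimes> h) c)"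
    if g: "g \<in> carrier G" and h: "h \<in> carrier G" for g h
  proof -
    obtain \<epsilon> where e: "\<epsilon> = 1 \<or> \<epsilon> = -1" "\<And>x i. i < d \<Longrightarrow> act g (act h x) i = \<epsilon> * act (g \<otimes> h) x i"
      using act_act[OF g h] by blast
    have "\<phi> g (lam h c) * lam g (h <# c) = \<epsilon> * lam (g \<otimes> h) c" if c: "c \<in> C" for c
    proof -
      obtain i where i: "i < d" "yc ((g \<otimes> h) <# c) i \<noteq> 0"
        using yc_nz[OF T_in[OF _ c], of "g \<otimes> h"] g h by auto
      have "act g (act h (yc c)) i = act g (\<lambda>j. lam h c * yc (h <# c) j) i"
        by (rule fun_cong[OF act_cong]) (rule lam(2)[OF h c])
      also have "\<dots> = \<phi> g (lam h c) * (lam g (h <# c) * yc ((g \<otimes> h) <# c) i)"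
        using act_scale[OF g] lam(2)[OF g T_in[OF h c] i(1)] T_mult[OF g h c] by simp
      finally have "\<epsilon> * (lam (g \<otimes> h) c * yc ((g \<otimes> h) <# c) i)
          = \<phi> g (lam h c) * (lam g (h <# c) * yc ((g \<otimes> h) <# c) i)"
        unfolding e(2)[OF i(1)] lam(2)[OF m_closed[OF g h] c i(1)] .
      then have "\<phi> g (lam h c) * lam g (h <# c) * yc ((g \<otimes> h) <# c) i
          = \<epsilon> * lam (g \<otimes> h) c * yc ((g \<otimes> h) <# c) i"
        by (simp only: mult.assoc)
      then show ?thesis using i(2) by (metis mult_cancel_right)
    qed
    then show ?thesis using e(1) by blast
  qed
  define Lam where "Lam g = (\<Prod>c\<in>C. lam g c)" for g
  have Lam_nz: "Lam g \<noteq> 0" if "g \<in> carrier G" for g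
    using lam(1)[OF that] C_fin by (simp add: Lam_def)
  \<comment> \<open>The sign enters \<open>Lam\<close> with exponent \<open>card C\<close>, which is
    odd, so it enters \<open>lam\<close> and \<open>Lam\<close> alike. The quotient is an exact
    cocycle.\<close>
  define kap where "kap g c = lam g c / Lam g" for g c
  have kap_nz: "kap g c \<noteq> 0" if "g \<in> carrier G" "c \<in> C" for g c
    using lam(1) Lam_nz that by (simp add: kap_def)
  have kap_mult: "kap g (h <# c) * \<phi> g (kap h c) = kap (g \<otimes> h) c"
    if g: "g \<in> carrier G" and h: "h \<in> carrier G" and c: "c \<in> C" for g h c
  proof -
    interpret gh: field_hom "\<phi> g" using g by (rule field_hom)
    obtain \<epsilon> where e: "\<epsilon> = 1 \<or> \<epsilon> = -1"
      and lm: "\<And>c. c \<in> C \<Longrightarrow> \<phi> g (lam h c) * lam g (h <# c) = \<epsilon> * lam (g \<otimes> h) c"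
      using lam_mult[OF g h] by blast
    have e_odd: "\<epsilon> ^ card C = \<epsilon>" using e oddH by (auto simp: C_def)
    have "\<phi> g (Lam h) * Lam g = (\<Prod>c\<in>C. \<phi> g (lam h c)) * (\<Prod>c\<in>C. lam g (h <# c))"
      unfolding Lam_def gh.hom_prod
      using prod.reindex_bij_betw[OF T_bij[OF h], of "lam g"] by simp
    also have "\<dots> = (\<Prod>c\<in>C. \<epsilon> * lam (g \<otimes> h) c)"
      unfolding prod.distrib[symmetric] by (rule prod.cong) (simp_all add: lm)
    also have "\<dots> = \<epsilon> * Lam (g \<otimes> h)" by (simp add: prod.distrib Lam_def e_odd)
    finally have LL: "\<phi> g (Lam h) * Lam g = \<epsilon> * Lam (g \<otimes> h)" .
    have "kap g (h <# c) * \<phi> g (kap h c) = (\<phi> g (lam h c) * lam g (h <# c)) / (\<phi> g (Lam h) * Lam g)"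
      by (simp add: kap_def gh.hom_div field_simps)
    also have "\<dots> = kap (g \<otimes> h) c"
      unfolding LL lm[OF c] kap_def using e by auto
    finally show ?thesis .
  qed

  \<comment> \<open>Independence of characters: if the twisted trace vanished on all powers of
    \<open>X \<one>\<close>, it would vanish on the polynomial that isolates the unit of
    \<open>H\<close>, and \<open>kap \<one> H\<close> would be zero.\<close>
  have ex_f: "\<exists>f. (\<Sum>h\<in>H. kap h H * \<phi> h f) \<noteq> 0"
  proof (rule ccontr)
    assume "\<not> ?thesis"
    then have z: "(\<Sum>h\<in>H. kap h H * \<phi> h f) = 0" for f by blast
    have X_distinct: "X h \<noteq> X g" if "h \<in> H" "g \<in> H" "h \<noteq> g" for g h
      using X_inj[unfolded inj_on_def, rule_format, of "{h}" "{g}"] that hsub by auto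
    have "(\<Sum>h\<in>H. kap h H * X h ^ i) = 0" for i
    proof -
      have "\<phi> h (X \<one> ^ i) = X h ^ i" if "h \<in> H" for h
      proof -
        interpret field_hom "\<phi> h" using that hsub by (intro field_hom) auto
        show ?thesis using X[of h \<one>] that hsub by (auto simp: hom_power)
      qed
      then show ?thesis using z[of "X \<one> ^ i"] by simp
    qed
    then have "(\<Sum>i\<le>degree P. coeff P i * (\<Sum>h\<in>H. kap h H * X h ^ i)) = 0" for P by simp
    then have "(\<Sum>h\<in>H. kap h H * poly P (X h)) = 0" for P
      unfolding poly_altdef sum_distrib_left by (subst sum.swap) (simp add: mult_ac)
    moreover obtain P where P: "\<And>h. h \<in> H \<Longrightarrow> poly P (X h) = (if h = \<one> then 1 else 0)"
      using poly_interpolation_ex[of H X "\<lambda>h. if h = \<one> then 1 else 0"] X_distinct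
        finite_subset[OF hsub fin] unfolding inj_on_def by metis
    moreover have "(\<Sum>h\<in>H. kap h H * poly P (X h)) = (\<Sum>h\<in>H. kap h H * (if h = \<one> then 1 else 0))"
      by (rule sum.cong[OF refl]) (simp add: P)
    ultimately have "(\<Sum>h\<in>H. kap h H * (if h = \<one> then 1 else 0)) = 0"
      by (simp only:)
    then have "kap \<one> H = 0"
      using finite_subset[OF hsub fin] subgroup.one_closed[OF H]
      by (simp add: if_distrib[of "\<lambda>a. _ * a"] cong: if_cong)
    then show False using kap_nz[OF _ H_in] by simp
  qed
  then obtain f where f: "(\<Sum>h\<in>H. kap h H * \<phi> h f) \<noteq> 0" by blast
  \<comment> \<open>The Hilbert 90 sum, taken over one coset at a time. By \<open>a_mult\<close> it
    exhibits \<open>kap\<close> as a coboundary.\<close>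
  define a where "a c = (\<Sum>g\<in>c. kap g H * \<phi> g f)" for c
  have a_mult: "a (g <# c) = \<phi> g (a c) * kap g c" if g: "g \<in> carrier G" and c: "c \<in> C" for g c
  proof -
    interpret gh: field_hom "\<phi> g" using g by (rule field_hom)
    have inj: "inj_on (\<lambda>k. g \<otimes> k) c"
      by (rule inj_on_g'[OF C_carrier[OF c] g])
    have "a (g <# c) = (\<Sum>k\<in>c. kap (g \<otimes> k) H * \<phi> (g \<otimes> k) f)"
      unfolding a_def T_image by (simp add: sum.reindex[OF inj])
    also have "\<dots> = (\<Sum>k\<in>c. \<phi> g (kap k H * \<phi> k f) * kap g c)"
    proof (rule sum.cong[OF refl])
      fix k assume k: "k \<in> c"
      then have kc: "k \<in> carrier G" using C_carrier[OF c] by auto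
      have "kap (g \<otimes> k) H = kap g c * \<phi> g (kap k H)"
        using kap_mult[OF g kc H_in] mem_coset[OF k c] by simp
      then show "kap (g \<otimes> k) H * \<phi> (g \<otimes> k) f = \<phi> g (kap k H * \<phi> k f) * kap g c"
        by (simp add: \<phi>_mult[OF g kc] gh.hom_mult mult_ac)
    qed
    finally show ?thesis by (simp add: a_def gh.hom_sum sum_distrib_right)
  qed
  have a_nz: "a c \<noteq> 0" if c: "c \<in> C" for c
  proof -
    obtain g where g: "g \<in> carrier G" "c = g <# H" using C_ex[OF c] by blast
    interpret gh: field_hom "\<phi> g" using g(1) by (rule field_hom)
    have "a H \<noteq> 0" using f by (simp add: a_def)
    then show ?thesis using a_mult[OF g(1) H_in] kap_nz[OF g(1) H_in] g(2) by simp
  qed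
  \<comment> \<open>After this rescaling \<open>g\<close> carries \<open>w c\<close> to
    \<open>w (g <# c)\<close> with one scalar \<open>Lam g\<close> for all cosets, which is what
    makes the interpolating vector invariant up to a scalar.\<close>
  define w where "w c i = a c * yc c i" for c i
  have w_act: "act g (w c) i = Lam g * w (g <# c) i"
    if g: "g \<in> carrier G" and c: "c \<in> C" and i: "i < d" for g c i
  proof -
    have "act g (w c) i = \<phi> g (a c) * (lam g c * yc (g <# c) i)"
      unfolding w_def using act_scale[OF g] lam(2)[OF g c i] by simp
    also have "\<dots> = Lam g * (\<phi> g (a c) * kap g c) * yc (g <# c) i"
      using Lam_nz[OF g] by (simp add: kap_def)
    finally show ?thesis using a_mult[OF g c] by (simp add: w_def mult_ac)
  qed

  define th where "th c = sum X c" for c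
  have th_inj: "inj_on th C"
    using X_inj C_carrier unfolding th_def inj_on_def by auto
  have th_act: "\<phi> g (th c) = th (g <# c)" if g: "g \<in> carrier G" and c: "c \<in> C" for g c
  proof -
    interpret gh: field_hom "\<phi> g" using g by (rule field_hom)
    have inj: "inj_on (\<lambda>k. g \<otimes> k) c"
      by (rule inj_on_g'[OF C_carrier[OF c] g])
    show ?thesis unfolding th_def gh.hom_sum T_image sum.reindex[OF inj]
      using X[OF g] C_carrier[OF c] by (intro sum.cong) auto
  qed
  define p where "p = (\<Prod>c\<in>C. [:- th c, 1:])"
  \<comment> \<open>The Lagrange products are used without their denominators: at
    \<open>th c\<close> the vector \<open>x\<close> takes a nonzero multiple of \<open>w c\<close>,
    which is enough for a projective point.\<close>
  define P where "P c = (\<Prod>b\<in>C - {c}. [:- th b, 1:])" for c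
  define x where "x i = (\<Sum>c\<in>C. smult (w c i) (P c))" for i
  have p_inv: "map_poly (\<phi> g) p = p" if g: "g \<in> carrier G" for g
  proof -
    interpret gh: field_hom "\<phi> g" using g by (rule field_hom)
    interpret map_poly_inj_idom_hom "\<phi> g" ..
    have "map_poly (\<phi> g) p = (\<Prod>c\<in>C. [:- th (g <# c), 1:])"
      unfolding p_def hom_prod by (rule prod.cong) (simp_all add: th_act[OF g] gh.map_poly_pCons_hom hom_distribs)
    also have "\<dots> = p" unfolding p_def by (rule prod.reindex_bij_betw[OF T_bij[OF g]])
    finally show ?thesis .
  qed
  have P_inv: "map_poly (\<phi> g) (P c) = P (g <# c)" if g: "g \<in> carrier G" and c: "c \<in> C" for g c
  proof -
    interpret gh: field_hom "\<phi> g" using g by (rule field_hom)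
    interpret map_poly_inj_idom_hom "\<phi> g" ..
    have bij: "bij_betw (\<lambda>c. g <# c) (C - {c}) (C - {g <# c})"
      proof -
      have "inj_on (\<lambda>c. g <# c) C" "(\<lambda>c. g <# c) ` C = C" using T_bij[OF g] by (auto simp: bij_betw_def)
      then have "(\<lambda>c. g <# c) ` (C - {c}) = C - {g <# c}"
        using c inj_on_image_set_diff[of "\<lambda>c. g <# c" C C "{c}"] by simp
      with \<open>inj_on (\<lambda>c. g <# c) C\<close> show ?thesis
        using inj_on_subset[OF _ Diff_subset, of "\<lambda>c. g <# c" C "{c}"] by (simp add: bij_betw_def)
    qed
    have "map_poly (\<phi> g) (P c) = (\<Prod>b\<in>C - {c}. [:- th (g <# b), 1:])"
      unfolding P_def hom_prod by (rule prod.cong) (simp_all add: th_act[OF g] gh.map_poly_pCons_hom hom_distribs)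
    also have "\<dots> = P (g <# c)" unfolding P_def by (rule prod.reindex_bij_betw[OF bij])
    finally show ?thesis .
  qed
  have x_eval: "poly (x i) (th c) = w c i * poly (P c) (th c)" if c: "c \<in> C" for c i
  proof -
    have "poly (x i) (th c) = (\<Sum>b\<in>C. if b = c then w c i * poly (P c) (th c) else 0)"
      unfolding x_def poly_sum
      by (rule sum.cong[OF refl]) (use c C_fin in \<open>auto simp: P_def poly_prod prod_zero_iff\<close>)
    then show ?thesis using c C_fin by simp
  qed
  have P_nz: "poly (P c) (th c) \<noteq> 0" if "c \<in> C" for c
    using that C_fin th_inj by (auto simp: P_def poly_prod prod_zero_iff inj_on_def)
  have "pinv x"
    unfolding pinv_def
  proof
    fix g assume g: "g \<in> carrier G"
    interpret gh: field_hom "\<phi> g" using g by (rule field_hom)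
    interpret map_poly_inj_idom_hom "\<phi> g" ..
    have "mv d (Ap g) (\<lambda>j. map_poly (\<phi> g) (x j)) i = smult (Lam g) (x i)" if i: "i < d" for i
    proof -
      have "mv d (Ap g) (\<lambda>j. map_poly (\<phi> g) (x j)) i
          = (\<Sum>j<d. \<Sum>c\<in>C. smult (A g i j * \<phi> g (w c j)) (P (g <# c)))"
        unfolding mv_def x_def hom_sum
        by (rule sum.cong[OF refl]) (simp add: P_inv[OF g] gh.map_poly_hom_smult smult_sum2)
      also have "\<dots> = (\<Sum>c\<in>C. \<Sum>j<d. smult (A g i j * \<phi> g (w c j)) (P (g <# c)))"
        by (rule sum.swap)
      also have "\<dots> = (\<Sum>c\<in>C. smult (act g (w c) i) (P (g <# c)))"
        unfolding act_def mv_def smult_sum ..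
      also have "\<dots> = (\<Sum>c\<in>C. smult (Lam g * w (g <# c) i) (P (g <# c)))"
        by (rule sum.cong) (simp_all add: w_act[OF g _ i])
      also have "\<dots> = (\<Sum>c\<in>C. smult (Lam g * w c i) (P c))"
        by (rule sum.reindex_bij_betw[OF T_bij[OF g]])
      finally show ?thesis by (simp add: x_def smult_sum2)
    qed
    then show "\<exists>c. c \<noteq> 0 \<and> (\<forall>i<d. mv d (Ap g) (\<lambda>j. map_poly (\<phi> g) (x j)) i = smult c (x i))"
      using Lam_nz[OF g] by blast
  qed
  moreover have "p dvd qp x"
    unfolding p_def
  proof (rule poly_prod_linear_dvd[OF C_fin th_inj])
    fix c assume c: "c \<in> C"
    have "poly (qp x) (th c) = qf d Q (\<lambda>i. w c i * poly (P c) (th c))"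
      unfolding poly_hom.qf_hom by (simp add: x_eval[OF c])
    also have "\<dots> = qf d Q (\<lambda>i. (a c * poly (P c) (th c)) * yc c i)" by (simp add: w_def mult_ac)
    also have "\<dots> = 0" unfolding qf_scale yc_q[OF c] by simp
    finally show "poly (qp x) (th c) = 0" .
  qed
  \<comment> \<open>At each root of \<open>p\<close> some coordinate \<open>k c\<close> of
    \<open>x\<close> is nonzero. Interpolating the inverse values gives a combination of the
    \<open>x i\<close> congruent to 1 modulo \<open>p\<close>.\<close>
  moreover have "\<exists>a u. a * p + (\<Sum>i<d. u i * x i) = 1"
  proof -
    define k where "k c = (SOME i. i < d \<and> yc c i \<noteq> 0)" for c
    have k: "k c < d" "yc c (k c) \<noteq> 0" if "c \<in> C" for c
      using someI_ex[OF yc_nz[OF that]] by (simp_all add: k_def)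
    have xk: "poly (x (k c)) (th c) \<noteq> 0" if "c \<in> C" for c
      using x_eval[OF that] P_nz[OF that] a_nz[OF that] k(2)[OF that] by (simp add: w_def)
    have "\<exists>u. \<forall>c\<in>C. poly u (th c) = (if i = k c then 1 / poly (x i) (th c) else 0)" for i
      using poly_interpolation_ex[OF C_fin th_inj, of "\<lambda>c. if i = k c then 1 / poly (x i) (th c) else 0"] by metis
    then obtain u where u: "\<And>i c. c \<in> C \<Longrightarrow> poly (u i) (th c) = (if i = k c then 1 / poly (x i) (th c) else 0)"
      by metis
    have "p dvd 1 - (\<Sum>i<d. u i * x i)"
      unfolding p_def
    proof (rule poly_prod_linear_dvd[OF C_fin th_inj])
      fix c assume c: "c \<in> C"
      have "poly (\<Sum>i<d. u i * x i) (th c) = (\<Sum>i<d. if i = k c then 1 else 0)"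
        unfolding poly_sum poly_mult by (rule sum.cong[OF refl]) (use u[OF c] xk[OF c] in auto)
      then show "poly (1 - (\<Sum>i<d. u i * x i)) (th c) = 0" using k(1)[OF c] by simp
    qed
    then obtain q where "1 - (\<Sum>i<d. u i * x i) = p * q" ..
    then have "q * p + (\<Sum>i<d. u i * x i) = 1" by (simp add: algebra_simps)
    then show ?thesis by blast
  qed
  moreover have "lead_coeff p = 1" "odd (degree p)"
    using oddH degree_prod_linear[of th C] by (simp_all add: p_def C_def)
  ultimately show ?thesis using springer_descent[of p x] p_inv by blast
qed

end

section \<open>Polynomial functions\<close>

text \<open>Polynomials in an arbitrary set of variables, identified with the functions they define.\<close>

inductive_set polyfun :: "(('g \<Rightarrow> 'k::comm_ring_1) \<Rightarrow> 'k) set" where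
  const: "(\<lambda>_. c) \<in> polyfun"
| var: "(\<lambda>w. w x) \<in> polyfun"
| add: "f \<in> polyfun \<Longrightarrow> g \<in> polyfun \<Longrightarrow> (\<lambda>w. f w + g w) \<in> polyfun"
| mult: "f \<in> polyfun \<Longrightarrow> g \<in> polyfun \<Longrightarrow> (\<lambda>w. f w * g w) \<in> polyfun"

lemma polyfun_sum: "(\<And>i. i \<in> I \<Longrightarrow> f i \<in> polyfun) \<Longrightarrow> (\<lambda>w. \<Sum>i\<in>I. f i w) \<in> polyfun"
  by (induction I rule: infinite_finite_induct) (auto intro: polyfun.intros)

lemma polyfun_prod: "(\<And>i. i \<in> I \<Longrightarrow> f i \<in> polyfun) \<Longrightarrow> (\<lambda>w. \<Prod>i\<in>I. f i w) \<in> polyfun"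
  by (induction I rule: infinite_finite_induct) (auto intro: polyfun.intros)

lemma polyfun_power: "f \<in> polyfun \<Longrightarrow> (\<lambda>w. f w ^ n) \<in> polyfun"
  by (induction n) (auto intro: polyfun.intros)

lemma polyfun_compose:
  assumes "f \<in> polyfun" "\<And>x. (\<lambda>w. h w x) \<in> polyfun"
  shows "(\<lambda>w. f (h w)) \<in> polyfun"
  using assms(1) by induction (auto intro: polyfun.intros assms(2))

lemma polyfun_poly: "f \<in> polyfun \<Longrightarrow> (\<lambda>w. poly p (f w)) \<in> polyfun"
  by (induction p) (auto intro: polyfun.intros)

text \<open>Along a curve with polynomial coordinates, nonvanishing questions become questions about
  polynomials in one variable. Most density arguments below rest on this.\<close>

lemma polyfun_poly_curve:
  assumes "f \<in> polyfun"
  shows "\<exists>p. \<forall>t. poly p t = f (\<lambda>x. poly (c x) t)"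
  using assms
proof induction
  case (const a)
  show ?case by (rule exI[of _ "[:a:]"]) simp
next
  case (var x)
  show ?case by (rule exI[of _ "c x"]) simp
next
  case (add f g)
  then show ?case by (metis poly_add)
next
  case (mult f g)
  then show ?case by (metis poly_mult)
qed

text \<open>Both functions are restricted to the line through \<open>a\<close> and \<open>b\<close>;
  the product of two nonzero polynomials in one variable has a non-root because the field is
  infinite.\<close>

lemma polyfun_nonzero_mult:
  fixes f g :: "('g \<Rightarrow> 'k::field_char_0) \<Rightarrow> 'k"
  assumes "f \<in> polyfun" "g \<in> polyfun" "f a \<noteq> 0" "g b \<noteq> 0"
  obtains w where "f w \<noteq> 0" "g w \<noteq> 0"
proof -
  define c where "c x = [:a x, b x - a x:]" for x
  obtain p where p: "\<And>t. poly p t = f (\<lambda>x. poly (c x) t)" using polyfun_poly_curve[OF assms(1)] by blast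
  obtain q where q: "\<And>t. poly q t = g (\<lambda>x. poly (c x) t)" using polyfun_poly_curve[OF assms(2)] by blast
  have "poly p 0 \<noteq> 0" "poly q 1 \<noteq> 0" using assms(3,4) by (simp_all add: p q c_def)
  then have "p * q \<noteq> 0" by auto
  then obtain t where "poly (p * q) t \<noteq> 0" using poly_all_0_iff_0 by blast
  then show thesis using that p q by auto
qed

text \<open>Elements are functions, so identities are checked at points. As the field is infinite
  they form an integral domain, whose fraction field plays the part of \<open>k(W)\<close>.\<close>

typedef (overloaded) ('g, 'k::field_char_0) pfun = "polyfun :: (('g \<Rightarrow> 'k) \<Rightarrow> 'k) set"
  morphisms ev Abs_pfun
  by (auto intro: polyfun.const)

setup_lifting type_definition_pfun

instantiation pfun :: (type, field_char_0) idom
begin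

lift_definition zero_pfun :: "('a, 'b) pfun" is "\<lambda>_. 0" by (rule polyfun.const)
lift_definition one_pfun :: "('a, 'b) pfun" is "\<lambda>_. 1" by (rule polyfun.const)
lift_definition plus_pfun :: "('a, 'b) pfun \<Rightarrow> ('a, 'b) pfun \<Rightarrow> ('a, 'b) pfun"
  is "\<lambda>f g w. f w + g w" by (rule polyfun.add)
lift_definition times_pfun :: "('a, 'b) pfun \<Rightarrow> ('a, 'b) pfun \<Rightarrow> ('a, 'b) pfun"
  is "\<lambda>f g w. f w * g w" by (rule polyfun.mult)
lift_definition uminus_pfun :: "('a, 'b) pfun \<Rightarrow> ('a, 'b) pfun"
  is "\<lambda>f w. - f w"
  using polyfun.mult[OF polyfun.const[of "-1"]] by simp
definition minus_pfun :: "('a, 'b) pfun \<Rightarrow> ('a, 'b) pfun \<Rightarrow> ('a, 'b) pfun"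
  where "minus_pfun f g = f + - g"

instance
proof
  fix a b c :: "('a, 'b) pfun"
  show "a * b * c = a * (b * c)" by transfer (simp add: mult_ac)
  show "a * b = b * a" by transfer (simp add: mult_ac)
  show "1 * a = a" by transfer simp
  show "a + b + c = a + (b + c)" by transfer (simp add: add_ac)
  show "a + b = b + a" by transfer (simp add: add_ac)
  show "0 + a = a" by transfer simp
  show "- a + a = 0" by transfer simp
  show "a - b = a + - b" by (rule minus_pfun_def)
  show "(a + b) * c = a * c + b * c" by transfer (simp add: algebra_simps)
  show "a * (b + c) = a * b + a * c" by transfer (simp add: algebra_simps)
  show "0 * a = 0" "a * 0 = 0" by (transfer, simp)+
  show "(0 :: ('a, 'b) pfun) \<noteq> 1" by transfer (simp add: fun_eq_iff)
  show "a * b \<noteq> 0" if "a \<noteq> 0" "b \<noteq> 0"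
    using that
  proof transfer
    fix f g :: "('a \<Rightarrow> 'b) \<Rightarrow> 'b"
    assume "f \<in> polyfun" "g \<in> polyfun" "f \<noteq> (\<lambda>_. 0)" "g \<noteq> (\<lambda>_. 0)"
    then show "(\<lambda>w. f w * g w) \<noteq> (\<lambda>_. 0)"
      unfolding fun_eq_iff using polyfun_nonzero_mult[of f g] by (metis mult_eq_0_iff)
  qed
qed

end

lift_definition pconst :: "'k::field_char_0 \<Rightarrow> ('g, 'k) pfun" is "\<lambda>c _. c" by (rule polyfun.const)
lift_definition pvar :: "'g \<Rightarrow> ('g, 'k::field_char_0) pfun" is "\<lambda>x w. w x" by (rule polyfun.var)
lift_definition psubst :: "('g \<Rightarrow> 'g) \<Rightarrow> ('g, 'k::field_char_0) pfun \<Rightarrow> ('g, 'k) pfun"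
  is "\<lambda>s f w. f (\<lambda>x. w (s x))"
  by (rule polyfun_compose) (auto intro: polyfun.var)

lemma ev_simps [simp]:
  "ev 0 w = 0" "ev 1 w = 1" "ev (f + g) w = ev f w + ev g w" "ev (f * g) w = ev f w * ev g w"
  "ev (- f) w = - ev f w" "ev (f - g) w = ev f w - ev g w"
  "ev (pconst c) w = c" "ev (pvar x) w = w x" "ev (psubst s f) w = ev f (\<lambda>x. w (s x))"
proof -
  show *: "ev (f + g) w = ev f w + ev g w" for f g by transfer simp
  show **: "ev (- f) w = - ev f w" for f by transfer simp
  show "ev (f - g) w = ev f w - ev g w" unfolding minus_pfun_def * ** by simp
qed (transfer; simp)+

lemma ev_sum [simp]: "ev (sum f I) w = (\<Sum>i\<in>I. ev (f i) w)"
  by (induction I rule: infinite_finite_induct) auto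

lemma ev_prod [simp]: "ev (prod f I) w = (\<Prod>i\<in>I. ev (f i) w)"
  by (induction I rule: infinite_finite_induct) auto

lemma ev_inverse: "f \<in> polyfun \<Longrightarrow> ev (Abs_pfun f) w = f w"
  by (simp add: Abs_pfun_inverse)

lemma pfun_eqI: "(\<And>w. ev f w = ev g w) \<Longrightarrow> f = g"
  by (simp add: ev_inject[symmetric] fun_eq_iff)

lemma pfun_nonzero: "f \<noteq> 0 \<Longrightarrow> \<exists>w. ev f w \<noteq> 0"
  by (metis ev_simps(1) pfun_eqI)

lemma pconst_hom: "comm_ring_hom (pconst :: 'k::field_char_0 \<Rightarrow> ('g, 'k) pfun)"
  by unfold_locales (auto intro!: pfun_eqI)

lemma psubst_hom:
  assumes "bij s"
  shows "inj_idom_hom (psubst s :: ('g, 'k::field_char_0) pfun \<Rightarrow> _)"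
proof
  fix f :: "('g, 'k) pfun"
  assume "psubst s f = 0"
  then have *: "ev f (\<lambda>x. w (s x)) = 0" for w by (metis ev_simps(1,9))
  have "ev f w = 0" for w
    using *[of "\<lambda>x. w (inv_into UNIV s x)"] assms by (simp add: bij_is_inj)
  then show "f = 0" by (intro pfun_eqI) simp
qed (auto intro!: pfun_eqI)

text \<open>The extension of a ring homomorphism to fraction fields. It is pinned down by all
  representing fractions at once; for injective \<open>h\<close> they agree.\<close>

definition map_fract :: "('a::idom \<Rightarrow> 'b::idom) \<Rightarrow> 'a fract \<Rightarrow> 'b fract" where
  "map_fract h x = (THE z. \<forall>a b. b \<noteq> 0 \<and> x = Fract a b \<longrightarrow> z = Fract (h a) (h b))"

lemma (in inj_idom_hom) map_fract_Fract:
  assumes "b \<noteq> 0" shows "map_fract hom (Fract a b) = Fract (hom a) (hom b)"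
  unfolding map_fract_def
proof (rule the_equality)
  show "\<forall>a' b'. b' \<noteq> 0 \<and> Fract a b = Fract a' b' \<longrightarrow> Fract (hom a) (hom b) = Fract (hom a') (hom b')"
    using assms by (auto simp: eq_fract simp flip: hom_mult)
qed (use assms in blast)

lemma (in inj_idom_hom) map_fract_hom: "field_hom (map_fract hom)"
proof
  show "map_fract hom 0 = 0" "map_fract hom 1 = 1"
    by (simp_all add: Zero_fract_def One_fract_def map_fract_Fract)
  fix x y :: "'a fract"
  obtain a b where x: "x = Fract a b" "b \<noteq> 0" by (cases x) auto
  obtain c e where y: "y = Fract c e" "e \<noteq> 0" by (cases y) auto
  show "map_fract hom (x + y) = map_fract hom x + map_fract hom y"
    using x y by (simp add: map_fract_Fract hom_distribs)
  show "map_fract hom (x * y) = map_fract hom x * map_fract hom y"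
    using x y by (simp add: map_fract_Fract hom_distribs)
qed

lemma to_fract_hom: "inj_idom_hom to_fract"
  by unfold_locales auto

lemma (in inj_idom_hom) map_fract_to_fract: "map_fract hom (to_fract a) = to_fract (hom a)"
  by (simp add: to_fract_def map_fract_Fract)

lemma common_denominator:
  fixes y :: "nat \<Rightarrow> 'a::idom fract"
  obtains D N where "D \<noteq> 0" "\<And>i. i < d \<Longrightarrow> y i * to_fract D = to_fract (N i)"
proof -
  have "\<exists>a b. b \<noteq> 0 \<and> y i = Fract a b" for i by (cases "y i") auto
  then obtain a b where ab: "\<And>i. b i \<noteq> 0" "\<And>i. y i = Fract (a i) (b i)" by metis
  show thesis
  proof (rule that[of "prod b {..<d}" "\<lambda>i. a i * prod b ({..<d} - {i})"])
    show "prod b {..<d} \<noteq> 0" using ab(1) by auto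
    fix i assume "i < d"
    then have "prod b {..<d} = b i * prod b ({..<d} - {i})" by (simp add: prod.remove)
    then show "y i * to_fract (prod b {..<d}) = to_fract (a i * prod b ({..<d} - {i}))"
      using ab by (simp add: to_fract_def eq_fract)
  qed
qed

locale isometric_lift = group G
  for G (structure) and d :: nat and Q :: "nat \<Rightarrow> nat \<Rightarrow> 'k::field_char_0"
    and a :: "'g \<Rightarrow> nat \<Rightarrow> nat \<Rightarrow> 'k" +
  assumes fin: "finite (carrier G)"
    and isom: "g \<in> carrier G \<Longrightarrow> isometry d Q (a g)"
    and a_mult: "g \<in> carrier G \<Longrightarrow> h \<in> carrier G \<Longrightarrow>
      \<exists>\<epsilon>\<in>{1,-1}. \<forall>i<d. \<forall>l<d. (\<Sum>j<d. a g i j * a h j l) = \<epsilon> * a (g \<otimes> h) i l"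
    and a_one: "i < d \<Longrightarrow> l < d \<Longrightarrow> a \<one> i l = (if i = l then 1 else 0)"
begin

text \<open>Left translation, extended by the identity outside the carrier. It has to permute the
  whole type, because every element of the type indexes a variable.\<close>

definition tr :: "'g \<Rightarrow> 'g \<Rightarrow> 'g" where
  "tr g x = (if x \<in> carrier G then g \<otimes> x else x)"

lemma tr_tr: "g \<in> carrier G \<Longrightarrow> h \<in> carrier G \<Longrightarrow> tr g (tr h x) = tr (g \<otimes> h) x"
  by (simp add: tr_def m_assoc)

lemma tr_one: "tr \<one> x = x"
  by (simp add: tr_def)

lemma tr_bij: "g \<in> carrier G \<Longrightarrow> bij (tr g)"
  by (rule o_bij[of "tr (inv g)"]) (auto simp: fun_eq_iff tr_tr tr_one)

lemma a_mult_mv: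
  assumes "g \<in> carrier G" "h \<in> carrier G"
  obtains \<epsilon> where "\<epsilon> = 1 \<or> \<epsilon> = -1" "\<And>x i. i < d \<Longrightarrow> mv d (a g) (mv d (a h) x) i = \<epsilon> * mv d (a (g \<otimes> h)) x i"
proof -
  obtain \<epsilon> where e: "\<epsilon> \<in> {1,-1}" "\<And>i l. i < d \<Longrightarrow> l < d \<Longrightarrow> (\<Sum>j<d. a g i j * a h j l) = \<epsilon> * a (g \<otimes> h) i l"
    using a_mult[OF assms] by blast
  have "mv d (a g) (mv d (a h) x) i = \<epsilon> * mv d (a (g \<otimes> h)) x i" if "i < d" for x i
    unfolding mv_mv unfolding mv_def sum_distrib_left by (rule sum.cong) (use e(2) that in auto)
  then show thesis using that e(1) by blast
qed

lemma mv_one: "i < d \<Longrightarrow> mv d (a \<one>) x i = x i"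
proof -
  assume i: "i < d"
  have "mv d (a \<one>) x i = (\<Sum>j<d. if i = j then x j else 0)"
    unfolding mv_def by (rule sum.cong[OF refl]) (use i a_one in simp)
  then show ?thesis using i by simp
qed

lemma a_nonzero:
  assumes g: "g \<in> carrier G" and x: "\<exists>i<d. x i \<noteq> 0"
  shows "\<exists>i<d. mv d (a g) x i \<noteq> 0"
proof (rule ccontr)
  assume *: "\<not> ?thesis"
  obtain \<epsilon> where \<epsilon>: "\<epsilon> = 1 \<or> \<epsilon> = -1"
      "\<And>x i. i < d \<Longrightarrow> mv d (a (inv g)) (mv d (a g) x) i = \<epsilon> * mv d (a (inv g \<otimes> g)) x i"
    using a_mult_mv[of "inv g" g] g by auto
  have "mv d (a (inv g)) (mv d (a g) x) i = 0" for i
    using * by (simp add: mv_def)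
  then have "x i = 0" if "i < d" for i
    using \<epsilon>(1) \<epsilon>(2)[OF that, of x] mv_one[OF that] g by auto
  then show False using x by auto
qed

text \<open>The semilinear action on vectors over \<open>k(W)\<close>. Invariance up to scalars is expressed by the
  vanishing of the two-by-two minors, which makes sense over the ring of polynomial functions.\<close>

definition pact :: "'g \<Rightarrow> (nat \<Rightarrow> ('g, 'k) pfun) \<Rightarrow> nat \<Rightarrow> ('g, 'k) pfun" where
  "pact g Y i = mv d (\<lambda>i j. pconst (a g i j)) (\<lambda>j. psubst (tr g) (Y j)) i"

definition par_inv :: "'g set \<Rightarrow> (nat \<Rightarrow> ('g, 'k) pfun) \<Rightarrow> bool" where
  "par_inv H Y \<longleftrightarrow> (\<forall>g\<in>H. \<forall>i<d. \<forall>j<d. pact g Y i * Y j = pact g Y j * Y i)"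

text \<open>The descent needs a field, so it takes place over the fraction field of the polynomial
  functions. Clearing denominators afterwards does not change the projective point.\<close>

lemma descent_pfun:
  assumes H: "subgroup H G" "odd (card (lcosets H))"
    and Y: "\<exists>i<d. Y i \<noteq> 0" "qf d (\<lambda>i j. pconst (Q i j)) Y = 0" "par_inv H Y"
  obtains Z where "\<exists>i<d. Z i \<noteq> 0" "qf d (\<lambda>i j. pconst (Q i j)) Z = 0" "par_inv (carrier G) Z"
proof -
  define \<phi> :: "'g \<Rightarrow> ('g, 'k) pfun fract \<Rightarrow> ('g, 'k) pfun fract" where
    "\<phi> g = map_fract (psubst (tr g))" for g
  define cc :: "'k \<Rightarrow> ('g, 'k) pfun fract" where "cc c = to_fract (pconst c)" for c
  interpret tf: inj_idom_hom "to_fract :: ('g, 'k) pfun \<Rightarrow> _" by (rule to_fract_hom)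
  interpret pc: comm_ring_hom "pconst :: 'k \<Rightarrow> ('g, 'k) pfun" by (rule pconst_hom)
  interpret cc: comm_ring_hom cc
    by unfold_locales (simp_all add: cc_def pc.hom_add tf.hom_add pc.hom_mult tf.hom_mult)
  have tr_hom: "inj_idom_hom (psubst (tr g) :: ('g, 'k) pfun \<Rightarrow> _)" if "g \<in> carrier G" for g
    using tr_bij[OF that] by (rule psubst_hom)
  have \<phi>_to: "\<phi> g (to_fract f) = to_fract (psubst (tr g) f)" if "g \<in> carrier G" for g f
    unfolding \<phi>_def by (rule inj_idom_hom.map_fract_to_fract[OF tr_hom[OF that]])
  have ps_const: "psubst s (pconst c) = (pconst c :: ('g, 'k) pfun)" for s c
    by (rule pfun_eqI) simp
  have ps_ps: "psubst (tr g) (psubst (tr h) f) = psubst (tr (g \<otimes> h)) f"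
    if "g \<in> carrier G" "h \<in> carrier G" for g h and f :: "('g, 'k) pfun"
    by (rule pfun_eqI) (simp add: tr_tr that)
  have \<phi>_mult: "\<phi> (g \<otimes> h) x = \<phi> g (\<phi> h x)" if g: "g \<in> carrier G" and h: "h \<in> carrier G" for g h x
  proof -
    obtain p q where x: "x = Fract p q" "q \<noteq> 0" by (cases x) auto
    interpret hh: inj_idom_hom "psubst (tr h) :: ('g, 'k) pfun \<Rightarrow> _" by (rule tr_hom[OF h])
    interpret gg: inj_idom_hom "psubst (tr g) :: ('g, 'k) pfun \<Rightarrow> _" by (rule tr_hom[OF g])
    interpret gh: inj_idom_hom "psubst (tr (g \<otimes> h)) :: ('g, 'k) pfun \<Rightarrow> _" by (rule tr_hom) (simp add: g h)
    have "psubst (tr h) q \<noteq> 0" using x(2) by simp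
    then show ?thesis
      unfolding x(1) \<phi>_def hh.map_fract_Fract[OF x(2)] gh.map_fract_Fract[OF x(2)]
      by (simp add: gg.map_fract_Fract ps_ps g h)
  qed
  interpret tw: twisted_action G \<phi> d "\<lambda>i j. cc (Q i j)" "\<lambda>g i j. cc (a g i j)"
  proof unfold_locales
    fix g assume g: "g \<in> carrier G"
    interpret gg: inj_idom_hom "psubst (tr g) :: ('g, 'k) pfun \<Rightarrow> _" by (rule tr_hom[OF g])
    interpret fh: field_hom "\<phi> g" unfolding \<phi>_def by (rule gg.map_fract_hom)
    show "\<phi> g 0 = 0" "\<phi> g 1 = 1" by (rule fh.hom_zero, rule fh.hom_one)
    show "\<phi> g (x + y) = \<phi> g x + \<phi> g y" "\<phi> g (x * y) = \<phi> g x * \<phi> g y" for x y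
      by (rule fh.hom_add, rule fh.hom_mult)
    show "\<phi> g (cc (Q i j)) = cc (Q i j)" for i j by (simp add: cc_def \<phi>_to[OF g] ps_const)
    show "isometry d (\<lambda>i j. cc (Q i j)) (\<lambda>i j. cc (a g i j))"
      by (rule cc.isometry_hom[OF isom[OF g]])
    fix h assume h: "h \<in> carrier G"
    show "\<phi> g (cc (a h i j)) = cc (a h i j)" for i j by (simp add: cc_def \<phi>_to[OF g] ps_const)
    show "\<phi> (g \<otimes> h) x = \<phi> g (\<phi> h x)" for x by (rule \<phi>_mult[OF g h])
    obtain e where e: "e \<in> {1,-1}" "\<And>i l. i < d \<Longrightarrow> l < d \<Longrightarrow> (\<Sum>j<d. a g i j * a h j l) = e * a (g \<otimes> h) i l"
      using a_mult[OF g h] by blast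
    have "(\<Sum>j<d. cc (a g i j) * cc (a h j l)) = cc e * cc (a (g \<otimes> h) i l)" if "i < d" "l < d" for i l
      using arg_cong[OF e(2)[OF that], of cc] by (simp add: cc.hom_sum cc.hom_mult)
    moreover have "cc e \<in> {1,-1}" using e(1) cc.hom_one cc.hom_uminus[of 1] by auto
    ultimately show "\<exists>\<epsilon>\<in>{1,-1}. \<forall>i<d. \<forall>l<d. (\<Sum>j<d. cc (a g i j) * cc (a h j l)) = \<epsilon> * cc (a (g \<otimes> h) i l)"
      by blast
  next
    show "finite (carrier G)" by (rule fin)
    show "cc (a \<one> i l) = (if i = l then 1 else 0)" if "i < d" "l < d" for i l
      using a_one[OF that] by simp
  qed
  have act_to: "tw.act g (\<lambda>i. to_fract (F i)) i = to_fract (pact g F i)" if "g \<in> carrier G" for g F i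
    unfolding tw.act_def pact_def mv_def tf.hom_sum tf.hom_mult by (simp add: \<phi>_to[OF that] cc_def)
  have qf_to: "qf d (\<lambda>i j. cc (Q i j)) (\<lambda>i. to_fract (F i)) = to_fract (qf d (\<lambda>i j. pconst (Q i j)) F)" for F
    unfolding tf.qf_hom cc_def ..
  \<comment> \<open>The variables themselves serve as \<open>X\<close>: translation permutes those
    indexed by \<open>G\<close>, and evaluation at indicator functions shows that sums over
    different subsets differ.\<close>
  define X where "X g = to_fract (pvar g :: ('g, 'k) pfun)" for g
  have "\<exists>y. (\<exists>i<d. y i \<noteq> 0) \<and> tw.cinv y \<and> qf d (\<lambda>i j. cc (Q i j)) y = 0"
  proof (rule tw.odd_index_descent[OF H, where y = "\<lambda>i. to_fract (Y i)" and X = X])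
    show "\<exists>i<d. to_fract (Y i) \<noteq> 0" using Y(1) by simp
    show "qf d (\<lambda>i j. cc (Q i j)) (\<lambda>i. to_fract (Y i)) = 0" unfolding qf_to Y(2) by simp
  next
    fix h assume h: "h \<in> H"
    then have hc: "h \<in> carrier G" using subgroup.subset[OF H(1)] by auto
    obtain k where k: "k < d" "Y k \<noteq> 0" using Y(1) by blast
    \<comment> \<open>A nonzero coordinate \<open>k\<close> turns the vanishing of minors into
      proportionality.\<close>
    have par: "tw.act h (\<lambda>i. to_fract (Y i)) i = tw.act h (\<lambda>i. to_fract (Y i)) k / to_fract (Y k) * to_fract (Y i)"
      if i: "i < d" for i
    proof -
      have "pact h Y i * Y k = pact h Y k * Y i" using Y(3) h i k(1) unfolding par_inv_def by blast
      from arg_cong[OF this, of to_fract] show ?thesis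
        using k(2) unfolding act_to[OF hc] tf.hom_mult by (simp add: field_simps)
    qed
    moreover have "tw.act h (\<lambda>i. to_fract (Y i)) k / to_fract (Y k) \<noteq> 0"
    proof
      assume z: "tw.act h (\<lambda>i. to_fract (Y i)) k / to_fract (Y k) = 0"
      have "\<forall>i<d. tw.act h (\<lambda>i. to_fract (Y i)) i = 0"
        using par unfolding z by (metis mult_zero_left)
      moreover have "\<exists>i<d. tw.act h (\<lambda>i. to_fract (Y i)) i \<noteq> 0"
        using tw.act_nonzero[OF hc, of "\<lambda>i. to_fract (Y i)"] Y(1) by simp
      ultimately show False by blast
    qed
    ultimately show "\<exists>c. c \<noteq> 0 \<and> (\<forall>i<d. tw.act h (\<lambda>i. to_fract (Y i)) i = c * to_fract (Y i))"
      by blast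
  next
    fix g h assume g: "g \<in> carrier G" and h: "h \<in> carrier G"
    have "psubst (tr g) (pvar h) = (pvar (g \<otimes> h) :: ('g, 'k) pfun)"
      by (rule pfun_eqI) (simp add: tr_def h)
    then show "\<phi> g (X h) = X (g \<otimes> h)" by (simp add: X_def \<phi>_to[OF g])
  next
    show "inj_on (sum X) (Pow (carrier G))"
    proof (rule inj_onI)
      fix c e assume ce: "c \<in> Pow (carrier G)" "e \<in> Pow (carrier G)" "sum X c = sum X e"
      then have "to_fract (sum pvar c) = (to_fract (sum pvar e) :: ('g, 'k) pfun fract)"
        unfolding X_def tf.hom_sum by simp
      then have "sum pvar c = (sum pvar e :: ('g, 'k) pfun)" by (rule tf.injectivity)
      then have *: "(\<Sum>x\<in>c. w x) = (\<Sum>x\<in>e. w x)" for w :: "'g \<Rightarrow> 'k"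
        by (metis (no_types, lifting) ev_simps(8) ev_sum sum.cong)
      have fin': "finite c" "finite e" using ce fin finite_subset by auto
      have "x \<in> c \<longleftrightarrow> x \<in> e" for x
        using *[of "\<lambda>z. if z = x then 1 else 0"] fin' by (simp split: if_splits)
      then show "c = e" by blast
    qed
  qed
  then obtain y where y: "\<exists>i<d. y i \<noteq> 0" "tw.cinv y" "qf d (\<lambda>i j. cc (Q i j)) y = 0" by blast
  obtain D N where D: "D \<noteq> 0" "\<And>i. i < d \<Longrightarrow> y i * to_fract D = to_fract (N i)"
    using common_denominator[of d y] by blast
  have N: "to_fract (N i) = to_fract D * y i" if "i < d" for i using D(2)[OF that] by (simp add: mult.commute)
  show thesis
  proof (rule that[of N])
    obtain i where i: "i < d" "y i \<noteq> 0" using y(1) by blast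
    then have "to_fract (N i) \<noteq> 0" using N[OF i(1)] D(1) by simp
    then show "\<exists>i<d. N i \<noteq> 0" using i(1) by auto
    have "to_fract (qf d (\<lambda>i j. pconst (Q i j)) N) = qf d (\<lambda>i j. cc (Q i j)) (\<lambda>i. to_fract D * y i)"
      unfolding qf_to[symmetric] by (rule qf_cong) (rule N)
    also have "\<dots> = 0" unfolding qf_scale y(3) by simp
    finally show "qf d (\<lambda>i j. pconst (Q i j)) N = 0" by simp
    show "par_inv (carrier G) N"
      unfolding par_inv_def
    proof (intro ballI allI impI)
      fix g i j assume g: "g \<in> carrier G" and ij: "i < d" "j < d"
      obtain c where c: "\<And>i. i < d \<Longrightarrow> tw.act g y i = c * y i"
        using y(2) g unfolding tw.cinv_def tw.act_def by blast
      have "to_fract (pact g N i) = \<phi> g (to_fract D) * (c * y i)" if "i < d" for i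
      proof -
        have "to_fract (pact g N i) = tw.act g (\<lambda>i. to_fract D * y i) i"
          unfolding act_to[OF g, symmetric] by (rule fun_cong[OF tw.act_cong]) (rule N)
        then show ?thesis using tw.act_scale[OF g] c[OF that] by simp
      qed
      then have "to_fract (pact g N i * N j) = to_fract (pact g N j * N i)"
        using N ij by (simp add: tf.hom_mult)
      then show "pact g N i * N j = pact g N j * N i" by (rule tf.injectivity)
    qed
  qed
qed

end

section \<open>Projective varieties as spaces with functions\<close>

definition mon :: "(nat \<Rightarrow>\<^sub>0 nat) \<Rightarrow> 'k::comm_ring_1 vec \<Rightarrow> 'k" where
  "mon m v = (\<Prod>i\<in>Poly_Mapping.keys m. (v $ i) ^ Poly_Mapping.lookup m i)"

definition mdeg :: "(nat \<Rightarrow>\<^sub>0 nat) \<Rightarrow> nat" where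
  "mdeg m = (\<Sum>i\<in>Poly_Mapping.keys m. Poly_Mapping.lookup m i)"

lemma mon_superset:
  assumes "finite K" "Poly_Mapping.keys m \<subseteq> K"
  shows "mon m v = (\<Prod>i\<in>K. (v $ i) ^ Poly_Mapping.lookup m i)"
  unfolding mon_def by (rule prod.mono_neutral_left) (use assms in \<open>auto simp: in_keys_iff\<close>)

lemma mdeg_superset:
  assumes "finite K" "Poly_Mapping.keys m \<subseteq> K"
  shows "mdeg m = (\<Sum>i\<in>K. Poly_Mapping.lookup m i)"
  unfolding mdeg_def by (rule sum.mono_neutral_left) (use assms in \<open>auto simp: in_keys_iff\<close>)

lemma mon_add: "mon (m + m') v = mon m v * mon m' v"
proof -
  let ?K = "Poly_Mapping.keys m \<union> Poly_Mapping.keys m'"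
  have "Poly_Mapping.keys (m + m') \<subseteq> ?K" by (rule Poly_Mapping.keys_add)
  then show ?thesis
    by (simp add: mon_superset[of ?K] lookup_add power_add prod.distrib)
qed

lemma mdeg_add: "mdeg (m + m') = mdeg m + mdeg m'"
proof -
  let ?K = "Poly_Mapping.keys m \<union> Poly_Mapping.keys m'"
  have "Poly_Mapping.keys (m + m') \<subseteq> ?K" by (rule Poly_Mapping.keys_add)
  then show ?thesis
    by (simp add: mdeg_superset[of ?K] lookup_add sum.distrib)
qed

lemma eval_mpoly_superset:
  assumes "finite K" "Poly_Mapping.keys p \<subseteq> K"
  shows "eval_mpoly p v = (\<Sum>m\<in>K. Poly_Mapping.lookup p m * mon m v)"
  unfolding eval_mpoly_def mon_def
  by (rule sum.mono_neutral_left) (use assms in \<open>auto simp: in_keys_iff\<close>)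

lemma eval_mpoly_0 [simp]: "eval_mpoly 0 v = 0"
  by (simp add: eval_mpoly_def)

lemma eval_mpoly_single: "eval_mpoly (Poly_Mapping.single m c) v = c * mon m v"
  by (subst eval_mpoly_superset[of "{m}"]) auto

lemma eval_mpoly_add: "eval_mpoly (p + q) v = eval_mpoly p v + eval_mpoly q v"
proof -
  let ?K = "Poly_Mapping.keys p \<union> Poly_Mapping.keys q"
  have "Poly_Mapping.keys (p + q) \<subseteq> ?K" by (rule Poly_Mapping.keys_add)
  then show ?thesis
    by (simp add: eval_mpoly_superset[of ?K] lookup_add sum.distrib distrib_right)
qed

lemma eval_mpoly_sum: "eval_mpoly (sum f I) v = (\<Sum>i\<in>I. eval_mpoly (f i) v)"
  by (induction I rule: infinite_finite_induct) (auto simp: eval_mpoly_add)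

lemma mpoly_monomials: "(\<Sum>m\<in>Poly_Mapping.keys p. Poly_Mapping.single m (Poly_Mapping.lookup p m)) = p"
  by (rule poly_mapping_eqI) (auto simp: lookup_sum lookup_single when_def in_keys_iff)

lemma eval_mpoly_mult: "eval_mpoly (p * q) v = eval_mpoly p v * eval_mpoly q v"
proof -
  have "p * q = (\<Sum>m\<in>Poly_Mapping.keys p. \<Sum>m'\<in>Poly_Mapping.keys q.
      Poly_Mapping.single (m + m') (Poly_Mapping.lookup p m * Poly_Mapping.lookup q m'))"
    by (subst (1) mpoly_monomials[of p, symmetric], subst (1) mpoly_monomials[of q, symmetric])
      (simp add: sum_product mult_single)
  then have "eval_mpoly (p * q) v = (\<Sum>m\<in>Poly_Mapping.keys p. \<Sum>m'\<in>Poly_Mapping.keys q.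
      (Poly_Mapping.lookup p m * mon m v) * (Poly_Mapping.lookup q m' * mon m' v))"
    by (simp add: eval_mpoly_sum eval_mpoly_single mon_add mult_ac)
  then show ?thesis
    by (simp add: sum_product[symmetric] eval_mpoly_superset[OF finite_keys order_refl])
qed

lemma homogeneous_iff: "homogeneous n d p \<longleftrightarrow> (\<forall>m\<in>Poly_Mapping.keys p. Poly_Mapping.keys m \<subseteq> {..n} \<and> mdeg m = d)"
  by (simp add: homogeneous_def mdeg_def)

lemma homogeneous_add: "homogeneous n d p \<Longrightarrow> homogeneous n d q \<Longrightarrow> homogeneous n d (p + q)"
  unfolding homogeneous_iff using Poly_Mapping.keys_add[of p q] by blast

lemma homogeneous_mult:
  assumes "homogeneous n d p" "homogeneous n e q"
  shows "homogeneous n (d + e) (p * q)"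
  unfolding homogeneous_iff
proof
  fix m assume "m \<in> Poly_Mapping.keys (p * q)"
  then obtain a b where ab: "a \<in> Poly_Mapping.keys p" "b \<in> Poly_Mapping.keys q" "m = a + b"
    using keys_mult[of p q] by blast
  then show "Poly_Mapping.keys m \<subseteq> {..n} \<and> mdeg m = d + e"
    using assms subset_trans[OF Poly_Mapping.keys_add[of a b], of "{..n}"] unfolding homogeneous_iff
    by (simp add: mdeg_add)
qed

lemma homogeneous_0 [simp]: "homogeneous n d 0"
  by (simp add: homogeneous_def)

lemma homogeneous_1 [simp]: "homogeneous n 0 1"
  by (simp add: homogeneous_def)

lemma eval_mpoly_1 [simp]: "eval_mpoly 1 v = 1"
  using eval_mpoly_single[of 0 1 v] by (simp add: mon_def)

lemma homogeneous_const: "homogeneous n 0 (Poly_Mapping.single 0 c)"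
  by (auto simp: homogeneous_def)

lemma eval_const: "eval_mpoly (Poly_Mapping.single 0 c) v = c"
  by (simp add: eval_mpoly_single mon_def)

lemma homogeneous_var: "i \<le> n \<Longrightarrow> homogeneous n 1 (Poly_Mapping.single (Poly_Mapping.single i 1) c)"
  by (auto simp: homogeneous_iff mdeg_def)

lemma eval_var: "eval_mpoly (Poly_Mapping.single (Poly_Mapping.single i 1) 1) v = v $ i"
  by (simp add: eval_mpoly_single mon_def)

text \<open>Homogeneity confines the variables to indices at most \<open>n\<close>, where the
  entries of \<open>vec (n + 1) u\<close> are those of \<open>u\<close>. From here on points are
  handled through coordinate functions.\<close>

lemma eval_vec:
  assumes "homogeneous n d p"
  shows "eval_mpoly p (vec (n + 1) u) = (\<Sum>m\<in>Poly_Mapping.keys p. Poly_Mapping.lookup p m * (\<Prod>i\<in>Poly_Mapping.keys m. u i ^ Poly_Mapping.lookup m i))"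
  unfolding eval_mpoly_def
proof (rule sum.cong[OF refl])
  fix m assume "m \<in> Poly_Mapping.keys p"
  then have "Poly_Mapping.keys m \<subseteq> {..n}" using assms by (auto simp: homogeneous_def)
  then have "(\<Prod>i\<in>Poly_Mapping.keys m. (vec (n + 1) u $ i) ^ Poly_Mapping.lookup m i) = (\<Prod>i\<in>Poly_Mapping.keys m. u i ^ Poly_Mapping.lookup m i)"
    by (intro prod.cong[OF refl]) auto
  then show "Poly_Mapping.lookup p m * (\<Prod>i\<in>Poly_Mapping.keys m. (vec (n + 1) u $ i) ^ Poly_Mapping.lookup m i)
     = Poly_Mapping.lookup p m * (\<Prod>i\<in>Poly_Mapping.keys m. u i ^ Poly_Mapping.lookup m i)" by simp
qed

lemma eval_scale:
  assumes "homogeneous n d p"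
  shows "eval_mpoly p (vec (n + 1) (\<lambda>i. c * u i)) = c ^ d * eval_mpoly p (vec (n + 1) u)"
  unfolding eval_vec[OF assms] sum_distrib_left
proof (rule sum.cong[OF refl])
  fix m assume "m \<in> Poly_Mapping.keys p"
  then have "mdeg m = d" using assms by (auto simp: homogeneous_iff)
  then have "(\<Prod>i\<in>Poly_Mapping.keys m. c ^ Poly_Mapping.lookup m i) = c ^ d"
    using power_sum[of c "Poly_Mapping.lookup m" "Poly_Mapping.keys m"] by (simp add: mdeg_def)
  then show "Poly_Mapping.lookup p m * (\<Prod>i\<in>Poly_Mapping.keys m. (c * u i) ^ Poly_Mapping.lookup m i)
      = c ^ d * (Poly_Mapping.lookup p m * (\<Prod>i\<in>Poly_Mapping.keys m. u i ^ Poly_Mapping.lookup m i))"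
    by (simp add: power_mult_distrib prod.distrib)
qed

section \<open>Points of projective space in homogeneous coordinates\<close>

definition pt :: "nat \<Rightarrow> (nat \<Rightarrow> 'k::field) \<Rightarrow> 'k vec set" where
  "pt n u = {c \<cdot>\<^sub>v vec (n + 1) u | c. c \<noteq> 0}"

lemma pt_alt: "pt n u = {vec (n + 1) (\<lambda>i. c * u i) | c. c \<noteq> 0}"
proof -
  have "c \<cdot>\<^sub>v vec (n + 1) u = vec (n + 1) (\<lambda>i. c * u i)" for c by (rule eq_vecI) auto
  then show ?thesis by (simp add: pt_def)
qed

lemma vec_in_pt: "vec (n + 1) u \<in> pt n u"
  unfolding pt_alt by (rule CollectI, rule exI[of _ 1]) simp

lemma vec_nonzero: "vec (n + 1) u \<noteq> 0\<^sub>v (n + 1) \<longleftrightarrow> (\<exists>i\<le>n. u i \<noteq> 0)"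
  by (auto simp: vec_eq_iff less_Suc_eq_le)

lemma proj_points_pt: "p \<in> proj_points n \<longleftrightarrow> (\<exists>u. p = pt n u \<and> (\<exists>i\<le>n. u i \<noteq> 0))"
proof
  assume "p \<in> proj_points n"
  then obtain v where v: "v \<in> carrier_vec (n + 1)" "v \<noteq> 0\<^sub>v (n + 1)" "p = {c \<cdot>\<^sub>v v | c. c \<noteq> 0}"
    unfolding proj_points_def by blast
  have "v = vec (n + 1) (\<lambda>i. v $ i)" using v(1) by (intro eq_vecI) auto
  then have "p = pt n (\<lambda>i. v $ i)" "\<exists>i\<le>n. v $ i \<noteq> 0"
    using v(2,3) vec_nonzero[of n "\<lambda>i. v $ i"] unfolding pt_def by simp_all
  then show "\<exists>u. p = pt n u \<and> (\<exists>i\<le>n. u i \<noteq> 0)" by blast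
next
  assume "\<exists>u. p = pt n u \<and> (\<exists>i\<le>n. u i \<noteq> 0)"
  then obtain u where "p = pt n u" "vec (n + 1) u \<noteq> 0\<^sub>v (n + 1)" using vec_nonzero by blast
  then show "p \<in> proj_points n"
    unfolding proj_points_def pt_def by (intro CollectI exI[of _ "vec (n + 1) u"]) simp
qed

lemma pt_scale: "c \<noteq> 0 \<Longrightarrow> pt n (\<lambda>i. c * u i) = pt n u"
proof -
  assume c: "c \<noteq> 0"
  have "\<exists>e. vec (n + 1) (\<lambda>i. b * u i) = vec (n + 1) (\<lambda>i. e * (c * u i)) \<and> e \<noteq> 0" if "b \<noteq> 0" for b
    using that c by (intro exI[of _ "b / c"]) (auto simp: field_simps)
  moreover have "\<exists>e. vec (n + 1) (\<lambda>i. b * (c * u i)) = vec (n + 1) (\<lambda>i. e * u i) \<and> e \<noteq> 0" if "b \<noteq> 0" for b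
    using that c by (intro exI[of _ "b * c"]) (auto simp: field_simps)
  ultimately show ?thesis unfolding pt_alt by blast
qed

lemma pt_cong: "(\<And>i. i \<le> n \<Longrightarrow> u i = u' i) \<Longrightarrow> pt n u = pt n u'"
proof -
  assume "\<And>i. i \<le> n \<Longrightarrow> u i = u' i"
  then have "vec (n + 1) u = vec (n + 1) u'" by (auto simp: vec_eq_iff)
  then show ?thesis by (simp add: pt_def)
qed

lemma pt_eq_iff:
  assumes "\<exists>i\<le>n. u i \<noteq> 0"
  shows "pt n u = pt n u' \<longleftrightarrow> (\<exists>c. c \<noteq> 0 \<and> (\<forall>i\<le>n. u i = c * u' i))"
proof
  assume "pt n u = pt n u'"
  then have "vec (n + 1) u \<in> pt n u'" using vec_in_pt by metis
  then obtain c where "c \<noteq> 0" "vec (n + 1) u = vec (n + 1) (\<lambda>i. c * u' i)" unfolding pt_alt by blast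
  then show "\<exists>c. c \<noteq> 0 \<and> (\<forall>i\<le>n. u i = c * u' i)" by (auto simp: vec_eq_iff)
next
  assume "\<exists>c. c \<noteq> 0 \<and> (\<forall>i\<le>n. u i = c * u' i)"
  then show "pt n u = pt n u'" using pt_scale pt_cong by metis
qed

lemma pt_nonvanish:
  assumes "homogeneous n d h"
  shows "(\<forall>v\<in>pt n u. eval_mpoly h v \<noteq> 0) \<longleftrightarrow> eval_mpoly h (vec (n + 1) u) \<noteq> 0"
proof -
  have "(\<forall>v\<in>pt n u. eval_mpoly h v \<noteq> 0) \<longleftrightarrow> (\<forall>c. c \<noteq> 0 \<longrightarrow> c ^ d * eval_mpoly h (vec (n + 1) u) \<noteq> 0)"
    unfolding pt_alt using eval_scale[OF assms, of _ u] by auto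
  moreover have "\<exists>c :: 'a. c \<noteq> 0" by (rule exI[of _ 1]) simp
  ultimately show ?thesis by auto
qed

lemma pt_vanish:
  assumes "homogeneous n d h"
  shows "(\<forall>v\<in>pt n u. eval_mpoly h v = 0) \<longleftrightarrow> eval_mpoly h (vec (n + 1) u) = 0"
proof -
  have "(\<forall>v\<in>pt n u. eval_mpoly h v = 0) \<longleftrightarrow> (\<forall>c. c \<noteq> 0 \<longrightarrow> c ^ d * eval_mpoly h (vec (n + 1) u) = 0)"
    unfolding pt_alt using eval_scale[OF assms, of _ u] by auto
  moreover have "\<exists>c :: 'a. c \<noteq> 0" by (rule exI[of _ 1]) simp
  ultimately show ?thesis by auto
qed

section \<open>The Zariski topology and its standard open sets\<close>

definition nonvan :: "nat \<Rightarrow> 'k::field mpoly \<Rightarrow> 'k vec set set" where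
  "nonvan n h = {p \<in> proj_points n. \<forall>v\<in>p. eval_mpoly h v \<noteq> 0}"

lemma zariski_alt: "zariski n = topology_generated_by {nonvan n h | h d. homogeneous n d h}"
  by (simp add: zariski_def nonvan_def)

lemma nonvan_open: "homogeneous n d h \<Longrightarrow> openin (zariski n) (nonvan n h)"
  unfolding zariski_alt by (rule topology_generated_by_Basis) blast

lemma nonvan_mult: "nonvan n (g * h) = nonvan n g \<inter> nonvan n h"
  by (auto simp: nonvan_def eval_mpoly_mult)

lemma nonvan_one: "nonvan n (Poly_Mapping.single 0 1) = proj_points n"
  by (auto simp: nonvan_def eval_const)

lemma topspace_zariski: "topspace (zariski n) = proj_points n"
proof
  show "topspace (zariski n) \<subseteq> proj_points n"
    unfolding zariski_alt topology_generated_by_topspace by (auto simp: nonvan_def)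
  show "proj_points n \<subseteq> topspace (zariski n)"
    using openin_subset[OF nonvan_open[OF homogeneous_const[of n 1]]] nonvan_one by metis
qed

lemma zariski_basis:
  assumes "openin (zariski n) U" "p \<in> U"
  obtains h d where "homogeneous n d h" "p \<in> nonvan n h" "nonvan n h \<subseteq> U"
proof -
  have "generate_topology_on {nonvan n h | h d. homogeneous n d h} U"
    using assms(1) unfolding zariski_alt by (rule openin_topology_generated_by)
  then have "\<forall>p\<in>U. \<exists>h d. homogeneous n d h \<and> p \<in> nonvan n h \<and> nonvan n h \<subseteq> U"
  proof induction
    case (Int a b)
    show ?case
    proof
      fix p assume p: "p \<in> a \<inter> b"
      obtain h d where "homogeneous n d h" "p \<in> nonvan n h" "nonvan n h \<subseteq> a" using Int.IH(1) p by blast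
      moreover obtain h' d' where "homogeneous n d' h'" "p \<in> nonvan n h'" "nonvan n h' \<subseteq> b"
        using Int.IH(2) p by blast
      ultimately show "\<exists>h d. homogeneous n d h \<and> p \<in> nonvan n h \<and> nonvan n h \<subseteq> a \<inter> b"
        by (intro exI[of _ "h * h'"] exI[of _ "d + d'"]) (auto simp: homogeneous_mult nonvan_mult)
    qed
  qed blast+
  then show thesis using assms(2) that by blast
qed

text \<open>The closure rules for regular functions that hold alike for projective varieties, their
  products and open subspaces. \<open>reg_local\<close> compares functions on neighbourhoods only,
  since regular functions are total and matter only on their open set.\<close>

locale fspace =
  fixes S :: "('p, 'k::field) fun_space"
  assumes reg_open: "f \<in> regular S U \<Longrightarrow> openin (topol S) U"
    and reg_const: "openin (topol S) U \<Longrightarrow> (\<lambda>_. c) \<in> regular S U"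
    and reg_add: "f \<in> regular S U \<Longrightarrow> g \<in> regular S U \<Longrightarrow> (\<lambda>x. f x + g x) \<in> regular S U"
    and reg_mult: "f \<in> regular S U \<Longrightarrow> g \<in> regular S U \<Longrightarrow> (\<lambda>x. f x * g x) \<in> regular S U"
    and reg_nonzero: "f \<in> regular S U \<Longrightarrow> openin (topol S) {x \<in> U. f x \<noteq> 0}"
    and reg_inverse: "f \<in> regular S U \<Longrightarrow> (\<And>x. x \<in> U \<Longrightarrow> f x \<noteq> 0) \<Longrightarrow> (\<lambda>x. inverse (f x)) \<in> regular S U"
    and reg_subset: "f \<in> regular S U \<Longrightarrow> openin (topol S) V \<Longrightarrow> V \<subseteq> U \<Longrightarrow> f \<in> regular S V"
    and reg_local: "openin (topol S) U \<Longrightarrow>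
      (\<And>x. x \<in> U \<Longrightarrow> \<exists>N g. openin (topol S) N \<and> x \<in> N \<and> N \<subseteq> U \<and> g \<in> regular S N \<and> (\<forall>z\<in>N. f z = g z)) \<Longrightarrow>
      f \<in> regular S U"
begin

lemma reg_sum:
  "openin (topol S) U \<Longrightarrow> (\<And>i. i \<in> I \<Longrightarrow> f i \<in> regular S U) \<Longrightarrow> (\<lambda>x. \<Sum>i\<in>I. f i x) \<in> regular S U"
  by (induction I rule: infinite_finite_induct) (auto intro: reg_const reg_add)

lemma reg_prod:
  "openin (topol S) U \<Longrightarrow> (\<And>i. i \<in> I \<Longrightarrow> f i \<in> regular S U) \<Longrightarrow> (\<lambda>x. \<Prod>i\<in>I. f i x) \<in> regular S U"
  by (induction I rule: infinite_finite_induct) (auto intro: reg_const reg_mult)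

lemma reg_power: "f \<in> regular S U \<Longrightarrow> (\<lambda>x. f x ^ n) \<in> regular S U"
  by (induction n) (auto intro: reg_const reg_mult dest: reg_open)

lemma reg_divide:
  "f \<in> regular S U \<Longrightarrow> g \<in> regular S U \<Longrightarrow> (\<And>x. x \<in> U \<Longrightarrow> g x \<noteq> 0) \<Longrightarrow> (\<lambda>x. f x / g x) \<in> regular S U"
  unfolding divide_inverse by (intro reg_mult reg_inverse)

lemma reg_eval:
  assumes "openin (topol S) U" "\<And>i. i \<le> n \<Longrightarrow> u i \<in> regular S U" "homogeneous n d p"
  shows "(\<lambda>x. eval_mpoly p (vec (n + 1) (\<lambda>i. u i x))) \<in> regular S U"
  unfolding eval_vec[OF assms(3)]
proof (intro reg_sum assms(1))
  fix m assume "m \<in> Poly_Mapping.keys p"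
  then have "Poly_Mapping.keys m \<subseteq> {..n}" using assms(3) by (auto simp: homogeneous_def)
  then show "(\<lambda>x. Poly_Mapping.lookup p m * (\<Prod>i\<in>Poly_Mapping.keys m. u i x ^ Poly_Mapping.lookup m i)) \<in> regular S U"
    by (intro reg_mult reg_const reg_prod reg_power assms) auto
qed

lemma fspace_open_subspace:
  assumes "openin (topol S) W"
  shows "fspace (open_subspace S W)"
proof -
  have op: "openin (topol (open_subspace S W)) U \<longleftrightarrow> openin (topol S) U \<and> U \<subseteq> W" for U
    using assms by (simp add: open_subspace_def openin_open_subtopology)
  have rg: "f \<in> regular (open_subspace S W) U \<longleftrightarrow> U \<subseteq> W \<and> f \<in> regular S U" for f U
    using op[of U] by (auto simp: open_subspace_def dest: reg_open)
  show ?thesis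
  proof
    show "f \<in> regular (open_subspace S W) U"
      if "openin (topol (open_subspace S W)) U" and
      l: "\<And>x. x \<in> U \<Longrightarrow> \<exists>N g. openin (topol (open_subspace S W)) N \<and> x \<in> N \<and> N \<subseteq> U \<and>
        g \<in> regular (open_subspace S W) N \<and> (\<forall>z\<in>N. f z = g z)" for f U
      unfolding rg
    proof (intro conjI reg_local)
      show "U \<subseteq> W" "openin (topol S) U" using that(1) by (simp_all add: op)
      show "\<exists>N g. openin (topol S) N \<and> x \<in> N \<and> N \<subseteq> U \<and> g \<in> regular S N \<and> (\<forall>z\<in>N. f z = g z)"
        if "x \<in> U" for x using l[OF that] unfolding op rg by blast
    qed
  qed (auto simp: op rg intro: reg_open reg_const reg_add reg_mult reg_nonzero reg_inverse reg_subset)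
qed

end

lemma topspace_proj_variety: "X \<subseteq> proj_points n \<Longrightarrow> topspace (topol (proj_variety n X)) = X"
  by (auto simp: proj_variety_def topspace_zariski)

lemma fspace_proj_variety:
  assumes X: "X \<subseteq> proj_points n"
  shows "fspace (proj_variety n X)"
proof -
  let ?T = "subtopology (zariski n) X"
  have D_open: "openin ?T (X \<inter> nonvan n h)" if "homogeneous n d h" for d h
    using nonvan_open[OF that] by (metis Int_commute openin_subtopology)
  have topol: "topol (proj_variety n X) = ?T" by (simp add: proj_variety_def)
  have rep: "\<exists>u. x = pt n u" if "x \<in> U" "openin ?T U" for x U
  proof -
    have "x \<in> proj_points n" using openin_subset[OF that(2)] that(1) X by auto
    then show ?thesis using proj_points_pt by blast
  qed
  define R where "R W g h f \<longleftrightarrow> (\<forall>x\<in>W. \<forall>v\<in>x. eval_mpoly h v \<noteq> 0 \<and> f x = eval_mpoly g v / eval_mpoly h v)"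
    for W g h and f :: "'a vec set \<Rightarrow> 'a"
  have rg: "f \<in> regular (proj_variety n X) U \<longleftrightarrow> openin ?T U \<and>
      (\<forall>p\<in>U. \<exists>W d g h. openin ?T W \<and> p \<in> W \<and> W \<subseteq> U \<and> homogeneous n d g \<and> homogeneous n d h \<and> R W g h f)" for f U
    by (simp add: proj_variety_def R_def)
  have R_sub: "R W' g h f" if "R W g h f" "W' \<subseteq> W" for W W' g h f
    using that by (auto simp: R_def)
  show ?thesis
  proof
    show "openin (topol (proj_variety n X)) U" if "f \<in> regular (proj_variety n X) U" for f U
      using that by (simp add: rg topol)
    show "(\<lambda>_. c) \<in> regular (proj_variety n X) U" if "openin (topol (proj_variety n X)) U" for c U
      using that unfolding rg topol
      by (intro conjI ballI exI[of _ U] exI[of _ 0] exI[of _ "Poly_Mapping.single 0 c"] exI[of _ "Poly_Mapping.single 0 1"])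
        (auto simp: homogeneous_const R_def eval_const)
    show "f \<in> regular (proj_variety n X) V"
      if fU: "f \<in> regular (proj_variety n X) U" and VO: "openin (topol (proj_variety n X)) V" and VU: "V \<subseteq> U" for f U V
      unfolding rg
    proof (intro conjI ballI)
      show "openin ?T V" using VO by (simp add: topol)
      fix p assume p: "p \<in> V"
      then obtain W d g h where W: "openin ?T W" "p \<in> W" "W \<subseteq> U" "homogeneous n d g" "homogeneous n d h" "R W g h f"
        using fU VU unfolding rg by blast
      show "\<exists>W d g h. openin ?T W \<and> p \<in> W \<and> W \<subseteq> V \<and> homogeneous n d g \<and> homogeneous n d h \<and> R W g h f"
        using W p \<open>openin ?T V\<close> R_sub[OF W(6), of "W \<inter> V"]
        by (intro exI[of _ "W \<inter> V"] exI[of _ d] exI[of _ g] exI[of _ h]) auto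
    qed
    show "f \<in> regular (proj_variety n X) U"
      if "openin (topol (proj_variety n X)) U" and
      l: "\<And>x. x \<in> U \<Longrightarrow> \<exists>N g. openin (topol (proj_variety n X)) N \<and> x \<in> N \<and> N \<subseteq> U \<and>
        g \<in> regular (proj_variety n X) N \<and> (\<forall>z\<in>N. f z = g z)" for f U
      unfolding rg
    proof (intro conjI ballI)
      show "openin ?T U" using that(1) by (simp add: topol)
      fix p assume p: "p \<in> U"
      then obtain N k where N: "openin ?T N" "p \<in> N" "N \<subseteq> U" "k \<in> regular (proj_variety n X) N" "\<forall>z\<in>N. f z = k z"
        using l[OF p] unfolding topol by blast
      then obtain W d g h where W: "openin ?T W" "p \<in> W" "W \<subseteq> N" "homogeneous n d g" "homogeneous n d h" "R W g h k"
        unfolding rg by blast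
      have "R W g h f" using W(3,6) N(5) unfolding R_def by (simp add: subset_iff)
      then show "\<exists>W d g h. openin ?T W \<and> p \<in> W \<and> W \<subseteq> U \<and> homogeneous n d g \<and> homogeneous n d h \<and> R W g h f"
        using W N(3) by blast
    qed
  next
    fix f k U assume f: "f \<in> regular (proj_variety n X) U" and k: "k \<in> regular (proj_variety n X) U"
    have loc: "\<exists>W d e g h g' h'. openin ?T W \<and> p \<in> W \<and> W \<subseteq> U \<and> homogeneous n d g \<and> homogeneous n d h \<and>
       homogeneous n e g' \<and> homogeneous n e h' \<and> R W g h f \<and> R W g' h' k" if p: "p \<in> U" for p
    proof -
      obtain W d g h where W: "openin ?T W" "p \<in> W" "W \<subseteq> U" "homogeneous n d g" "homogeneous n d h" "R W g h f"
        using f p unfolding rg by blast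
      obtain W' d' g' h' where W': "openin ?T W'" "p \<in> W'" "W' \<subseteq> U" "homogeneous n d' g'" "homogeneous n d' h'" "R W' g' h' k"
        using k p unfolding rg by blast
      show ?thesis
        using W(1-5) W'(1-5) R_sub[OF W(6) Int_lower1] R_sub[OF W'(6) Int_lower2]
        by (intro exI[of _ "W \<inter> W'"] exI[of _ d] exI[of _ d'] exI[of _ g] exI[of _ h] exI[of _ g'] exI[of _ h'])
          (simp add: openin_Int le_infI1)
    qed
    have U: "openin ?T U" using f by (simp add: rg)
    show "(\<lambda>x. f x + k x) \<in> regular (proj_variety n X) U"
      unfolding rg
    proof (intro conjI ballI U)
      fix p assume "p \<in> U"
      from loc[OF this] obtain W d e g h g' h' where W: "openin ?T W" "p \<in> W" "W \<subseteq> U" "homogeneous n d g" "homogeneous n d h"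
       "homogeneous n e g'" "homogeneous n e h'" "R W g h f" "R W g' h' k" by (elim exE conjE) (rule that)
      have "R W (g * h' + h * g') (h * h') (\<lambda>x. f x + k x)"
        using W(8,9) unfolding R_def by (auto simp: eval_mpoly_add eval_mpoly_mult add_frac_eq mult_ac)
      then show "\<exists>W d g h. openin ?T W \<and> p \<in> W \<and> W \<subseteq> U \<and> homogeneous n d g \<and> homogeneous n d h \<and> R W g h (\<lambda>x. f x + k x)"
        using W homogeneous_add[OF homogeneous_mult[OF W(4,7)] homogeneous_mult[OF W(5,6)]] homogeneous_mult[OF W(5,7)]
        by (intro exI[of _ W] exI[of _ "d + e"] exI[of _ "g * h' + h * g'"] exI[of _ "h * h'"]) simp
    qed
    show "(\<lambda>x. f x * k x) \<in> regular (proj_variety n X) U"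
      unfolding rg
    proof (intro conjI ballI U)
      fix p assume "p \<in> U"
      from loc[OF this] obtain W d e g h g' h' where W: "openin ?T W" "p \<in> W" "W \<subseteq> U" "homogeneous n d g" "homogeneous n d h"
       "homogeneous n e g'" "homogeneous n e h'" "R W g h f" "R W g' h' k" by (elim exE conjE) (rule that)
      have "R W (g * g') (h * h') (\<lambda>x. f x * k x)"
        using W(8,9) unfolding R_def by (auto simp: eval_mpoly_mult)
      then show "\<exists>W d g h. openin ?T W \<and> p \<in> W \<and> W \<subseteq> U \<and> homogeneous n d g \<and> homogeneous n d h \<and> R W g h (\<lambda>x. f x * k x)"
        using W homogeneous_mult[OF W(4,6)] homogeneous_mult[OF W(5,7)]
        by (intro exI[of _ W] exI[of _ "d + e"] exI[of _ "g * g'"] exI[of _ "h * h'"]) simp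
    qed
  next
    fix f U assume f: "f \<in> regular (proj_variety n X) U"
    have U: "openin ?T U" using f by (simp add: rg)
    have loc: "\<exists>W d g h. openin ?T W \<and> p \<in> W \<and> W \<subseteq> U \<and> homogeneous n d g \<and> homogeneous n d h \<and>
       R W g h f \<and> R W h g (\<lambda>x. inverse (f x)) \<and> (\<forall>x\<in>W. f x \<noteq> 0)" if p: "p \<in> U" "f p \<noteq> 0" for p
    proof -
      obtain W d g h where W: "openin ?T W" "p \<in> W" "W \<subseteq> U" "homogeneous n d g" "homogeneous n d h" "R W g h f"
        using f p unfolding rg by blast
      \<comment> \<open>Removing the zeros of the numerator makes the inverse a local quotient as
        well.\<close>
      define W' where "W' = W \<inter> (X \<inter> nonvan n g)"
      have W'o: "openin ?T W'" unfolding W'_def using W(1) D_open[OF W(4)] by (rule openin_Int)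
      have "p \<in> X" using openin_subset[OF W(1)] W(2) by auto
      moreover have "\<forall>v\<in>p. eval_mpoly g v \<noteq> 0" using W(2,6) p(2) unfolding R_def by fastforce
      ultimately have pW: "p \<in> W'" using W(2) X by (auto simp: W'_def nonvan_def)
      have "R W' h g (\<lambda>x. inverse (f x))" "R W' g h f" using W(6) unfolding R_def W'_def nonvan_def by auto
      moreover have "f x \<noteq> 0" if x: "x \<in> W'" for x
      proof -
        obtain u where "x = pt n u" using rep[OF x W'o] by blast
        then have v: "vec (n + 1) u \<in> x" using vec_in_pt by metis
        then have "f x = eval_mpoly g (vec (n + 1) u) / eval_mpoly h (vec (n + 1) u)"
            "eval_mpoly h (vec (n + 1) u) \<noteq> 0"
          using W(6) x unfolding R_def W'_def by auto
        moreover have "eval_mpoly g (vec (n + 1) u) \<noteq> 0" using x v unfolding W'_def nonvan_def by blast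
        ultimately show ?thesis by simp
      qed
      ultimately show ?thesis using W'o pW W by (intro exI[of _ W'] exI[of _ d] exI[of _ g] exI[of _ h]) (auto simp: W'_def)
    qed
    show "openin (topol (proj_variety n X)) {x \<in> U. f x \<noteq> 0}"
      unfolding topol
    proof (subst openin_subopen, intro ballI)
      fix p assume "p \<in> {x \<in> U. f x \<noteq> 0}"
      then show "\<exists>T. openin ?T T \<and> p \<in> T \<and> T \<subseteq> {x \<in> U. f x \<noteq> 0}"
        using loc[of p] by blast
    qed
    show "(\<lambda>x. inverse (f x)) \<in> regular (proj_variety n X) U" if "\<And>x. x \<in> U \<Longrightarrow> f x \<noteq> 0"
      unfolding rg
    proof (intro conjI ballI U)
      fix p assume "p \<in> U"
      from loc[OF this that[OF this]] obtain W d g h where "openin ?T W" "p \<in> W" "W \<subseteq> U"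
          "homogeneous n d g" "homogeneous n d h" "R W h g (\<lambda>x. inverse (f x))"
        by blast
      then show "\<exists>W d g h. openin ?T W \<and> p \<in> W \<and> W \<subseteq> U \<and> homogeneous n d g \<and>
          homogeneous n d h \<and> R W g h (\<lambda>x. inverse (f x))"
        by (intro exI[of _ W] exI[of _ d] exI[of _ h] exI[of _ g]) simp
    qed
  qed
qed

section \<open>Products of spaces with functions\<close>

lemma tensor_functionsI:
  assumes "finite I" "\<And>i. i \<in> I \<Longrightarrow> f i \<in> regular X U" "\<And>i. i \<in> I \<Longrightarrow> g i \<in> regular Y V"
  shows "(\<lambda>(x, y). \<Sum>i\<in>I. f i x * g i y) \<in> tensor_functions X Y U V"
proof -
  obtain e where e: "bij_betw e {..<card I} I"
    using ex_bij_betw_nat_finite[OF assms(1)] by (auto simp: atLeast0LessThan)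
  have "(\<Sum>i\<in>I. f i x * g i y) = (\<Sum>i<card I. f (e i) x * g (e i) y)" for x y
    by (rule sum.reindex_bij_betw[OF e, of "\<lambda>i. f i x * g i y", symmetric])
  then have "(\<lambda>(x, y). \<Sum>i\<in>I. f i x * g i y) = (\<lambda>(x, y). \<Sum>i<card I. f (e i) x * g (e i) y)"
    by (simp add: fun_eq_iff)
  moreover have "\<forall>i<card I. f (e i) \<in> regular X U \<and> g (e i) \<in> regular Y V"
    using assms(2,3) bij_betwE[OF e] by auto
  ultimately show ?thesis unfolding tensor_functions_def
    by (intro CollectI exI[of _ "card I"] exI[of _ "\<lambda>i. f (e i)"] exI[of _ "\<lambda>i. g (e i)"]) simp
qed

lemma tensor_functionsE:
  assumes "h \<in> tensor_functions X Y U V"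
  obtains r f g where "h = (\<lambda>(x, y). \<Sum>i<r. f i x * g i y)"
    "\<And>i. i < (r::nat) \<Longrightarrow> f i \<in> regular X U" "\<And>i. i < r \<Longrightarrow> g i \<in> regular Y V"
  using assms unfolding tensor_functions_def by blast

locale fspace_pair = X: fspace X + Y: fspace Y
  for X :: "('p, 'k::field) fun_space" and Y :: "('q, 'k) fun_space"
begin

lemma tensor_const:
  assumes "openin (topol X) U" "openin (topol Y) V"
  shows "(\<lambda>_. c) \<in> tensor_functions X Y U V"
  using tensor_functionsI[of "{()}" "\<lambda>_ _. c" X U "\<lambda>_ _. 1" Y V] assms
  by (simp add: X.reg_const Y.reg_const case_prod_unfold)

lemma tensor_fst:
  assumes "f \<in> regular X U" "openin (topol Y) V"
  shows "f \<circ> fst \<in> tensor_functions X Y U V"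
  using tensor_functionsI[of "{()}" "\<lambda>_. f" X U "\<lambda>_ _. 1" Y V] assms
  by (simp add: Y.reg_const case_prod_unfold comp_def)

lemma tensor_snd:
  assumes "openin (topol X) U" "g \<in> regular Y V"
  shows "g \<circ> snd \<in> tensor_functions X Y U V"
  using tensor_functionsI[of "{()}" "\<lambda>_ _. 1" X U "\<lambda>_. g" Y V] assms
  by (simp add: X.reg_const case_prod_unfold comp_def)

lemma tensor_add:
  assumes "h \<in> tensor_functions X Y U V" "h' \<in> tensor_functions X Y U V"
  shows "(\<lambda>z. h z + h' z) \<in> tensor_functions X Y U V"
proof -
  obtain r f g where h: "h = (\<lambda>(x, y). \<Sum>i<r. f i x * g i y)"
    "\<And>i. i < (r::nat) \<Longrightarrow> f i \<in> regular X U" "\<And>i. i < r \<Longrightarrow> g i \<in> regular Y V"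
    using tensor_functionsE[OF assms(1)] by blast
  obtain r' f' g' where h': "h' = (\<lambda>(x, y). \<Sum>i<r'. f' i x * g' i y)"
    "\<And>i. i < (r'::nat) \<Longrightarrow> f' i \<in> regular X U" "\<And>i. i < r' \<Longrightarrow> g' i \<in> regular Y V"
    using tensor_functionsE[OF assms(2)] by blast
  have "(\<lambda>(x, y). \<Sum>i\<in>{..<r} <+> {..<r'}. case_sum f f' i x * case_sum g g' i y) \<in> tensor_functions X Y U V"
    by (rule tensor_functionsI) (auto simp: h h')
  moreover have "(\<lambda>(x, y). \<Sum>i\<in>{..<r} <+> {..<r'}. case_sum f f' i x * case_sum g g' i y) = (\<lambda>z. h z + h' z)"
    by (simp add: fun_eq_iff h(1) h'(1) sum.Plus comp_def)
  ultimately show ?thesis by simp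
qed

lemma tensor_mult:
  assumes "h \<in> tensor_functions X Y U V" "h' \<in> tensor_functions X Y U V"
  shows "(\<lambda>z. h z * h' z) \<in> tensor_functions X Y U V"
proof -
  obtain r f g where h: "h = (\<lambda>(x, y). \<Sum>i<r. f i x * g i y)"
    "\<And>i. i < (r::nat) \<Longrightarrow> f i \<in> regular X U" "\<And>i. i < r \<Longrightarrow> g i \<in> regular Y V"
    using tensor_functionsE[OF assms(1)] by blast
  obtain r' f' g' where h': "h' = (\<lambda>(x, y). \<Sum>i<r'. f' i x * g' i y)"
    "\<And>i. i < (r'::nat) \<Longrightarrow> f' i \<in> regular X U" "\<And>i. i < r' \<Longrightarrow> g' i \<in> regular Y V"
    using tensor_functionsE[OF assms(2)] by blast
  have "(\<lambda>(x, y). \<Sum>i\<in>{..<r} \<times> {..<r'}. (f (fst i) x * f' (snd i) x) * (g (fst i) y * g' (snd i) y))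
      \<in> tensor_functions X Y U V"
    by (rule tensor_functionsI) (auto simp: h h' intro: X.reg_mult Y.reg_mult)
  moreover have "(\<lambda>(x, y). \<Sum>i\<in>{..<r} \<times> {..<r'}. (f (fst i) x * f' (snd i) x) * (g (fst i) y * g' (snd i) y))
      = (\<lambda>z. h z * h' z)"
    unfolding h(1) h'(1) case_prod_unfold sum_product sum.cartesian_product
    by (intro ext sum.cong refl) (simp add: mult_ac)
  ultimately show ?thesis by simp
qed

lemma tensor_subset:
  assumes "h \<in> tensor_functions X Y U V" "openin (topol X) U'" "U' \<subseteq> U" "openin (topol Y) V'" "V' \<subseteq> V"
  shows "h \<in> tensor_functions X Y U' V'"
proof -
  obtain r f g where h: "h = (\<lambda>(x, y). \<Sum>i<r. f i x * g i y)"
    "\<And>i. i < (r::nat) \<Longrightarrow> f i \<in> regular X U" "\<And>i. i < r \<Longrightarrow> g i \<in> regular Y V"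
    using tensor_functionsE[OF assms(1)] by blast
  show ?thesis unfolding h(1)
    by (rule tensor_functionsI)
      (auto intro: X.reg_subset[OF h(2) assms(2,3)] Y.reg_subset[OF h(3) assms(4,5)])
qed

abbreviation "P \<equiv> product_topol X Y"

lemma basic_open:
  assumes "openin (topol X) U" "openin (topol Y) V" "h \<in> tensor_functions X Y U V"
  shows "openin P {z \<in> U \<times> V. h z \<noteq> 0}"
  unfolding product_topol_def by (rule topology_generated_by_Basis) (use assms in blast)

lemma times_open:
  assumes "openin (topol X) U" "openin (topol Y) V"
  shows "openin P (U \<times> V)"
  using basic_open[OF assms tensor_const[OF assms, of 1]] by simp

lemma topspace_product: "topspace P = topspace (topol X) \<times> topspace (topol Y)"
proof
  show "topspace P \<subseteq> topspace (topol X) \<times> topspace (topol Y)"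
    unfolding product_topol_def topology_generated_by_topspace
    using openin_subset[of "topol X"] openin_subset[of "topol Y"] by blast
  show "topspace (topol X) \<times> topspace (topol Y) \<subseteq> topspace P"
    by (rule openin_subset[OF times_open]) simp_all
qed

text \<open>A local presentation of \<open>f\<close> as a quotient of tensor functions. The box is
  hidden behind an existential so that charts over different boxes can be combined on the
  intersection.\<close>

definition chart :: "('p \<times> 'q) set \<Rightarrow> ('p \<times> 'q \<Rightarrow> 'k) \<Rightarrow> ('p \<times> 'q \<Rightarrow> 'k) \<Rightarrow> ('p \<times> 'q \<Rightarrow> 'k) \<Rightarrow> bool" where
  "chart N g h f \<longleftrightarrow> openin P N \<and> (\<exists>U V. openin (topol X) U \<and> openin (topol Y) V \<and> N \<subseteq> U \<times> V \<and>
     g \<in> tensor_functions X Y U V \<and> h \<in> tensor_functions X Y U V) \<and> (\<forall>w\<in>N. h w \<noteq> 0 \<and> f w = g w / h w)"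

lemma regular_product:
  "f \<in> regular (product_space X Y) W \<longleftrightarrow> openin P W \<and> (\<forall>z\<in>W. \<exists>N g h. z \<in> N \<and> N \<subseteq> W \<and> chart N g h f)"
proof -
  have "(\<exists>N U V g h. openin P N \<and> z \<in> N \<and> N \<subseteq> W \<and> openin (topol X) U \<and> openin (topol Y) V \<and> N \<subseteq> U \<times> V \<and>
          g \<in> tensor_functions X Y U V \<and> h \<in> tensor_functions X Y U V \<and> (\<forall>w\<in>N. h w \<noteq> 0 \<and> f w = g w / h w))
      \<longleftrightarrow> (\<exists>N g h. z \<in> N \<and> N \<subseteq> W \<and> chart N g h f)" for z
    unfolding chart_def by blast
  then show ?thesis by (simp add: product_space_def)
qed

lemma topol_product: "topol (product_space X Y) = P"
  by (simp add: product_space_def)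

lemma chart_subset: "chart N g h f \<Longrightarrow> openin P N' \<Longrightarrow> N' \<subseteq> N \<Longrightarrow> chart N' g h f"
  unfolding chart_def by (meson subset_iff)

lemma chart_pair:
  assumes "chart N g h f" "chart N' g' h' f'"
  obtains U V where "openin P (N \<inter> N')" "openin (topol X) U" "openin (topol Y) V" "N \<inter> N' \<subseteq> U \<times> V"
    "g \<in> tensor_functions X Y U V" "h \<in> tensor_functions X Y U V"
    "g' \<in> tensor_functions X Y U V" "h' \<in> tensor_functions X Y U V"
    "\<And>w. w \<in> N \<inter> N' \<Longrightarrow> h w \<noteq> 0 \<and> f w = g w / h w \<and> h' w \<noteq> 0 \<and> f' w = g' w / h' w"
proof -
  obtain U V where U: "openin (topol X) U" "openin (topol Y) V" "N \<subseteq> U \<times> V"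
     "g \<in> tensor_functions X Y U V" "h \<in> tensor_functions X Y U V" using assms(1) unfolding chart_def by blast
  obtain U' V' where U': "openin (topol X) U'" "openin (topol Y) V'" "N' \<subseteq> U' \<times> V'"
     "g' \<in> tensor_functions X Y U' V'" "h' \<in> tensor_functions X Y U' V'" using assms(2) unfolding chart_def by blast
  have o: "openin (topol X) (U \<inter> U')" "openin (topol Y) (V \<inter> V')" using U U' by auto
  show thesis
  proof (rule that[of "U \<inter> U'" "V \<inter> V'"])
    show "openin P (N \<inter> N')" using assms unfolding chart_def by auto
    show "N \<inter> N' \<subseteq> (U \<inter> U') \<times> (V \<inter> V')" using U(3) U'(3) by auto
    show "g \<in> tensor_functions X Y (U \<inter> U') (V \<inter> V')" "h \<in> tensor_functions X Y (U \<inter> U') (V \<inter> V')"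
      "g' \<in> tensor_functions X Y (U \<inter> U') (V \<inter> V')" "h' \<in> tensor_functions X Y (U \<inter> U') (V \<inter> V')"
      using tensor_subset[OF _ o(1) _ o(2)] U U' by auto
    show "h w \<noteq> 0 \<and> f w = g w / h w \<and> h' w \<noteq> 0 \<and> f' w = g' w / h' w" if "w \<in> N \<inter> N'" for w
      using assms that unfolding chart_def by blast
  qed (rule o)+
qed

lemma chart_add:
  assumes "chart N g h f" "chart N' g' h' f'"
  shows "chart (N \<inter> N') (\<lambda>z. g z * h' z + g' z * h z) (\<lambda>z. h z * h' z) (\<lambda>z. f z + f' z)"
  using chart_pair[OF assms]
proof (cases rule: chart_pair[OF assms, case_names pair])
  case (pair U V)
  have t: "(\<lambda>z. g z * h' z + g' z * h z) \<in> tensor_functions X Y U V" "(\<lambda>z. h z * h' z) \<in> tensor_functions X Y U V"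
    using pair by (auto intro: tensor_add tensor_mult)
  show ?thesis
    unfolding chart_def
    using pair(1-4) t pair(9) by (intro conjI exI[of _ U] exI[of _ V] ballI) (auto simp: add_frac_eq)
qed

lemma chart_mult:
  assumes "chart N g h f" "chart N' g' h' f'"
  shows "chart (N \<inter> N') (\<lambda>z. g z * g' z) (\<lambda>z. h z * h' z) (\<lambda>z. f z * f' z)"
proof (cases rule: chart_pair[OF assms, case_names pair])
  case (pair U V)
  have t: "(\<lambda>z. g z * g' z) \<in> tensor_functions X Y U V" "(\<lambda>z. h z * h' z) \<in> tensor_functions X Y U V"
    using pair by (auto intro: tensor_mult)
  show ?thesis
    unfolding chart_def
    using pair(1-4) t pair(9) by (intro conjI exI[of _ U] exI[of _ V] ballI) auto
qed

lemma chart_inverse: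
  assumes "chart N g h f"
  shows "chart {z \<in> N. f z \<noteq> 0} h g (\<lambda>z. inverse (f z))"
proof -
  obtain U V where U: "openin (topol X) U" "openin (topol Y) V" "N \<subseteq> U \<times> V"
     "g \<in> tensor_functions X Y U V" "h \<in> tensor_functions X Y U V" using assms unfolding chart_def by blast
  have gh: "openin P N" "\<And>w. w \<in> N \<Longrightarrow> h w \<noteq> 0 \<and> f w = g w / h w" using assms unfolding chart_def by blast+
  have "{z \<in> N. f z \<noteq> 0} = N \<inter> {z \<in> U \<times> V. g z \<noteq> 0}" using gh(2) U(3) by auto
  then have "openin P {z \<in> N. f z \<noteq> 0}" using openin_Int[OF gh(1) basic_open[OF U(1,2,4)]] by simp
  then show ?thesis unfolding chart_def
    using U gh(2) by (intro conjI exI[of _ U] exI[of _ V] ballI) auto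
qed

sublocale prod: fspace "product_space X Y"
proof
  show "openin (topol (product_space X Y)) U" if "f \<in> regular (product_space X Y) U" for f U
    using that by (simp add: regular_product topol_product)
  show "(\<lambda>_. c) \<in> regular (product_space X Y) U" if "openin (topol (product_space X Y)) U" for c U
    unfolding regular_product
  proof (intro conjI ballI)
    show U: "openin P U" using that by (simp add: topol_product)
    fix z assume z: "z \<in> U"
    have "chart U (\<lambda>_. c) (\<lambda>_. 1) (\<lambda>_. c)"
      unfolding chart_def using U openin_subset[OF U] topspace_product
      by (intro conjI exI[of _ "topspace (topol X)"] exI[of _ "topspace (topol Y)"])
        (simp_all add: tensor_const)
    then show "\<exists>N g h. z \<in> N \<and> N \<subseteq> U \<and> chart N g h (\<lambda>_. c)" using z by blast
  qed
  show "f \<in> regular (product_space X Y) V"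
    if f: "f \<in> regular (product_space X Y) U" and V: "openin (topol (product_space X Y)) V" "V \<subseteq> U" for f U V
    unfolding regular_product
  proof (intro conjI ballI)
    show VP: "openin P V" using V(1) by (simp add: topol_product)
    fix z assume z: "z \<in> V"
    then obtain N g h where N: "z \<in> N" "N \<subseteq> U" "chart N g h f" using f V(2) unfolding regular_product by blast
    have "openin P (N \<inter> V)" using N(3) VP unfolding chart_def by blast
    then show "\<exists>N g h. z \<in> N \<and> N \<subseteq> V \<and> chart N g h f"
      using chart_subset[OF N(3)] N(1) z by (intro exI[of _ "N \<inter> V"] exI[of _ g] exI[of _ h]) simp
  qed
  show "f \<in> regular (product_space X Y) U"
    if U: "openin (topol (product_space X Y)) U" and
    l: "\<And>x. x \<in> U \<Longrightarrow> \<exists>N g. openin (topol (product_space X Y)) N \<and> x \<in> N \<and> N \<subseteq> U \<and>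
      g \<in> regular (product_space X Y) N \<and> (\<forall>z\<in>N. f z = g z)" for f U
    unfolding regular_product
  proof (intro conjI ballI)
    show UP: "openin P U" using U by (simp add: topol_product)
    fix z assume z: "z \<in> U"
    obtain M k where M: "z \<in> M" "M \<subseteq> U" "k \<in> regular (product_space X Y) M" "\<forall>z\<in>M. f z = k z" using l[OF z] by blast
    obtain N g h where N: "z \<in> N" "N \<subseteq> M" "chart N g h k" using M(1,3) unfolding regular_product by blast
    have "\<forall>w\<in>N. f w = k w" using N(2) M(4) by blast
    then have "chart N g h f" using N(3) unfolding chart_def by simp
    then show "\<exists>N g h. z \<in> N \<and> N \<subseteq> U \<and> chart N g h f" using N M(2) by blast
  qed
next
  fix f f' U assume f: "f \<in> regular (product_space X Y) U" and f': "f' \<in> regular (product_space X Y) U"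
  have U: "openin P U" using f unfolding regular_product by blast
  show "(\<lambda>z. f z + f' z) \<in> regular (product_space X Y) U"
    unfolding regular_product
  proof (intro conjI ballI U)
    fix z assume z: "z \<in> U"
    obtain N g h where N: "z \<in> N" "N \<subseteq> U" "chart N g h f" using f z unfolding regular_product by blast
    obtain N' g' h' where N': "z \<in> N'" "N' \<subseteq> U" "chart N' g' h' f'" using f' z unfolding regular_product by blast
    have "z \<in> N \<inter> N'" "N \<inter> N' \<subseteq> U" using N N' by auto
    then show "\<exists>N g h. z \<in> N \<and> N \<subseteq> U \<and> chart N g h (\<lambda>z. f z + f' z)"
      using chart_add[OF N(3) N'(3)] by blast
  qed
  show "(\<lambda>z. f z * f' z) \<in> regular (product_space X Y) U"
    unfolding regular_product
  proof (intro conjI ballI U)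
    fix z assume z: "z \<in> U"
    obtain N g h where N: "z \<in> N" "N \<subseteq> U" "chart N g h f" using f z unfolding regular_product by blast
    obtain N' g' h' where N': "z \<in> N'" "N' \<subseteq> U" "chart N' g' h' f'" using f' z unfolding regular_product by blast
    have "z \<in> N \<inter> N'" "N \<inter> N' \<subseteq> U" using N N' by auto
    then show "\<exists>N g h. z \<in> N \<and> N \<subseteq> U \<and> chart N g h (\<lambda>z. f z * f' z)"
      using chart_mult[OF N(3) N'(3)] by blast
  qed
next
  fix f U assume f: "f \<in> regular (product_space X Y) U"
  have U: "openin P U" using f unfolding regular_product by blast
  show "openin (topol (product_space X Y)) {z \<in> U. f z \<noteq> 0}"
    unfolding topol_product
  proof (subst openin_subopen, intro ballI)
    fix z assume z: "z \<in> {z \<in> U. f z \<noteq> 0}"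
    then obtain N g h where N: "z \<in> N" "N \<subseteq> U" "chart N g h f" using f unfolding regular_product by blast
    have "openin P {z \<in> N. f z \<noteq> 0}" using chart_inverse[OF N(3)] unfolding chart_def by blast
    then show "\<exists>T. openin P T \<and> z \<in> T \<and> T \<subseteq> {z \<in> U. f z \<noteq> 0}" using N z by blast
  qed
  show "(\<lambda>z. inverse (f z)) \<in> regular (product_space X Y) U" if nz: "\<And>z. z \<in> U \<Longrightarrow> f z \<noteq> 0"
    unfolding regular_product
  proof (intro conjI ballI U)
    fix z assume z: "z \<in> U"
    then obtain N g h where N: "z \<in> N" "N \<subseteq> U" "chart N g h f" using f unfolding regular_product by blast
    have "{z \<in> N. f z \<noteq> 0} = N" using N(2) nz by blast
    then show "\<exists>N g h. z \<in> N \<and> N \<subseteq> U \<and> chart N g h (\<lambda>z. inverse (f z))"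
      using chart_inverse[OF N(3)] N by metis
  qed
qed

lemma morphism_fst: "morphism (product_space X Y) X fst"
  unfolding morphism_def
proof (intro conjI allI impI)
  have pre: "{z \<in> topspace P. fst z \<in> U} = U \<times> topspace (topol Y)" if "openin (topol X) U" for U
    using openin_subset[OF that] topspace_product by auto
  show "continuous_map (topol (product_space X Y)) (topol X) fst"
    unfolding continuous_map_def topol_product
  proof (intro conjI allI impI)
    show "fst \<in> topspace P \<rightarrow> topspace (topol X)" by (auto simp: topspace_product)
    show "openin P {z \<in> topspace P. fst z \<in> U}" if "openin (topol X) U" for U
      unfolding pre[OF that] using that by (intro times_open) simp_all
  qed
  fix V h assume "openin (topol X) V \<and> h \<in> regular X V"
  then have V: "openin (topol X) V" "h \<in> regular X V" by auto
  show "h \<circ> fst \<in> regular (product_space X Y) {z \<in> topspace (topol (product_space X Y)). fst z \<in> V}"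
    unfolding topol_product pre[OF V(1)] regular_product
  proof (intro conjI ballI)
    show o: "openin P (V \<times> topspace (topol Y))" using V by (simp add: times_open)
    fix z assume "z \<in> V \<times> topspace (topol Y)"
    moreover have "chart (V \<times> topspace (topol Y)) (h \<circ> fst) (\<lambda>_. 1) (h \<circ> fst)"
      unfolding chart_def using o V tensor_fst[OF V(2)] tensor_const
      by (intro conjI exI[of _ V] exI[of _ "topspace (topol Y)"]) simp_all
    ultimately show "\<exists>N g k. z \<in> N \<and> N \<subseteq> V \<times> topspace (topol Y) \<and> chart N g k (h \<circ> fst)"
      by (intro exI[of _ "V \<times> topspace (topol Y)"] exI[of _ "h \<circ> fst"] exI[of _ "\<lambda>_. 1"]) simp
  qed
qed

lemma morphism_snd: "morphism (product_space X Y) Y snd"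
  unfolding morphism_def
proof (intro conjI allI impI)
  have pre: "{z \<in> topspace P. snd z \<in> U} = topspace (topol X) \<times> U" if "openin (topol Y) U" for U
    using openin_subset[OF that] topspace_product by auto
  show "continuous_map (topol (product_space X Y)) (topol Y) snd"
    unfolding continuous_map_def topol_product
  proof (intro conjI allI impI)
    show "snd \<in> topspace P \<rightarrow> topspace (topol Y)" by (auto simp: topspace_product)
    show "openin P {z \<in> topspace P. snd z \<in> U}" if "openin (topol Y) U" for U
      unfolding pre[OF that] using that by (intro times_open) simp_all
  qed
  fix V h assume "openin (topol Y) V \<and> h \<in> regular Y V"
  then have V: "openin (topol Y) V" "h \<in> regular Y V" by auto
  show "h \<circ> snd \<in> regular (product_space X Y) {z \<in> topspace (topol (product_space X Y)). snd z \<in> V}"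
    unfolding topol_product pre[OF V(1)] regular_product
  proof (intro conjI ballI)
    show o: "openin P (topspace (topol X) \<times> V)" using V by (simp add: times_open)
    fix z assume "z \<in> topspace (topol X) \<times> V"
    moreover have "chart (topspace (topol X) \<times> V) (h \<circ> snd) (\<lambda>_. 1) (h \<circ> snd)"
      unfolding chart_def using o V tensor_snd[OF _ V(2)] tensor_const
      by (intro conjI exI[of _ "topspace (topol X)"] exI[of _ V]) simp_all
    ultimately show "\<exists>N g k. z \<in> N \<and> N \<subseteq> topspace (topol X) \<times> V \<and> chart N g k (h \<circ> snd)"
      by (intro exI[of _ "topspace (topol X) \<times> V"] exI[of _ "h \<circ> snd"] exI[of _ "\<lambda>_. 1"]) simp
  qed
qed

text \<open>The universal property of the product. A tensor function pulls back to a sum of products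
  of regular functions, and both the topology and the regular functions of the product are generated
  by tensor functions.\<close>

lemma morphism_pair:
  assumes S: "fspace S" and f: "morphism S X f" and f': "morphism S Y f'"
  shows "morphism S (product_space X Y) (\<lambda>x. (f x, f' x))"
proof -
  interpret S: fspace S by (rule S)
  let ?F = "\<lambda>x. (f x, f' x)" and ?T = "topspace (topol S)"
  have cf: "continuous_map (topol S) (topol X) f" "continuous_map (topol S) (topol Y) f'"
    using f f' by (auto simp: morphism_def)
  have pull: "(\<lambda>x. h (f x, f' x)) \<in> regular S {x \<in> ?T. f x \<in> U \<and> f' x \<in> V}"
    if UV: "openin (topol X) U" "openin (topol Y) V" "h \<in> tensor_functions X Y U V" for U V h
  proof -
    obtain r a b where h: "h = (\<lambda>(x, y). \<Sum>i<r. a i x * b i y)"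
      "\<And>i. i < (r::nat) \<Longrightarrow> a i \<in> regular X U" "\<And>i. i < r \<Longrightarrow> b i \<in> regular Y V"
      using tensor_functionsE[OF UV(3)] by blast
    have oU: "openin (topol S) {x \<in> ?T. f x \<in> U}" "openin (topol S) {x \<in> ?T. f' x \<in> V}"
      using cf UV unfolding continuous_map_def by auto
    have "{x \<in> ?T. f x \<in> U \<and> f' x \<in> V} = {x \<in> ?T. f x \<in> U} \<inter> {x \<in> ?T. f' x \<in> V}" by auto
    then have o: "openin (topol S) {x \<in> ?T. f x \<in> U \<and> f' x \<in> V}" using openin_Int[OF oU] by simp
    have "(\<lambda>x. \<Sum>i<r. a i (f x) * b i (f' x)) \<in> regular S {x \<in> ?T. f x \<in> U \<and> f' x \<in> V}"
    proof (intro S.reg_sum S.reg_mult o)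
      fix i assume "i \<in> {..<r}"
      then have "a i \<circ> f \<in> regular S {x \<in> ?T. f x \<in> U}" "b i \<circ> f' \<in> regular S {x \<in> ?T. f' x \<in> V}"
        using h(2,3) f f' UV unfolding morphism_def by auto
      then show "(\<lambda>x. a i (f x)) \<in> regular S {x \<in> ?T. f x \<in> U \<and> f' x \<in> V}"
        "(\<lambda>x. b i (f' x)) \<in> regular S {x \<in> ?T. f x \<in> U \<and> f' x \<in> V}"
        using S.reg_subset[OF _ o] by (auto simp: comp_def)
    qed
    then show ?thesis by (simp add: h(1))
  qed
  have cont: "continuous_map (topol S) P ?F"
    unfolding product_topol_def
  proof (rule continuous_on_generated_topo)
    fix B assume "B \<in> {{z \<in> U \<times> V. h z \<noteq> 0} |U V h. openin (topol X) U \<and> openin (topol Y) V \<and> h \<in> tensor_functions X Y U V}"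
    then obtain U V h where B: "B = {z \<in> U \<times> V. h z \<noteq> 0}" and UV: "openin (topol X) U" "openin (topol Y) V" "h \<in> tensor_functions X Y U V"
      by blast
    have "?F -` B \<inter> ?T = {x \<in> {x \<in> ?T. f x \<in> U \<and> f' x \<in> V}. h (f x, f' x) \<noteq> 0}" unfolding B by auto
    then show "openin (topol S) (?F -` B \<inter> ?T)" using S.reg_nonzero[OF pull[OF UV]] by simp
  next
    show "?F ` ?T \<subseteq> \<Union> {{z \<in> U \<times> V. h z \<noteq> 0} |U V h. openin (topol X) U \<and> openin (topol Y) V \<and> h \<in> tensor_functions X Y U V}"
      using cf topspace_product unfolding product_topol_def topology_generated_by_topspace continuous_map_def by auto
  qed
  show ?thesis
    unfolding morphism_def topol_product
  proof (intro conjI allI impI cont)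
    fix W h assume "openin P W \<and> h \<in> regular (product_space X Y) W"
    then have W: "openin P W" "h \<in> regular (product_space X Y) W" by auto
    have pre: "openin (topol S) {x \<in> ?T. ?F x \<in> N}" if "openin P N" for N
      using cont that unfolding continuous_map_def by auto
    show "h \<circ> ?F \<in> regular S {x \<in> ?T. ?F x \<in> W}"
    proof (rule S.reg_local[OF pre[OF W(1)]])
      fix x assume x: "x \<in> {x \<in> ?T. ?F x \<in> W}"
      then obtain N a b where N: "?F x \<in> N" "N \<subseteq> W" "chart N a b h" using W(2) unfolding regular_product by blast
      then obtain U V where U: "openin (topol X) U" "openin (topol Y) V" "N \<subseteq> U \<times> V"
         "a \<in> tensor_functions X Y U V" "b \<in> tensor_functions X Y U V"
         "openin P N" "\<And>w. w \<in> N \<Longrightarrow> b w \<noteq> 0 \<and> h w = a w / b w" unfolding chart_def by blast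
      let ?N = "{x \<in> ?T. ?F x \<in> N}"
      have sub: "?N \<subseteq> {x \<in> ?T. f x \<in> U \<and> f' x \<in> V}" using U(3) by auto
      have "(\<lambda>x. a (f x, f' x) / b (f x, f' x)) \<in> regular S ?N"
        using S.reg_subset[OF pull[OF U(1,2,4)] pre[OF U(6)] sub] S.reg_subset[OF pull[OF U(1,2,5)] pre[OF U(6)] sub] U(7)
        by (intro S.reg_divide) auto
      then show "\<exists>M g. openin (topol S) M \<and> x \<in> M \<and> M \<subseteq> {x \<in> ?T. ?F x \<in> W} \<and> g \<in> regular S M \<and> (\<forall>z\<in>M. (h \<circ> ?F) z = g z)"
        using pre[OF U(6)] N(1,2) x U(7)
        by (intro exI[of _ ?N] exI[of _ "\<lambda>x. a (f x, f' x) / b (f x, f' x)"]) auto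
    qed
  qed
qed

end

section \<open>Morphisms into projective varieties\<close>

lemma regular_proj_varietyE:
  assumes "f \<in> regular (proj_variety n X) U" "p \<in> U"
  obtains W d g h where "openin (topol (proj_variety n X)) W" "p \<in> W" "W \<subseteq> U"
    "homogeneous n d g" "homogeneous n d h"
    "\<forall>x\<in>W. \<forall>v\<in>x. eval_mpoly h v \<noteq> 0 \<and> f x = eval_mpoly g v / eval_mpoly h v"
proof -
  have "\<forall>p\<in>U. \<exists>W d g h. openin (subtopology (zariski n) X) W \<and> p \<in> W \<and> W \<subseteq> U \<and>
     homogeneous n d g \<and> homogeneous n d h \<and>
     (\<forall>x\<in>W. \<forall>v\<in>x. eval_mpoly h v \<noteq> 0 \<and> f x = eval_mpoly g v / eval_mpoly h v)"
    using assms(1) by (simp add: proj_variety_def)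
  from bspec[OF this assms(2)] show thesis
    by (elim exE conjE) (rule that, simp_all add: proj_variety_def)
qed

text \<open>A homogeneous polynomial in the regular functions \<open>u i\<close> is regular, and
  quotients of such polynomials give the pullbacks of regular functions on the target.\<close>

lemma (in fspace) morphism_to_proj:
  assumes X: "X \<subseteq> proj_points n"
    and u: "\<And>i. i \<le> n \<Longrightarrow> u i \<in> regular S (topspace (topol S))"
    and f: "\<And>x. x \<in> topspace (topol S) \<Longrightarrow> f x = pt n (\<lambda>i. u i x) \<and> f x \<in> X"
  shows "morphism S (proj_variety n X) f"
proof -
  let ?T = "topspace (topol S)" and ?U = "\<lambda>x. vec (n + 1) (\<lambda>i. u i x)"
  have ev: "(\<lambda>x. eval_mpoly p (?U x)) \<in> regular S ?T" if "homogeneous n d p" for p d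
    by (rule reg_eval[OF _ u that]) auto
  have mem: "?U x \<in> f x" if "x \<in> ?T" for x using f[OF that] vec_in_pt by metis
  have cz: "continuous_map (topol S) (zariski n) f"
    unfolding zariski_alt
  proof (rule continuous_on_generated_topo)
    fix B :: "'k vec set set" assume "B \<in> {nonvan n h |h d. homogeneous n d h}"
    then obtain h d where B: "B = nonvan n h" "homogeneous n d h" by blast
    have "f x \<in> nonvan n h \<longleftrightarrow> eval_mpoly h (?U x) \<noteq> 0" if "x \<in> ?T" for x
      using f[OF that] X pt_nonvanish[OF B(2)] unfolding nonvan_def by auto
    then have "f -` B \<inter> ?T = {x \<in> ?T. eval_mpoly h (?U x) \<noteq> 0}" unfolding B(1) by auto
    then show "openin (topol S) (f -` B \<inter> ?T)" using reg_nonzero[OF ev[OF B(2)]] by simp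
  next
    have "f ` ?T \<subseteq> proj_points n" using f X by blast
    moreover have "topspace (zariski n) = (proj_points n :: 'k vec set set)" by (rule topspace_zariski)
    ultimately show "f ` ?T \<subseteq> \<Union> {nonvan n h |h d. homogeneous n d h}"
      unfolding zariski_alt topology_generated_by_topspace by simp
  qed
  have cont: "continuous_map (topol S) (topol (proj_variety n X)) f"
    using cz f unfolding proj_variety_def by (auto simp: continuous_map_in_subtopology)
  have pre: "openin (topol S) {x \<in> ?T. f x \<in> N}" if "openin (topol (proj_variety n X)) N" for N
    using cont that unfolding continuous_map_def by auto
  show ?thesis
    unfolding morphism_def
  proof (intro conjI allI impI cont)
    fix V h assume "openin (topol (proj_variety n X)) V \<and> h \<in> regular (proj_variety n X) V"
    then have V: "openin (topol (proj_variety n X)) V" "h \<in> regular (proj_variety n X) V" by auto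
    show "h \<circ> f \<in> regular S {x \<in> ?T. f x \<in> V}"
    proof (rule reg_local[OF pre[OF V(1)]])
      fix x assume x: "x \<in> {x \<in> ?T. f x \<in> V}"
      then have fx: "f x \<in> V" by simp
      obtain W d a b where W: "openin (topol (proj_variety n X)) W" "f x \<in> W" "W \<subseteq> V"
          "homogeneous n d a" "homogeneous n d b"
          "\<And>y v. y \<in> W \<Longrightarrow> v \<in> y \<Longrightarrow> eval_mpoly b v \<noteq> 0 \<and> h y = eval_mpoly a v / eval_mpoly b v"
        using regular_proj_varietyE[OF V(2) fx] by metis
      let ?N = "{x \<in> ?T. f x \<in> W}"
      have sub: "?N \<subseteq> ?T" by auto
      have ab: "eval_mpoly b (?U z) \<noteq> 0 \<and> h (f z) = eval_mpoly a (?U z) / eval_mpoly b (?U z)" if "z \<in> ?N" for z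
        using W(6)[of "f z" "?U z"] mem that by auto
      have "(\<lambda>x. eval_mpoly a (?U x) / eval_mpoly b (?U x)) \<in> regular S ?N"
        using reg_subset[OF ev[OF W(4)] pre[OF W(1)] sub] reg_subset[OF ev[OF W(5)] pre[OF W(1)] sub] ab
        by (intro reg_divide) auto
      then show "\<exists>M g. openin (topol S) M \<and> x \<in> M \<and> M \<subseteq> {x \<in> ?T. f x \<in> V} \<and> g \<in> regular S M \<and> (\<forall>z\<in>M. (h \<circ> f) z = g z)"
        using pre[OF W(1)] W(2,3) x ab
        by (intro exI[of _ ?N] exI[of _ "\<lambda>x. eval_mpoly a (?U x) / eval_mpoly b (?U x)"]) auto
    qed
  qed
qed

section \<open>Quadratic forms and quadrics\<close>

definition bl :: "nat \<Rightarrow> (nat \<Rightarrow> nat \<Rightarrow> 'r::comm_ring_1) \<Rightarrow> (nat \<Rightarrow> 'r) \<Rightarrow> (nat \<Rightarrow> 'r) \<Rightarrow> 'r" where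
  "bl d Q u v = (\<Sum>i<d. \<Sum>j<d. Q i j * u i * v j)"

lemma qf_bl: "qf d Q x = bl d Q x x"
  by (simp add: qf_def bl_def)

lemma bl_add_left: "bl d Q (\<lambda>i. u i + c * u' i) v = bl d Q u v + c * bl d Q u' v"
  unfolding bl_def sum_distrib_left sum.distrib[symmetric]
  by (intro sum.cong refl) (simp add: algebra_simps)

lemma bl_add_right: "bl d Q u (\<lambda>i. v i + c * v' i) = bl d Q u v + c * bl d Q u v'"
  unfolding bl_def sum_distrib_left sum.distrib[symmetric]
  by (intro sum.cong refl) (simp add: algebra_simps)

lemma bl_scale_left: "bl d Q (\<lambda>i. c * u i) v = c * bl d Q u v"
  unfolding bl_def sum_distrib_left by (intro sum.cong refl) (simp add: algebra_simps)

lemma bl_scale_right: "bl d Q u (\<lambda>i. c * v i) = c * bl d Q u v"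
  unfolding bl_def sum_distrib_left by (intro sum.cong refl) (simp add: algebra_simps)

lemma bl_cong: "(\<And>i. i < d \<Longrightarrow> u i = u' i) \<Longrightarrow> (\<And>i. i < d \<Longrightarrow> v i = v' i) \<Longrightarrow> bl d Q u v = bl d Q u' v'"
  by (simp add: bl_def)

lemma bl_zero: "(\<And>i. i < d \<Longrightarrow> u i = 0) \<Longrightarrow> bl d Q u v = 0"
  by (simp add: bl_def)

lemma bl_unit:
  assumes "k < d" "l < d"
  shows "bl d Q (\<lambda>i. if i = k then 1 else 0) (\<lambda>i. if i = l then 1 else 0) = Q k l"
proof -
  have "Q i j * (if i = k then 1 else 0) * (if j = l then 1 else 0) = (if j = l then if i = k then Q i l else 0 else 0)" for i j
    by simp
  then show ?thesis using assms by (simp add: bl_def)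
qed

locale quadratic =
  fixes d :: nat and Q :: "nat \<Rightarrow> nat \<Rightarrow> 'k::field_char_0"
  assumes sym: "Q i j = Q j i"
begin

abbreviation "q \<equiv> qf d Q"
abbreviation "b \<equiv> bl d Q"

lemma b_sym: "b u v = b v u"
  unfolding bl_def by (subst sum.swap) (intro sum.cong refl, simp add: sym mult_ac)

lemma q_add: "q (\<lambda>i. u i + c * v i) = q u + 2 * c * b u v + c ^ 2 * q v"
  unfolding qf_bl bl_add_left bl_add_right using b_sym[of v u] by (simp add: algebra_simps power2_eq_square)

lemma polarization:
  assumes "\<And>v. qf d Q' v = \<mu> * q v" "\<And>i j. Q' i j = Q' j i"
  shows "bl d Q' u v = \<mu> * b u v"
proof -
  interpret Q': quadratic d Q' by unfold_locales (rule assms(2))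
  have "qf d Q' (\<lambda>i. u i + 1 * v i) = \<mu> * q (\<lambda>i. u i + 1 * v i)" by (rule assms(1))
  then have "2 * bl d Q' u v = 2 * (\<mu> * b u v)"
    unfolding q_add Q'.q_add assms(1) by (simp add: algebra_simps)
  then show ?thesis by simp
qed

end

text \<open>Nondegeneracy is the smoothness of the quadric, and \<open>d3\<close> provides a nonzero
  vector orthogonal to any two given ones.\<close>

locale quadric = quadratic +
  assumes nondeg: "\<exists>i<d. u i \<noteq> 0 \<Longrightarrow> \<exists>v. b u v \<noteq> 0"
    and d3: "d \<ge> 3"
begin

text \<open>A vector space is not the union of two hyperplanes: if neither given vector works for
  both functionals, their sum does.\<close>

lemma common_nonvanish:
  assumes "b u v1 \<noteq> 0" "l v2 \<noteq> 0" and l: "\<And>v v' c. l (\<lambda>i. v i + c * v' i) = l v + c * l v'"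
  shows "\<exists>v. b u v \<noteq> 0 \<and> l v \<noteq> (0::'a)"
proof (cases "l v1 \<noteq> 0 \<or> b u v2 \<noteq> 0")
  case False
  then have "b u (\<lambda>i. v1 i + 1 * v2 i) \<noteq> 0 \<and> l (\<lambda>i. v1 i + 1 * v2 i) \<noteq> 0"
    unfolding l bl_add_right using assms by simp
  then show ?thesis by blast
qed (use assms in blast)

text \<open>The cross product of the two rows, if it is nonzero. Otherwise the rows are
  proportional, and a vector orthogonal to a nonzero one of them is enough.\<close>

lemma three_unknowns:
  fixes p0 p1 p2 r0 r1 r2 :: 'a
  obtains u0 u1 u2 where "u0 \<noteq> 0 \<or> u1 \<noteq> 0 \<or> u2 \<noteq> 0"
    "p0 * u0 + p1 * u1 + p2 * u2 = 0" "r0 * u0 + r1 * u1 + r2 * u2 = 0"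
proof (cases "p1 * r2 - p2 * r1 = 0 \<and> p2 * r0 - p0 * r2 = 0 \<and> p0 * r1 - p1 * r0 = 0")
  case False
  show thesis
    by (rule that[of "p1 * r2 - p2 * r1" "p2 * r0 - p0 * r2" "p0 * r1 - p1 * r0"]) (use False in \<open>auto simp: algebra_simps\<close>)
next
  case True
  show thesis
  proof (cases "p0 = 0 \<and> p1 = 0")
    case p: False
    show thesis by (rule that[of p1 "- p0" 0]) (use p True in \<open>auto simp: algebra_simps\<close>)
  next
    case p: True
    show thesis
    proof (cases "p2 = 0")
      case False
      then have "r0 = 0" "r1 = 0" using True p by auto
      then show thesis using p by (intro that[of 1 0 0]) auto
    next
      case p2: True
      show thesis
      proof (cases "r0 = 0 \<and> r1 = 0")
        case True
        then show thesis using p by (intro that[of 1 0 0]) auto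
      next
        case False
        then show thesis using p p2 by (intro that[of r1 "- r0" 0]) auto
      qed
    qed
  qed
qed

lemma ex_orthogonal:
  obtains u where "\<exists>i<d. u i \<noteq> 0" "b u x = 0" "b u y = 0"
proof -
  define e where "e k = (\<lambda>i::nat. if i = k then 1 else (0::'a))" for k
  obtain u0 u1 u2 where u: "u0 \<noteq> 0 \<or> u1 \<noteq> 0 \<or> u2 \<noteq> 0"
    "b (e 0) x * u0 + b (e 1) x * u1 + b (e 2) x * u2 = 0"
    "b (e 0) y * u0 + b (e 1) y * u1 + b (e 2) y * u2 = 0"
    by (rule three_unknowns)
  define u where "u i = (u0 * e 0 i + u1 * e 1 i) + u2 * e 2 i" for i
  have bu: "b u v = b (e 0) v * u0 + b (e 1) v * u1 + b (e 2) v * u2" for v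
    unfolding u_def bl_add_left bl_scale_left by (simp add: mult_ac)
  have "u 0 = u0" "u 1 = u1" "u 2 = u2" by (simp_all add: u_def e_def)
  then have "\<exists>i<d. u i \<noteq> 0" using u(1) d3 by (metis One_nat_def Suc_1 Suc_le_lessD le_eq_less_or_eq less_trans numeral_3_eq_3 zero_less_Suc lessI)
  then show thesis using that[of u] u(2,3) bu by simp
qed

text \<open>\<open>x\<close> and \<open>y\<close> span a hyperbolic plane with nonzero complement.
  Subtracting from \<open>v\<close> its part in the plane gives \<open>w\<close> in the complement
  with \<open>b u w\<close> nonzero, so \<open>u\<close>, \<open>w\<close> and \<open>u + w\<close>
  cannot all be isotropic.\<close>

lemma ex_orthogonal_anisotropic:
  assumes "q x = 0" "q y = 0" "b x y \<noteq> 0"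
  obtains w where "b w x = 0" "b w y = 0" "q w \<noteq> 0"
proof -
  obtain u where u: "\<exists>i<d. u i \<noteq> 0" "b u x = 0" "b u y = 0" by (rule ex_orthogonal)
  obtain v where v: "b u v \<noteq> 0" using nondeg[OF u(1)] by blast
  define w where "w i = (v i + (- (b v y / b x y)) * x i) + (- (b v x / b x y)) * y i" for i
  have bw: "b w z = b v z + (- (b v y / b x y)) * b x z + (- (b v x / b x y)) * b y z" for z
    unfolding w_def bl_add_left ..
  have w: "b w x = 0" "b w y = 0" "b u w \<noteq> 0"
    using assms b_sym[of y x] b_sym[of u w] b_sym[of u v] b_sym[of x u] b_sym[of y u] u v bw
    by (simp_all add: qf_bl)
  show thesis
  proof (cases "q u \<noteq> 0 \<or> q w \<noteq> 0")
    case True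
    then show thesis using that u w by blast
  next
    case False
    then have "q (\<lambda>i. u i + 1 * w i) \<noteq> 0" using w(3) unfolding q_add by simp
    moreover have "b (\<lambda>i. u i + 1 * w i) x = 0" "b (\<lambda>i. u i + 1 * w i) y = 0"
      unfolding bl_add_left using u w by simp_all
    ultimately show thesis using that by blast
  qed
qed

text \<open>This is \<open>q v\<close> times the reflection of \<open>z\<close> in \<open>v\<close>,
  written without division; it represents the second intersection of the quadric with the line
  through \<open>z\<close> and \<open>v\<close>.\<close>

lemma isotropic_reflect:
  assumes "q z = 0"
  shows "q (\<lambda>i. q v * z i + (- 2 * b z v) * v i) = 0"
proof -
  have "q (\<lambda>i. q v * z i + (- 2 * b z v) * v i) = (q v)^2 * q z + 2 * (- 2 * b z v) * (q v * b z v) + (- 2 * b z v)^2 * q v"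
    unfolding q_add qf_scale bl_scale_left by simp
  then show ?thesis using assms by (simp add: power2_eq_square)
qed

text \<open>Adding a multiple of the isotropic \<open>x\<close> to \<open>u\<close> changes
  \<open>q u\<close> linearly and leaves \<open>b x u\<close> as it is.\<close>

lemma ex_isotropic_partner:
  assumes "\<exists>i<d. x i \<noteq> 0" "q x = 0"
  obtains y where "q y = 0" "b x y \<noteq> 0"
proof -
  obtain u where u: "b x u \<noteq> 0" using nondeg[OF assms(1)] by blast
  define y where "y i = u i + (- (q u / (2 * b x u))) * x i" for i
  have "q y = q u - 2 * (q u / (2 * b x u)) * b u x"
    unfolding y_def q_add assms(2) by simp
  then have "q y = 0" using u b_sym[of u x] by simp
  moreover have "b x y \<noteq> 0" unfolding y_def bl_add_right using u assms(2) by (simp add: qf_bl)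
  ultimately show thesis by (rule that)
qed

text \<open>Such a \<open>z\<close> is the centre of projection for \<open>isotropic_curve\<close>.
  If \<open>x\<close> and \<open>y\<close> are orthogonal, a common nonorthogonal vector is
  corrected by a multiple of \<open>x\<close>; otherwise \<open>z\<close> leaves the hyperbolic
  plane in an orthogonal direction.\<close>

lemma ex_isotropic_common:
  assumes x: "\<exists>i<d. x i \<noteq> 0" "q x = 0" and y: "\<exists>i<d. y i \<noteq> 0" "q y = 0"
  obtains z where "q z = 0" "b z x \<noteq> 0" "b z y \<noteq> 0"
proof (cases "b x y = 0")
  case True
  obtain v1 where "b x v1 \<noteq> 0" using nondeg[OF x(1)] by blast
  moreover obtain v2 where "b y v2 \<noteq> 0" using nondeg[OF y(1)] by blast
  ultimately obtain u where u: "b x u \<noteq> 0" "b y u \<noteq> 0"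
    using common_nonvanish[of x v1 "b y" v2] bl_add_right by blast
  define z where "z i = u i + (- (q u / (2 * b x u))) * x i" for i
  have "q z = q u - 2 * (q u / (2 * b x u)) * b u x"
    unfolding z_def q_add x(2) by simp
  then have "q z = 0" using u b_sym[of u x] by simp
  moreover have "b z x \<noteq> 0" unfolding z_def bl_add_left using u x(2) b_sym[of u x] by (simp add: qf_bl)
  moreover have "b z y \<noteq> 0" unfolding z_def bl_add_left using u True b_sym[of u y] by simp
  ultimately show thesis by (rule that)
next
  case False
  obtain w where w: "b w x = 0" "b w y = 0" "q w \<noteq> 0"
    using ex_orthogonal_anisotropic[OF x(2) y(2) False] by blast
  \<comment> \<open>This value makes the contribution of the plane, \<open>2 * a * b x y\<close>,
    cancel \<open>q w\<close>.\<close>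
  define a where "a = - (q w / (2 * b x y))"
  have a: "a \<noteq> 0" "2 * a * b x y = - q w" using w(3) False by (simp_all add: a_def)
  define z where "z i = (x i + a * y i) + 1 * w i" for i
  have "q z = q x + 2 * a * b x y + a ^ 2 * q y + 2 * (b x w + a * b y w) + q w"
    unfolding z_def q_add[of _ 1] q_add[of x] bl_add_left by simp
  then have "q z = 0" using x(2) y(2) a w b_sym[of x w] b_sym[of y w] by simp
  moreover have "b z x \<noteq> 0"
    unfolding z_def bl_add_left using a(1) False w(1) x(2) b_sym[of y x] by (simp add: qf_bl)
  moreover have "b z y \<noteq> 0"
    unfolding z_def bl_add_left using a(1) False w(2) y(2) by (simp add: qf_bl)
  ultimately show thesis by (rule that)
qed

text \<open>\<open>isotropic_reflect\<close> with fixed \<open>z\<close> is applied along the line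
  from \<open>x\<close> to \<open>y\<close>. At an isotropic point only a multiple of the point
  itself remains, and it is nonzero because \<open>z\<close> is orthogonal to neither end.\<close>

lemma isotropic_curve:
  assumes x: "\<exists>i<d. x i \<noteq> 0" "q x = 0" and y: "\<exists>i<d. y i \<noteq> 0" "q y = 0"
  obtains \<kappa> \<alpha> \<beta> where "\<And>t. q (\<lambda>i. poly (\<kappa> i) t) = 0" "\<alpha> \<noteq> 0" "\<beta> \<noteq> 0"
    "\<And>i. poly (\<kappa> i) 0 = \<alpha> * x i" "\<And>i. poly (\<kappa> i) 1 = \<beta> * y i"
proof -
  obtain z where z: "q z = 0" "b z x \<noteq> 0" "b z y \<noteq> 0" using ex_isotropic_common[OF assms] by blast
  define c where "c i = [:x i, y i - x i:]" for i
  define qc where "qc = qf d (\<lambda>i j. [:Q i j:]) c"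
  define bc where "bc = bl d (\<lambda>i j. [:Q i j:]) (\<lambda>i. [:z i:]) c"
  define \<kappa> where "\<kappa> i = qc * [:z i:] + (- 2 * bc) * c i" for i
  have qc: "poly qc t = q (\<lambda>i. poly (c i) t)" for t
    by (simp add: qc_def qf_def poly_sum mult_ac)
  have bc: "poly bc t = b z (\<lambda>i. poly (c i) t)" for t
    by (simp add: bc_def bl_def poly_sum mult_ac)
  have \<kappa>: "poly (\<kappa> i) t = q (\<lambda>i. poly (c i) t) * z i + (- 2 * b z (\<lambda>i. poly (c i) t)) * poly (c i) t" for i t
    by (simp add: \<kappa>_def qc bc)
  show thesis
  proof (rule that[of \<kappa> "- 2 * b z x" "- 2 * b z y"])
    show "q (\<lambda>i. poly (\<kappa> i) t) = 0" for t unfolding \<kappa> by (rule isotropic_reflect[OF z(1)])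
    show "poly (\<kappa> i) 0 = - 2 * b z x * x i" for i unfolding \<kappa> using x(2) by (simp add: c_def)
    show "poly (\<kappa> i) 1 = - 2 * b z y * y i" for i unfolding \<kappa> using y(2) by (simp add: c_def)
  qed (use z in simp_all)
qed

text \<open>The vector is \<open>isotropic_reflect\<close> of \<open>y\<close> in a \<open>v\<close>
  on which both functionals are nonzero. Both vanish at \<open>y\<close>, so they see only the
  multiple of \<open>v\<close>.\<close>

lemma isotropic_avoid:
  assumes y: "\<exists>i<d. y i \<noteq> 0" "q y = 0" and l: "\<And>v v' c. l (\<lambda>i. v i + c * v' i) = l v + c * l v'"
    and "l v2 \<noteq> 0" "l y = (0::'a)"
  obtains x where "q x = 0" "b y x \<noteq> 0" "l x \<noteq> 0"
proof -
  obtain v1 where "b y v1 \<noteq> 0" using nondeg[OF y(1)] by blast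
  then obtain v where v: "b y v \<noteq> 0" "l v \<noteq> 0" using common_nonvanish[OF _ assms(4) l] by blast
  have l0: "l (\<lambda>i. c * y i) = 0" for c
  proof -
    have "l (\<lambda>i. y i + (c - 1) * y i) = 0" unfolding l using assms(5) by simp
    then show ?thesis by (simp add: algebra_simps)
  qed
  show thesis
  proof (rule that)
    show "q (\<lambda>i. q v * y i + (- 2 * b y v) * v i) = 0" by (rule isotropic_reflect[OF y(2)])
    show "b y (\<lambda>i. q v * y i + (- 2 * b y v) * v i) \<noteq> 0"
      unfolding bl_add_right bl_scale_right using v y(2) by (simp add: qf_bl)
    show "l (\<lambda>i. q v * y i + (- 2 * b y v) * v i) \<noteq> 0"
      unfolding l l0 using v by simp
  qed
qed

text \<open>Evaluating \<open>Q'\<close> at the isotropic vector built from \<open>z\<close> and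
  \<open>v\<close> gives \<open>key\<close>. It remains to show that \<open>?b z\<close> is a
  multiple of \<open>b z\<close>, and to pass from generic \<open>v\<close> to all
  \<open>v\<close>.\<close>

lemma vanish_on_quadric:
  assumes z: "\<exists>i<d. z i \<noteq> 0" "q z = 0"
    and Q': "\<And>i j. Q' i j = Q' j i" and van: "\<And>v. q v = 0 \<Longrightarrow> qf d Q' v = 0"
  obtains \<mu> where "\<And>v. qf d Q' v = \<mu> * q v"
proof -
  interpret Q': quadratic d Q' by unfold_locales (rule Q')
  let ?q = "qf d Q'" and ?b = "bl d Q'"
  have key: "b z v * ?q v = q v * ?b z v" if "b z v \<noteq> 0" for v
  proof -
    have "?q (\<lambda>i. q v * z i + (- 2 * b z v) * v i) = 0" using van isotropic_reflect[OF z(2)] by blast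
    then have "2 * (- 2 * b z v) * (q v * ?b z v) + (- 2 * b z v)^2 * ?q v = 0"
      unfolding Q'.q_add qf_scale bl_scale_left using van[OF z(2)] by simp
    then have "(4 * b z v) * (b z v * ?q v - q v * ?b z v) = 0" by (simp add: algebra_simps power2_eq_square)
    then show ?thesis using that by simp
  qed
  obtain y where y: "q y = 0" "b z y \<noteq> 0" using ex_isotropic_partner[OF z] by blast
  obtain u1 where u1: "b u1 z = 0" "b u1 y = 0" "q u1 \<noteq> 0"
    using ex_orthogonal_anisotropic[OF z(2) y] by blast
  have bzu1: "b z u1 = 0" using u1(1) b_sym by metis
  define v0 where "v0 i = (1 / b z y) * y i" for i
  have v0: "b z v0 = 1" unfolding v0_def bl_scale_right using y(2) by simp
  have step1: "?b z v = 0" if v: "b z v = 0" "q v \<noteq> 0" for v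
  proof -
    have g: "s * (?q v + 2 * s * ?b v v0 + s^2 * ?q v0) = (q v + 2 * s * b v v0 + s^2 * q v0) * (?b z v + s * ?b z v0)"
      if "s \<noteq> 0" for s
      using key[of "\<lambda>i. v i + s * v0 i"] that unfolding bl_add_right Q'.q_add q_add v v0 by simp
    define L where "L s = s * (?q v + 2 * s * ?b v v0 + s^2 * ?q v0)" for s
    define R where "R s = (q v + 2 * s * b v v0 + s^2 * q v0) * (?b z v + s * ?b z v0)" for s
    \<comment> \<open>The weights 4, 4, -1, -1 at 1, -1, 2, -2 cancel odd powers and squares of
      \<open>s\<close> and leave six times the constant term. Only nonzero \<open>s\<close> are
      sampled, as \<open>g\<close> requires.\<close>
    have "6 * (q v * ?b z v) = 4 * (R 1 + R (- 1)) - (R 2 + R (- 2))"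
      by (simp add: R_def algebra_simps)
    also have "\<dots> = 4 * (L 1 + L (- 1)) - (L 2 + L (- 2))"
    proof -
      have LR: "R s = L s" if "s \<noteq> 0" for s using g[OF that] by (simp only: L_def R_def)
      have "R 1 = L 1" "R (- 1) = L (- 1)" "R 2 = L 2" "R (- 2) = L (- 2)" by (rule LR; simp)+
      then show ?thesis by (simp only:)
    qed
    also have "\<dots> = 0" by (simp add: L_def algebra_simps)
    finally have "6 * (q v * ?b z v) = 0" .
    then show ?thesis using v(2) by simp
  qed
  \<comment> \<open>A suitable multiple of \<open>u1\<close> makes \<open>u\<close> anisotropic
    without leaving the hyperplane orthogonal to \<open>z\<close>, so \<open>step1\<close> applies
    to the sum and to \<open>u1\<close>.\<close>
  have step2: "?b z u = 0" if u: "b z u = 0" for u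
  proof -
    have "\<exists>s. q (\<lambda>i. u i + s * u1 i) \<noteq> 0"
    proof (rule ccontr)
      assume "\<not> ?thesis"
      then have e: "q u + 2 * s * b u u1 + s ^ 2 * q u1 = 0" for s unfolding q_add by blast
      have "2 * q u1 = (q u + 2 * 2 * b u u1 + 2 ^ 2 * q u1) - 2 * (q u + 2 * 1 * b u u1 + 1 ^ 2 * q u1) + (q u + 2 * 0 * b u u1 + 0 ^ 2 * q u1)"
        by (simp add: algebra_simps)
      also have "\<dots> = 0" unfolding e by simp
      finally have "2 * q u1 = 0" .
      then show False using u1(3) by simp
    qed
    then obtain s where s: "q (\<lambda>i. u i + s * u1 i) \<noteq> 0" by blast
    have "?b z (\<lambda>i. u i + s * u1 i) = 0"
      by (rule step1[OF _ s]) (simp add: bl_add_right u bzu1)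
    then show ?thesis unfolding bl_add_right using step1[OF bzu1 u1(3)] by simp
  qed
  define \<mu> where "\<mu> = ?b z v0"
  have bz: "?b z v = \<mu> * b z v" for v
  proof -
    have "?b z (\<lambda>i. v i + (- b z v) * v0 i) = 0"
      by (rule step2) (simp only: bl_add_right v0, simp)
    then show ?thesis unfolding bl_add_right by (simp add: \<mu>_def mult.commute)
  qed
  have gen: "?q v = \<mu> * q v" if "b z v \<noteq> 0" for v
    using key[OF that] bz[of v] that by (metis mult.commute mult.left_commute mult_left_cancel)
  have "?q v = \<mu> * q v" for v
  proof (cases "b z v = 0")
    case True
    have g: "?q v + 2 * s * ?b v v0 + s^2 * ?q v0 = \<mu> * (q v + 2 * s * b v v0 + s^2 * q v0)" if "s \<noteq> 0" for s
      using gen[of "\<lambda>i. v i + s * v0 i"] that unfolding bl_add_right Q'.q_add q_add True v0 by simp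
    \<comment> \<open>The same weights isolate the constant term of a quadratic polynomial in
      \<open>s\<close>; off \<open>s = 0\<close> it vanishes by \<open>gen\<close>, since
      \<open>b z\<close> takes the value \<open>s\<close> there.\<close>
    define H where "H s = ?q v + 2 * s * ?b v v0 + s^2 * ?q v0 - \<mu> * (q v + 2 * s * b v v0 + s^2 * q v0)" for s
    have "6 * (?q v - \<mu> * q v) = 4 * (H 1 + H (- 1)) - (H 2 + H (- 2))"
      by (simp add: H_def algebra_simps)
    also have "\<dots> = 0"
    proof -
      have H0: "H s = 0" if "s \<noteq> 0" for s using g[OF that] by (simp only: H_def diff_self)
      have "H 1 = 0" "H (- 1) = 0" "H 2 = 0" "H (- 2) = 0" by (rule H0; simp)+
      then show ?thesis by simp
    qed
    finally have "6 * (?q v - \<mu> * q v) = 0" .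
    then show ?thesis by simp
  qed (rule gen)
  then show thesis by (rule that)
qed

end

text \<open>On the span of two coordinate vectors the form is a quadratic polynomial in one
  parameter, unless the second vector is already isotropic.\<close>

lemma (in quadric) ex_isotropic:
  assumes "\<And>p :: 'a poly. degree p > 0 \<Longrightarrow> \<exists>t. poly p t = 0"
  obtains z where "\<exists>i<d. z i \<noteq> 0" "q z = 0"
proof -
  define e where "e k = (\<lambda>i::nat. if i = k then 1 else (0::'a))" for k
  show thesis
  proof (cases "q (e 1) = 0")
    case True
    moreover have "\<exists>i<d. e 1 i \<noteq> 0" using d3 by (intro exI[of _ 1]) (simp add: e_def)
    ultimately show thesis using that by blast
  next
    case False
    obtain t where t: "poly [:q (e 0), 2 * b (e 0) (e 1), q (e 1):] t = 0"
      using assms[of "[:q (e 0), 2 * b (e 0) (e 1), q (e 1):]"] False by auto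
    have "q (\<lambda>i. e 0 i + t * e 1 i) = 0"
      unfolding q_add using t by (simp add: algebra_simps power2_eq_square)
    moreover have "\<exists>i<d. e 0 i + t * e 1 i \<noteq> 0" using d3 by (intro exI[of _ 0]) (simp add: e_def)
    ultimately show thesis using that[of "\<lambda>i. e 0 i + t * e 1 i"] by blast
  qed
qed

section \<open>Irreducibility of projective spaces and of products\<close>

definition irreducible_top :: "'p topology \<Rightarrow> bool" where
  "irreducible_top T \<longleftrightarrow> (\<forall>U V. openin T U \<and> openin T V \<and> U \<noteq> {} \<and> V \<noteq> {} \<longrightarrow> U \<inter> V \<noteq> {})"

lemma dense_openI:
  "irreducible_top (topol S) \<Longrightarrow> openin (topol S) U \<Longrightarrow> U \<noteq> {} \<Longrightarrow> dense_open S U"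
  by (simp add: dense_open_def irreducible_top_def dense_intersects_open)

lemma dense_open_meets:
  "dense_open S U \<Longrightarrow> openin (topol S) V \<Longrightarrow> V \<noteq> {} \<Longrightarrow> U \<inter> V \<noteq> {}"
  by (simp add: dense_open_def dense_intersects_open)

lemma eval_poly_curve:
  assumes "homogeneous n d h"
  obtains P where "\<And>t. poly P t = eval_mpoly h (vec (n + 1) (\<lambda>i. poly (c i) t))"
proof
  show "poly (\<Sum>m\<in>Poly_Mapping.keys h. Polynomial.smult (Poly_Mapping.lookup h m) (\<Prod>i\<in>Poly_Mapping.keys m. c i ^ Poly_Mapping.lookup m i)) t
      = eval_mpoly h (vec (n + 1) (\<lambda>i. poly (c i) t))" for t
    unfolding eval_vec[OF assms] by (simp add: poly_sum poly_prod)
qed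

text \<open>The two open sets are tested on the line through a point of each. The factor
  \<open>c k\<close> keeps the parameter away from the zero vector.\<close>

lemma irreducible_proj_space:
  "irreducible_top (topol (proj_space n :: ('k::field_char_0 vec set, 'k) fun_space))"
  unfolding irreducible_top_def
proof (intro allI impI, elim conjE)
  have top: "topol (proj_space n) = (zariski n :: 'k vec set topology)"
    by (simp add: proj_space_def proj_variety_def topspace_zariski[symmetric] subtopology_topspace)
  fix U V :: "'k vec set set"
  assume UV: "openin (topol (proj_space n)) U" "openin (topol (proj_space n)) V" "U \<noteq> {}" "V \<noteq> {}"
  obtain p q where pq: "p \<in> U" "q \<in> V" using UV by blast
  obtain g d where g: "homogeneous n d g" "p \<in> nonvan n g" "nonvan n g \<subseteq> U"
    by (rule zariski_basis[OF UV(1)[unfolded top] pq(1)])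
  obtain h e where h: "homogeneous n e h" "q \<in> nonvan n h" "nonvan n h \<subseteq> V"
    by (rule zariski_basis[OF UV(2)[unfolded top] pq(2)])
  obtain u where u: "p = pt n u" "\<exists>i\<le>n. u i \<noteq> 0" using g(2) unfolding nonvan_def proj_points_pt by blast
  obtain v where v: "q = pt n v" using h(2) unfolding nonvan_def proj_points_pt by blast
  define c where "c i = [:u i, v i - u i:]" for i
  obtain k where k: "k \<le> n" "u k \<noteq> 0" using u(2) by blast
  obtain P where P: "\<And>t. poly P t = eval_mpoly g (vec (n + 1) (\<lambda>i. poly (c i) t))" using eval_poly_curve[OF g(1)] by metis
  obtain R where R: "\<And>t. poly R t = eval_mpoly h (vec (n + 1) (\<lambda>i. poly (c i) t))" using eval_poly_curve[OF h(1)] by metis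
  have "poly P 0 \<noteq> 0" using g(2) pt_nonvanish[OF g(1)] unfolding P u(1) nonvan_def by (simp add: c_def)
  moreover have "poly R 1 \<noteq> 0" using h(2) pt_nonvanish[OF h(1)] unfolding R v nonvan_def by (simp add: c_def)
  moreover have "poly (c k) 0 \<noteq> 0" using k by (simp add: c_def)
  ultimately have "P * R * c k \<noteq> 0" by auto
  then obtain t where "poly (P * R * c k) t \<noteq> 0" using poly_all_0_iff_0 by blast
  then have t: "poly P t \<noteq> 0" "poly R t \<noteq> 0" "poly (c k) t \<noteq> 0" by auto
  have "pt n (\<lambda>i. poly (c i) t) \<in> proj_points n" using t(3) k(1) proj_points_pt by blast
  then have "pt n (\<lambda>i. poly (c i) t) \<in> nonvan n g \<inter> nonvan n h"
    using t(1,2) pt_nonvanish[OF g(1)] pt_nonvanish[OF h(1)] unfolding nonvan_def P R by simp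
  then show "U \<inter> V \<noteq> {}" using g(3) h(3) by blast
qed

text \<open>The affine coordinate x_i / x_j. The representative picked by \<open>SOME\<close> is
  harmless because the ratio does not depend on it.\<close>

definition crd :: "nat \<Rightarrow> nat \<Rightarrow> 'k::field vec set \<Rightarrow> 'k" where
  "crd j i p = (SOME v. v \<in> p) $ i / (SOME v. v \<in> p) $ j"

definition chart_at :: "nat \<Rightarrow> 'k::field vec set set \<Rightarrow> nat \<Rightarrow> 'k vec set set" where
  "chart_at n X j = {p \<in> X. \<forall>v\<in>p. v $ j \<noteq> 0}"

lemma pt_some:
  obtains c where "c \<noteq> 0" "(SOME v. v \<in> pt n u) = vec (n + 1) (\<lambda>i. c * u i)"
proof -
  have "(SOME v. v \<in> pt n u) \<in> pt n u" using vec_in_pt by (rule someI)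
  then show thesis using that unfolding pt_alt by blast
qed

lemma crd_pt: "i \<le> n \<Longrightarrow> j \<le> n \<Longrightarrow> crd j i (pt n u) = u i / u j"
proof -
  assume "i \<le> n" "j \<le> n"
  obtain c where "c \<noteq> 0" "(SOME v. v \<in> pt n u) = vec (n + 1) (\<lambda>i. c * u i)" by (rule pt_some)
  then show ?thesis using \<open>i \<le> n\<close> \<open>j \<le> n\<close> by (simp add: crd_def)
qed

lemma pt_in_chart:
  assumes "j \<le> n"
  shows "pt n u \<in> chart_at n X j \<longleftrightarrow> pt n u \<in> X \<and> u j \<noteq> 0"
proof -
  have "(\<forall>v\<in>pt n u. v $ j \<noteq> 0) \<longleftrightarrow> (\<forall>c. c \<noteq> 0 \<longrightarrow> c * u j \<noteq> 0)"
    unfolding pt_alt using assms by auto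
  moreover have "\<exists>c :: 'a. c \<noteq> 0" by (rule exI[of _ 1]) simp
  ultimately show ?thesis by (auto simp: chart_at_def)
qed

lemma chart_at_rep:
  assumes "X \<subseteq> proj_points n" "p \<in> chart_at n X j" "j \<le> n"
  shows "p = pt n (\<lambda>i. crd j i p)" "crd j j p = 1"
proof -
  obtain u where u: "p = pt n u" using assms(1,2) proj_points_pt unfolding chart_at_def by blast
  then have uj: "u j \<noteq> 0" using assms(2,3) pt_in_chart by metis
  have "pt n (\<lambda>i. crd j i p) = pt n (\<lambda>i. inverse (u j) * u i)"
    unfolding u by (rule pt_cong) (simp add: crd_pt assms(3) divide_inverse mult.commute)
  then show "p = pt n (\<lambda>i. crd j i p)" using uj u by (simp add: pt_scale)
  show "crd j j p = 1" unfolding u using uj assms(3) by (simp add: crd_pt)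
qed

lemma chart_at_open:
  assumes "X \<subseteq> proj_points n" "j \<le> n"
  shows "openin (topol (proj_variety n X)) (chart_at n X j)"
proof -
  have "chart_at n X j = X \<inter> nonvan n (Poly_Mapping.single (Poly_Mapping.single j 1) 1)"
    using assms(1) by (auto simp: chart_at_def nonvan_def eval_var simp del: One_nat_def)
  then show ?thesis using nonvan_open[OF homogeneous_var[OF assms(2)]]
    unfolding proj_variety_def fun_space.simps openin_subtopology by (metis Int_commute)
qed

lemma crd_regular:
  assumes X: "X \<subseteq> proj_points n" and ij: "i \<le> n" "j \<le> n"
  shows "crd j i \<in> regular (proj_variety n X) (chart_at n X j)"
proof -
  let ?x = "\<lambda>i. Poly_Mapping.single (Poly_Mapping.single i 1) 1 :: 'a mpoly"
  have o: "openin (subtopology (zariski n) X) (chart_at n X j)"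
    using chart_at_open[OF X ij(2)] by (simp add: proj_variety_def)
  have "\<forall>x\<in>chart_at n X j. \<forall>v\<in>x. eval_mpoly (?x j) v \<noteq> 0 \<and> crd j i x = eval_mpoly (?x i) v / eval_mpoly (?x j) v"
  proof (intro ballI)
    fix x v assume x: "x \<in> chart_at n X j" and v: "v \<in> x"
    obtain u where u: "x = pt n u" using X x proj_points_pt unfolding chart_at_def by blast
    obtain c where c: "c \<noteq> 0" "v = vec (n + 1) (\<lambda>i. c * u i)" using v unfolding u pt_alt by blast
    have "u j \<noteq> 0" using x pt_in_chart[OF ij(2)] u by metis
    then show "eval_mpoly (?x j) v \<noteq> 0 \<and> crd j i x = eval_mpoly (?x i) v / eval_mpoly (?x j) v"
      using c ij by (simp add: eval_var u crd_pt del: One_nat_def)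
  qed
  then show ?thesis
    unfolding proj_variety_def fun_space.simps mem_Collect_eq
    using o homogeneous_var[OF ij(1)] homogeneous_var[OF ij(2)]
    by (intro conjI ballI exI[of _ "chart_at n X j"] exI[of _ 1] exI[of _ "?x i"] exI[of _ "?x j"])
      (simp_all del: One_nat_def)
qed

lemma (in fspace) reg_poly: "f \<in> regular S U \<Longrightarrow> (\<lambda>x. poly p (f x)) \<in> regular S U"
  unfolding poly_altdef by (intro reg_sum reg_mult reg_const reg_power) (auto dest: reg_open)

text \<open>Any two points lie on a rational curve in \<open>X\<close>. Parameters at which all
  coordinates vanish are allowed, since they define no point.\<close>

definition joinable :: "nat \<Rightarrow> 'k::field vec set set \<Rightarrow> bool" where
  "joinable n X \<longleftrightarrow> (\<forall>x\<in>X. \<forall>y\<in>X. \<exists>\<kappa>. (\<forall>t. (\<exists>i\<le>n. poly (\<kappa> i) t \<noteq> 0) \<longrightarrow> pt n (\<lambda>i. poly (\<kappa> i) t) \<in> X) \<and>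
     (\<exists>i\<le>n. poly (\<kappa> i) 0 \<noteq> 0) \<and> (\<exists>i\<le>n. poly (\<kappa> i) 1 \<noteq> 0) \<and>
     pt n (\<lambda>i. poly (\<kappa> i) 0) = x \<and> pt n (\<lambda>i. poly (\<kappa> i) 1) = y)"

lemma joinable_proj_points: "joinable n (proj_points n)"
  unfolding joinable_def
proof (intro ballI)
  fix x y :: "'a vec set" assume "x \<in> proj_points n" "y \<in> proj_points n"
  then obtain u v where "x = pt n u" "\<exists>i\<le>n. u i \<noteq> 0" "y = pt n v" "\<exists>i\<le>n. v i \<noteq> 0"
    using proj_points_pt by metis
  then show "\<exists>\<kappa>. (\<forall>t. (\<exists>i\<le>n. poly (\<kappa> i) t \<noteq> 0) \<longrightarrow> pt n (\<lambda>i. poly (\<kappa> i) t) \<in> proj_points n) \<and>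
     (\<exists>i\<le>n. poly (\<kappa> i) 0 \<noteq> 0) \<and> (\<exists>i\<le>n. poly (\<kappa> i) 1 \<noteq> 0) \<and>
     pt n (\<lambda>i. poly (\<kappa> i) 0) = x \<and> pt n (\<lambda>i. poly (\<kappa> i) 1) = y"
    using proj_points_pt by (intro exI[of _ "\<lambda>i. [:u i, v i - u i:]"]) auto
qed

text \<open>Two curves with a common parameter map an open part of the projective line into the
  product. Open sets meeting the two ends pull back to nonempty open sets of an irreducible space,
  which intersect.\<close>

lemma irreducible_product:
  fixes X :: "'k::field_char_0 vec set set"
  assumes X: "X \<subseteq> proj_points n" "joinable n X" and Y: "Y \<subseteq> proj_points m" "joinable m Y"
  shows "irreducible_top (topol (product_space (proj_variety n X) (proj_variety m Y)))"
  unfolding irreducible_top_def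
proof (intro allI impI, elim conjE)
  interpret XY: fspace_pair "proj_variety n X" "proj_variety m Y"
    using fspace_proj_variety[OF X(1)] fspace_proj_variety[OF Y(1)] by (simp add: fspace_pair_def)
  define L where "L = (proj_space 1 :: ('k vec set, 'k) fun_space)"
  interpret L: fspace L unfolding L_def proj_space_def by (rule fspace_proj_variety) simp
  fix U V assume UV: "openin (topol (product_space (proj_variety n X) (proj_variety m Y))) U"
     "openin (topol (product_space (proj_variety n X) (proj_variety m Y))) V" "U \<noteq> {}" "V \<noteq> {}"
  have sub: "U \<subseteq> X \<times> Y" "V \<subseteq> X \<times> Y"
    using openin_subset[OF UV(1)] openin_subset[OF UV(2)] X Y
    by (simp_all add: XY.topol_product XY.topspace_product topspace_proj_variety)
  obtain x0 y0 x1 y1 where z: "(x0, y0) \<in> U" "(x1, y1) \<in> V" using UV by fast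
  have mem: "x0 \<in> X" "x1 \<in> X" "y0 \<in> Y" "y1 \<in> Y" using z sub by auto
  from bspec[OF bspec[OF X(2)[unfolded joinable_def] mem(1)] mem(2)]
  obtain \<kappa> where \<kappa>: "\<forall>t. (\<exists>i\<le>n. poly (\<kappa> i) t \<noteq> 0) \<longrightarrow> pt n (\<lambda>i. poly (\<kappa> i) t) \<in> X"
     "\<exists>i\<le>n. poly (\<kappa> i) 0 \<noteq> 0" "\<exists>i\<le>n. poly (\<kappa> i) 1 \<noteq> 0" "pt n (\<lambda>i. poly (\<kappa> i) 0) = x0" "pt n (\<lambda>i. poly (\<kappa> i) 1) = x1"
    by - (erule exE, (erule conjE)+, rule that)
  from bspec[OF bspec[OF Y(2)[unfolded joinable_def] mem(3)] mem(4)]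
  obtain \<nu> where \<nu>: "\<forall>t. (\<exists>i\<le>m. poly (\<nu> i) t \<noteq> 0) \<longrightarrow> pt m (\<lambda>i. poly (\<nu> i) t) \<in> Y"
     "\<exists>i\<le>m. poly (\<nu> i) 0 \<noteq> 0" "\<exists>i\<le>m. poly (\<nu> i) 1 \<noteq> 0" "pt m (\<lambda>i. poly (\<nu> i) 0) = y0" "pt m (\<lambda>i. poly (\<nu> i) 1) = y1"
    by - (erule exE, (erule conjE)+, rule that)
  define C where "C = chart_at 1 (proj_points 1 :: 'k vec set set) 0"
  have T: "(\<lambda>p. poly a (crd 0 1 p)) \<in> regular L C" for a
    unfolding L_def proj_space_def C_def
    by (rule fspace.reg_poly[OF fspace_proj_variety crd_regular]) simp_all
  \<comment> \<open>The points of the affine line at which both curves have a nonzero coordinate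
    vector.\<close>
  define D where "D = {p \<in> C. (\<exists>i\<le>n. poly (\<kappa> i) (crd 0 1 p) \<noteq> 0)} \<inter> {p \<in> C. (\<exists>i\<le>m. poly (\<nu> i) (crd 0 1 p) \<noteq> 0)}"
  have un: "openin (topol L) {p \<in> C. (\<exists>i\<le>k. poly (a i) (crd 0 1 p) \<noteq> 0)}" for k :: nat and a
  proof -
    have "{p \<in> C. (\<exists>i\<le>k. poly (a i) (crd 0 1 p) \<noteq> 0)} = (\<Union>i\<in>{..k}. {p \<in> C. poly (a i) (crd 0 1 p) \<noteq> 0})" by auto
    then show ?thesis using L.reg_nonzero[OF T] by (simp only:) (rule openin_Union, blast)
  qed
  have D: "openin (topol L) D" unfolding D_def by (rule openin_Int[OF un un])
  define S where "S = open_subspace L D"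
  interpret S: fspace S unfolding S_def by (rule L.fspace_open_subspace[OF D])
  have topS: "topspace (topol S) = D" using openin_subset[OF D] by (auto simp: S_def open_subspace_def)
  have TS: "(\<lambda>p. poly a (crd 0 1 p)) \<in> regular S (topspace (topol S))" for a
    unfolding topS using L.reg_subset[OF T D] D by (auto simp: S_def open_subspace_def openin_open_subtopology D_def)
  have "morphism S (proj_variety n X) (\<lambda>p. pt n (\<lambda>i. poly (\<kappa> i) (crd 0 1 p)))"
    by (rule S.morphism_to_proj[OF X(1) TS]) (use \<kappa>(1) in \<open>auto simp: topS D_def\<close>)
  moreover have "morphism S (proj_variety m Y) (\<lambda>p. pt m (\<lambda>i. poly (\<nu> i) (crd 0 1 p)))"
    by (rule S.morphism_to_proj[OF Y(1) TS]) (use \<nu>(1) in \<open>auto simp: topS D_def\<close>)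
  ultimately have mor: "morphism S (product_space (proj_variety n X) (proj_variety m Y))
     (\<lambda>p. (pt n (\<lambda>i. poly (\<kappa> i) (crd 0 1 p)), pt m (\<lambda>i. poly (\<nu> i) (crd 0 1 p))))" (is "morphism _ _ ?F")
    by (rule XY.morphism_pair[OF S.fspace_axioms])
  have pre: "openin (topol L) {p \<in> D. ?F p \<in> W}"
    if "openin (topol (product_space (proj_variety n X) (proj_variety m Y))) W" for W
  proof -
    have "openin (topol S) {p \<in> topspace (topol S). ?F p \<in> W}"
      using mor that unfolding morphism_def continuous_map_def by blast
    then show ?thesis unfolding topS using D by (simp add: S_def open_subspace_def openin_open_subtopology)
  qed
  define e where "e t = pt 1 (\<lambda>i. if i = 0 then 1 else t)" for t :: 'k
  have eC: "e t \<in> C" "crd 0 1 (e t) = t" for t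
  proof -
    have "e t \<in> proj_points 1" unfolding e_def proj_points_pt by (rule exI, rule conjI[OF refl], rule exI[of _ 0]) simp
    then show "e t \<in> C" unfolding C_def e_def by (subst pt_in_chart) auto
    show "crd 0 1 (e t) = t" unfolding e_def by (simp add: crd_pt)
  qed
  have "e 0 \<in> {p \<in> D. ?F p \<in> U}" "e 1 \<in> {p \<in> D. ?F p \<in> V}"
    using eC \<kappa> \<nu> z by (simp_all add: D_def)
  then have "{p \<in> D. ?F p \<in> U} \<inter> {p \<in> D. ?F p \<in> V} \<noteq> {}"
    using irreducible_proj_space[of 1, where ?'k = 'k] pre[OF UV(1)] pre[OF UV(2)]
    unfolding irreducible_top_def L_def by blast
  then show "U \<inter> V \<noteq> {}" by blast
qed

section \<open>The equivariant chart\<close>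

lemma (in fspace) reg_polyfun:
  assumes "F \<in> polyfun" "openin (topol S) U" "\<And>x. (\<lambda>p. h p x) \<in> regular S U"
  shows "(\<lambda>p. F (h p)) \<in> regular S U"
  using assms(1) by induction (auto intro: reg_const reg_add reg_mult assms(2,3))

section \<open>Determinants and inverses of matrices given as functions\<close>

definition mdet :: "nat \<Rightarrow> (nat \<Rightarrow> nat \<Rightarrow> 'k::field) \<Rightarrow> 'k" where
  "mdet d M = det (mat d d (\<lambda>(i, j). M i j))"

definition madj :: "nat \<Rightarrow> (nat \<Rightarrow> nat \<Rightarrow> 'k::field) \<Rightarrow> nat \<Rightarrow> nat \<Rightarrow> 'k" where
  "madj d M i j = adj_mat (mat d d (\<lambda>(i, j). M i j)) $$ (i, j)"

text \<open>The inverse through the adjugate: polynomials in the entries over the determinant, so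
  regularity of the entries passes to the inverse.\<close>

definition minv :: "nat \<Rightarrow> (nat \<Rightarrow> nat \<Rightarrow> 'k::field) \<Rightarrow> nat \<Rightarrow> nat \<Rightarrow> 'k" where
  "minv d M i j = madj d M i j / mdet d M"

lemma polyfun_det:
  assumes "\<And>i j. (\<lambda>w. M w i j) \<in> polyfun"
  shows "(\<lambda>w. mdet d (M w)) \<in> polyfun"
proof -
  have "(\<lambda>w. \<Sum>p\<in>{p. p permutes {0..<d}}. signof p * (\<Prod>i\<in>{0..<d}. M w i (p i))) \<in> polyfun"
    by (intro polyfun_sum polyfun.mult polyfun.const polyfun_prod assms)
  moreover have "mdet d (M w) = (\<Sum>p\<in>{p. p permutes {0..<d}}. signof p * (\<Prod>i\<in>{0..<d}. M w i (p i)))" for w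
  proof -
    have "(\<Prod>i = 0..<d. mat d d (\<lambda>(i, j). M w i j) $$ (i, p i)) = (\<Prod>i\<in>{0..<d}. M w i (p i))"
      if "p permutes {0..<d}" for p
      by (rule prod.cong[OF refl]) (use permutes_in_image[OF that] in auto)
    then show ?thesis unfolding mdet_def det_def by simp
  qed
  ultimately show ?thesis by simp
qed

lemma polyfun_adj:
  assumes "\<And>i j. (\<lambda>w. M w i j) \<in> polyfun" and ij: "i < d" "j < d"
  shows "(\<lambda>w. madj d (M w) i j) \<in> polyfun"
proof -
  have "madj d (M w) i j = (-1) ^ (j + i) * mdet (d - 1) (\<lambda>a b. M w (insert_index j a) (insert_index i b))" for w
  proof -
    have "mat_delete (mat d d (\<lambda>(i, j). M w i j)) j i
       = mat (d - 1) (d - 1) (\<lambda>(a, b). M w (insert_index j a) (insert_index i b))"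
      using ij by (intro eq_matI) (auto simp: mat_delete_index[symmetric] mat_delete_def insert_index_def)
    then show ?thesis using ij unfolding madj_def adj_mat_def mdet_def by (simp add: cofactor_def)
  qed
  then show ?thesis
    by (simp only:) (intro polyfun.mult polyfun.const polyfun_det assms)
qed

lemma mat_sum:
  assumes "i < d" "l < d"
  shows "(mat d d (\<lambda>(i, j). M i j) * mat d d (\<lambda>(i, j). M' i j)) $$ (i, l) = (\<Sum>j<d. M i j * M' j l)"
  using assms by (simp add: times_mat_def scalar_prod_def atLeast0LessThan)

lemma madj_mat: "mat d d (\<lambda>(i, j). madj d M i j) = adj_mat (mat d d (\<lambda>(i, j). M i j))"
  by (rule eq_matI) (auto simp: madj_def adj_mat_def)

lemma minv_right:
  assumes "mdet d M \<noteq> 0" "i < d" "l < d"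
  shows "(\<Sum>j<d. M i j * minv d M j l) = (if i = l then 1 else 0)"
proof -
  have "(\<Sum>j<d. M i j * madj d M j l) = (det (mat d d (\<lambda>(i, j). M i j)) \<cdot>\<^sub>m 1\<^sub>m d) $$ (i, l)"
    unfolding mat_sum[OF assms(2,3), symmetric] madj_mat
    by (subst adj_mat(2)[of _ d]) auto
  then have "(\<Sum>j<d. M i j * madj d M j l) = (if i = l then mdet d M else 0)"
    using assms(2,3) by (simp add: mdet_def)
  then show ?thesis using assms(1) by (simp add: minv_def flip: sum_divide_distrib)
qed

lemma minv_left:
  assumes "mdet d M \<noteq> 0" "i < d" "l < d"
  shows "(\<Sum>j<d. minv d M i j * M j l) = (if i = l then 1 else 0)"
proof -
  have "(\<Sum>j<d. madj d M i j * M j l) = (det (mat d d (\<lambda>(i, j). M i j)) \<cdot>\<^sub>m 1\<^sub>m d) $$ (i, l)"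
    unfolding mat_sum[OF assms(2,3), symmetric] madj_mat
    by (subst adj_mat(3)[of _ d]) auto
  then have "(\<Sum>j<d. madj d M i j * M j l) = (if i = l then mdet d M else 0)"
    using assms(2,3) by (simp add: mdet_def)
  then show ?thesis using assms(1) by (simp add: minv_def sum_divide_distrib[symmetric])
qed

lemma mv_minv_right:
  assumes "mdet d M \<noteq> 0" "i < d"
  shows "mv d M (mv d (minv d M) x) i = x i"
proof -
  have "mv d M (mv d (minv d M) x) i = (\<Sum>l<d. (if i = l then 1 else 0) * x l)"
    unfolding mv_mv by (rule sum.cong[OF refl]) (simp add: minv_right assms)
  also have "\<dots> = (\<Sum>l<d. if i = l then x l else 0)" by (rule sum.cong) auto
  also have "\<dots> = x i" using assms(2) by simp
  finally show ?thesis .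
qed

lemma mv_minv_left:
  assumes "mdet d M \<noteq> 0" "i < d"
  shows "mv d (minv d M) (mv d M x) i = x i"
proof -
  have "mv d (minv d M) (mv d M x) i = (\<Sum>l<d. (if i = l then 1 else 0) * x l)"
    unfolding mv_mv by (rule sum.cong[OF refl]) (simp add: minv_left assms)
  also have "\<dots> = (\<Sum>l<d. if i = l then x l else 0)" by (rule sum.cong) auto
  also have "\<dots> = x i" using assms(2) by simp
  finally show ?thesis .
qed

lemma mdet_nonzeroI:
  assumes "\<And>x. (\<And>i. i < d \<Longrightarrow> mv d M x i = 0) \<Longrightarrow> (\<And>i. i < d \<Longrightarrow> x i = 0)"
  shows "mdet d M \<noteq> 0"
proof
  let ?M = "mat d d (\<lambda>(i, j). M i j)"
  assume "mdet d M = 0"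
  then obtain v where v: "v \<in> carrier_vec d" "v \<noteq> 0\<^sub>v d" "?M *\<^sub>v v = 0\<^sub>v d"
    unfolding mdet_def using det_0_iff_vec_prod_zero[of ?M d] by auto
  have "mv d M (\<lambda>i. v $ i) i = 0" if i: "i < d" for i
  proof -
    have "(?M *\<^sub>v v) $ i = 0" using v(3) i by simp
    then show ?thesis using i v(1) by (simp add: mv_def scalar_prod_def atLeast0LessThan)
  qed
  then have "v = 0\<^sub>v d" using assms[of "\<lambda>i. v $ i"] v(1) by (intro eq_vecI) auto
  then show False using v(2) by blast
qed

lemma (in fspace) reg_mdet:
  assumes U: "openin (topol S) U" and M: "\<And>i j. i < d \<Longrightarrow> j < d \<Longrightarrow> (\<lambda>p. M p i j) \<in> regular S U"
  shows "(\<lambda>p. mdet d (M p)) \<in> regular S U"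
    and "i < d \<Longrightarrow> j < d \<Longrightarrow> (\<And>p. p \<in> U \<Longrightarrow> mdet d (M p) \<noteq> 0) \<Longrightarrow> (\<lambda>p. minv d (M p) i j) \<in> regular S U"
proof -
  \<comment> \<open>\<open>reg_polyfun\<close> asks for regularity of every variable, so entries out
    of range are replaced by zero.\<close>
  let ?h = "\<lambda>p (k :: nat \<times> nat). if fst k < d \<and> snd k < d then M p (fst k) (snd k) else 0"
  have h: "(\<lambda>p. ?h p k) \<in> regular S U" for k
    using M reg_const[OF U] by (cases "fst k < d \<and> snd k < d") auto
  have eq: "mat d d (\<lambda>(i, j). M p i j) = mat d d (\<lambda>(i, j). ?h p (i, j))" for p
    by (rule eq_matI) auto
  have "(\<lambda>w. mdet d (\<lambda>i j. w (i, j))) \<in> polyfun"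
    by (rule polyfun_det) (rule polyfun.var)
  from reg_polyfun[where h = ?h, OF this U h] show 1: "(\<lambda>p. mdet d (M p)) \<in> regular S U"
    unfolding mdet_def eq by simp
  assume ij: "i < d" "j < d" and nz: "\<And>p. p \<in> U \<Longrightarrow> mdet d (M p) \<noteq> 0"
  have "(\<lambda>w. madj d (\<lambda>i j. w (i, j)) i j) \<in> polyfun"
    by (rule polyfun_adj[OF _ ij]) (rule polyfun.var)
  from reg_polyfun[where h = ?h, OF this U h] have "(\<lambda>p. madj d (M p) i j) \<in> regular S U"
    unfolding madj_def eq by simp
  then show "(\<lambda>p. minv d (M p) i j) \<in> regular S U"
    unfolding minv_def by (rule reg_divide[OF _ 1 nz])
qed

lemma (in fspace) reg_mv:
  assumes U: "openin (topol S) U" and "\<And>j. j < d \<Longrightarrow> (\<lambda>p. M p i j) \<in> regular S U" "\<And>j. j < d \<Longrightarrow> (\<lambda>p. x p j) \<in> regular S U"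
  shows "(\<lambda>p. mv d (M p) (x p) i) \<in> regular S U"
  unfolding mv_def by (intro reg_sum U reg_mult assms) auto

lemma (in fspace) reg_bl:
  assumes U: "openin (topol S) U" and "\<And>j. j < d \<Longrightarrow> (\<lambda>p. x p j) \<in> regular S U" "\<And>j. j < d \<Longrightarrow> (\<lambda>p. y p j) \<in> regular S U"
  shows "(\<lambda>p. bl d Q (x p) (y p)) \<in> regular S U"
  unfolding bl_def by (intro reg_sum U reg_mult reg_const assms) auto

lemma mdet_scale: "mdet d (\<lambda>i j. c * M i j) = c ^ d * mdet d M"
proof -
  have "mat d d (\<lambda>(i, j). c * M i j) = c \<cdot>\<^sub>m mat d d (\<lambda>(i, j). M i j)" by (rule eq_matI) auto
  then show ?thesis by (simp add: mdet_def)
qed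

lemma mv_lin: "mv d A (\<lambda>i. s * x i + t * y i) i = s * mv d A x i + t * mv d A y i"
  unfolding mv_def sum_distrib_left sum.distrib[symmetric] by (simp add: algebra_simps)

text \<open>The equivariant rational map \<open>Z\<close> is defined at all translates of the base point \<open>ws\<close>, where
  \<open>\<psi>\<close> isolates the coordinate of the unit. The forms \<open>\<theta> j\<close> distinguish the points of the orbit of \<open>u0\<close>; their degree \<open>e\<close> is
  even because \<open>a\<close> is multiplicative only up to sign. A point \<open>w\<close> of \<open>W\<close> is a function on the whole type
  of group elements, which is kept equal to \<open>ws\<close> outside the carrier.\<close>

locale stable_chart = isometric_lift G d Q a + quadric d Q
  for G (structure) and d :: nat and Q :: "nat \<Rightarrow> nat \<Rightarrow> 'k::field_char_0"
    and a :: "'g \<Rightarrow> nat \<Rightarrow> nat \<Rightarrow> 'k" +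
  fixes Z :: "nat \<Rightarrow> ('g, 'k) pfun" and k0 :: nat and ws :: "'g \<Rightarrow> 'k" and \<psi> :: "'k poly"
    and \<theta> :: "'g \<Rightarrow> (nat \<Rightarrow> 'k) \<Rightarrow> 'k" and e :: nat and en :: "nat \<Rightarrow> 'g" and u0 :: "nat \<Rightarrow> 'k"
  assumes k0: "k0 < d"
    and Z_q: "qf d (\<lambda>i j. pconst (Q i j)) Z = 0"
    and Z_inv: "par_inv (carrier G) Z"
    and ws_Z: "g \<in> carrier G \<Longrightarrow> ev (Z k0) (\<lambda>x. ws (tr g x)) \<noteq> 0"
    and ws_\<psi>: "g \<in> carrier G \<Longrightarrow> poly \<psi> (ws g) = (if g = \<one> then 1 else 0)"
    and \<theta>_poly: "j \<in> carrier G \<Longrightarrow> \<theta> j \<in> polyfun"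
    and \<theta>_hom: "j \<in> carrier G \<Longrightarrow> \<theta> j (\<lambda>i. c * u i) = c ^ e * \<theta> j u"
    and \<theta>_cong: "j \<in> carrier G \<Longrightarrow> (\<And>i. i < d \<Longrightarrow> u i = u' i) \<Longrightarrow> \<theta> j u = \<theta> j u'"
    and e_even: "even e"
    and \<theta>_u0: "j \<in> carrier G \<Longrightarrow> h \<in> carrier G \<Longrightarrow> \<theta> j (mv d (a (inv h)) u0) \<noteq> 0 \<longleftrightarrow> h = j"
    and en: "bij_betw en {..<card (carrier G)} (carrier G)"
    and u0: "\<exists>i<d. u0 i \<noteq> 0" "q u0 = 0"
begin

abbreviation "N \<equiv> card (carrier G)"

definition idx :: "'g \<Rightarrow> nat" where "idx = inv_into {..<N} en"

lemma en_in: "i < N \<Longrightarrow> en i \<in> carrier G"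
  using en by (auto simp: bij_betw_def)

lemma idx_en: "i < N \<Longrightarrow> idx (en i) = i"
  unfolding idx_def using en by (simp add: bij_betw_def)

lemma en_idx: "g \<in> carrier G \<Longrightarrow> en (idx g) = g" and idx_less: "g \<in> carrier G \<Longrightarrow> idx g < N"
  unfolding idx_def using en f_inv_into_f[of g en "{..<N}"] inv_into_into[of g en "{..<N}"]
  by (auto simp: bij_betw_def)

text \<open>Translation reverses the order of composition (\<open>sh_sh\<close>); therefore
  equivariance is stated as \<open>a g\<close> applied to the value at \<open>sh g w\<close>,
  compared with the value at \<open>w\<close>.\<close>

definition sh :: "'g \<Rightarrow> ('g \<Rightarrow> 'k) \<Rightarrow> 'g \<Rightarrow> 'k" where "sh g w x = w (tr g x)"

lemma sh_eq: "sh g w = (\<lambda>x. w (tr g x))"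
  by (simp add: sh_def fun_eq_iff)

lemma sh_sh: "g \<in> carrier G \<Longrightarrow> h \<in> carrier G \<Longrightarrow> sh h (sh g w) = sh (g \<otimes> h) w"
  by (simp add: sh_def fun_eq_iff tr_tr)

lemma sh_one: "sh \<one> w = w"
  by (simp add: sh_def fun_eq_iff tr_one)

definition Y :: "('g \<Rightarrow> 'k) \<Rightarrow> nat \<Rightarrow> 'k" where "Y w i = ev (Z i) w"

lemma q_Y: "q (Y w) = 0"
proof -
  have "ev (qf d (\<lambda>i j. pconst (Q i j)) Z) w = 0" unfolding Z_q by simp
  then show ?thesis by (simp add: qf_def Y_def)
qed

lemma Y_parallel:
  assumes "g \<in> carrier G" "i < d" "j < d"
  shows "mv d (a g) (Y (sh g w)) i * Y w j = mv d (a g) (Y (sh g w)) j * Y w i"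
proof -
  have *: "ev (pact g Z i) w = mv d (a g) (Y (sh g w)) i" for i
    by (simp add: pact_def mv_def Y_def sh_eq)
  have "pact g Z i * Z j = pact g Z j * Z i" using Z_inv assms unfolding par_inv_def by blast
  from arg_cong[OF this, of "\<lambda>f. ev f w"] show ?thesis unfolding ev_simps * Y_def .
qed

text \<open>One and the same coordinate \<open>k0\<close> of \<open>Z\<close> is nonzero at all
  translates. This makes the set stable under \<open>G\<close> and gives \<open>Lam\<close> a
  nonzero denominator throughout an orbit.\<close>

definition \<Omega> :: "('g \<Rightarrow> 'k) set" where "\<Omega> = {w. \<forall>g\<in>carrier G. Y (sh g w) k0 \<noteq> 0}"

lemma sh_\<Omega>: "w \<in> \<Omega> \<Longrightarrow> g \<in> carrier G \<Longrightarrow> sh g w \<in> \<Omega>"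
  unfolding \<Omega>_def by (simp add: sh_sh)

lemma \<Omega>_Y: "w \<in> \<Omega> \<Longrightarrow> Y w k0 \<noteq> 0"
proof -
  assume "w \<in> \<Omega>"
  then have "Y (sh \<one> w) k0 \<noteq> 0" unfolding \<Omega>_def using one_closed by blast
  then show ?thesis by (simp add: sh_one)
qed

lemma ws_\<Omega>: "ws \<in> \<Omega>"
  unfolding \<Omega>_def Y_def sh_eq by (intro CollectI ballI) (rule ws_Z)

text \<open>The scalar by which \<open>Z\<close> fails to be equivariant on the affine cone.\<close>

definition Lam :: "'g \<Rightarrow> ('g \<Rightarrow> 'k) \<Rightarrow> 'k" where
  "Lam g w = mv d (a g) (Y (sh g w)) k0 / Y w k0"

lemma Y_equiv:
  assumes w: "w \<in> \<Omega>" and g: "g \<in> carrier G"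
  shows "Lam g w \<noteq> 0" "\<And>i. i < d \<Longrightarrow> mv d (a g) (Y (sh g w)) i = Lam g w * Y w i"
proof -
  show *: "mv d (a g) (Y (sh g w)) i = Lam g w * Y w i" if "i < d" for i
    using Y_parallel[OF g that k0, of w] \<Omega>_Y[OF w] by (simp add: Lam_def field_simps)
  have "\<exists>i<d. Y (sh g w) i \<noteq> 0" using \<Omega>_Y[OF sh_\<Omega>[OF w g]] k0 by blast
  then show "Lam g w \<noteq> 0" using a_nonzero[OF g] * by fastforce
qed

lemma Lam_one: "w \<in> \<Omega> \<Longrightarrow> Lam \<one> w = 1"
  unfolding Lam_def using \<Omega>_Y k0 by (simp add: mv_one sh_one)

text \<open>The defect of \<open>Lam\<close> is exactly the sign of the lifts, because both arise
  from applying \<open>a g\<close> and \<open>a h\<close> to the same vector.\<close>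

lemma Lam_mult:
  assumes w: "w \<in> \<Omega>" and g: "g \<in> carrier G" and h: "h \<in> carrier G"
  obtains \<epsilon> where "\<epsilon> = 1 \<or> \<epsilon> = -1" "Lam (g \<otimes> h) w = \<epsilon> * Lam g w * Lam h (sh g w)"
    "\<And>x i. i < d \<Longrightarrow> mv d (a g) (mv d (a h) x) i = \<epsilon> * mv d (a (g \<otimes> h)) x i"
proof -
  obtain \<epsilon> where e: "\<epsilon> = 1 \<or> \<epsilon> = -1" "\<And>x i. i < d \<Longrightarrow> mv d (a g) (mv d (a h) x) i = \<epsilon> * mv d (a (g \<otimes> h)) x i"
    using a_mult_mv[OF g h] by blast
  have "mv d (a g) (mv d (a h) (Y (sh h (sh g w)))) k0 = mv d (a g) (\<lambda>i. Lam h (sh g w) * Y (sh g w) i) k0"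
    by (rule fun_cong[OF mv_cong]) (rule Y_equiv(2)[OF sh_\<Omega>[OF w g] h])
  also have "\<dots> = Lam h (sh g w) * (Lam g w * Y w k0)"
    unfolding mv_scale Y_equiv(2)[OF w g k0] ..
  finally have "\<epsilon> * (Lam (g \<otimes> h) w * Y w k0) = Lam h (sh g w) * (Lam g w * Y w k0)"
    unfolding e(2)[OF k0] sh_sh[OF g h] Y_equiv(2)[OF w m_closed[OF g h] k0] .
  then have "\<epsilon> * Lam (g \<otimes> h) w = Lam h (sh g w) * Lam g w"
    using \<Omega>_Y[OF w] by (simp add: mult.assoc[symmetric])
  moreover have "Lam (g \<otimes> h) w = \<epsilon> * (\<epsilon> * Lam (g \<otimes> h) w)" using e(1) by auto
  ultimately have "Lam (g \<otimes> h) w = \<epsilon> * Lam g w * Lam h (sh g w)"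
    by (simp add: mult_ac)
  then show thesis using that e by blast
qed

text \<open>The transposition of \<open>0\<close> and \<open>k0\<close>. Column \<open>0\<close> of
  the frame is \<open>Z(w)\<close>, which is nonzero in row \<open>k0\<close>, so the other columns
  specialise to the basis vectors other than number \<open>k0\<close>.\<close>

definition \<tau> :: "nat \<Rightarrow> nat" where "\<tau> j = (if j = 0 then k0 else if j = k0 then 0 else j)"

text \<open>The columns of \<open>C w\<close> form an equivariant frame: the first one is \<open>Z(w)\<close>, the others are averages
  over \<open>G\<close> that specialise to basis vectors at \<open>ws\<close>.\<close>

definition C :: "('g \<Rightarrow> 'k) \<Rightarrow> nat \<Rightarrow> nat \<Rightarrow> 'k" where
  "C w i j = (if j = 0 then Y w i else \<Sum>h\<in>carrier G. inverse (Lam h w) * poly \<psi> (w h) * a h i (\<tau> j))"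

lemma tr_in: "g \<in> carrier G \<Longrightarrow> x \<in> carrier G \<Longrightarrow> tr g x = g \<otimes> x"
  by (simp add: tr_def)

lemma \<tau>_less: "j < d \<Longrightarrow> \<tau> j < d"
  using k0 d3 by (auto simp: \<tau>_def)

text \<open>For an averaged column the sum is reindexed by \<open>h \<mapsto> g \<otimes> h\<close>;
  the sign from the matrices and the sign from \<open>Lam_mult\<close> are the same and
  cancel.\<close>

lemma C_equiv:
  assumes w: "w \<in> \<Omega>" and g: "g \<in> carrier G" and ij: "i < d" "j < d"
  shows "(\<Sum>l<d. a g i l * C (sh g w) l j) = Lam g w * C w i j"
proof (cases "j = 0")
  case True
  then show ?thesis using Y_equiv(2)[OF w g ij(1)] by (simp add: C_def mv_def)
next
  case False
  have bij: "bij_betw (\<lambda>h. g \<otimes> h) (carrier G) (carrier G)"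
    by (rule bij_betw_byWitness[of _ "\<lambda>h. inv g \<otimes> h"]) (use g in \<open>auto simp: m_assoc[symmetric]\<close>)
  have term_eq: "(\<Sum>l<d. a g i l * (inverse (Lam h (sh g w)) * poly \<psi> (sh g w h) * a h l (\<tau> j)))
      = Lam g w * (inverse (Lam (g \<otimes> h) w) * poly \<psi> (w (g \<otimes> h)) * a (g \<otimes> h) i (\<tau> j))"
    if h: "h \<in> carrier G" for h
  proof -
    obtain \<epsilon> where e: "\<epsilon> = 1 \<or> \<epsilon> = -1" "Lam (g \<otimes> h) w = \<epsilon> * Lam g w * Lam h (sh g w)"
      "\<And>x i. i < d \<Longrightarrow> mv d (a g) (mv d (a h) x) i = \<epsilon> * mv d (a (g \<otimes> h)) x i"
      using Lam_mult[OF w g h] by blast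
    have unit: "mv d A (\<lambda>i. if i = \<tau> j then 1 else 0) i = A i (\<tau> j)" for A :: "nat \<Rightarrow> nat \<Rightarrow> 'k" and i
    proof -
      have "mv d A (\<lambda>i. if i = \<tau> j then 1 else 0) i = (\<Sum>l<d. if l = \<tau> j then A i l else 0)"
        unfolding mv_def by (rule sum.cong) auto
      then show ?thesis using \<tau>_less[OF ij(2)] by simp
    qed
    have "(\<Sum>l<d. a g i l * a h l (\<tau> j)) = \<epsilon> * a (g \<otimes> h) i (\<tau> j)"
      using e(3)[OF ij(1), of "\<lambda>i. if i = \<tau> j then 1 else 0"] unfolding unit
      by (simp add: mv_def)
    moreover have "inverse (Lam h (sh g w)) = Lam g w * \<epsilon> * inverse (Lam (g \<otimes> h) w)"
      unfolding e(2) using e(1) Y_equiv(1)[OF w g] Y_equiv(1)[OF sh_\<Omega>[OF w g] h] by (auto simp: field_simps)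
    moreover have "(\<Sum>l<d. a g i l * (inverse (Lam h (sh g w)) * poly \<psi> (sh g w h) * a h l (\<tau> j)))
       = inverse (Lam h (sh g w)) * poly \<psi> (sh g w h) * (\<Sum>l<d. a g i l * a h l (\<tau> j))"
      unfolding sum_distrib_left by (rule sum.cong) (simp_all add: mult_ac)
    moreover have "sh g w h = w (g \<otimes> h)" by (simp add: sh_def tr_in g h)
    ultimately show ?thesis using e(1) by (auto simp: mult_ac)
  qed
  have "(\<Sum>l<d. a g i l * C (sh g w) l j)
      = (\<Sum>h\<in>carrier G. \<Sum>l<d. a g i l * (inverse (Lam h (sh g w)) * poly \<psi> (sh g w h) * a h l (\<tau> j)))"
    using False by (simp add: C_def sum_distrib_left) (rule sum.swap)
  also have "\<dots> = (\<Sum>h\<in>carrier G. Lam g w * (inverse (Lam (g \<otimes> h) w) * poly \<psi> (w (g \<otimes> h)) * a (g \<otimes> h) i (\<tau> j)))"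
    by (rule sum.cong[OF refl]) (rule term_eq)
  also have "\<dots> = (\<Sum>h\<in>carrier G. Lam g w * (inverse (Lam h w) * poly \<psi> (w h) * a h i (\<tau> j)))"
    by (rule sum.reindex_bij_betw[OF bij])
  finally show ?thesis using False by (simp add: C_def sum_distrib_left)
qed

text \<open>At \<open>ws\<close> only the summand of the unit survives, so the columns are
  \<open>Z(ws)\<close> and basis vectors. In a linear relation row \<open>k0\<close> kills the
  coefficient of \<open>Z(ws)\<close>, and the other rows kill the rest.\<close>

lemma C_ws: "mdet d (C ws) \<noteq> 0"
proof (rule mdet_nonzeroI)
  have col: "C ws i j = (if i = \<tau> j then 1 else 0)" if "i < d" "j < d" "j \<noteq> 0" for i j
  proof -
    have "C ws i j = (\<Sum>h\<in>carrier G. if h = \<one> then a \<one> i (\<tau> j) else 0)"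
      unfolding C_def using that(3) by (simp add: ws_\<psi> Lam_one[OF ws_\<Omega>] cong: sum.cong) (rule sum.cong; simp add: ws_\<psi> Lam_one[OF ws_\<Omega>])
    then show ?thesis using fin a_one[OF that(1) \<tau>_less[OF that(2)]] by simp
  qed
  fix x assume x: "\<And>i. i < d \<Longrightarrow> mv d (C ws) x i = 0"
  have d0: "0 < d" using d3 by simp
  have mvx: "mv d (C ws) x i = Y ws i * x 0 + (\<Sum>j\<in>{..<d} - {0}. (if i = \<tau> j then 1 else 0) * x j)" if "i < d" for i
    unfolding mv_def using d0 col[OF that] by (simp add: sum.remove[of "{..<d}" 0] C_def)
  have "k0 \<noteq> \<tau> j" if "j \<noteq> 0" for j using that by (auto simp: \<tau>_def)
  then have "(\<Sum>j\<in>{..<d} - {0}. (if k0 = \<tau> j then 1 else 0) * x j) = 0" by (intro sum.neutral) auto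
  then have x0: "x 0 = 0" using x[OF k0] mvx[OF k0] \<Omega>_Y[OF ws_\<Omega>] by simp
  fix i assume i: "i < d"
  show "x i = 0"
  proof (cases "i = 0")
    case False
    have "\<tau> i = \<tau> j \<longleftrightarrow> j = i" for j by (auto simp: \<tau>_def)
    then have "(\<Sum>j\<in>{..<d} - {0}. (if \<tau> i = \<tau> j then 1 else 0) * x j) = (\<Sum>j\<in>{..<d} - {0}. if j = i then x j else 0)"
      by (intro sum.cong) auto
    then show ?thesis using x[OF \<tau>_less[OF i]] mvx[OF \<tau>_less[OF i]] x0 i False by simp
  qed (simp add: x0)
qed

text \<open>The columns of \<open>M0 u\<close> form an equivariant frame of the regular representation over the quadric;
  dividing by the invariant \<open>I u\<close> makes them homogeneous of degree zero.\<close>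

definition M0 :: "(nat \<Rightarrow> 'k) \<Rightarrow> nat \<Rightarrow> nat \<Rightarrow> 'k" where
  "M0 u i j = (if i < N \<and> j < N then \<theta> (en j) (mv d (a (inv (en i))) u) else 0)"

definition I :: "(nat \<Rightarrow> 'k) \<Rightarrow> 'k" where
  "I u = (\<Sum>h\<in>carrier G. \<theta> \<one> (mv d (a (inv h)) u))"

lemma \<theta>_sign:
  assumes "j \<in> carrier G" "\<epsilon> = 1 \<or> \<epsilon> = -1" shows "\<theta> j (\<lambda>i. \<epsilon> * u i) = \<theta> j u"
  using assms(2) e_even unfolding \<theta>_hom[OF assms(1)] by auto

lemma \<theta>_act:
  assumes j: "j \<in> carrier G" and h: "h \<in> carrier G" and g: "g \<in> carrier G"
  shows "\<theta> j (mv d (a h) (mv d (a g) u)) = \<theta> j (mv d (a (h \<otimes> g)) u)"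
proof -
  obtain \<epsilon> where e: "\<epsilon> = 1 \<or> \<epsilon> = -1" "\<And>x i. i < d \<Longrightarrow> mv d (a h) (mv d (a g) x) i = \<epsilon> * mv d (a (h \<otimes> g)) x i"
    using a_mult_mv[OF h g] by blast
  have "\<theta> j (mv d (a h) (mv d (a g) u)) = \<theta> j (\<lambda>i. \<epsilon> * mv d (a (h \<otimes> g)) u i)"
    by (rule \<theta>_cong[OF j]) (rule e(2))
  then show ?thesis using \<theta>_sign[OF j e(1)] by simp
qed

lemma M0_scale: "i < N \<Longrightarrow> j < N \<Longrightarrow> M0 (\<lambda>i. c * u i) i j = c ^ e * M0 u i j"
proof -
  assume j: "j < N"
  have "mv d A (\<lambda>i. c * u i) = (\<lambda>i. c * mv d A u i)" for A by (rule ext) (rule mv_scale)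
  then show ?thesis unfolding M0_def by (simp add: \<theta>_hom en_in[OF j])
qed

lemma I_scale: "I (\<lambda>i. c * u i) = c ^ e * I u"
proof -
  have "mv d A (\<lambda>i. c * u i) = (\<lambda>i. c * mv d A u i)" for A by (rule ext) (rule mv_scale)
  then show ?thesis unfolding I_def sum_distrib_left by (simp add: \<theta>_hom)
qed

lemma M0_cong: "(\<And>i. i < d \<Longrightarrow> u i = u' i) \<Longrightarrow> M0 u = M0 u'"
  unfolding M0_def using mv_cong[of d u u'] by presburger

lemma I_cong: "(\<And>i. i < d \<Longrightarrow> u i = u' i) \<Longrightarrow> I u = I u'"
  unfolding I_def using mv_cong[of d u u'] by presburger

lemma I_act:
  assumes g: "g \<in> carrier G" shows "I (mv d (a g) u) = I u"
proof -
  have bij: "bij_betw (\<lambda>h. inv g \<otimes> h) (carrier G) (carrier G)"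
    by (rule bij_betw_byWitness[of _ "\<lambda>h. g \<otimes> h"]) (use g in \<open>auto simp: m_assoc[symmetric]\<close>)
  have "I (mv d (a g) u) = (\<Sum>h\<in>carrier G. \<theta> \<one> (mv d (a (inv (inv g \<otimes> h))) u))"
    unfolding I_def by (rule sum.cong[OF refl]) (simp add: \<theta>_act g inv_mult_group)
  also have "\<dots> = I u" unfolding I_def by (rule sum.reindex_bij_betw[OF bij])
  finally show ?thesis .
qed

text \<open>Moving \<open>u\<close> by \<open>g\<close> permutes the rows as left translation does;
  the sign of the lifts disappears in \<open>\<theta>_act\<close>.\<close>

lemma M0_act:
  assumes g: "g \<in> carrier G" and i: "i < N" and j: "j < N"
  shows "M0 (mv d (a g) u) (idx (g \<otimes> en i)) j = M0 u i j"
proof -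
  have gi: "g \<otimes> en i \<in> carrier G" using g en_in[OF i] by simp
  have "inv (g \<otimes> en i) \<otimes> g = inv (en i)"
    using g en_in[OF i] by (simp add: inv_mult_group m_assoc)
  then show ?thesis
    unfolding M0_def en_idx[OF gi] using \<theta>_act[OF en_in[OF j] inv_closed[OF gi] g] i j idx_less[OF gi] by simp
qed

definition wvec :: "('g \<Rightarrow> 'k) \<Rightarrow> nat \<Rightarrow> 'k" where "wvec w i = w (en i)"

text \<open>\<open>Wf u\<close> and \<open>Af u\<close> are the two directions of the no-name
  trivialisation: \<open>A\<close> holds the coordinates of \<open>w\<close> in the frame
  \<open>M0 u\<close> divided by \<open>I u\<close>.\<close>

definition Wf :: "(nat \<Rightarrow> 'k) \<Rightarrow> (nat \<Rightarrow> 'k) \<Rightarrow> 'g \<Rightarrow> 'k" where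
  "Wf u A x = (if x \<in> carrier G then mv N (M0 u) A (idx x) / I u else ws x)"

definition Af :: "(nat \<Rightarrow> 'k) \<Rightarrow> ('g \<Rightarrow> 'k) \<Rightarrow> nat \<Rightarrow> 'k" where
  "Af u w i = I u * mv N (minv N (M0 u)) (wvec w) i"

text \<open>A line through \<open>Z(w)\<close> is a direction modulo \<open>Z(w)\<close>, up to
  scaling: frame coordinate \<open>0\<close> is set to zero and coordinate \<open>1\<close> to one.
  The free coordinates are those from index 2 on, \<open>d - 2\<close> in number.\<close>

definition ct :: "(nat \<Rightarrow> 'k) \<Rightarrow> nat \<Rightarrow> 'k" where
  "ct c j = (if j = 0 then 0 else if j = 1 then 1 else c j)"

definition Vf :: "('g \<Rightarrow> 'k) \<Rightarrow> (nat \<Rightarrow> 'k) \<Rightarrow> nat \<Rightarrow> 'k" where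
  "Vf w c = mv d (C w) (ct c)"

text \<open>The second intersection point of the quadric with the line through \<open>Z(w)\<close> and \<open>Vf w c\<close>.\<close>

definition Xf :: "('g \<Rightarrow> 'k) \<Rightarrow> (nat \<Rightarrow> 'k) \<Rightarrow> nat \<Rightarrow> 'k" where
  "Xf w c i = q (Vf w c) * Y w i + (- 2 * b (Y w) (Vf w c)) * Vf w c i"

text \<open>The coordinates of \<open>u\<close> in the frame \<open>C w\<close>; their ratios to
  coordinate \<open>1\<close> recover the slice coordinates of \<open>ct\<close>.\<close>

definition \<gamma> :: "('g \<Rightarrow> 'k) \<Rightarrow> (nat \<Rightarrow> 'k) \<Rightarrow> nat \<Rightarrow> 'k" where
  "\<gamma> w u = mv d (minv d (C w)) u"

text \<open>Everything by which the map or its inverse divides is nonzero;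
  \<open>b (Y w) (Vf w c)\<close> excludes lines tangent to the quadric at \<open>Z(w)\<close>.
  \<open>dom1\<close> and \<open>dom2\<close> correspond to each other under \<open>fwd\<close> and
  \<open>bwd\<close>.\<close>

definition dom1 :: "('g \<Rightarrow> 'k) \<Rightarrow> (nat \<Rightarrow> 'k) \<Rightarrow> bool" where
  "dom1 w c \<longleftrightarrow> w \<in> \<Omega> \<and> mdet d (C w) \<noteq> 0 \<and> b (Y w) (Vf w c) \<noteq> 0 \<and> I (Xf w c) \<noteq> 0 \<and> mdet N (M0 (Xf w c)) \<noteq> 0"

definition dom2 :: "(nat \<Rightarrow> 'k) \<Rightarrow> (nat \<Rightarrow> 'k) \<Rightarrow> bool" where
  "dom2 u A \<longleftrightarrow> I u \<noteq> 0 \<and> mdet N (M0 u) \<noteq> 0 \<and> Wf u A \<in> \<Omega> \<and> mdet d (C (Wf u A)) \<noteq> 0 \<and>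
     \<gamma> (Wf u A) u 1 \<noteq> 0 \<and> b (Y (Wf u A)) u \<noteq> 0"

lemma C_inverse:
  assumes w: "mdet d (C w) \<noteq> 0" and j: "j < d"
  shows "\<gamma> w (Y w) j = (if j = 0 then 1 else 0)" "\<gamma> w (Vf w c) j = ct c j"
proof -
  have "Y w = mv d (C w) (\<lambda>i. if i = 0 then 1 else 0)"
  proof
    fix i
    have "mv d (C w) (\<lambda>i. if i = 0 then 1 else 0) i = (\<Sum>l<d. if l = 0 then C w i l else 0)"
      unfolding mv_def by (rule sum.cong) auto
    then show "Y w i = mv d (C w) (\<lambda>i. if i = 0 then 1 else 0) i" using d3 by (simp add: C_def)
  qed
  then show "\<gamma> w (Y w) j = (if j = 0 then 1 else 0)"
    unfolding \<gamma>_def using mv_minv_left[OF w j, of "\<lambda>i. if i = 0 then 1 else 0"] by simp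
  show "\<gamma> w (Vf w c) j = ct c j" unfolding \<gamma>_def Vf_def by (rule mv_minv_left[OF w j])
qed

lemma Xf_eq: "Xf w c = (\<lambda>i. q (Vf w c) * Y w i + (- 2 * b (Y w) (Vf w c)) * Vf w c i)"
  by (rule ext) (simp add: Xf_def)

lemma q_Xf: "q (Xf w c) = 0"
  unfolding Xf_eq by (rule isotropic_reflect[OF q_Y])

lemma \<gamma>_Xf:
  assumes "mdet d (C w) \<noteq> 0" "j < d"
  shows "\<gamma> w (Xf w c) j = q (Vf w c) * (if j = 0 then 1 else 0) + (- 2 * b (Y w) (Vf w c)) * ct c j"
  unfolding C_inverse[OF assms, symmetric] unfolding \<gamma>_def Xf_eq by (rule mv_lin)

lemma b_Y_Xf: "b (Y w) (Xf w c) = - 2 * b (Y w) (Vf w c) ^ 2"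
  unfolding Xf_eq bl_add_right bl_scale_right using q_Y[of w] by (simp add: qf_bl power2_eq_square)

lemma Wf_Af:
  assumes "I u \<noteq> 0" "mdet N (M0 u) \<noteq> 0" "\<And>x. x \<notin> carrier G \<Longrightarrow> w x = ws x"
  shows "Wf u (Af u w) = w"
proof
  fix x
  show "Wf u (Af u w) x = w x"
  proof (cases "x \<in> carrier G")
    case True
    have "mv N (M0 u) (Af u w) (idx x) = I u * mv N (M0 u) (mv N (minv N (M0 u)) (wvec w)) (idx x)"
      unfolding Af_def[abs_def] by (rule mv_scale)
    also have "\<dots> = I u * w x"
      using mv_minv_right[OF assms(2) idx_less[OF True]] by (simp add: wvec_def en_idx True)
    finally show ?thesis using True assms(1) by (simp add: Wf_def)
  qed (simp add: Wf_def assms)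
qed

lemma fwd:
  assumes "dom1 w c" "\<And>x. x \<notin> carrier G \<Longrightarrow> w x = ws x"
  shows "dom2 (Xf w c) (Af (Xf w c) w)" "Wf (Xf w c) (Af (Xf w c) w) = w"
    "\<And>j. 2 \<le> j \<Longrightarrow> j < d \<Longrightarrow> \<gamma> w (Xf w c) j / \<gamma> w (Xf w c) 1 = c j"
proof -
  have d1: "1 < d" using d3 by simp
  have g1: "\<gamma> w (Xf w c) 1 = - 2 * b (Y w) (Vf w c)"
    using \<gamma>_Xf[OF _ d1, of w c] assms(1) by (simp add: dom1_def ct_def)
  show W: "Wf (Xf w c) (Af (Xf w c) w) = w"
    by (rule Wf_Af) (use assms in \<open>auto simp: dom1_def\<close>)
  show "dom2 (Xf w c) (Af (Xf w c) w)"
    unfolding dom2_def W g1 b_Y_Xf using assms(1) by (simp add: dom1_def)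
  show "\<gamma> w (Xf w c) j / \<gamma> w (Xf w c) 1 = c j" if "2 \<le> j" "j < d" for j
    unfolding g1 using \<gamma>_Xf[OF _ that(2), of w c] assms(1) that by (simp add: dom1_def ct_def)
qed

text \<open>The constructions depend on the projective point only: \<open>M0\<close> and
  \<open>I\<close> scale by the same power of \<open>s\<close>, so \<open>Wf\<close> does not
  change.\<close>

lemma scale_rep:
  assumes "s \<noteq> 0" "\<forall>i<d. u i = s * u' i"
  shows "I u = s ^ e * I u'" "\<And>i j. M0 u i j = s ^ e * M0 u' i j" "mdet N (M0 u) = (s ^ e) ^ N * mdet N (M0 u')"
    "Wf u A = Wf u' A" "\<gamma> w u j = s * \<gamma> w u' j" "dom2 u A \<longleftrightarrow> dom2 u' A"
proof -
  show I: "I u = s ^ e * I u'" unfolding I_scale[symmetric] by (rule I_cong) (rule assms(2)[rule_format])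
  show M: "M0 u i j = s ^ e * M0 u' i j" for i j
  proof -
    have "M0 u = M0 (\<lambda>i. s * u' i)" by (rule M0_cong) (rule assms(2)[rule_format])
    then show ?thesis using M0_scale[of i j s u'] by (cases "i < N \<and> j < N") (auto simp: M0_def)
  qed
  then have "M0 u = (\<lambda>i j. s ^ e * M0 u' i j)" by (intro ext)
  then show D: "mdet N (M0 u) = (s ^ e) ^ N * mdet N (M0 u')" by (simp only: mdet_scale)
  show W: "Wf u A = Wf u' A"
    using assms(1) by (auto simp: fun_eq_iff Wf_def I M mv_def mult.assoc simp flip: sum_distrib_left)
  show \<gamma>: "\<gamma> w u j = s * \<gamma> w u' j" for w j
    unfolding \<gamma>_def mv_scale[symmetric] by (rule fun_cong[OF mv_cong]) (rule assms(2)[rule_format])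
  have "b y u = s * b y u'" for y
    unfolding bl_scale_right[symmetric] by (rule bl_cong) (auto simp: assms(2)[rule_format])
  then show "dom2 u A \<longleftrightarrow> dom2 u' A"
    unfolding dom2_def I D W \<gamma> using assms(1) by simp
qed

text \<open>Projection of \<open>u\<close> from \<open>Z(w)\<close> gives the slice vector,
  \<open>Vf w c = (u - g0 Z(w)) / g1\<close>, and the line through it and \<open>Z(w)\<close> meets
  the quadric again in \<open>u\<close>.\<close>

lemma bwd:
  assumes u: "q u = 0" and dom: "dom2 u A"
  defines "w \<equiv> Wf u A"
  defines "c \<equiv> \<lambda>j. \<gamma> w u j / \<gamma> w u 1"
  obtains s where "s \<noteq> 0" "\<And>i. i < d \<Longrightarrow> Xf w c i = s * u i" "dom1 w c" "\<And>i. i < N \<Longrightarrow> Af (Xf w c) w i = A i"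
proof -
  have D: "mdet d (C w) \<noteq> 0" "\<gamma> w u 1 \<noteq> 0" "b (Y w) u \<noteq> 0" "w \<in> \<Omega>" "I u \<noteq> 0" "mdet N (M0 u) \<noteq> 0"
    using dom unfolding dom2_def w_def by auto
  define g0 where "g0 = \<gamma> w u 0"
  define g1 where "g1 = \<gamma> w u 1"
  have g1: "g1 \<noteq> 0" using D by (simp add: g1_def)
  have v: "Vf w c i = (1 / g1) * u i + (- g0 / g1) * Y w i" if i: "i < d" for i
  proof -
    have "ct c = (\<lambda>j. (1 / g1) * \<gamma> w u j + (- g0 / g1) * (if j = 0 then 1 else 0))"
      using g1 by (auto simp: fun_eq_iff ct_def c_def g0_def g1_def)
    then have "Vf w c i = (1 / g1) * mv d (C w) (\<gamma> w u) i + (- g0 / g1) * mv d (C w) (\<lambda>j. if j = 0 then 1 else 0) i"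
      unfolding Vf_def by (simp only: mv_lin)
    moreover have "mv d (C w) (\<lambda>j. if j = 0 then 1 else 0) i = Y w i"
    proof -
      have "mv d (C w) (\<lambda>i. if i = 0 then 1 else 0) i = (\<Sum>l<d. if l = 0 then C w i l else 0)"
        unfolding mv_def by (rule sum.cong) auto
      then show ?thesis using d3 by (simp add: C_def)
    qed
    ultimately show ?thesis unfolding \<gamma>_def using mv_minv_right[OF D(1) i] by simp
  qed
  define B where "B = b (Y w) u"
  have bYv: "b (Y w) (Vf w c) = B / g1"
  proof -
    have "b (Y w) (Vf w c) = b (Y w) (\<lambda>i. (1 / g1) * u i + (- g0 / g1) * Y w i)"
      by (rule bl_cong) (simp_all add: v)
    then show ?thesis unfolding bl_add_right bl_scale_right using q_Y[of w] by (simp add: qf_bl B_def)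
  qed
  have qv: "q (Vf w c) = - 2 * g0 * B / g1 ^ 2"
  proof -
    have "q (Vf w c) = q (\<lambda>i. (1 / g1) * u i + (- g0 / g1) * Y w i)"
      by (rule qf_cong) (simp add: v)
    then show ?thesis unfolding q_add qf_scale bl_scale_left u q_Y b_sym[of u] using g1
      by (simp add: B_def power2_eq_square field_simps)
  qed
  \<comment> \<open>When \<open>v\<close>, \<open>bYv\<close> and \<open>qv\<close> are substituted
    into \<open>Xf\<close>, the multiples of \<open>Y w\<close> cancel and this multiple of
    \<open>u\<close> remains.\<close>
  define s where "s = - 2 * B / g1 ^ 2"
  have s: "s \<noteq> 0" using D g1 by (simp add: s_def B_def)
  have X: "Xf w c i = s * u i" if "i < d" for i
    unfolding Xf_def qv bYv v[OF that] s_def using g1 by (simp add: field_simps power2_eq_square)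
  have "\<forall>i<d. Xf w c i = s * u i" using X by blast
  note sc = scale_rep[OF s this]
  have dom1: "dom1 w c"
    unfolding dom1_def sc(1) sc(3) bYv using D s g1 by (simp add: B_def)
  have "Af (Xf w c) w i = A i" if i: "i < N" for i
  proof -
    have Ix: "I (Xf w c) \<noteq> 0" and Mx: "mdet N (M0 (Xf w c)) \<noteq> 0" using dom1 by (simp_all add: dom1_def)
    have wv: "wvec w l = (1 / I (Xf w c)) * mv N (M0 (Xf w c)) A l" if l: "l < N" for l
    proof -
      have "mv N (M0 (Xf w c)) A l = s ^ e * mv N (M0 u) A l"
        unfolding mv_def sc(2) sum_distrib_left by (simp add: mult.assoc)
      moreover have "w (en l) = mv N (M0 u) A l / I u"
        using en_in[OF l] idx_en[OF l] by (simp add: w_def Wf_def)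
      ultimately show ?thesis unfolding wvec_def sc(1) using s D(5) by simp
    qed
    have "Af (Xf w c) w i = I (Xf w c) * mv N (minv N (M0 (Xf w c))) (\<lambda>l. (1 / I (Xf w c)) * mv N (M0 (Xf w c)) A l) i"
      unfolding Af_def using mv_cong[of N "wvec w"] wv by metis
    also have "\<dots> = A i"
      unfolding mv_scale mv_minv_left[OF Mx i] using Ix by simp
    finally show ?thesis .
  qed
  then show thesis using that s X dom1 by blast
qed

lemma bl_isometry:
  assumes "g \<in> carrier G" shows "b (mv d (a g) x) (mv d (a g) y) = b x y"
proof -
  have l: "mv d (a g) (\<lambda>i. x i + 1 * y i) = (\<lambda>i. mv d (a g) x i + 1 * mv d (a g) y i)"
    using mv_lin[of d "a g" 1 x 1 y] by (simp add: fun_eq_iff)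
  have "q (mv d (a g) (\<lambda>i. x i + 1 * y i)) = q (\<lambda>i. x i + 1 * y i)"
    by (rule qf_isometry[OF isom[OF assms]])
  then show ?thesis unfolding l q_add qf_isometry[OF isom[OF assms]] by simp
qed

text \<open>\<open>Xf\<close> is cubic in \<open>Y\<close> and \<open>Vf\<close> together, hence the
  scalar \<open>Lam g w ^ 3\<close>. It enters \<open>M0\<close> and \<open>I\<close> with the same
  exponent, so the coordinates \<open>Af\<close> are invariant and carry the trivial action.\<close>

lemma equivariant:
  assumes g: "g \<in> carrier G" and w: "dom1 w c" and w': "dom1 (sh g w) c"
  obtains s where "s \<noteq> 0" "\<And>i. i < d \<Longrightarrow> mv d (a g) (Xf (sh g w) c) i = s * Xf w c i"
    "\<And>i. i < N \<Longrightarrow> Af (Xf (sh g w) c) (sh g w) i = Af (Xf w c) w i"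
proof -
  let ?w' = "sh g w" and ?L = "Lam g w"
  have \<Omega>: "w \<in> \<Omega>" using w by (simp add: dom1_def)
  note L = Y_equiv[OF \<Omega> g]
  have v: "mv d (a g) (Vf ?w' c) i = ?L * Vf w c i" if i: "i < d" for i
  proof -
    have "mv d (a g) (Vf ?w' c) i = (\<Sum>l<d. (?L * C w i l) * ct c l)"
      unfolding Vf_def mv_mv by (rule sum.cong) (use C_equiv[OF \<Omega> g i] in auto)
    then show ?thesis by (simp add: Vf_def mv_def sum_distrib_left mult.assoc)
  qed
  have bb: "b (Y ?w') (Vf ?w' c) = ?L ^ 2 * b (Y w) (Vf w c)"
  proof -
    have "b (Y ?w') (Vf ?w' c) = b (\<lambda>i. ?L * Y w i) (\<lambda>i. ?L * Vf w c i)"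
      unfolding bl_isometry[OF g, symmetric, of "Y ?w'"] by (rule bl_cong) (simp_all add: L v)
    then show ?thesis by (simp add: bl_scale_left bl_scale_right power2_eq_square)
  qed
  have qq: "q (Vf ?w' c) = ?L ^ 2 * q (Vf w c)"
    unfolding qf_isometry[OF isom[OF g], symmetric, of "Vf ?w' c"] qf_scale[symmetric]
    by (rule qf_cong) (rule v)
  have X: "mv d (a g) (Xf ?w' c) i = ?L ^ 3 * Xf w c i" if i: "i < d" for i
    unfolding Xf_eq mv_lin L(2)[OF i] v[OF i] bb qq by (simp add: power3_eq_cube power2_eq_square algebra_simps)
  have s: "?L ^ 3 \<noteq> 0" using L(1) by simp
  have "Af (Xf ?w' c) ?w' i = Af (Xf w c) w i" if i: "i < N" for i
  proof -
    let ?x = "Xf w c" and ?x' = "Xf ?w' c"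
    let ?A = "Af ?x w"
    have "\<forall>i<d. mv d (a g) ?x' i = ?L ^ 3 * ?x i" using X by blast
    note sc = scale_rep[OF s this]
    have Ix: "I ?x' = (?L ^ 3) ^ e * I ?x" using sc(1) I_act[OF g] by simp
    have nz: "I ?x' \<noteq> 0" "mdet N (M0 ?x') \<noteq> 0" "I ?x \<noteq> 0" "mdet N (M0 ?x) \<noteq> 0"
      using w w' by (simp_all add: dom1_def)
    have wv: "I ?x' * wvec ?w' l = mv N (M0 ?x') ?A l" if l: "l < N" for l
    proof -
      have gl: "g \<otimes> en l \<in> carrier G" using g en_in[OF l] by simp
      have "mv N (M0 ?x') ?A l = (\<Sum>j<N. (?L ^ 3) ^ e * M0 ?x (idx (g \<otimes> en l)) j * ?A j)"
        unfolding mv_def by (rule sum.cong) (simp_all add: M0_act[OF g l, symmetric] sc(2))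
      also have "\<dots> = (?L ^ 3) ^ e * mv N (M0 ?x) ?A (idx (g \<otimes> en l))"
        by (simp add: mv_def sum_distrib_left mult.assoc)
      also have "mv N (M0 ?x) ?A (idx (g \<otimes> en l)) = I ?x * w (g \<otimes> en l)"
        unfolding Af_def[abs_def] mv_scale mv_minv_right[OF nz(4) idx_less[OF gl]] wvec_def en_idx[OF gl] ..
      finally show ?thesis unfolding Ix wvec_def sh_def by (simp add: tr_in g en_in[OF l])
    qed
    have "Af ?x' ?w' i = mv N (minv N (M0 ?x')) (\<lambda>l. I ?x' * wvec ?w' l) i"
      unfolding Af_def mv_scale ..
    also have "\<dots> = mv N (minv N (M0 ?x')) (mv N (M0 ?x') ?A) i"
      by (rule fun_cong[OF mv_cong]) (rule wv)
    also have "\<dots> = ?A i" by (rule mv_minv_left[OF nz(2) i])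
    finally show ?thesis .
  qed
  then show thesis using that s X by blast
qed

lemma I_poly: "I \<in> polyfun"
proof -
  have "(\<lambda>u. \<theta> \<one> (mv d (a (inv h)) u)) \<in> polyfun" for h
    by (rule polyfun_compose[OF \<theta>_poly[OF one_closed]])
      (unfold mv_def, intro polyfun_sum polyfun.mult polyfun.const polyfun.var)
  then show ?thesis unfolding I_def[abs_def] by (rule polyfun_sum)
qed

lemma M0_poly: "(\<lambda>u. M0 u i j) \<in> polyfun"
proof (cases "i < N \<and> j < N")
  case True
  have "(\<lambda>u. \<theta> (en j) (mv d (a (inv (en i))) u)) \<in> polyfun"
    by (rule polyfun_compose[OF \<theta>_poly[OF en_in]])
      (use True in simp, unfold mv_def, intro polyfun_sum polyfun.mult polyfun.const polyfun.var)
  then show ?thesis using True by (simp add: M0_def)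
next
  case False
  then have "(\<lambda>u. M0 u i j) = (\<lambda>_. 0)" by (auto simp: M0_def fun_eq_iff)
  then show ?thesis by (simp add: polyfun.const)
qed

lemma I_u0: "I u0 \<noteq> 0"
proof -
  have "I u0 = (\<Sum>h\<in>carrier G. if h = \<one> then \<theta> \<one> (mv d (a (inv \<one>)) u0) else 0)"
    unfolding I_def by (rule sum.cong) (use \<theta>_u0[OF one_closed] in auto)
  then show ?thesis using fin \<theta>_u0[of \<one> \<one>] by simp
qed

text \<open>Each \<open>\<theta> j\<close> is nonzero at exactly one of the chosen points of the
  orbit, so the matrix is diagonal with nonzero entries.\<close>

lemma M0_u0: "mdet N (M0 u0) \<noteq> 0"
proof (rule mdet_nonzeroI)
  fix x i assume x: "\<And>i. i < N \<Longrightarrow> mv N (M0 u0) x i = 0" and i: "i < N"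
  have "M0 u0 i j \<noteq> 0 \<longleftrightarrow> j = i" if "j < N" for j
  proof -
    have "en i = en j \<longleftrightarrow> j = i" using idx_en[OF i] idx_en[OF that] by metis
    then show ?thesis unfolding M0_def using \<theta>_u0[OF en_in[OF that] en_in[OF i]] i that by simp
  qed
  then have "mv N (M0 u0) x i = (\<Sum>j<N. if j = i then M0 u0 i i * x i else 0)"
    unfolding mv_def by (intro sum.cong) auto
  then show "x i = 0" using x[OF i] i \<open>\<And>j. j < N \<Longrightarrow> M0 u0 i j \<noteq> 0 \<longleftrightarrow> j = i\<close>[OF i] by simp
qed

text \<open>The conditions on \<open>u\<close> alone hold at \<open>u0\<close>, those relative to
  \<open>ws\<close> at a suitable \<open>u1\<close>. Along an isotropic curve from one to the other
  each fails for finitely many parameters only. Taking for \<open>A\<close> the coordinates of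
  \<open>ws\<close> makes \<open>Wf u A\<close> equal to \<open>ws\<close>.\<close>

lemma dom2_nonempty:
  assumes j0: "u0 j0 \<noteq> 0"
  obtains u A where "q u = 0" "u j0 \<noteq> 0" "dom2 u A"
proof -
  have d1: "1 < d" using d3 by simp
  let ?l = "\<lambda>u. \<gamma> ws u 1"
  have Yn: "\<exists>i<d. Y ws i \<noteq> 0" using \<Omega>_Y[OF ws_\<Omega>] k0 by blast
  have lin: "?l (\<lambda>i. v i + c * v' i) = ?l v + c * ?l v'" for v v' c
    unfolding \<gamma>_def using mv_lin[of d _ 1 v c v'] by simp
  have "?l (Vf ws (\<lambda>_. 0)) \<noteq> 0" unfolding C_inverse(2)[OF C_ws d1] by (simp add: ct_def)
  moreover have "?l (Y ws) = 0" using C_inverse(1)[OF C_ws d1] by simp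
  ultimately obtain u1 where u1: "q u1 = 0" "b (Y ws) u1 \<noteq> 0" "?l u1 \<noteq> 0"
    using isotropic_avoid[OF Yn q_Y, of ?l] lin by blast
  have u1n: "\<exists>i<d. u1 i \<noteq> 0"
  proof (rule ccontr)
    assume "\<not> ?thesis"
    then have "b (Y ws) u1 = 0" unfolding b_sym[of "Y ws"] by (intro bl_zero) auto
    then show False using u1(2) by blast
  qed
  obtain \<kappa> \<alpha> \<beta> where \<kappa>: "\<And>t. q (\<lambda>i. poly (\<kappa> i) t) = 0" "\<alpha> \<noteq> 0" "\<beta> \<noteq> 0"
    "\<And>i. poly (\<kappa> i) 0 = \<alpha> * u0 i" "\<And>i. poly (\<kappa> i) 1 = \<beta> * u1 i"
    using isotropic_curve[OF u0 u1n u1(1)] by blast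
  have mp: "(\<lambda>u. mdet N (M0 u)) \<in> polyfun" by (rule polyfun_det) (rule M0_poly)
  have bp: "b (Y ws) \<in> polyfun"
    unfolding bl_def[abs_def] by (intro polyfun_sum polyfun.mult polyfun.const polyfun.var)
  have lp: "?l \<in> polyfun"
    unfolding \<gamma>_def mv_def by (intro polyfun_sum polyfun.mult polyfun.const polyfun.var)
  obtain p1 where p1: "\<And>t. poly p1 t = I (\<lambda>i. poly (\<kappa> i) t)" using polyfun_poly_curve[OF I_poly] by metis
  obtain p2 where p2: "\<And>t. poly p2 t = mdet N (M0 (\<lambda>i. poly (\<kappa> i) t))" using polyfun_poly_curve[OF mp] by metis
  obtain p3 where p3: "\<And>t. poly p3 t = b (Y ws) (\<lambda>i. poly (\<kappa> i) t)" using polyfun_poly_curve[OF bp] by metis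
  obtain p4 where p4: "\<And>t. poly p4 t = \<gamma> ws (\<lambda>i. poly (\<kappa> i) t) 1" using polyfun_poly_curve[OF lp] by metis
  have s0: "\<forall>i<d. poly (\<kappa> i) 0 = \<alpha> * u0 i" and s1: "\<forall>i<d. poly (\<kappa> i) 1 = \<beta> * u1 i"
    using \<kappa>(4,5) by auto
  have "poly p1 0 \<noteq> 0" unfolding p1 scale_rep(1)[OF \<kappa>(2) s0] using I_u0 \<kappa>(2) by simp
  moreover have "poly p2 0 \<noteq> 0" unfolding p2 scale_rep(3)[OF \<kappa>(2) s0] using M0_u0 \<kappa>(2) by simp
  moreover have "poly p3 1 \<noteq> 0" unfolding p3 \<kappa>(5) bl_scale_right using u1(2) \<kappa>(3) by simp
  moreover have "poly p4 1 \<noteq> 0" unfolding p4 scale_rep(5)[OF \<kappa>(3) s1] using u1(3) \<kappa>(3) by simp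
  moreover have "poly (\<kappa> j0) 0 \<noteq> 0" using \<kappa>(2,4) j0 by simp
  ultimately have "p1 * p2 * p3 * p4 * \<kappa> j0 \<noteq> 0" by auto
  then obtain t where t: "poly (p1 * p2 * p3 * p4 * \<kappa> j0) t \<noteq> 0" using poly_all_0_iff_0 by blast
  define u where "u = (\<lambda>i. poly (\<kappa> i) t)"
  have nz: "I u \<noteq> 0" "mdet N (M0 u) \<noteq> 0" "b (Y ws) u \<noteq> 0" "\<gamma> ws u 1 \<noteq> 0" "u j0 \<noteq> 0"
    using t unfolding u_def p1[symmetric] p2[symmetric] p3[symmetric] p4[symmetric] by auto
  have W: "Wf u (Af u ws) = ws" by (rule Wf_Af[OF nz(1,2)]) simp
  show thesis
  proof (rule that)
    show "q u = 0" unfolding u_def by (rule \<kappa>)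
    show "u j0 \<noteq> 0" by (rule nz)
    show "dom2 u (Af u ws)" unfolding dom2_def W using nz ws_\<Omega> C_ws by simp
  qed
qed

end

section \<open>Regularity of the chart and of its inverse\<close>

lemma ev_polyfun: "ev f \<in> polyfun"
  by (rule ev)

context stable_chart
begin

context
  fixes S :: "('p, 'k) fun_space" and U :: "'p set" and w :: "'p \<Rightarrow> 'g \<Rightarrow> 'k"
  assumes S: "fspace S" and U: "openin (topol S) U" and w: "\<And>x. (\<lambda>p. w p x) \<in> regular S U"
begin

interpretation fspace S by (rule S)

lemma Y_regular: "(\<lambda>p. Y (w p) i) \<in> regular S U"
  unfolding Y_def by (rule reg_polyfun[OF ev_polyfun U w])

lemma Y_sh_regular: "(\<lambda>p. Y (sh g (w p)) i) \<in> regular S U"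
  unfolding Y_def sh_eq by (rule reg_polyfun[OF ev_polyfun U w])

lemma \<Omega>_open: "openin (topol S) {p \<in> U. w p \<in> \<Omega>}"
proof -
  have "{p \<in> U. w p \<in> \<Omega>} = {p \<in> U. (\<Prod>g\<in>carrier G. Y (sh g (w p)) k0) \<noteq> 0}"
    using fin by (auto simp: \<Omega>_def)
  then show ?thesis using reg_nonzero[OF reg_prod[OF U Y_sh_regular]] by simp
qed

lemma C_regular:
  assumes \<Omega>: "\<And>p. p \<in> U \<Longrightarrow> w p \<in> \<Omega>"
  shows "(\<lambda>p. C (w p) i j) \<in> regular S U"
proof (cases "j = 0")
  case True
  then show ?thesis using Y_regular by (simp add: C_def)
next
  case False
  have "(\<lambda>p. inverse (Lam h (w p))) \<in> regular S U" if h: "h \<in> carrier G" for h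
  proof (rule reg_inverse)
    show "(\<lambda>p. Lam h (w p)) \<in> regular S U"
      unfolding Lam_def mv_def
      by (intro reg_divide reg_sum U reg_mult reg_const Y_regular Y_sh_regular) (use \<Omega> \<Omega>_Y in auto)
    show "Lam h (w p) \<noteq> 0" if "p \<in> U" for p using Y_equiv(1)[OF \<Omega>[OF that] h] .
  qed
  then show ?thesis using False
    unfolding C_def by simp (intro reg_sum U reg_mult reg_const reg_poly w)
qed

end

text \<open>\<open>C\<close> contains inverses of \<open>Lam\<close> and is regular over
  \<open>\<Omega>\<close> only. After shrinking to \<open>U1\<close> the remaining conditions say
  that a single regular function is nonzero.\<close>

lemma dom1_regular:
  fixes S :: "('p, 'k) fun_space"
  assumes S: "fspace S" and U: "openin (topol S) U" and w: "\<And>x. (\<lambda>p. w p x) \<in> regular S U"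
    and c: "\<forall>j. 2 \<le> j \<and> j < d \<longrightarrow> (\<lambda>p. c p j) \<in> regular S U"
  defines "D \<equiv> {p \<in> U. dom1 (w p) (c p)}"
  shows "openin (topol S) D" "i < d \<Longrightarrow> (\<lambda>p. Xf (w p) (c p) i) \<in> regular S D"
    "k < N \<Longrightarrow> (\<lambda>p. Af (Xf (w p) (c p)) (w p) k) \<in> regular S D"
proof -
  interpret fspace S by (rule S)
  define U1 where "U1 = {p \<in> U. w p \<in> \<Omega>}"
  have U1: "openin (topol S) U1" unfolding U1_def by (rule \<Omega>_open[OF S U w])
  have U1U: "U1 \<subseteq> U" by (auto simp: U1_def)
  have w1: "(\<lambda>p. w p x) \<in> regular S U1" for x by (rule reg_subset[OF w U1 U1U])
  have C1: "(\<lambda>p. C (w p) i j) \<in> regular S U1" for i j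
    by (rule C_regular[OF S U1 w1]) (simp add: U1_def)
  have Y1: "(\<lambda>p. Y (w p) i) \<in> regular S U1" for i by (rule Y_regular[OF S U1 w1])
  have ct1: "(\<lambda>p. ct (c p) j) \<in> regular S U1" if "j < d" for j
    using reg_subset[OF c[rule_format] U1 U1U, of j] that reg_const[OF U1]
    by (cases "j = 0"; cases "j = 1") (simp_all add: ct_def)
  have V1: "(\<lambda>p. Vf (w p) (c p) i) \<in> regular S U1" for i
    unfolding Vf_def by (intro reg_mv U1 C1 ct1)
  have b1: "(\<lambda>p. b (Y (w p)) (Vf (w p) (c p))) \<in> regular S U1"
    by (intro reg_bl U1 Y1 V1)
  have q1: "(\<lambda>p. q (Vf (w p) (c p))) \<in> regular S U1"
    unfolding qf_bl by (intro reg_bl U1 V1)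
  have X1: "(\<lambda>p. Xf (w p) (c p) i) \<in> regular S U1" for i
    unfolding Xf_def by (intro reg_add reg_mult reg_const U1 Y1 V1 b1 q1)
  have I1: "(\<lambda>p. I (Xf (w p) (c p))) \<in> regular S U1"
    by (rule reg_polyfun[OF I_poly U1 X1])
  have M1: "(\<lambda>p. M0 (Xf (w p) (c p)) i j) \<in> regular S U1" for i j
    by (rule reg_polyfun[OF M0_poly U1 X1])
  have dC: "(\<lambda>p. mdet d (C (w p))) \<in> regular S U1" by (rule reg_mdet(1)[OF U1 C1])
  have dM: "(\<lambda>p. mdet N (M0 (Xf (w p) (c p)))) \<in> regular S U1" by (rule reg_mdet(1)[OF U1 M1])
  have "D = {p \<in> U1. mdet d (C (w p)) * b (Y (w p)) (Vf (w p) (c p)) * I (Xf (w p) (c p)) * mdet N (M0 (Xf (w p) (c p))) \<noteq> 0}"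
    by (auto simp: D_def U1_def dom1_def)
  then show D: "openin (topol S) D"
    using reg_nonzero[OF reg_mult[OF reg_mult[OF reg_mult[OF dC b1] I1] dM]] by simp
  have DU: "D \<subseteq> U1" by (auto simp: D_def U1_def dom1_def)
  show "(\<lambda>p. Xf (w p) (c p) i) \<in> regular S D" by (rule reg_subset[OF X1 D DU])
  assume k: "k < N"
  show "(\<lambda>p. Af (Xf (w p) (c p)) (w p) k) \<in> regular S D"
    unfolding Af_def
  proof (intro reg_mult reg_mv D)
    show "(\<lambda>p. I (Xf (w p) (c p))) \<in> regular S D" by (rule reg_subset[OF I1 D DU])
    show "(\<lambda>p. minv N (M0 (Xf (w p) (c p))) k j) \<in> regular S D" if "j < N" for j
      by (rule reg_mdet(2)[OF D reg_subset[OF M1 D DU] k that]) (auto simp: D_def dom1_def)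
    show "(\<lambda>p. wvec (w p) j) \<in> regular S D" for j
      unfolding wvec_def by (rule reg_subset[OF w1 D DU])
  qed
qed

text \<open>The domain shrinks in stages, because each condition becomes the nonvanishing of a
  regular function only where the previous ones hold: \<open>Wf\<close> is regular on
  \<open>U1\<close>, \<open>C\<close> on \<open>U2\<close> and the inverse frame on
  \<open>U3\<close>.\<close>

lemma dom2_regular:
  fixes S :: "('p, 'k) fun_space"
  assumes S: "fspace S" and U: "openin (topol S) U" and u: "\<And>i. (\<lambda>p. u p i) \<in> regular S U"
    and A: "\<forall>j<N. (\<lambda>p. A p j) \<in> regular S U"
  defines "D \<equiv> {p \<in> U. dom2 (u p) (A p)}"
  shows "openin (topol S) D" "(\<lambda>p. Wf (u p) (A p) x) \<in> regular S D"
    "j < d \<Longrightarrow> (\<lambda>p. \<gamma> (Wf (u p) (A p)) (u p) j / \<gamma> (Wf (u p) (A p)) (u p) 1) \<in> regular S D"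
proof -
  interpret fspace S by (rule S)
  have d1: "1 < d" using d3 by simp
  have I0: "(\<lambda>p. I (u p)) \<in> regular S U" by (rule reg_polyfun[OF I_poly U u])
  have M0: "(\<lambda>p. M0 (u p) i j) \<in> regular S U" for i j by (rule reg_polyfun[OF M0_poly U u])
  have dM0: "(\<lambda>p. mdet N (M0 (u p))) \<in> regular S U" by (rule reg_mdet(1)[OF U M0])
  define U1 where "U1 = {p \<in> U. I (u p) * mdet N (M0 (u p)) \<noteq> 0}"
  have U1: "openin (topol S) U1" unfolding U1_def by (rule reg_nonzero[OF reg_mult[OF I0 dM0]])
  have U1U: "U1 \<subseteq> U" by (auto simp: U1_def)
  have W1: "(\<lambda>p. Wf (u p) (A p) x) \<in> regular S U1" for x
  proof (cases "x \<in> carrier G")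
    case True
    have "(\<lambda>p. mv N (M0 (u p)) (A p) (idx x) / I (u p)) \<in> regular S U1"
      by (intro reg_divide reg_mv U1 reg_subset[OF M0 U1 U1U] reg_subset[OF A[rule_format] U1 U1U] reg_subset[OF I0 U1 U1U])
        (auto simp: U1_def)
    then show ?thesis using True by (simp add: Wf_def)
  qed (simp add: Wf_def reg_const[OF U1])
  define U2 where "U2 = {p \<in> U1. Wf (u p) (A p) \<in> \<Omega>}"
  have U2: "openin (topol S) U2" unfolding U2_def by (rule \<Omega>_open[OF S U1 W1])
  have U21: "U2 \<subseteq> U1" by (auto simp: U2_def)
  have U2U: "U2 \<subseteq> U" using U21 U1U by blast
  note W2 = reg_subset[OF W1 U2 U21]
  have C2: "(\<lambda>p. C (Wf (u p) (A p)) i j) \<in> regular S U2" for i j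
    by (rule C_regular[OF S U2 W2]) (simp add: U2_def)
  have Y2: "(\<lambda>p. Y (Wf (u p) (A p)) i) \<in> regular S U2" for i by (rule Y_regular[OF S U2 W2])
  have b2: "(\<lambda>p. b (Y (Wf (u p) (A p))) (u p)) \<in> regular S U2"
    by (intro reg_bl U2 Y2 reg_subset[OF u U2 U2U])
  define U3 where "U3 = {p \<in> U2. mdet d (C (Wf (u p) (A p))) \<noteq> 0}"
  have U3: "openin (topol S) U3" unfolding U3_def by (rule reg_nonzero[OF reg_mdet(1)[OF U2 C2]])
  have U32: "U3 \<subseteq> U2" by (auto simp: U3_def)
  have U3U: "U3 \<subseteq> U" using U32 U2U by blast
  have g3: "(\<lambda>p. \<gamma> (Wf (u p) (A p)) (u p) j) \<in> regular S U3" if "j < d" for j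
    unfolding \<gamma>_def
  proof (intro reg_mv U3 reg_subset[OF u U3 U3U])
    show "(\<lambda>p. minv d (C (Wf (u p) (A p))) j l) \<in> regular S U3" if "l < d" for l
      by (rule reg_mdet(2)[OF U3 reg_subset[OF C2 U3 U32] \<open>j < d\<close> that]) (auto simp: U3_def)
  qed
  have "D = {p \<in> U3. \<gamma> (Wf (u p) (A p)) (u p) 1 * b (Y (Wf (u p) (A p))) (u p) \<noteq> 0}"
    by (auto simp: D_def U3_def U2_def U1_def dom2_def)
  then show D: "openin (topol S) D"
    using reg_nonzero[OF reg_mult[OF g3[OF d1] reg_subset[OF b2 U3 U32]]] by simp
  have D3: "D \<subseteq> U3" by (auto simp: D_def U3_def U2_def U1_def dom2_def)
  have D1: "D \<subseteq> U1" using D3 U32 U21 by blast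
  show "(\<lambda>p. Wf (u p) (A p) x) \<in> regular S D" by (rule reg_subset[OF W1 D D1])
  assume "j < d"
  then show "(\<lambda>p. \<gamma> (Wf (u p) (A p)) (u p) j / \<gamma> (Wf (u p) (A p)) (u p) 1) \<in> regular S D"
    by (intro reg_divide reg_subset[OF g3 D D3] d1) (auto simp: D_def dom2_def)
qed

lemma Wf_cong: "(\<And>i. i < N \<Longrightarrow> A i = A' i) \<Longrightarrow> Wf u A = Wf u A'"
  using mv_cong[of N A A' "M0 u"] by (simp add: Wf_def fun_eq_iff)

lemma Vf_cong: "(\<And>j. 2 \<le> j \<Longrightarrow> j < d \<Longrightarrow> c j = c' j) \<Longrightarrow> Vf w c = Vf w c'"
  unfolding Vf_def by (rule mv_cong) (auto simp: ct_def)

end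

locale projective_lift = isometric_lift G d Q a
  for G (structure) and d :: nat and Q :: "nat \<Rightarrow> nat \<Rightarrow> 'k::field_char_0"
    and a :: "'g \<Rightarrow> nat \<Rightarrow> nat \<Rightarrow> 'k" +
  fixes n :: nat and X :: "'k vec set set" and \<phi> :: "'g \<Rightarrow> 'k vec set \<Rightarrow> 'k vec set"
  assumes d_n: "d = n + 1"
    and X_eq: "X = {pt n u | u. (\<exists>i\<le>n. u i \<noteq> 0) \<and> qf d Q u = 0}"
    and \<phi>: "g \<in> carrier G \<Longrightarrow> \<phi> g (pt n u) = pt n (mv d (a g) u)"
begin

lemma X_sub: "X \<subseteq> proj_points n"
  unfolding X_eq using proj_points_pt by auto

lemma less_d: "i < d \<longleftrightarrow> i \<le> n" using d_n by auto

lemma pt_in_X: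
  assumes "\<exists>i\<le>n. u i \<noteq> 0" shows "pt n u \<in> X \<longleftrightarrow> qf d Q u = 0"
proof
  assume "pt n u \<in> X"
  then obtain u' where u': "pt n u = pt n u'" "qf d Q u' = 0" unfolding X_eq by blast
  then obtain c where "c \<noteq> 0" "\<forall>i\<le>n. u i = c * u' i" using pt_eq_iff[OF assms] by blast
  then have "qf d Q u = qf d Q (\<lambda>i. c * u' i)" by (intro qf_cong) (simp add: less_d)
  then show "qf d Q u = 0" using u'(2) by (simp add: qf_scale)
qed (use assms X_eq in blast)

end

section \<open>The equivariant birational map from \<open>P^r\<close> to the product of
  \<open>X\<close> and \<open>P^N\<close>\<close>

locale stable_map = stable_chart G d Q a Z k0 ws \<psi> \<theta> e en u0 + projective_lift G d Q a n X \<phi>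
  for G (structure) and d :: nat and Q :: "nat \<Rightarrow> nat \<Rightarrow> 'k::field_char_0"
    and a :: "'g \<Rightarrow> nat \<Rightarrow> nat \<Rightarrow> 'k" and Z :: "nat \<Rightarrow> ('g, 'k) pfun" and k0 :: nat
    and ws :: "'g \<Rightarrow> 'k" and \<psi> :: "'k poly" and \<theta> :: "'g \<Rightarrow> (nat \<Rightarrow> 'k) \<Rightarrow> 'k"
    and e :: nat and en :: "nat \<Rightarrow> 'g" and u0 :: "nat \<Rightarrow> 'k"
    and n :: nat and X :: "'k vec set set" and \<phi> :: "'g \<Rightarrow> 'k vec set \<Rightarrow> 'k vec set" +
  fixes j0 :: nat
  assumes j0: "j0 \<le> n" "u0 j0 \<noteq> 0"
begin

lemma n2: "n \<ge> 2" using d3 d_n by simp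

lemma joinable_X: "joinable n X"
  unfolding joinable_def
proof (intro ballI)
  fix x y assume "x \<in> X" "y \<in> X"
  then obtain u v where u: "x = pt n u" "\<exists>i\<le>n. u i \<noteq> 0" "q u = 0" and v: "y = pt n v" "\<exists>i\<le>n. v i \<noteq> 0" "q v = 0"
    unfolding X_eq by blast
  have "\<exists>i<d. u i \<noteq> 0" "\<exists>i<d. v i \<noteq> 0" using u(2) v(2) less_d by auto
  from isotropic_curve[OF this(1) u(3) this(2) v(3)]
  obtain \<kappa> \<alpha> \<beta> where \<kappa>: "\<And>t. q (\<lambda>i. poly (\<kappa> i) t) = 0" "\<alpha> \<noteq> 0" "\<beta> \<noteq> 0"
    "\<And>i. poly (\<kappa> i) 0 = \<alpha> * u i" "\<And>i. poly (\<kappa> i) 1 = \<beta> * v i" by blast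
  show "\<exists>\<kappa>. (\<forall>t. (\<exists>i\<le>n. poly (\<kappa> i) t \<noteq> 0) \<longrightarrow> pt n (\<lambda>i. poly (\<kappa> i) t) \<in> X) \<and>
     (\<exists>i\<le>n. poly (\<kappa> i) 0 \<noteq> 0) \<and> (\<exists>i\<le>n. poly (\<kappa> i) 1 \<noteq> 0) \<and>
     pt n (\<lambda>i. poly (\<kappa> i) 0) = x \<and> pt n (\<lambda>i. poly (\<kappa> i) 1) = y"
  proof (intro exI[of _ \<kappa>] conjI allI impI)
    show "pt n (\<lambda>i. poly (\<kappa> i) t) \<in> X" if "\<exists>i\<le>n. poly (\<kappa> i) t \<noteq> 0" for t
      using pt_in_X[OF that] \<kappa>(1) by simp
    show "\<exists>i\<le>n. poly (\<kappa> i) 0 \<noteq> 0" "\<exists>i\<le>n. poly (\<kappa> i) 1 \<noteq> 0"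
      unfolding \<kappa>(4,5) using u(2) v(2) \<kappa>(2,3) by auto
    show "pt n (\<lambda>i. poly (\<kappa> i) 0) = x" "pt n (\<lambda>i. poly (\<kappa> i) 1) = y"
      unfolding \<kappa>(4,5) pt_scale[OF \<kappa>(2)] pt_scale[OF \<kappa>(3)] u(1) v(1) by (rule refl)+
  qed
qed

text \<open>\<open>P^r\<close> is the projective space of the sum of a trivial line,
  \<open>W\<close> and \<open>n - 1\<close> further trivial lines: coordinate \<open>0\<close>
  dehomogenises, \<open>1\<close> to \<open>N\<close> belong to \<open>w\<close>, and the rest are
  the slice coordinates 2 to \<open>n\<close>. This explains the shift in \<open>cp\<close>.\<close>

definition r :: nat where "r = N + n - 1"

abbreviation "L \<equiv> proj_space r :: ('k vec set, 'k) fun_space"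
abbreviation "XP \<equiv> product_space (proj_variety n X) (proj_space N) :: ('k vec set \<times> 'k vec set, 'k) fun_space"

sublocale L: fspace L unfolding proj_space_def by (rule fspace_proj_variety) simp

sublocale XP: fspace_pair "proj_variety n X" "proj_space N"
  unfolding fspace_pair_def proj_space_def using fspace_proj_variety[OF X_sub] fspace_proj_variety by auto

definition wp :: "'k vec set \<Rightarrow> 'g \<Rightarrow> 'k" where
  "wp p x = (if x \<in> carrier G then crd 0 (1 + idx x) p else ws x)"

definition cp :: "'k vec set \<Rightarrow> nat \<Rightarrow> 'k" where
  "cp p j = crd 0 (N + j - 1) p"

text \<open>The representative with coordinate \<open>j0\<close> equal to one on the chart,
  continued by zero so that the coordinate functions of all indices are regular.\<close>

definition uf :: "'k vec set \<times> 'k vec set \<Rightarrow> nat \<Rightarrow> 'k" where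
  "uf z i = (if i \<le> n then crd j0 i (fst z) else 0)"

definition af :: "'k vec set \<times> 'k vec set \<Rightarrow> nat \<Rightarrow> 'k" where
  "af z i = crd 0 (i + 1) (snd z)"

definition xf :: "'k vec set \<Rightarrow> nat \<Rightarrow> 'k" where "xf p = Xf (wp p) (cp p)"

definition K :: "'k vec set set" where "K = chart_at r (proj_points r) 0"
definition K' :: "('k vec set \<times> 'k vec set) set" where
  "K' = chart_at n X j0 \<times> chart_at N (proj_points N) 0"

text \<open>The condition on coordinate \<open>j0\<close> makes the image lie in \<open>K'\<close>,
  where \<open>uf\<close> is a representative.\<close>

definition UD :: "'k vec set set" where
  "UD = {p \<in> K. dom1 (wp p) (cp p) \<and> xf p j0 \<noteq> 0}"

definition OV :: "('k vec set \<times> 'k vec set) set" where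
  "OV = {z \<in> K'. dom2 (uf z) (af z)}"

definition FM :: "'k vec set \<Rightarrow> 'k vec set \<times> 'k vec set" where
  "FM p = (pt n (xf p), pt N (\<lambda>i. if i = 0 then 1 else Af (xf p) (wp p) (i - 1)))"

text \<open>Above \<open>N\<close> the index \<open>i + 1 - N\<close> undoes the shift in
  \<open>cp\<close>, and the division by frame coordinate \<open>1\<close> restores the
  normalisation of \<open>ct\<close>.\<close>

definition GM :: "'k vec set \<times> 'k vec set \<Rightarrow> 'k vec set" where
  "GM z = pt r (\<lambda>i. if i = 0 then 1 else if i \<le> N then Wf (uf z) (af z) (en (i - 1))
      else \<gamma> (Wf (uf z) (af z)) (uf z) (i + 1 - N) / \<gamma> (Wf (uf z) (af z)) (uf z) 1)"

lemma FM_OV: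
  assumes p: "p \<in> UD" shows "FM p \<in> OV" "GM (FM p) = p"
proof -
  let ?w = "wp p" and ?c = "cp p" and ?x = "xf p"
  let ?A = "Af ?x ?w"
  have pK: "p \<in> K" and d1: "dom1 ?w ?c" and x0: "?x j0 \<noteq> 0" using p by (auto simp: UD_def)
  have out: "\<And>x. x \<notin> carrier G \<Longrightarrow> ?w x = ws x" by (simp add: wp_def)
  have f: "dom2 ?x ?A" "Wf ?x ?A = ?w" "\<And>j. 2 \<le> j \<Longrightarrow> j < d \<Longrightarrow> \<gamma> ?w ?x j / \<gamma> ?w ?x 1 = ?c j"
    unfolding xf_def using fwd[OF d1] out by blast+
  have xn: "\<exists>i\<le>n. ?x i \<noteq> 0" using x0 j0 by blast
  have qx: "q ?x = 0" unfolding xf_def by (rule q_Xf)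
  have u: "uf (FM p) i = (1 / ?x j0) * ?x i" if "i \<le> n" for i
    using that by (simp add: uf_def FM_def crd_pt j0)
  have s: "1 / ?x j0 \<noteq> 0" and s': "\<forall>i<d. uf (FM p) i = (1 / ?x j0) * ?x i" using x0 u less_d by auto
  note sc = scale_rep[OF s s']
  have A: "af (FM p) i = ?A i" if "i < N" for i
    using that by (simp add: af_def FM_def crd_pt)
  have W: "Wf (uf (FM p)) (af (FM p)) = ?w"
    unfolding sc(4) using Wf_cong[of "af (FM p)" ?A] A f(2) by simp
  have "dom2 (uf (FM p)) (af (FM p)) \<longleftrightarrow> dom2 ?x ?A"
    unfolding sc(6) unfolding dom2_def using Wf_cong[of "af (FM p)" ?A] A by simp
  then have d2: "dom2 (uf (FM p)) (af (FM p))" using f(1) by simp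
  have "fst (FM p) \<in> chart_at n X j0" unfolding FM_def fst_conv
    using pt_in_chart[OF j0(1)] pt_in_X[OF xn] qx x0 by blast
  moreover have "snd (FM p) \<in> chart_at N (proj_points N) 0"
    unfolding FM_def snd_conv by (subst pt_in_chart) (auto simp: proj_points_pt intro!: exI)
  ultimately show "FM p \<in> OV" using d2 unfolding OV_def K'_def by (cases "FM p") auto
  have sub: "proj_points r \<subseteq> (proj_points r :: 'k vec set set)" by simp
  have "GM (FM p) = pt r (\<lambda>i. crd 0 i p)"
    unfolding GM_def W
  proof (rule pt_cong)
    fix i assume i: "i \<le> r"
    consider "i = 0" | "0 < i" "i \<le> N" | "N < i" by linarith
    then show "(if i = 0 then 1 else if i \<le> N then ?w (en (i - 1))
      else \<gamma> ?w (uf (FM p)) (i + 1 - N) / \<gamma> ?w (uf (FM p)) 1) = crd 0 i p"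
    proof cases
      case 1
      then show ?thesis using chart_at_rep(2)[OF sub pK[unfolded K_def]] by simp
    next
      case 2
      then show ?thesis using en_in[of "i - 1"] idx_en[of "i - 1"] by (simp add: wp_def)
    next
      case 3
      then have j: "2 \<le> i + 1 - N" "i + 1 - N < d" using i n2 d_n by (auto simp: r_def)
      have "\<gamma> ?w (uf (FM p)) (i + 1 - N) / \<gamma> ?w (uf (FM p)) 1 = \<gamma> ?w ?x (i + 1 - N) / \<gamma> ?w ?x 1"
        unfolding sc(5) using s by simp
      also have "\<dots> = ?c (i + 1 - N)" by (rule f(3)[OF j])
      finally show ?thesis using 3 by (simp add: cp_def)
    qed
  qed
  then show "GM (FM p) = p" using chart_at_rep(1)[OF sub pK[unfolded K_def]] by simp
qed

lemma GM_UD: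
  assumes z: "z \<in> OV" shows "GM z \<in> UD" "FM (GM z) = z"
proof -
  let ?u = "uf z" and ?A = "af z"
  let ?w = "Wf ?u ?A"
  let ?p = "GM z"
  define c where "c j = \<gamma> ?w ?u j / \<gamma> ?w ?u 1" for j
  have z1: "fst z \<in> chart_at n X j0" and z2: "snd z \<in> chart_at N (proj_points N) 0" and d2: "dom2 ?u ?A"
    using z by (auto simp: OV_def K'_def)
  have uj: "?u j0 = 1" using chart_at_rep(2)[OF X_sub z1 j0(1)] j0 by (simp add: uf_def)
  have z1u: "fst z = pt n ?u"
    using chart_at_rep(1)[OF X_sub z1 j0(1)] pt_cong[of n "\<lambda>i. crd j0 i (fst z)" ?u] by (simp add: uf_def)
  have un: "\<exists>i\<le>n. ?u i \<noteq> 0" using uj j0(1) by (intro exI[of _ j0]) simp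
  have "pt n ?u \<in> X" using z1 z1u by (auto simp: chart_at_def)
  then have qu: "q ?u = 0" using pt_in_X[OF un] by simp
  obtain s where s: "s \<noteq> 0" "\<And>i. i < d \<Longrightarrow> Xf ?w c i = s * ?u i" "dom1 ?w c" "\<And>i. i < N \<Longrightarrow> Af (Xf ?w c) ?w i = ?A i"
    using bwd[OF qu d2] unfolding c_def[abs_def] by blast
  have crd_p: "crd 0 i ?p = (if i = 0 then 1 else if i \<le> N then ?w (en (i - 1)) else c (i + 1 - N))" if "i \<le> r" for i
    unfolding GM_def c_def using that by (simp add: crd_pt)
  have "wp ?p = ?w"
  proof
    fix x
    show "wp ?p x = ?w x"
    proof (cases "x \<in> carrier G")
      case True
      have "1 + idx x \<le> r" "1 + idx x \<le> N" using idx_less[OF True] n2 by (auto simp: r_def)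
      then show ?thesis using True crd_p[of "1 + idx x"] by (simp add: wp_def en_idx)
    qed (simp add: wp_def Wf_def)
  qed
  note wfp = this
  have cfp: "cp ?p j = c j" if "2 \<le> j" "j < d" for j
  proof -
    have "\<not> N + j - 1 \<le> N" "N + j - 1 \<le> r" "N + j - 1 \<noteq> 0" "N + j - 1 + 1 - N = j"
      using that d_n by (auto simp: r_def)
    then show ?thesis using crd_p[of "N + j - 1"] unfolding cp_def by presburger
  qed
  have V: "Vf ?w (cp ?p) = Vf ?w c" by (rule Vf_cong) (rule cfp)
  have xp: "xf ?p = Xf ?w c" unfolding xf_def wfp Xf_eq V ..
  have "dom1 (wp ?p) (cp ?p)" using s(3) unfolding wfp dom1_def Xf_eq V .
  moreover have "xf ?p j0 \<noteq> 0" unfolding xp using s(1,2) uj j0(1) less_d by simp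
  moreover have "?p \<in> K" unfolding K_def GM_def by (subst pt_in_chart) (auto simp: proj_points_pt intro!: exI)
  ultimately show "?p \<in> UD" by (simp add: UD_def)
  have sub: "proj_points N \<subseteq> (proj_points N :: 'k vec set set)" by simp
  have "pt n (xf ?p) = pt n (\<lambda>i. s * ?u i)" unfolding xp by (rule pt_cong) (simp add: s(2) less_d)
  then have 1: "pt n (xf ?p) = fst z" using pt_scale[OF s(1)] z1u by simp
  have "pt N (\<lambda>i. if i = 0 then 1 else Af (xf ?p) (wp ?p) (i - 1)) = pt N (\<lambda>i. crd 0 i (snd z))"
    unfolding xp wfp
  proof (rule pt_cong)
    fix i assume i: "i \<le> N"
    show "(if i = 0 then 1 else Af (Xf ?w c) ?w (i - 1)) = crd 0 i (snd z)"
      using chart_at_rep(2)[OF sub z2] s(4)[of "i - 1"] i by (simp add: af_def)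
  qed
  then have 2: "pt N (\<lambda>i. if i = 0 then 1 else Af (xf ?p) (wp ?p) (i - 1)) = snd z"
    using chart_at_rep(1)[OF sub z2] by simp
  show "FM ?p = z" unfolding FM_def 1 2 by simp
qed

lemma idx_r: "x \<in> carrier G \<Longrightarrow> 1 + idx x \<le> r"
  using idx_less[of x] n2 by (simp add: r_def)

lemma K_regular:
  "openin (topol L) K" "(\<lambda>p. wp p x) \<in> regular L K" "\<forall>j. 2 \<le> j \<and> j < d \<longrightarrow> (\<lambda>p. cp p j) \<in> regular L K"
proof -
  show K: "openin (topol L) K" unfolding K_def proj_space_def by (rule chart_at_open) auto
  have c: "crd 0 i \<in> regular L K" if "i \<le> r" for i
    unfolding K_def proj_space_def by (rule crd_regular) (use that in auto)
  show "(\<lambda>p. wp p x) \<in> regular L K"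
    using c[OF idx_r] L.reg_const[OF K] by (cases "x \<in> carrier G") (auto simp: wp_def)
  show "\<forall>j. 2 \<le> j \<and> j < d \<longrightarrow> (\<lambda>p. cp p j) \<in> regular L K"
    unfolding cp_def by (intro allI impI c) (use d_n in \<open>auto simp: r_def\<close>)
qed

lemma UD_regular:
  "openin (topol L) UD" "i \<le> n \<Longrightarrow> (\<lambda>p. xf p i) \<in> regular L UD"
  "k < N \<Longrightarrow> (\<lambda>p. Af (xf p) (wp p) k) \<in> regular L UD"
proof -
  let ?D = "{p \<in> K. dom1 (wp p) (cp p)}"
  note D = dom1_regular[OF L.fspace_axioms K_regular]
  have "j0 < d" using j0(1) less_d by simp
  have UD: "UD = {p \<in> ?D. xf p j0 \<noteq> 0}" by (auto simp: UD_def)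
  show o: "openin (topol L) UD" unfolding UD xf_def by (rule L.reg_nonzero[OF D(2)[OF \<open>j0 < d\<close>]])
  have sub: "UD \<subseteq> ?D" by (auto simp: UD)
  show "(\<lambda>p. xf p i) \<in> regular L UD" if "i \<le> n"
    unfolding xf_def by (rule L.reg_subset[OF D(2) o sub]) (use that less_d in simp)
  show "(\<lambda>p. Af (xf p) (wp p) k) \<in> regular L UD" if "k < N"
    unfolding xf_def by (rule L.reg_subset[OF D(3) o sub]) (rule that)
qed

lemma K'_regular:
  "openin (topol XP) K'" "(\<lambda>z. uf z i) \<in> regular XP K'" "\<forall>j<N. (\<lambda>z. af z j) \<in> regular XP K'"
proof -
  have o: "openin (topol (proj_variety n X)) (chart_at n X j0)" "openin (topol (proj_space N)) (chart_at N (proj_points N :: 'k vec set set) 0)"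
    using chart_at_open[OF X_sub j0(1)] unfolding proj_space_def by (auto intro: chart_at_open)
  show K': "openin (topol XP) K'" unfolding K'_def XP.topol_product by (rule XP.times_open[OF o])
  have u: "crd j0 i \<circ> fst \<in> regular XP K'" if "i \<le> n" for i
  proof -
    have "crd j0 i \<circ> fst \<in> regular XP {z \<in> topspace (topol XP). fst z \<in> chart_at n X j0}"
      using XP.morphism_fst o(1) crd_regular[OF X_sub that j0(1)] unfolding morphism_def by blast
    moreover have "K' \<subseteq> {z \<in> topspace (topol XP). fst z \<in> chart_at n X j0}"
      using openin_subset[OF K'] by (auto simp: K'_def)
    ultimately show ?thesis by (rule XP.prod.reg_subset[OF _ K'])
  qed
  show "(\<lambda>z. uf z i) \<in> regular XP K'"
    using u[of i] XP.prod.reg_const[OF K'] by (cases "i \<le> n") (auto simp: uf_def comp_def)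
  show "\<forall>j<N. (\<lambda>z. af z j) \<in> regular XP K'"
  proof (intro allI impI)
    fix j assume that: "j < N"
    have "crd 0 (j + 1) \<in> regular (proj_space N) (chart_at N (proj_points N :: 'k vec set set) 0)"
      unfolding proj_space_def by (rule crd_regular) (use that in auto)
    then have "crd 0 (j + 1) \<circ> snd \<in> regular XP {z \<in> topspace (topol XP). snd z \<in> chart_at N (proj_points N) 0}"
      using XP.morphism_snd o(2) unfolding morphism_def by blast
    moreover have "K' \<subseteq> {z \<in> topspace (topol XP). snd z \<in> chart_at N (proj_points N) 0}"
      using openin_subset[OF K'] by (auto simp: K'_def)
    ultimately have "crd 0 (j + 1) \<circ> snd \<in> regular XP K'" by (rule XP.prod.reg_subset[OF _ K'])
    then show "(\<lambda>z. af z j) \<in> regular XP K'" by (simp add: af_def comp_def)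
  qed
qed

lemma OV_regular:
  "openin (topol XP) OV" "(\<lambda>z. Wf (uf z) (af z) x) \<in> regular XP OV"
  "j < d \<Longrightarrow> (\<lambda>z. \<gamma> (Wf (uf z) (af z)) (uf z) j / \<gamma> (Wf (uf z) (af z)) (uf z) 1) \<in> regular XP OV"
  unfolding OV_def by (rule dom2_regular[OF XP.prod.fspace_axioms K'_regular], assumption?)+

lemma open_subspace_regular:
  assumes "fspace S" "openin (topol S) W"
  shows "fspace (open_subspace S W)" "topspace (topol (open_subspace S W)) = W"
    "f \<in> regular S W \<Longrightarrow> f \<in> regular (open_subspace S W) W"
  using fspace.fspace_open_subspace[OF assms] openin_subset[OF assms(2)] assms(2)
  by (auto simp: open_subspace_def openin_open_subtopology)

lemma morphism_FM: "morphism (open_subspace L UD) XP FM"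
proof -
  note s = open_subspace_regular[OF L.fspace_axioms UD_regular(1)]
  interpret S: fspace "open_subspace L UD" by (rule s(1))
  have "morphism (open_subspace L UD) (proj_variety n X) (\<lambda>p. fst (FM p))"
  proof (rule S.morphism_to_proj[OF X_sub, of "\<lambda>i p. xf p i"])
    show "(\<lambda>p. xf p i) \<in> regular (open_subspace L UD) (topspace (topol (open_subspace L UD)))" if "i \<le> n" for i
      unfolding s(2) by (rule s(3)[OF UD_regular(2)[OF that]])
    show "fst (FM p) = pt n (\<lambda>i. xf p i) \<and> fst (FM p) \<in> X" if "p \<in> topspace (topol (open_subspace L UD))" for p
      using FM_OV(1)[of p] that unfolding s(2) by (auto simp: FM_def OV_def K'_def chart_at_def)
  qed
  moreover have "morphism (open_subspace L UD) (proj_space N) (\<lambda>p. snd (FM p))"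
    unfolding proj_space_def[of N]
  proof (rule S.morphism_to_proj[OF subset_refl, of _ "\<lambda>i p. if i = 0 then 1 else Af (xf p) (wp p) (i - 1)"])
    show "(\<lambda>p. if i = 0 then 1 else Af (xf p) (wp p) (i - 1)) \<in> regular (open_subspace L UD) (topspace (topol (open_subspace L UD)))" if "i \<le> N" for i
      unfolding s(2) using s(3)[OF UD_regular(3)[of "i - 1"]] S.reg_const[of UD 1] s(2) that
      by (cases "i = 0") (auto simp: openin_topspace[of "topol (open_subspace L UD)", unfolded s(2)])
    show "snd (FM p) = pt N (\<lambda>i. if i = 0 then 1 else Af (xf p) (wp p) (i - 1)) \<and> snd (FM p) \<in> proj_points N"
      if "p \<in> topspace (topol (open_subspace L UD))" for p
      using FM_OV(1)[of p] that unfolding s(2) by (auto simp: FM_def OV_def K'_def chart_at_def)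
  qed
  ultimately have "morphism (open_subspace L UD) XP (\<lambda>p. (fst (FM p), snd (FM p)))"
    by (rule XP.morphism_pair[OF s(1)])
  then show ?thesis by simp
qed

lemma morphism_GM: "morphism (open_subspace XP OV) L GM"
proof -
  note s = open_subspace_regular[OF XP.prod.fspace_axioms OV_regular(1)]
  interpret S: fspace "open_subspace XP OV" by (rule s(1))
  let ?u = "\<lambda>i z. if i = 0 then 1 else if i \<le> N then Wf (uf z) (af z) (en (i - 1))
      else \<gamma> (Wf (uf z) (af z)) (uf z) (i + 1 - N) / \<gamma> (Wf (uf z) (af z)) (uf z) 1"
  show ?thesis
    unfolding proj_space_def[of r]
  proof (rule S.morphism_to_proj[OF subset_refl, of _ ?u])
    have oo: "openin (topol (open_subspace XP OV)) OV"
      using openin_topspace[of "topol (open_subspace XP OV)"] unfolding s(2) .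
    show "?u i \<in> regular (open_subspace XP OV) (topspace (topol (open_subspace XP OV)))" if "i \<le> r" for i
    proof -
      consider "i = 0" | "0 < i" "i \<le> N" | "N < i" by linarith
      then show ?thesis
      proof cases
        case 1
        then show ?thesis unfolding s(2) using S.reg_const[OF oo] by simp
      next
        case 2
        then show ?thesis unfolding s(2) using s(3)[OF OV_regular(2)] by simp
      next
        case 3
        then have "i + 1 - N < d" using that n2 d_n by (auto simp: r_def)
        from s(3)[OF OV_regular(3)[OF this]] show ?thesis unfolding s(2) using 3 by simp
      qed
    qed
    show "GM z = pt r (\<lambda>i. ?u i z) \<and> GM z \<in> proj_points r" if "z \<in> topspace (topol (open_subspace XP OV))" for z
      using GM_UD(1)[of z] that unfolding s(2) by (auto simp: GM_def UD_def K_def chart_at_def)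
  qed
qed

lemma OV_nonempty: "OV \<noteq> {}"
proof -
  obtain u A where u: "q u = 0" "u j0 \<noteq> 0" "dom2 u A" using dom2_nonempty[OF j0(2)] by blast
  define z where "z = (pt n u, pt N (\<lambda>i. if i = 0 then 1 else A (i - 1)))"
  have un: "\<exists>i\<le>n. u i \<noteq> 0" using u(2) j0(1) by blast
  have "fst z \<in> chart_at n X j0" unfolding z_def fst_conv
    using pt_in_chart[OF j0(1)] pt_in_X[OF un] u by blast
  moreover have "snd z \<in> chart_at N (proj_points N) 0"
    unfolding z_def snd_conv by (subst pt_in_chart) (auto simp: proj_points_pt intro!: exI)
  moreover have "dom2 (uf z) (af z)"
  proof -
    have s: "1 / u j0 \<noteq> 0" and s': "\<forall>i<d. uf z i = (1 / u j0) * u i"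
      using u(2) less_d by (auto simp: uf_def z_def crd_pt j0)
    have A: "af z i = A i" if "i < N" for i using that by (simp add: af_def z_def crd_pt)
    show ?thesis using u(3) unfolding scale_rep(6)[OF s s'] unfolding dom2_def using Wf_cong[of "af z" A] A by simp
  qed
  ultimately have "z \<in> OV" unfolding OV_def K'_def by (cases z) auto
  then show ?thesis by blast
qed

text \<open>\<open>FM\<close> and \<open>GM\<close> carry \<open>UD\<close> and \<open>OV\<close>
  into each other, so both compositions are defined on the full domains; nonempty open sets are
  dense by irreducibility.\<close>

lemma birational_FM: "birational_map L XP UD FM"
proof -
  have irrL: "irreducible_top (topol L)" by (rule irreducible_proj_space)
  have irrXP: "irreducible_top (topol XP)"
    unfolding proj_space_def using X_sub joinable_X subset_refl joinable_proj_points by (rule irreducible_product)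
  have UUn: "UD \<noteq> {}" using OV_nonempty GM_UD(1) by blast
  have dU: "dense_open L UD" by (rule dense_openI[OF irrL UD_regular(1) UUn])
  have dO: "dense_open XP OV" by (rule dense_openI[OF irrXP OV_regular(1) OV_nonempty])
  have "{x \<in> UD. FM x \<in> OV} = UD" "{x \<in> OV. GM x \<in> UD} = OV" using FM_OV(1) GM_UD(1) by auto
  then show ?thesis
    unfolding birational_map_def rational_map_def rational_left_inverse_def
    using dU dO morphism_FM morphism_GM FM_OV(2) GM_UD(2)
    by (intro conjI exI[of _ OV] exI[of _ GM]) auto
qed

text \<open>On the block of \<open>W\<close> the matrix \<open>\<sigma> g\<close> sends a function
  \<open>w\<close> to \<open>x \<mapsto> w (inv g \<otimes> x)\<close>; the other coordinates are
  fixed. This is a genuine permutation representation, free of the sign of the lifts.\<close>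

definition \<pi> :: "'g \<Rightarrow> nat \<Rightarrow> nat" where
  "\<pi> g i = (if 1 \<le> i \<and> i \<le> N then 1 + idx (inv g \<otimes> en (i - 1)) else i)"

definition \<sigma> :: "'g \<Rightarrow> 'k mat" where
  "\<sigma> g = mat (r + 1) (r + 1) (\<lambda>(i, j). if j = \<pi> g i then 1 else 0)"

lemma \<pi>_le: "g \<in> carrier G \<Longrightarrow> i \<le> r \<Longrightarrow> \<pi> g i \<le> r"
  unfolding \<pi>_def using idx_r[of "inv g \<otimes> en (i - 1)"] en_in[of "i - 1"] by auto

lemma \<pi>_mult:
  assumes "g \<in> carrier G" "h \<in> carrier G" shows "\<pi> h (\<pi> g i) = \<pi> (g \<otimes> h) i"
proof (cases "1 \<le> i \<and> i \<le> N")
  case True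
  then have e: "en (i - 1) \<in> carrier G" by (intro en_in) auto
  have "inv g \<otimes> en (i - 1) \<in> carrier G" using assms e by simp
  then show ?thesis
    using True idx_less[of "inv g \<otimes> en (i - 1)"] assms e
    by (simp add: \<pi>_def en_idx inv_mult_group m_assoc)
next
  case False
  then have "\<pi> k i = i" for k unfolding \<pi>_def by (rule if_not_P)
  then show ?thesis by simp
qed

lemma \<pi>_one: "\<pi> \<one> i = i"
  using en_in[of "i - 1"] idx_en[of "i - 1"] by (auto simp: \<pi>_def)

lemma \<sigma>_mult:
  assumes g: "g \<in> carrier G" and h: "h \<in> carrier G"
  shows "\<sigma> g * \<sigma> h = \<sigma> (g \<otimes> h)"
proof (rule eq_matI)
  fix i j assume "i < dim_row (\<sigma> (g \<otimes> h))" "j < dim_col (\<sigma> (g \<otimes> h))"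
  then have ij: "i \<le> r" "j \<le> r" by (auto simp: \<sigma>_def)
  have "(\<sigma> g * \<sigma> h) $$ (i, j) = (\<Sum>l<r + 1. (if l = \<pi> g i then 1 else 0) * (if j = \<pi> h l then 1 else 0))"
    using ij by (simp add: \<sigma>_def times_mat_def scalar_prod_def atLeast0LessThan)
  also have "\<dots> = (\<Sum>l<r + 1. if l = \<pi> g i then (if j = \<pi> h (\<pi> g i) then 1 else 0) else 0)"
    by (rule sum.cong) auto
  also have "\<dots> = (if j = \<pi> h (\<pi> g i) then 1 else 0)" using \<pi>_le[OF g ij(1)] by simp
  finally show "(\<sigma> g * \<sigma> h) $$ (i, j) = \<sigma> (g \<otimes> h) $$ (i, j)"
    using ij unfolding \<pi>_mult[OF g h] by (simp add: \<sigma>_def)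
qed (auto simp: \<sigma>_def)

lemma \<sigma>_one: "\<sigma> \<one> = 1\<^sub>m (r + 1)"
  by (rule eq_matI) (auto simp: \<sigma>_def \<pi>_one)

lemma \<sigma>_hom: "\<sigma> \<in> hom G (GL (r + 1))"
proof (rule homI)
  have carr: "\<sigma> g \<in> carrier_mat (r + 1) (r + 1)" for g by (simp add: \<sigma>_def)
  fix g assume g: "g \<in> carrier G"
  have "\<sigma> (inv g) * \<sigma> g = 1\<^sub>m (r + 1)" "\<sigma> g * \<sigma> (inv g) = 1\<^sub>m (r + 1)"
    using \<sigma>_mult[of g "inv g"] \<sigma>_mult[of "inv g" g] g \<sigma>_one by auto
  then show "\<sigma> g \<in> carrier (GL (r + 1))"
    using carr unfolding GL_def units_of_carrier Units_def by (auto simp: ring_mat_def)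
  fix h assume "h \<in> carrier G"
  then show "\<sigma> (g \<otimes> h) = \<sigma> g \<otimes>\<^bsub>GL (r + 1)\<^esub> \<sigma> h"
    using \<sigma>_mult[OF g] by (simp add: GL_def units_of_mult ring_mat_def)
qed

lemma \<sigma>_act:
  assumes g: "g \<in> carrier G"
  shows "(\<lambda>v. \<sigma> g *\<^sub>v v) ` pt r u = pt r (\<lambda>i. u (\<pi> g i))"
proof -
  have "\<sigma> g *\<^sub>v vec (r + 1) u = vec (r + 1) (\<lambda>i. u (\<pi> g i))" for u
  proof (rule eq_vecI)
    fix i assume "i < dim_vec (vec (r + 1) (\<lambda>i. u (\<pi> g i)))"
    then have i: "i \<le> r" by simp
    have "(\<sigma> g *\<^sub>v vec (r + 1) u) $ i = (\<Sum>l<r + 1. (if l = \<pi> g i then 1 else 0) * u l)"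
      using i by (simp add: \<sigma>_def scalar_prod_def atLeast0LessThan)
    also have "\<dots> = (\<Sum>l<r + 1. if l = \<pi> g i then u l else 0)" by (rule sum.cong) auto
    also have "\<dots> = u (\<pi> g i)" using \<pi>_le[OF g i] by simp
    finally show "(\<sigma> g *\<^sub>v vec (r + 1) u) $ i = vec (r + 1) (\<lambda>i. u (\<pi> g i)) $ i" using i by simp
  qed (simp add: \<sigma>_def)
  then have e: "\<sigma> g *\<^sub>v vec (r + 1) (\<lambda>i. c * u i) = vec (r + 1) (\<lambda>i. c * u (\<pi> g i))" for c by blast
  show ?thesis unfolding pt_alt
  proof (intro equalityI subsetI)
    fix v assume "v \<in> (\<lambda>v. \<sigma> g *\<^sub>v v) ` {vec (r + 1) (\<lambda>i. c * u i) |c. c \<noteq> 0}"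
    then show "v \<in> {vec (r + 1) (\<lambda>i. c * u (\<pi> g i)) |c. c \<noteq> 0}" using e by auto
  next
    fix v assume "v \<in> {vec (r + 1) (\<lambda>i. c * u (\<pi> g i)) |c. c \<noteq> 0}"
    then obtain c where "c \<noteq> 0" "v = \<sigma> g *\<^sub>v vec (r + 1) (\<lambda>i. c * u i)" using e by auto
    then show "v \<in> (\<lambda>v. \<sigma> g *\<^sub>v v) ` {vec (r + 1) (\<lambda>i. c * u i) |c. c \<noteq> 0}" by blast
  qed
qed

lemma equivariant_FM:
  "rationally_equivariant G (\<lambda>g p. (\<lambda>v. \<sigma> g *\<^sub>v v) ` p) (\<lambda>g (x, y). (\<phi> g x, y)) UD FM"
  unfolding rationally_equivariant_def
proof (intro ballI impI)
  fix g p assume g: "g \<in> carrier G" and p: "p \<in> UD" and p': "(\<lambda>v. \<sigma> g *\<^sub>v v) ` p \<in> UD"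
  have "p \<in> proj_points r" using p by (auto simp: UD_def K_def chart_at_def)
  then obtain u where u: "p = pt r u" using proj_points_pt by blast
  define p1 where "p1 = (\<lambda>v. \<sigma> g *\<^sub>v v) ` p"
  have p1: "p1 = pt r (\<lambda>i. u (\<pi> g i))" unfolding p1_def u by (rule \<sigma>_act[OF g])
  have crd1: "crd 0 i p1 = crd 0 (\<pi> g i) p" if "i \<le> r" for i
    unfolding p1 u using that \<pi>_le[OF g that] by (simp add: crd_pt \<pi>_def[of g 0])
  \<comment> \<open>The action on \<open>P^r\<close> translates by \<open>inv g\<close>, so
    \<open>p\<close> is the shift of its image. Hence \<open>equivariant\<close> is applied at
    \<open>p1\<close>.\<close>
  have w: "wp p = sh g (wp p1)"
  proof
    fix x
    show "wp p x = sh g (wp p1) x"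
    proof (cases "x \<in> carrier G")
      case True
      have gx: "g \<otimes> x \<in> carrier G" using g True by simp
      have "\<pi> g (1 + idx (g \<otimes> x)) = 1 + idx x"
        using idx_less[OF gx] en_idx[OF gx] g True by (simp add: \<pi>_def m_assoc[symmetric])
      then show ?thesis using True gx crd1[OF idx_r[OF gx]] by (simp add: sh_def tr_in[OF g True] wp_def)
    qed (simp add: sh_def tr_def wp_def)
  qed
  have c: "cp p1 j = cp p j" if "2 \<le> j" "j < d" for j
  proof -
    have "N + j - 1 \<le> r" using that d_n by (simp add: r_def)
    moreover have "\<not> (1 \<le> N + j - 1 \<and> N + j - 1 \<le> N)" using that by arith
    then have "\<pi> g (N + j - 1) = N + j - 1" unfolding \<pi>_def by (rule if_not_P)
    ultimately show ?thesis using crd1 by (simp add: cp_def)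
  qed
  have V: "Vf w (cp p1) = Vf w (cp p)" for w by (rule Vf_cong) (rule c)
  have X: "Xf w (cp p1) = Xf w (cp p)" for w unfolding Xf_eq V ..
  have dm: "dom1 w (cp p1) = dom1 w (cp p)" for w unfolding dom1_def X V ..
  have d: "dom1 (wp p1) (cp p)" "dom1 (sh g (wp p1)) (cp p)"
    using p p' dm w unfolding p1_def[symmetric] UD_def by auto
  obtain s where s: "s \<noteq> 0" "\<And>i. i < d \<Longrightarrow> mv d (a g) (xf p) i = s * xf p1 i"
      "\<And>i. i < N \<Longrightarrow> Af (xf p) (wp p) i = Af (xf p1) (wp p1) i"
    using equivariant[OF g d] unfolding w[symmetric] xf_def X by blast
  have "\<phi> g (pt n (xf p)) = pt n (\<lambda>i. s * xf p1 i)"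
    unfolding \<phi>[OF g] by (rule pt_cong) (simp add: s(2) less_d)
  then have 1: "\<phi> g (pt n (xf p)) = pt n (xf p1)" using pt_scale[OF s(1)] by simp
  have 2: "pt N (\<lambda>i. if i = 0 then 1 else Af (xf p) (wp p) (i - 1)) = pt N (\<lambda>i. if i = 0 then 1 else Af (xf p1) (wp p1) (i - 1))"
    by (rule pt_cong) (use s(3) in auto)
  show "FM ((\<lambda>v. \<sigma> g *\<^sub>v v) ` p) = (case FM p of (x, y) \<Rightarrow> (\<phi> g x, y))"
    unfolding p1_def[symmetric] FM_def using 1 2 by simp
qed

theorem linearizable_product: "linearizable G XP (\<lambda>g (x, y). (\<phi> g x, y))"
  unfolding linearizable_def using \<sigma>_hom birational_FM equivariant_FM by blast

end

section \<open>Quadrics and projective actions in coordinates\<close>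

lemma monomial_peel:
  assumes "Poly_Mapping.keys m \<subseteq> {..n}" "mdeg m = Suc k"
  obtains i m' where "i \<le> n" "m = m' + Poly_Mapping.single i 1" "Poly_Mapping.keys m' \<subseteq> {..n}" "mdeg m' = k"
proof -
  obtain i where i: "i \<in> Poly_Mapping.keys m" using assms(2) by (force simp: mdeg_def)
  define m' where "m' = m - Poly_Mapping.single i 1"
  have m: "m = m' + Poly_Mapping.single i 1"
    by (rule poly_mapping_eqI) (use i in \<open>auto simp: m'_def lookup_add lookup_minus lookup_single when_def in_keys_iff\<close>)
  have "Poly_Mapping.keys m' \<subseteq> Poly_Mapping.keys m"
    by (auto simp: m'_def in_keys_iff lookup_minus)
  moreover have "mdeg m = mdeg m' + 1" unfolding m mdeg_add by (simp add: mdeg_def)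
  ultimately show thesis using that[OF _ m] i assms by auto
qed

lemma monomial_two:
  assumes "Poly_Mapping.keys m \<subseteq> {..n}" "mdeg m = 2"
  obtains i j where "i \<le> n" "j \<le> n" "m = Poly_Mapping.single i 1 + Poly_Mapping.single j 1"
proof -
  obtain i m' where m': "i \<le> n" "m = m' + Poly_Mapping.single i 1" "Poly_Mapping.keys m' \<subseteq> {..n}" "mdeg m' = 1"
    using monomial_peel[OF assms(1), of 1] assms(2) by auto
  obtain j m'' where m'': "j \<le> n" "m' = m'' + Poly_Mapping.single j 1" "mdeg m'' = 0"
  proof (rule monomial_peel[OF m'(3), of 0])
    show "mdeg m' = Suc 0" using m'(4) by simp
  qed (rule that)
  have "m'' = 0" using m''(3) by (auto simp: mdeg_def in_keys_iff intro!: poly_mapping_eqI)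
  then show thesis using that[OF m''(1) m'(1)] m' m'' by simp
qed

lemma mon_single: "mon (Poly_Mapping.single i 1) v = v $ i"
  by (simp add: mon_def)

text \<open>The coefficient is split evenly between the positions (i, j) and (j, i); for i = j the
  halves add up. The last clause says that the gradient is twice the matrix applied to
  \<open>u\<close>.\<close>

lemma monomial_two_matrix:
  fixes c :: "'k::field_char_0"
  assumes "Poly_Mapping.keys m \<subseteq> {..n}" "mdeg m = 2"
  shows "\<exists>Q. (\<forall>i j. Q i j = Q j i) \<and> (\<forall>u. c * mon m (vec (n + 1) u) = qf (n + 1) Q u) \<and>
    (\<forall>k\<le>n. \<forall>u. of_nat (Poly_Mapping.lookup m k) * c * mon (m - Poly_Mapping.single k 1) (vec (n + 1) u) = 2 * (\<Sum>j<n + 1. Q k j * u j))"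
proof -
  obtain i j where ij: "i \<le> n" "j \<le> n" "m = Poly_Mapping.single i 1 + Poly_Mapping.single j 1"
    using monomial_two[OF assms] by blast
  define Q where "Q a b = (c / 2) * ((if b = j then (if a = i then 1 else 0) else 0) + (if b = i then (if a = j then 1 else 0) else 0))" for a b
  have row: "(\<Sum>b<n + 1. Q a b * u b) = (c / 2) * ((if a = i then u j else 0) + (if a = j then u i else 0))" for a u
  proof -
    have "(\<Sum>b<n + 1. Q a b * u b) = (\<Sum>b<n + 1. (if b = j then (c / 2) * (if a = i then u j else 0) else 0) + (if b = i then (c / 2) * (if a = j then u i else 0) else 0))"
      by (rule sum.cong) (auto simp: Q_def)
    also have "\<dots> = (c / 2) * ((if a = i then u j else 0) + (if a = j then u i else 0))"
      unfolding sum.distrib using ij by (simp add: distrib_left)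
    finally show ?thesis .
  qed
  have sub: "m - Poly_Mapping.single i 1 = Poly_Mapping.single j 1" "m - Poly_Mapping.single j 1 = Poly_Mapping.single i 1"
    unfolding ij(3) by simp_all
  have lk: "Poly_Mapping.lookup m k = (if k = i then 1 else 0) + (if k = j then 1 else 0)" for k
    unfolding ij(3) by (auto simp: lookup_add lookup_single when_def)
  show ?thesis
  proof (intro exI[of _ Q] conjI allI impI)
    show "Q a b = Q b a" for a b by (auto simp: Q_def)
    fix u :: "nat \<Rightarrow> 'k"
    have "qf (n + 1) Q u = (\<Sum>a<n + 1. u a * (\<Sum>b<n + 1. Q a b * u b))"
      unfolding qf_def sum_distrib_left by (intro sum.cong refl) (simp add: mult_ac)
    also have "\<dots> = (\<Sum>a<n + 1. (if a = i then (c / 2) * u i * u j else 0) + (if a = j then (c / 2) * u i * u j else 0))"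
      unfolding row by (rule sum.cong) auto
    also have "\<dots> = c * u i * u j" unfolding sum.distrib using ij by simp
    finally show "c * mon m (vec (n + 1) u) = qf (n + 1) Q u"
      using ij by (simp add: mon_add mon_single del: One_nat_def)
    fix k assume "k \<le> n"
    show "of_nat (Poly_Mapping.lookup m k) * c * mon (m - Poly_Mapping.single k 1) (vec (n + 1) u) = 2 * (\<Sum>j<n + 1. Q k j * u j)"
      unfolding row lk using sub ij(1,2) by (auto simp: mon_single simp del: One_nat_def)
  qed
qed

lemma quadric_matrix:
  fixes p :: "'k::field_char_0 mpoly"
  assumes "homogeneous n 2 p"
  obtains Q where "\<And>i j. Q i j = Q j i" "\<And>u. eval_mpoly p (vec (n + 1) u) = qf (n + 1) Q u"
    "\<And>k u. k \<le> n \<Longrightarrow> eval_mpoly (partial_deriv k p) (vec (n + 1) u) = 2 * (\<Sum>j<n + 1. Q k j * u j)"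
proof -
  let ?K = "Poly_Mapping.keys p" and ?c = "Poly_Mapping.lookup p"
  have "\<forall>m\<in>?K. \<exists>Q. (\<forall>i j. Q i j = Q j i) \<and> (\<forall>u. ?c m * mon m (vec (n + 1) u) = qf (n + 1) Q u) \<and>
    (\<forall>k\<le>n. \<forall>u. of_nat (Poly_Mapping.lookup m k) * ?c m * mon (m - Poly_Mapping.single k 1) (vec (n + 1) u) = 2 * (\<Sum>j<n + 1. Q k j * u j))"
    using monomial_two_matrix assms unfolding homogeneous_iff by blast
  then obtain Q where Q: "\<forall>m\<in>?K. (\<forall>i j. Q m i j = Q m j i) \<and> (\<forall>u. ?c m * mon m (vec (n + 1) u) = qf (n + 1) (Q m) u) \<and>
    (\<forall>k\<le>n. \<forall>u. of_nat (Poly_Mapping.lookup m k) * ?c m * mon (m - Poly_Mapping.single k 1) (vec (n + 1) u) = 2 * (\<Sum>j<n + 1. Q m k j * u j))"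
    by (rule bchoice[THEN exE])
  show thesis
  proof (rule that[of "\<lambda>i j. \<Sum>m\<in>?K. Q m i j"])
    show "(\<Sum>m\<in>?K. Q m i j) = (\<Sum>m\<in>?K. Q m j i)" for i j using Q by (intro sum.cong) auto
    show "eval_mpoly p (vec (n + 1) u) = qf (n + 1) (\<lambda>i j. \<Sum>m\<in>?K. Q m i j) u" for u
    proof -
      have "eval_mpoly p (vec (n + 1) u) = (\<Sum>m\<in>?K. qf (n + 1) (Q m) u)"
        unfolding eval_mpoly_superset[OF finite_keys order_refl] using Q by (intro sum.cong) auto
      also have "\<dots> = (\<Sum>i<n + 1. \<Sum>m\<in>?K. \<Sum>j<n + 1. Q m i j * u i * u j)"
        unfolding qf_def by (rule sum.swap)
      also have "\<dots> = (\<Sum>i<n + 1. \<Sum>j<n + 1. \<Sum>m\<in>?K. Q m i j * u i * u j)"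
        by (rule sum.cong[OF refl], rule sum.swap)
      finally show ?thesis unfolding qf_def by (simp only: sum_distrib_right)
    qed
    show "eval_mpoly (partial_deriv k p) (vec (n + 1) u) = 2 * (\<Sum>j<n + 1. (\<Sum>m\<in>?K. Q m k j) * u j)" if "k \<le> n" for k u
    proof -
      have "eval_mpoly (partial_deriv k p) (vec (n + 1) u)
          = (\<Sum>m\<in>?K. of_nat (Poly_Mapping.lookup m k) * ?c m * mon (m - Poly_Mapping.single k 1) (vec (n + 1) u))"
        unfolding partial_deriv_def eval_mpoly_sum eval_mpoly_single ..
      also have "\<dots> = (\<Sum>m\<in>?K. 2 * (\<Sum>j<n + 1. Q m k j * u j))"
        using Q that by (intro sum.cong[OF refl]) blast
      also have "\<dots> = 2 * (\<Sum>j<n + 1. \<Sum>m\<in>?K. Q m k j * u j)"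
        unfolding sum_distrib_left[symmetric] by (subst sum.swap) (rule refl)
      finally show ?thesis by (simp only: sum_distrib_right)
    qed
  qed
qed

text \<open>A nonzero vector in the radical is isotropic, so it gives a point of \<open>X\<close>;
  its gradient, twice the matrix applied to it, vanishes, against the Jacobian criterion.\<close>

lemma smooth_quadric:
  fixes X :: "'k::field_char_0 vec set set"
  assumes "smooth_quadric_hypersurface n X" "n \<ge> 2"
  obtains Q where "quadric (n + 1) Q" "X = {pt n u | u. (\<exists>i\<le>n. u i \<noteq> 0) \<and> qf (n + 1) Q u = 0}"
proof -
  obtain p where p: "homogeneous n 2 p" "X = {x \<in> proj_points n. \<forall>v\<in>x. eval_mpoly p v = 0}"
    "\<forall>x\<in>X. \<forall>v\<in>x. \<exists>i\<le>n. eval_mpoly (partial_deriv i p) v \<noteq> 0"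
    using assms(1) unfolding smooth_quadric_hypersurface_def by blast
  obtain Q where Q: "\<And>i j. Q i j = Q j i" "\<And>u. eval_mpoly p (vec (n + 1) u) = qf (n + 1) Q u"
    "\<And>k u. k \<le> n \<Longrightarrow> eval_mpoly (partial_deriv k p) (vec (n + 1) u) = 2 * (\<Sum>j<n + 1. Q k j * u j)"
    using quadric_matrix[OF p(1)] by metis
  have X: "X = {pt n u | u. (\<exists>i\<le>n. u i \<noteq> 0) \<and> qf (n + 1) Q u = 0}"
  proof (intro equalityI subsetI)
    fix x assume "x \<in> X"
    then obtain u where u: "x = pt n u" "\<exists>i\<le>n. u i \<noteq> 0" "\<forall>v\<in>x. eval_mpoly p v = 0"
      unfolding p(2) proj_points_pt by blast
    then have "qf (n + 1) Q u = 0" using pt_vanish[OF p(1)] Q(2) by metis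
    then show "x \<in> {pt n u | u. (\<exists>i\<le>n. u i \<noteq> 0) \<and> qf (n + 1) Q u = 0}" using u by blast
  next
    fix x assume "x \<in> {pt n u | u. (\<exists>i\<le>n. u i \<noteq> 0) \<and> qf (n + 1) Q u = 0}"
    then obtain u where u: "x = pt n u" "\<exists>i\<le>n. u i \<noteq> 0" "qf (n + 1) Q u = 0" by blast
    then have "\<forall>v\<in>x. eval_mpoly p v = 0" using pt_vanish[OF p(1)] Q(2) by metis
    then show "x \<in> X" unfolding p(2) using u proj_points_pt by blast
  qed
  interpret quadratic "n + 1" Q by unfold_locales (rule Q(1))
  have "\<exists>v. b u v \<noteq> 0" if u: "\<exists>i<n + 1. u i \<noteq> 0" for u
  proof (rule ccontr)
    assume "\<not> ?thesis"
    then have z: "b u v = 0" for v by blast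
    have "\<exists>i\<le>n. u i \<noteq> 0" using u by (auto simp: less_Suc_eq_le)
    then have "pt n u \<in> X" using z[of u] unfolding X by (auto simp: qf_bl)
    then obtain k where k: "k \<le> n" "eval_mpoly (partial_deriv k p) (vec (n + 1) u) \<noteq> 0"
      using p(3) vec_in_pt by blast
    have "b u (\<lambda>i. if i = k then 1 else 0) = (\<Sum>i<n + 1. \<Sum>j<n + 1. if j = k then Q i k * u i else 0)"
      unfolding bl_def by (intro sum.cong refl) auto
    also have "\<dots> = (\<Sum>i<n + 1. Q k i * u i)" using k(1) Q(1) by simp
    finally have S: "(\<Sum>i<n + 1. Q k i * u i) = 0" using z by metis
    show False using k(2) unfolding Q(3)[OF k(1)] S by simp
  qed
  then have "quadric (n + 1) Q"
  proof unfold_locales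
    show "n + 1 \<ge> 3" using assms(2) by simp
  qed
  then show thesis using that X by blast
qed

lemma (in quadric) ex_anisotropic: obtains v where "q v \<noteq> 0"
proof -
  define u :: "nat \<Rightarrow> 'a" where "u i = (if i = 0 then 1 else 0)" for i
  have "\<exists>i<d. u i \<noteq> 0" using d3 by (intro exI[of _ 0]) (auto simp: u_def)
  from nondeg[OF this] obtain v where v: "b u v \<noteq> 0" by blast
  show thesis
  proof (cases "q u \<noteq> 0 \<or> q v \<noteq> 0")
    case False
    then have "q (\<lambda>i. u i + 1 * v i) \<noteq> 0" unfolding q_add using v by simp
    then show thesis by (rule that)
  qed (use that in blast)
qed

section \<open>Lifting the projective action to isometries\<close>

definition mfun :: "'k mat \<Rightarrow> nat \<Rightarrow> nat \<Rightarrow> 'k" where "mfun A i j = A $$ (i, j)"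

lemma mat_vec_mfun:
  assumes "A \<in> carrier_mat d d"
  shows "A *\<^sub>v vec d u = vec d (mv d (mfun A) u)"
  by (rule eq_vecI) (use assms in \<open>auto simp: mv_def mfun_def scalar_prod_def atLeast0LessThan intro!: sum.cong\<close>)

lemma mfun_mult:
  assumes "A \<in> carrier_mat d d" "B \<in> carrier_mat d d" "i < d" "l < d"
  shows "mfun (A * B) i l = (\<Sum>j<d. mfun A i j * mfun B j l)"
  using assms by (simp add: mfun_def times_mat_def scalar_prod_def atLeast0LessThan)

lemma GL_carrier: "A \<in> carrier (GL d) \<longleftrightarrow> A \<in> carrier_mat d d \<and> (\<exists>B\<in>carrier_mat d d. B * A = 1\<^sub>m d \<and> A * B = 1\<^sub>m d)"
  by (auto simp: GL_def units_of_carrier Units_def ring_mat_def)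

lemma GL_mult: "A \<otimes>\<^bsub>GL d\<^esub> B = A * B"
  by (simp add: GL_def units_of_mult ring_mat_def)

lemma PGL_carrier:
  assumes "C \<in> carrier (PGL d)"
  obtains A where "A \<in> carrier (GL d)" "C = {c \<cdot>\<^sub>m A | c. c \<noteq> 0}"
proof -
  obtain A where A: "A \<in> carrier (GL d)" "C = scalars d #>\<^bsub>GL d\<^esub> A"
    using assms by (auto simp: PGL_def FactGroup_def RCOSETS_def)
  have "A \<in> carrier_mat d d" using A(1) GL_carrier by blast
  then have "(c \<cdot>\<^sub>m 1\<^sub>m d) * A = c \<cdot>\<^sub>m A" for c
    using mult_smult_assoc_mat[OF one_carrier_mat, of A d d c] by simp
  then have "C = {c \<cdot>\<^sub>m A | c. c \<noteq> 0}"
    unfolding A(2) r_coset_def GL_mult scalars_def by auto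
  then show thesis using that A(1) by blast
qed

lemma PGL_mult: "C \<otimes>\<^bsub>PGL d\<^esub> C' = {A * B | A B. A \<in> C \<and> B \<in> C'}"
  by (auto simp: PGL_def FactGroup_def set_mult_def GL_mult)

lemma pgl_act_pt:
  assumes "A \<in> carrier_mat (n + 1) (n + 1)" "C = {c \<cdot>\<^sub>m A | c. c \<noteq> 0}"
  shows "pgl_act C (pt n u) = pt n (mv (n + 1) (mfun A) u)"
proof -
  have e: "(c \<cdot>\<^sub>m A) *\<^sub>v vec (n + 1) (\<lambda>i. c' * u i) = vec (n + 1) (\<lambda>i. (c * c') * mv (n + 1) (mfun A) u i)" for c c'
  proof -
    have "(c \<cdot>\<^sub>m A) *\<^sub>v vec (n + 1) (\<lambda>i. c' * u i) = vec (n + 1) (mv (n + 1) (mfun (c \<cdot>\<^sub>m A)) (\<lambda>i. c' * u i))"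
      by (rule mat_vec_mfun) (use assms(1) in simp)
    moreover have "mv (n + 1) (mfun (c \<cdot>\<^sub>m A)) (\<lambda>i. c' * u i) i = (c * c') * mv (n + 1) (mfun A) u i" if "i < n + 1" for i
      unfolding mv_def sum_distrib_left by (rule sum.cong) (use assms(1) that in \<open>auto simp: mfun_def\<close>)
    ultimately show ?thesis by (auto simp: vec_eq_iff)
  qed
  show ?thesis
    unfolding pgl_act_def pt_alt
  proof (intro equalityI subsetI)
    fix v assume "v \<in> {A *\<^sub>v v |A v. A \<in> C \<and> v \<in> {vec (n + 1) (\<lambda>i. c * u i) |c. c \<noteq> 0}}"
    then obtain c c' where "c \<noteq> 0" "c' \<noteq> 0" "v = (c \<cdot>\<^sub>m A) *\<^sub>v vec (n + 1) (\<lambda>i. c' * u i)"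
      unfolding assms(2) by blast
    then show "v \<in> {vec (n + 1) (\<lambda>i. c * mv (n + 1) (mfun A) u i) |c. c \<noteq> 0}" unfolding e by force
  next
    fix v assume "v \<in> {vec (n + 1) (\<lambda>i. c * mv (n + 1) (mfun A) u i) |c. c \<noteq> 0}"
    then obtain c where "c \<noteq> 0" "v = vec (n + 1) (\<lambda>i. c * mv (n + 1) (mfun A) u i)" by blast
    then have "v = (c \<cdot>\<^sub>m A) *\<^sub>v vec (n + 1) (\<lambda>i. 1 * u i)" "c \<cdot>\<^sub>m A \<in> C" unfolding e assms(2) by auto
    then show "v \<in> {A *\<^sub>v v |A v. A \<in> C \<and> v \<in> {vec (n + 1) (\<lambda>i. c * u i) |c. c \<noteq> 0}}"
      by (intro CollectI exI[of _ "c \<cdot>\<^sub>m A"] exI[of _ "vec (n + 1) (\<lambda>i. 1 * u i)"] conjI exI[of _ 1]) simp_all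
  qed
qed

lemma (in quadratic) isometryI:
  assumes "\<And>v. q (mv d A v) = q v"
  shows "isometry d Q A"
  unfolding isometry_def
proof (intro allI impI)
  fix k l assume kl: "k < d" "l < d"
  let ?Q' = "\<lambda>k l. \<Sum>i<d. \<Sum>j<d. Q i j * A i k * A j l"
  have sym': "?Q' k l = ?Q' l k" for k l
    by (subst sum.swap) (intro sum.cong refl, simp add: sym mult_ac)
  have "qf d ?Q' v = 1 * q v" for v unfolding qf_mv[symmetric] using assms by simp
  from polarization[OF this sym'] have "bl d ?Q' u v = b u v" for u v by simp
  then show "?Q' k l = Q k l"
    using bl_unit[OF kl, of ?Q', symmetric] bl_unit[OF kl, of Q, symmetric] by simp
qed

lemma smult_smult_mat: "a \<cdot>\<^sub>m (b \<cdot>\<^sub>m A) = (a * b :: 'k::field) \<cdot>\<^sub>m A"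
  by (rule eq_matI) auto

lemma one_smult_mat: "(1 :: 'k::field) \<cdot>\<^sub>m A = A"
  by (rule eq_matI) auto

text \<open>A representative of \<open>\<rho> g\<close> preserves \<open>X\<close>, so the pulled
  back form vanishes at all zeros of \<open>q\<close> and is a multiple of \<open>q\<close>. A
  square root of the inverse factor makes the representative an isometry; the choice of root is the
  sign ambiguity.\<close>

lemma isometric_lifts:
  fixes G (structure) and Q :: "nat \<Rightarrow> nat \<Rightarrow> 'k::{alg_closed_field, field_char_0}"
  assumes G: "group G" and act: "proj_action G n X \<rho>" and Q: "quadric (n + 1) Q"
    and X: "X = {pt n u | u. (\<exists>i\<le>n. u i \<noteq> 0) \<and> qf (n + 1) Q u = 0}"
  obtains a where "\<And>g. g \<in> carrier G \<Longrightarrow> isometry (n + 1) Q (a g)"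
    "\<And>g h. g \<in> carrier G \<Longrightarrow> h \<in> carrier G \<Longrightarrow>
      \<exists>\<epsilon>\<in>{1,-1}. \<forall>i<n + 1. \<forall>l<n + 1. (\<Sum>j<n + 1. a g i j * a h j l) = \<epsilon> * a (g \<otimes> h) i l"
    "\<And>i l. i < n + 1 \<Longrightarrow> l < n + 1 \<Longrightarrow> a \<one> i l = (if i = l then 1 else 0)"
    "\<And>g u. g \<in> carrier G \<Longrightarrow> pgl_act (\<rho> g) (pt n u) = pt n (mv (n + 1) (a g) u)"
proof -
  interpret group G by (rule G)
  define d where "d = n + 1"
  interpret quadric d Q using Q by (simp add: d_def)
  have hom: "\<rho> g \<in> carrier (PGL d)" "h \<in> carrier G \<Longrightarrow> \<rho> (g \<otimes> h) = \<rho> g \<otimes>\<^bsub>PGL d\<^esub> \<rho> h" if "g \<in> carrier G" for g h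
    using act that unfolding proj_action_def d_def hom_def by auto
  define R where "R g A \<longleftrightarrow> A \<in> carrier_mat d d \<and> \<rho> g = {c \<cdot>\<^sub>m A | c. c \<noteq> 0}" for g A
  obtain z where z: "\<exists>i<d. z i \<noteq> 0" "q z = 0"
    using ex_isotropic alg_closed_imp_poly_has_root by metis
  obtain v0 where v0: "q v0 \<noteq> 0" by (rule ex_anisotropic)
  have act_R: "pgl_act (\<rho> g) (pt n u) = pt n (mv d (mfun A) u)" if "R g A" for g A u
    using pgl_act_pt[of A n "\<rho> g" u] that unfolding R_def d_def by blast
  \<comment> \<open>The class of the unit is idempotent, so a representative satisfies
    \<open>A * A = c \<cdot>\<^sub>m A\<close>; being invertible, it is scalar.\<close>
  have R_one: "R \<one> (1\<^sub>m d :: 'k mat)"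
  proof -
    obtain A where A: "A \<in> carrier (GL d)" "\<rho> \<one> = {c \<cdot>\<^sub>m A | c. c \<noteq> 0}" by (rule PGL_carrier[OF hom(1)[OF one_closed]])
    have Ac: "A \<in> carrier_mat d d" using A(1) GL_carrier by blast
    obtain B where B: "B \<in> carrier_mat d d" "A * B = 1\<^sub>m d" using A(1) GL_carrier by blast
    have "1 \<cdot>\<^sub>m A \<in> \<rho> \<one>" unfolding A(2) by (intro CollectI exI[of _ 1]) simp
    then have Ain: "A \<in> \<rho> \<one>" by (simp only: one_smult_mat)
    have "A * A \<in> \<rho> \<one>" using hom(2)[OF one_closed one_closed] Ain unfolding PGL_mult by auto
    then obtain c where c: "c \<noteq> 0" "A * A = c \<cdot>\<^sub>m A" unfolding A(2) by blast
    have "A * A * B = A" using assoc_mult_mat[OF Ac Ac B(1)] B Ac by simp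
    moreover have "A * A * B = c \<cdot>\<^sub>m 1\<^sub>m d" unfolding c(2) using mult_smult_assoc_mat[OF Ac B(1)] B(2) by simp
    ultimately have A1: "A = c \<cdot>\<^sub>m 1\<^sub>m d" by simp
    have "\<rho> \<one> = {b \<cdot>\<^sub>m 1\<^sub>m d | b. b \<noteq> 0}"
      unfolding A(2) A1
    proof (intro equalityI subsetI)
      fix M assume "M \<in> {b \<cdot>\<^sub>m (c \<cdot>\<^sub>m 1\<^sub>m d) | b. b \<noteq> 0}"
      then obtain b where "b \<noteq> 0" "M = (b * c) \<cdot>\<^sub>m 1\<^sub>m d" by (auto simp: smult_smult_mat)
      then show "M \<in> {b \<cdot>\<^sub>m 1\<^sub>m d | b. b \<noteq> 0}" using c(1) by (intro CollectI exI[of _ "b * c"]) auto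
    next
      fix M :: "'k mat" assume "M \<in> {b \<cdot>\<^sub>m 1\<^sub>m d | b. b \<noteq> 0}"
      then obtain b where "b \<noteq> 0" "M = b \<cdot>\<^sub>m 1\<^sub>m d" by blast
      then show "M \<in> {b \<cdot>\<^sub>m (c \<cdot>\<^sub>m 1\<^sub>m d) | b. b \<noteq> 0}"
        using c(1) by (intro CollectI exI[of _ "b / c"]) (auto simp: smult_smult_mat)
    qed
    then show ?thesis by (simp add: R_def)
  qed
  have ex: "\<exists>A. R g A \<and> isometry d Q (mfun A)" if g: "g \<in> carrier G" for g
  proof -
    obtain A where A: "A \<in> carrier (GL d)" "\<rho> g = {c \<cdot>\<^sub>m A | c. c \<noteq> 0}" by (rule PGL_carrier[OF hom(1)[OF g]])
    have Ac: "A \<in> carrier_mat d d" using A(1) GL_carrier by blast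
    obtain B where B: "B \<in> carrier_mat d d" "A * B = 1\<^sub>m d" using A(1) GL_carrier by blast
    have RA: "R g A" using Ac A(2) by (simp add: R_def)
    let ?Q' = "\<lambda>k l. \<Sum>i<d. \<Sum>j<d. Q i j * mfun A i k * mfun A j l"
    have sym': "?Q' k l = ?Q' l k" for k l
      by (subst sum.swap) (intro sum.cong refl, simp add: sym mult_ac)
    have van: "qf d ?Q' v = 0" if v: "q v = 0" for v
    proof (cases "\<exists>i\<le>n. v i \<noteq> 0")
      case True
      then have "pt n v \<in> X" using v unfolding X d_def by blast
      then have "pgl_act (\<rho> g) (pt n v) \<in> X" using act g unfolding proj_action_def by blast
      then obtain u where u: "pt n (mv d (mfun A) v) = pt n u" "\<exists>i\<le>n. u i \<noteq> 0" "q u = 0"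
        unfolding act_R[OF RA] X d_def by blast
      then obtain c where c: "c \<noteq> 0" "\<forall>i\<le>n. u i = c * mv d (mfun A) v i" using pt_eq_iff[OF u(2)] by metis
      have "q u = q (\<lambda>i. c * mv d (mfun A) v i)" by (rule qf_cong) (use c(2) in \<open>simp add: d_def\<close>)
      then have "q (mv d (mfun A) v) = 0" using c(1) u(3) by (simp add: qf_scale)
      then show ?thesis by (simp add: qf_mv)
    next
      case False
      then have "qf d ?Q' v = qf d ?Q' (\<lambda>i. 0)" by (intro qf_cong) (auto simp: d_def)
      then show ?thesis by (simp add: qf_def)
    qed
    obtain \<mu> where \<mu>: "\<And>v. qf d ?Q' v = \<mu> * q v" using vanish_on_quadric[OF z sym' van] by blast
    \<comment> \<open>Otherwise \<open>q\<close> would vanish on the image of the invertible matrix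
      \<open>A\<close>, which contains \<open>v0\<close>.\<close>
    have "\<mu> \<noteq> 0"
    proof
      assume "\<mu> = 0"
      then have "q (mv d (mfun A) (mv d (mfun B) v0)) = 0" unfolding qf_mv[of d Q "mfun A"] \<mu> by simp
      moreover have "mv d (mfun A) (mv d (mfun B) v0) i = v0 i" if i: "i < d" for i
      proof -
        have "mv d (mfun A) (mv d (mfun B) v0) i = (\<Sum>l<d. mfun (A * B) i l * v0 l)"
          unfolding mv_mv by (rule sum.cong) (use mfun_mult[OF Ac B(1) i] in auto)
        also have "\<dots> = (\<Sum>l<d. if i = l then v0 l else 0)" unfolding B(2) by (rule sum.cong) (use i in \<open>auto simp: mfun_def\<close>)
        finally show ?thesis using i by simp
      qed
      ultimately show False using v0 qf_cong[of d "mv d (mfun A) (mv d (mfun B) v0)" v0] by simp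
    qed
    obtain s where s: "s ^ 2 = inverse \<mu>" using nth_root_exists[of 2 "inverse \<mu>"] by auto
    have s0: "s \<noteq> 0" using s \<open>\<mu> \<noteq> 0\<close> by auto
    have "R g (s \<cdot>\<^sub>m A)"
      unfolding R_def
    proof (intro conjI)
      show "\<rho> g = {c \<cdot>\<^sub>m (s \<cdot>\<^sub>m A) | c. c \<noteq> 0}"
        unfolding A(2)
      proof (intro equalityI subsetI)
        fix M assume "M \<in> {c \<cdot>\<^sub>m A | c. c \<noteq> 0}"
        then obtain c where "c \<noteq> 0" "M = c \<cdot>\<^sub>m A" by blast
        then show "M \<in> {c \<cdot>\<^sub>m (s \<cdot>\<^sub>m A) | c. c \<noteq> 0}" using s0
          by (intro CollectI exI[of _ "c / s"]) (auto simp: smult_smult_mat)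
      next
        fix M assume "M \<in> {c \<cdot>\<^sub>m (s \<cdot>\<^sub>m A) | c. c \<noteq> 0}"
        then obtain c where "c \<noteq> 0" "M = (c * s) \<cdot>\<^sub>m A" by (auto simp: smult_smult_mat)
        then show "M \<in> {c \<cdot>\<^sub>m A | c. c \<noteq> 0}" using s0 by (intro CollectI exI[of _ "c * s"]) auto
      qed
    qed (use Ac in simp)
    moreover have "isometry d Q (mfun (s \<cdot>\<^sub>m A))"
    proof (rule isometryI)
      fix v
      have "q (mv d (mfun (s \<cdot>\<^sub>m A)) v) = q (\<lambda>i. s * mv d (mfun A) v i)"
        by (rule qf_cong) (use Ac in \<open>auto simp: mv_def mfun_def sum_distrib_left mult.assoc intro!: sum.cong\<close>)
      also have "\<dots> = s ^ 2 * (\<mu> * q v)" unfolding qf_scale by (simp add: qf_mv \<mu>)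
      also have "\<dots> = q v" using s \<open>\<mu> \<noteq> 0\<close> by simp
      finally show "q (mv d (mfun (s \<cdot>\<^sub>m A)) v) = q v" .
    qed
    ultimately show ?thesis by blast
  qed
  have iso1: "isometry d Q (mfun (1\<^sub>m d :: 'k mat))"
  proof (rule isometryI)
    fix v
    have "mv d (mfun (1\<^sub>m d :: 'k mat)) v i = v i" if i: "i < d" for i
    proof -
      have "mv d (mfun (1\<^sub>m d :: 'k mat)) v i = (\<Sum>l<d. if i = l then v l else 0)"
        unfolding mv_def by (rule sum.cong) (use i in \<open>auto simp: mfun_def\<close>)
      then show ?thesis using i by simp
    qed
    then show "q (mv d (mfun (1\<^sub>m d :: 'k mat)) v) = q v" by (rule qf_cong)
  qed
  \<comment> \<open>The identity matrix is prescribed for the unit, so that \<open>a \<one>\<close>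
    is exact and not just correct up to sign.\<close>
  have "\<forall>g\<in>carrier G. \<exists>A. R g A \<and> isometry d Q (mfun A) \<and> (g = \<one> \<longrightarrow> A = 1\<^sub>m d)"
    using ex R_one iso1 by blast
  then obtain A where A: "\<forall>g\<in>carrier G. R g (A g) \<and> isometry d Q (mfun (A g)) \<and> (g = \<one> \<longrightarrow> A g = 1\<^sub>m d)"
    by (rule bchoice[THEN exE])
  show thesis
  proof (rule that[of "\<lambda>g. mfun (A g)"], unfold d_def[symmetric])
    show "isometry d Q (mfun (A g))" if "g \<in> carrier G" for g using A that by blast
    show "mfun (A \<one>) i l = (if i = l then 1 else 0)" if "i < d" "l < d" for i l
    proof -
      have "A \<one> = 1\<^sub>m d" using A by blast
      then show ?thesis using that by (simp add: mfun_def)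
    qed
    show "pgl_act (\<rho> g) (pt n u) = pt n (mv d (mfun (A g)) u)" if "g \<in> carrier G" for g u
      using A that act_R by blast
    fix g h assume g: "g \<in> carrier G" and h: "h \<in> carrier G"
    have Rg: "R g (A g)" "R h (A h)" "R (g \<otimes> h) (A (g \<otimes> h))" using A g h by auto
    have self: "A k \<in> \<rho> k" if "R k (A k)" for k
    proof -
      have "1 \<cdot>\<^sub>m A k \<in> \<rho> k" using that unfolding R_def by (elim conjE ssubst) (intro CollectI exI[of _ 1], simp)
      then show ?thesis by (simp only: one_smult_mat)
    qed
    have "A g * A h \<in> \<rho> (g \<otimes> h)"
      using self[OF Rg(1)] self[OF Rg(2)] unfolding hom(2)[OF g h] PGL_mult by blast
    then obtain c where c: "A g * A h = c \<cdot>\<^sub>m A (g \<otimes> h)" using Rg(3) unfolding R_def by blast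
    have e: "(\<Sum>j<d. mfun (A g) i j * mfun (A h) j l) = c * mfun (A (g \<otimes> h)) i l" if "i < d" "l < d" for i l
    proof -
      have "mfun (A g * A h) i l = (\<Sum>j<d. mfun (A g) i j * mfun (A h) j l)"
        by (rule mfun_mult) (use Rg that in \<open>auto simp: R_def\<close>)
      then show ?thesis unfolding c using Rg(3) that by (auto simp: R_def mfun_def)
    qed
    \<comment> \<open>All lifts preserve \<open>q\<close>, so comparing values at the anisotropic
      \<open>v0\<close> forces \<open>c ^ 2 = 1\<close>.\<close>
    have "q (mv d (mfun (A g)) (mv d (mfun (A h)) v0)) = q (\<lambda>i. c * mv d (mfun (A (g \<otimes> h))) v0 i)"
    proof (rule qf_cong)
      fix i assume i: "i < d"
      show "mv d (mfun (A g)) (mv d (mfun (A h)) v0) i = c * mv d (mfun (A (g \<otimes> h))) v0 i"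
        unfolding mv_mv unfolding mv_def sum_distrib_left by (rule sum.cong[OF refl]) (simp add: e i mult.assoc)
    qed
    then have "q v0 = c ^ 2 * q v0"
      unfolding qf_scale using A g h by (simp add: qf_isometry)
    then have "c ^ 2 = 1" using v0 by simp
    then have "c \<in> {1, -1}" by (simp add: power2_eq_1_iff)
    then show "\<exists>\<epsilon>\<in>{1,-1}. \<forall>i<d. \<forall>l<d. (\<Sum>j<d. mfun (A g) i j * mfun (A h) j l) = \<epsilon> * mfun (A (g \<otimes> h)) i l"
      using e by blast
  qed
qed

section \<open>Rational maps in homogeneous coordinates\<close>

lemma morphism_compose:
  assumes "morphism S Y f" "morphism Y W g"
  shows "morphism S W (g \<circ> f)"
  unfolding morphism_def
proof (intro conjI allI impI)
  have c: "continuous_map (topol S) (topol Y) f" "continuous_map (topol Y) (topol W) g"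
    using assms by (auto simp: morphism_def)
  then show "continuous_map (topol S) (topol W) (g \<circ> f)" by (rule continuous_map_compose)
  fix V h assume "openin (topol W) V \<and> h \<in> regular W V"
  then have "openin (topol Y) {y \<in> topspace (topol Y). g y \<in> V}" "h \<circ> g \<in> regular Y {y \<in> topspace (topol Y). g y \<in> V}"
    using assms(2) c(2) unfolding morphism_def continuous_map_def by auto
  then have "(h \<circ> g) \<circ> f \<in> regular S {x \<in> topspace (topol S). f x \<in> {y \<in> topspace (topol Y). g y \<in> V}}"
    using assms(1) unfolding morphism_def by blast
  moreover have "{x \<in> topspace (topol S). f x \<in> {y \<in> topspace (topol Y). g y \<in> V}} = {x \<in> topspace (topol S). (g \<circ> f) x \<in> V}"
    using c(1) unfolding continuous_map_def by auto
  ultimately show "h \<circ> (g \<circ> f) \<in> regular S {x \<in> topspace (topol S). (g \<circ> f) x \<in> V}"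
    by (simp add: comp_assoc)
qed

lemma eval_polyfun:
  assumes "homogeneous n d h" shows "(\<lambda>u. eval_mpoly h (vec (n + 1) u)) \<in> polyfun"
  unfolding eval_vec[OF assms] by (intro polyfun_sum polyfun.mult polyfun.const polyfun_prod polyfun_power polyfun.var)

text \<open>Near a point the affine coordinates of \<open>f\<close> are quotients of forms.
  Multiplying by the product of all denominators gives polynomial homogeneous coordinates, valid
  where \<open>H\<close> is nonzero.\<close>

lemma rational_map_coordinates:
  fixes X :: "'k::field_char_0 vec set set"
  assumes X: "X \<subseteq> proj_points n"
    and f: "rational_map (proj_space r) (proj_variety n X) U f"
  obtains F :: "nat \<Rightarrow> (nat \<Rightarrow> 'k) \<Rightarrow> 'k" and H us where "\<And>i. F i \<in> polyfun" "H \<in> polyfun" "H us \<noteq> 0"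
    "\<And>u. H u \<noteq> 0 \<Longrightarrow> pt r u \<in> U \<and> (\<exists>i\<le>n. F i u \<noteq> 0) \<and> f (pt r u) = pt n (\<lambda>i. F i u) \<and> f (pt r u) \<in> X"
proof -
  define L where "L = (proj_space r :: ('k vec set, 'k) fun_space)"
  interpret L: fspace L unfolding L_def proj_space_def by (rule fspace_proj_variety) simp
  have topL: "topol L = zariski r"
    by (simp add: L_def proj_space_def proj_variety_def topspace_zariski[symmetric] subtopology_topspace)
  have U: "dense_open L U" and mor: "morphism (open_subspace L U) (proj_variety n X) f"
    using f by (auto simp: rational_map_def L_def)
  have Uo: "openin (topol L) U" using U by (simp add: dense_open_def)
  have "pt r (\<lambda>_. 1) \<in> (proj_points r :: 'k vec set set)" unfolding proj_points_pt by (intro exI[of _ "\<lambda>_. 1"]) auto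
  then have "U \<noteq> {}" using dense_open_meets[OF U openin_topspace] by (auto simp: topL topspace_zariski)
  then obtain p0 where p0: "p0 \<in> U" by blast
  have topS: "topspace (topol (open_subspace L U)) = U"
    using openin_subset[OF Uo] by (auto simp: open_subspace_def)
  have fX: "f p \<in> X" if "p \<in> U" for p
    using mor that topS topspace_proj_variety[OF X] unfolding morphism_def continuous_map_def by auto
  obtain x where x: "f p0 = pt n x" "\<exists>i\<le>n. x i \<noteq> 0" using fX[OF p0] X proj_points_pt by blast
  then obtain j where j: "j \<le> n" "x j \<noteq> 0" by blast
  define V where "V = chart_at n X j"
  have V: "openin (topol (proj_variety n X)) V" unfolding V_def by (rule chart_at_open[OF X j(1)])
  define W0 where "W0 = {p \<in> U. f p \<in> V}"
  have p0W: "p0 \<in> W0" using p0 fX[OF p0] pt_in_chart[OF j(1), of x X] j(2) x(1) unfolding W0_def V_def by simp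
  have reg: "crd j i \<circ> f \<in> regular L W0" if "i \<le> n" for i
  proof -
    have "crd j i \<circ> f \<in> regular (open_subspace L U) {p \<in> topspace (topol (open_subspace L U)). f p \<in> V}"
      using mor V crd_regular[OF X that j(1)] unfolding morphism_def V_def by blast
    then show ?thesis unfolding topS W0_def[symmetric] by (simp add: open_subspace_def split: if_splits)
  qed
  have "\<forall>i\<in>{..n}. \<exists>W d g h. openin (topol L) W \<and> p0 \<in> W \<and> W \<subseteq> W0 \<and> homogeneous r d g \<and> homogeneous r d h \<and>
    (\<forall>x\<in>W. \<forall>v\<in>x. eval_mpoly h v \<noteq> 0 \<and> (crd j i \<circ> f) x = eval_mpoly g v / eval_mpoly h v)"
  proof
    fix i assume "i \<in> {..n}"
    then have "crd j i \<circ> f \<in> regular (proj_variety r (proj_points r)) W0" using reg[of i] by (simp add: L_def proj_space_def)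
    from regular_proj_varietyE[OF this p0W]
    show "\<exists>W d g h. openin (topol L) W \<and> p0 \<in> W \<and> W \<subseteq> W0 \<and> homogeneous r d g \<and> homogeneous r d h \<and>
      (\<forall>x\<in>W. \<forall>v\<in>x. eval_mpoly h v \<noteq> 0 \<and> (crd j i \<circ> f) x = eval_mpoly g v / eval_mpoly h v)"
      unfolding L_def proj_space_def by metis
  qed
  then have "\<exists>W d g h. \<forall>i\<in>{..n}. openin (topol L) (W i) \<and> p0 \<in> W i \<and> W i \<subseteq> W0 \<and> homogeneous r (d i) (g i) \<and> homogeneous r (d i) (h i) \<and>
    (\<forall>x\<in>W i. \<forall>v\<in>x. eval_mpoly (h i) v \<noteq> 0 \<and> (crd j i \<circ> f) x = eval_mpoly (g i) v / eval_mpoly (h i) v)"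
    unfolding bchoice_iff .
  then obtain W d g h where "\<forall>i\<in>{..n}. openin (topol L) (W i) \<and> p0 \<in> W i \<and> W i \<subseteq> W0 \<and> homogeneous r (d i) (g i) \<and> homogeneous r (d i) (h i) \<and>
    (\<forall>x\<in>W i. \<forall>v\<in>x. eval_mpoly (h i) v \<noteq> 0 \<and> (crd j i \<circ> f) x = eval_mpoly (g i) v / eval_mpoly (h i) v)"
    by (elim exE) (rule that)
  then have W: "\<And>i. i \<le> n \<Longrightarrow> openin (topol L) (W i) \<and> p0 \<in> W i \<and> W i \<subseteq> W0 \<and> homogeneous r (d i) (g i) \<and> homogeneous r (d i) (h i) \<and>
    (\<forall>x\<in>W i. \<forall>v\<in>x. eval_mpoly (h i) v \<noteq> 0 \<and> (crd j i \<circ> f) x = eval_mpoly (g i) v / eval_mpoly (h i) v)"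
    unfolding Ball_def atMost_iff by (elim allE impE)
  define WW where "WW = (\<Inter>i\<in>{..n}. W i)"
  have WWo: "openin (zariski r) WW" unfolding WW_def topL[symmetric] using W by (intro openin_INT2) auto
  have p0WW: "p0 \<in> WW" using W by (auto simp: WW_def)
  obtain k e where k: "homogeneous r e k" "p0 \<in> nonvan r k" "nonvan r k \<subseteq> WW"
    by (rule zariski_basis[OF WWo p0WW])
  obtain us where us: "p0 = pt r us" "\<exists>i\<le>r. us i \<noteq> 0" using k(2) unfolding nonvan_def proj_points_pt by blast
  obtain l where l: "l \<le> r" "us l \<noteq> 0" using us(2) by blast
  define F where "F i u = (if i \<le> n then eval_mpoly (g i) (vec (r + 1) u) * (\<Prod>t\<in>{..n} - {i}. eval_mpoly (h t) (vec (r + 1) u)) else 0)" for i and u :: "nat \<Rightarrow> 'k"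
  \<comment> \<open>The factor \<open>u l\<close> excludes the zero vector, and \<open>k\<close>
    cuts out a neighbourhood inside all the \<open>W i\<close>.\<close>
  define H where "H u = u l * eval_mpoly k (vec (r + 1) u)" for u :: "nat \<Rightarrow> 'k"
  show thesis
  proof (rule that[of F H us])
    show "F i \<in> polyfun" for i
    proof (cases "i \<le> n")
      case True
      have "(\<lambda>u. eval_mpoly (g i) (vec (r + 1) u) * (\<Prod>t\<in>{..n} - {i}. eval_mpoly (h t) (vec (r + 1) u))) \<in> polyfun"
        using W True by (intro polyfun.mult polyfun_prod eval_polyfun) auto
      then show ?thesis unfolding F_def[abs_def] using True by simp
    qed (simp add: F_def[abs_def] polyfun.const)
    show "H \<in> polyfun" unfolding H_def[abs_def] by (intro polyfun.mult polyfun.var eval_polyfun[OF k(1)])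
    show "H us \<noteq> 0" using l(2) k(2) pt_nonvanish[OF k(1)] unfolding H_def us(1) nonvan_def by simp
    fix u assume Hu: "H u \<noteq> 0"
    have "pt r u \<in> proj_points r" unfolding proj_points_pt using Hu l(1) by (auto simp: H_def)
    then have "pt r u \<in> nonvan r k" using Hu pt_nonvanish[OF k(1)] unfolding nonvan_def H_def by simp
    then have uW: "pt r u \<in> W i" if "i \<le> n" for i using k(3) that unfolding WW_def by auto
    have uW0: "pt r u \<in> W0" using uW[of 0] W[of 0] by auto
    then have uU: "pt r u \<in> U" and fV: "f (pt r u) \<in> V" by (auto simp: W0_def)
    let ?h = "\<lambda>t. eval_mpoly (h t) (vec (r + 1) u)"
    have hh: "?h i \<noteq> 0" "crd j i (f (pt r u)) = eval_mpoly (g i) (vec (r + 1) u) / ?h i" if "i \<le> n" for i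
      using W[OF that] uW[OF that] vec_in_pt[of r u] by auto
    define s where "s = (\<Prod>t\<in>{..n}. ?h t)"
    have s: "s \<noteq> 0" using hh(1) by (simp add: s_def prod_zero_iff)
    have Fi: "F i u = s * crd j i (f (pt r u))" if "i \<le> n" for i
    proof -
      have "s = ?h i * (\<Prod>t\<in>{..n} - {i}. ?h t)" unfolding s_def using that by (subst prod.remove[of _ i]) auto
      then show ?thesis unfolding F_def hh(2)[OF that] using hh(1)[OF that] that by simp
    qed
    note rep = chart_at_rep[OF X fV[unfolded V_def] j(1)]
    have "pt n (\<lambda>i. F i u) = pt n (\<lambda>i. s * crd j i (f (pt r u)))" by (rule pt_cong) (rule Fi)
    then have "f (pt r u) = pt n (\<lambda>i. F i u)" using pt_scale[OF s] rep(1) by simp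
    moreover have "F j u \<noteq> 0" using Fi[OF j(1)] rep(2) s by simp
    ultimately show "pt r u \<in> U \<and> (\<exists>i\<le>n. F i u \<noteq> 0) \<and> f (pt r u) = pt n (\<lambda>i. F i u) \<and> f (pt r u) \<in> X"
      using uU fX[OF uU] j(1) by blast
  qed
qed

section \<open>Stable linearizability\<close>

text \<open>\<open>\<delta> h j\<close> is a two-by-two minor of \<open>P h\<close> and
  \<open>u\<close>; it vanishes at \<open>P h\<close> and its rows are chosen so that it does not
  vanish at \<open>P j\<close>. The squares make the degree even, which hides the signs of the
  lifts.\<close>

lemma separating_forms:
  fixes P :: "'g \<Rightarrow> nat \<Rightarrow> 'k::field_char_0"
  assumes fin: "finite S"
    and P: "\<And>h j. h \<in> S \<Longrightarrow> j \<in> S \<Longrightarrow> h \<noteq> j \<Longrightarrow> \<exists>\<alpha><d. \<exists>\<beta><d. P h \<alpha> * P j \<beta> \<noteq> P h \<beta> * P j \<alpha>"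
  obtains \<theta> :: "'g \<Rightarrow> (nat \<Rightarrow> 'k) \<Rightarrow> 'k" where
    "\<forall>j. \<theta> j \<in> polyfun"
    "\<forall>j\<in>S. \<forall>c u. \<theta> j (\<lambda>i. c * u i) = c ^ (2 * (card S - 1)) * \<theta> j u"
    "\<forall>j\<in>S. \<forall>u u'. (\<forall>i<d. u i = u' i) \<longrightarrow> \<theta> j u = \<theta> j u'"
    "\<forall>j\<in>S. \<forall>h\<in>S. \<theta> j (P h) \<noteq> 0 \<longleftrightarrow> h = j"
proof -
  have "\<forall>p\<in>{(h, j). h \<in> S \<and> j \<in> S \<and> h \<noteq> j}. \<exists>s. fst s < d \<and> snd s < d \<and>
      P (fst p) (fst s) * P (snd p) (snd s) \<noteq> P (fst p) (snd s) * P (snd p) (fst s)"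
  proof (intro ballI)
    fix p assume "p \<in> {(h, j). h \<in> S \<and> j \<in> S \<and> h \<noteq> j}"
    then have "fst p \<in> S" "snd p \<in> S" "fst p \<noteq> snd p" by auto
    then obtain \<alpha> \<beta> where "\<alpha> < d" "\<beta> < d" "P (fst p) \<alpha> * P (snd p) \<beta> \<noteq> P (fst p) \<beta> * P (snd p) \<alpha>"
      using P by blast
    then show "\<exists>s. fst s < d \<and> snd s < d \<and>
      P (fst p) (fst s) * P (snd p) (snd s) \<noteq> P (fst p) (snd s) * P (snd p) (fst s)"
      by (intro exI[of _ "(\<alpha>, \<beta>)"]) simp
  qed
  then obtain s where s0: "\<forall>p\<in>{(h, j). h \<in> S \<and> j \<in> S \<and> h \<noteq> j}. fst (s p) < d \<and> snd (s p) < d \<and>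
      P (fst p) (fst (s p)) * P (snd p) (snd (s p)) \<noteq> P (fst p) (snd (s p)) * P (snd p) (fst (s p))"
    by (rule bchoice[THEN exE])
  have s: "fst (s (h, j)) < d \<and> snd (s (h, j)) < d \<and>
      P h (fst (s (h, j))) * P j (snd (s (h, j))) \<noteq> P h (snd (s (h, j))) * P j (fst (s (h, j)))"
    if "h \<in> S" "j \<in> S" "h \<noteq> j" for h j using s0[rule_format, of "(h, j)"] that by simp
  define \<delta> where "\<delta> h j u = P h (fst (s (h, j))) * u (snd (s (h, j))) - P h (snd (s (h, j))) * u (fst (s (h, j)))"
    for h j and u :: "nat \<Rightarrow> 'k"
  have \<delta>_scale: "\<delta> h j (\<lambda>i. c * u i) = c * \<delta> h j u" for h j c u by (simp add: \<delta>_def algebra_simps)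
  have \<delta>_eq: "\<delta> h j u = P h (fst (s (h, j))) * u (snd (s (h, j))) + (- P h (snd (s (h, j)))) * u (fst (s (h, j)))" for h j u
    by (simp add: \<delta>_def)
  show thesis
  proof (rule that[of "\<lambda>j u. \<Prod>h\<in>S - {j}. \<delta> h j u ^ 2"]; intro allI ballI impI)
    show "(\<lambda>u. \<Prod>h\<in>S - {j}. \<delta> h j u ^ 2) \<in> polyfun" for j
      unfolding \<delta>_eq by (intro polyfun_prod polyfun_power polyfun.add polyfun.mult polyfun.const polyfun.var)
    fix j assume j: "j \<in> S"
    show "(\<Prod>h\<in>S - {j}. \<delta> h j (\<lambda>i. c * u i) ^ 2) = c ^ (2 * (card S - 1)) * (\<Prod>h\<in>S - {j}. \<delta> h j u ^ 2)" for c u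
      using j fin by (simp add: \<delta>_scale power_mult_distrib prod.distrib power_mult)
    show "(\<Prod>h\<in>S - {j}. \<delta> h j u ^ 2) = (\<Prod>h\<in>S - {j}. \<delta> h j u' ^ 2)" if "\<forall>i<d. u i = u' i" for u u'
      by (rule prod.cong[OF refl]) (use s j that in \<open>auto simp: \<delta>_def\<close>)
    fix h assume h: "h \<in> S"
    show "(\<Prod>h'\<in>S - {j}. \<delta> h' j (P h) ^ 2) \<noteq> 0 \<longleftrightarrow> h = j"
    proof (cases "h = j")
      case True
      have "\<delta> h' j (P h) \<noteq> 0" if "h' \<in> S - {j}" for h' using s[of h' j] j that True by (auto simp: \<delta>_def)
      then show ?thesis using True fin by (simp add: prod_zero_iff)
    next
      case False
      then have "\<delta> h j (P h) = 0" "h \<in> S - {j}" using h by (auto simp: \<delta>_def)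
      then show ?thesis using False fin by (auto simp: prod_zero_iff)
    qed
  qed
qed

context projective_lift begin

lemma act_act: "g \<in> carrier G \<Longrightarrow> h \<in> carrier G \<Longrightarrow> \<phi> g (\<phi> h (pt n u)) = \<phi> (g \<otimes> h) (pt n u)"
proof -
  assume g: "g \<in> carrier G" and h: "h \<in> carrier G"
  obtain \<epsilon> where e: "\<epsilon> = 1 \<or> \<epsilon> = -1" "\<And>x i. i < d \<Longrightarrow> mv d (a g) (mv d (a h) x) i = \<epsilon> * mv d (a (g \<otimes> h)) x i"
    using a_mult_mv[OF g h] by auto
  have "pt n (mv d (a g) (mv d (a h) u)) = pt n (\<lambda>i. \<epsilon> * mv d (a (g \<otimes> h)) u i)"
    by (rule pt_cong) (simp add: e(2) less_d)
  also have "\<dots> = pt n (mv d (a (g \<otimes> h)) u)" by (rule pt_scale) (use e(1) in auto)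
  finally show ?thesis using g h by (simp add: \<phi>)
qed

lemma act_one: "\<phi> \<one> (pt n u) = pt n u"
  unfolding \<phi>[OF one_closed] by (rule pt_cong) (simp add: mv_one less_d)

text \<open>If all minors vanished, two translates would be the same point, and
  \<open>j \<otimes> inv h\<close> would be a nontrivial element of the stabilizer.\<close>

lemma orbit_separated:
  assumes u0: "\<exists>i\<le>n. u0 i \<noteq> 0" and stab: "stabilizer G \<phi> (pt n u0) = {\<one>}"
    and h: "h \<in> carrier G" and j: "j \<in> carrier G" and hj: "h \<noteq> j"
  shows "\<exists>\<alpha><d. \<exists>\<beta><d. mv d (a (inv h)) u0 \<alpha> * mv d (a (inv j)) u0 \<beta> \<noteq> mv d (a (inv h)) u0 \<beta> * mv d (a (inv j)) u0 \<alpha>"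
proof (rule ccontr)
  assume neg: "\<not> ?thesis"
  let ?P = "\<lambda>h. mv d (a (inv h)) u0"
  have u0d: "\<exists>i<d. u0 i \<noteq> 0" using u0 less_d by auto
  obtain \<beta> where \<beta>: "\<beta> < d" "?P j \<beta> \<noteq> 0" using a_nonzero[OF inv_closed[OF j] u0d] by blast
  have e: "?P h \<alpha> = (?P h \<beta> / ?P j \<beta>) * ?P j \<alpha>" if "\<alpha> < d" for \<alpha>
    using neg that \<beta> by (auto simp: field_simps)
  have "?P h \<beta> \<noteq> 0"
  proof
    assume "?P h \<beta> = 0"
    then have "?P h \<alpha> = 0" if "\<alpha> < d" for \<alpha> using e[OF that] by simp
    then show False using a_nonzero[OF inv_closed[OF h] u0d] by blast
  qed
  then have c: "?P h \<beta> / ?P j \<beta> \<noteq> 0" using \<beta> by simp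
  have "pt n (?P h) = pt n (\<lambda>\<alpha>. (?P h \<beta> / ?P j \<beta>) * ?P j \<alpha>)"
    by (rule pt_cong) (use e less_d in blast)
  then have "pt n (?P h) = pt n (?P j)" using pt_scale[OF c] by simp
  then have "\<phi> (inv h) (pt n u0) = \<phi> (inv j) (pt n u0)" using h j by (simp add: \<phi>)
  then have "\<phi> (j \<otimes> inv h) (pt n u0) = pt n u0"
    using act_act[OF j inv_closed[OF h], of u0] act_act[OF j inv_closed[OF j], of u0] act_one j by simp
  then have "j \<otimes> inv h \<in> stabilizer G \<phi> (pt n u0)" using h j by (simp add: stabilizer_def)
  then have "j \<otimes> inv h = \<one>" using stab by simp
  then show False using h j hj by (metis inv_equality inv_inv inv_closed)
qed

text \<open>The equivariant map \<open>lc\<close> from \<open>W\<close> to the representation must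
  meet the domain of the rational map. It is an average over \<open>H\<close>, arranged to take the
  prescribed value \<open>us\<close> at \<open>ws\<close>.\<close>

lemma linearizable_point:
  assumes H: "subgroup H G" and lin: "stably_linearizable (G\<lparr>carrier := H\<rparr>) (proj_variety n X) \<phi>"
  obtains Z where "\<exists>i<d. Z i \<noteq> 0" "qf d (\<lambda>i j. pconst (Q i j)) Z = 0" "par_inv H Z"
proof -
  have sub: "h \<in> carrier G" if "h \<in> H" for h using subgroup.mem_carrier[OF H that] .
  obtain m r \<sigma> U f where \<sigma>: "\<sigma> \<in> hom (G\<lparr>carrier := H\<rparr>) (GL (r + 1))"
    and bir: "birational_map (proj_space r) (product_space (proj_variety n X) (proj_space m)) U f"
    and equ: "rationally_equivariant (G\<lparr>carrier := H\<rparr>) (\<lambda>g p. (\<lambda>v. \<sigma> g *\<^sub>v v) ` p) (\<lambda>g (x, y). (\<phi> g x, y)) U f"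
    using lin unfolding stably_linearizable_def linearizable_def by (elim exE conjE) (rule that)
  interpret P: fspace_pair "proj_variety n X" "proj_space m :: ('k vec set, 'k) fun_space"
    unfolding fspace_pair_def proj_space_def by (intro conjI fspace_proj_variety X_sub subset_refl)
  have "rational_map (proj_space r) (proj_variety n X) U (fst \<circ> f)"
    using bir morphism_compose[OF _ P.morphism_fst] unfolding rational_map_def birational_map_def by blast
  then obtain F Hd us where F: "\<And>i. F i \<in> polyfun" "Hd \<in> polyfun" "Hd us \<noteq> 0"
    "\<And>u. Hd u \<noteq> 0 \<Longrightarrow> pt r u \<in> U \<and> (\<exists>i\<le>n. F i u \<noteq> 0) \<and> (fst \<circ> f) (pt r u) = pt n (\<lambda>i. F i u) \<and> (fst \<circ> f) (pt r u) \<in> X"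
  proof (rule rational_map_coordinates[OF X_sub], goal_cases)
    case (1 F H us)
    show ?case by (rule 1(1)) (fact 1)+
  qed
  define R where "R = r + 1"
  define s where "s g = mfun (\<sigma> g)" for g
  have \<sigma>c: "\<sigma> g \<in> carrier_mat (R) (R)" if "g \<in> H" for g
    using hom_in_carrier[OF \<sigma>, of g] that GL_carrier by (auto simp: R_def)
  have \<sigma>m: "\<sigma> (g \<otimes> h) = \<sigma> g * \<sigma> h" if "g \<in> H" "h \<in> H" for g h
    using hom_mult[OF \<sigma>, of g h] that by (simp add: GL_mult)
  have s_mult: "mv R (s g) (mv R (s h) u) i = mv R (s (g \<otimes> h)) u i" if "g \<in> H" "h \<in> H" "i < R" for g h u i
    unfolding mv_mv unfolding mv_def s_def \<sigma>m[OF that(1,2)]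
    by (rule sum.cong[OF refl]) (simp add: mfun_mult[OF \<sigma>c[OF that(1)] \<sigma>c[OF that(2)] that(3)])
  have oneH: "\<one> \<in> H" by (rule subgroup.one_closed[OF H])
  have "\<sigma> \<one> = 1\<^sub>m (R)"
  proof -
    obtain B where B: "B \<in> carrier_mat (R) (R)" "\<sigma> \<one> * B = 1\<^sub>m (R)"
      using hom_in_carrier[OF \<sigma>, of \<one>] oneH GL_carrier by (auto simp: R_def)
    have "\<sigma> \<one> * (\<sigma> \<one> * B) = \<sigma> \<one> * \<sigma> \<one> * B" by (rule assoc_mult_mat[OF \<sigma>c[OF oneH] \<sigma>c[OF oneH] B(1), symmetric])
    also have "\<dots> = \<sigma> \<one> * B" using \<sigma>m[OF oneH oneH] by simp
    finally show ?thesis using \<sigma>c[OF oneH] by (simp add: B(2))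
  qed
  then have s_one: "mv R (s \<one>) u i = u i" if "i < R" for u i
  proof -
    have "mv R (s \<one>) u i = (\<Sum>l<R. if i = l then u l else 0)"
      unfolding mv_def s_def \<open>\<sigma> \<one> = _\<close> by (rule sum.cong) (use that in \<open>auto simp: mfun_def\<close>)
    then show ?thesis using that by simp
  qed
  have act_pt: "(\<lambda>v. \<sigma> g *\<^sub>v v) ` pt r u = pt r (mv R (s g) u)" if "g \<in> H" for g u
  proof -
    have "\<sigma> g *\<^sub>v vec R (\<lambda>i. c * u i) = vec R (\<lambda>i. c * mv R (s g) u i)" for c
      unfolding mat_vec_mfun[OF \<sigma>c[OF that]] mv_scale[abs_def, symmetric] s_def ..
    then have "(\<lambda>v. \<sigma> g *\<^sub>v v) ` {vec R (\<lambda>i. c * u i) | c. c \<noteq> 0} = {vec R (\<lambda>i. c * mv R (s g) u i) | c. c \<noteq> 0}"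
      by (simp only: image_Collect) metis
    then show ?thesis unfolding pt_alt R_def .
  qed
  \<comment> \<open>Any injective numbering yields distinct coordinates, since the characteristic is
    zero.\<close>
  obtain t :: "'g \<Rightarrow> nat" where t: "inj_on t (carrier G)" using finite_imp_inj_to_nat_seg[OF fin] by blast
  define ws where "ws x = (of_nat (t x) :: 'k)" for x
  have ws: "inj_on ws (carrier G)" using t by (auto simp: inj_on_def ws_def)
  obtain \<psi> where \<psi>: "\<And>x. x \<in> carrier G \<Longrightarrow> poly \<psi> (ws x) = (if x = \<one> then 1 else 0)"
    using poly_interpolation_ex[OF fin ws, of "\<lambda>x. if x = \<one> then 1 else 0"] by blast
  \<comment> \<open>At \<open>ws\<close> the factor \<open>poly \<psi> (w h)\<close> keeps only the
    unit. Entries from \<open>R\<close> on copy \<open>us\<close>, so that \<open>lc ws = us\<close>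
    holds as an equation of functions.\<close>
  define lc where "lc w i = (if i < R then \<Sum>h\<in>H. poly \<psi> (w h) * mv R (s h) us i else us i)" for w :: "'g \<Rightarrow> 'k" and i
  have finH: "finite H" using finite_subset[OF _ fin] sub by blast
  have lc_ws: "lc ws = us"
  proof
    fix i
    have "(\<Sum>h\<in>H. poly \<psi> (ws h) * mv R (s h) us i) = (\<Sum>h\<in>H. if h = \<one> then mv R (s h) us i else 0)"
      by (rule sum.cong[OF refl]) (simp add: \<psi> sub)
    then show "lc ws i = us i" using finH oneH by (simp add: lc_def s_one)
  qed
  have lc_poly: "(\<lambda>w. lc w i) \<in> polyfun" for i
    by (cases "i < R") (auto simp: lc_def[abs_def] intro!: polyfun_sum polyfun.mult polyfun_poly polyfun.const polyfun.var)
  have lc_equiv: "mv R (s g) (lc (\<lambda>x. w (tr g x))) i = lc w i" if g: "g \<in> H" and i: "i < R" for g w i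
  proof -
    have "mv R (s g) (lc (\<lambda>x. w (tr g x))) i = mv R (s g) (\<lambda>j. \<Sum>h\<in>H. poly \<psi> (w (tr g h)) * mv R (s h) us j) i"
      unfolding mv_def[of _ "s g"] lc_def by (rule sum.cong) auto
    also have "\<dots> = (\<Sum>h\<in>H. poly \<psi> (w (tr g h)) * mv R (s g) (mv R (s h) us) i)"
      unfolding mv_def[of _ "s g"] sum_distrib_left by (subst sum.swap) (simp add: mult_ac)
    also have "\<dots> = (\<Sum>h\<in>H. poly \<psi> (w (g \<otimes> h)) * mv R (s (g \<otimes> h)) us i)"
      by (rule sum.cong[OF refl]) (simp add: s_mult[OF g _ i] tr_def sub)
    also have "\<dots> = (\<Sum>h\<in>H. poly \<psi> (w h) * mv R (s h) us i)"
    proof (rule sum.reindex_bij_witness[of _ "\<lambda>h. inv g \<otimes> h" "\<lambda>h. g \<otimes> h"])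
      show "inv g \<otimes> h \<in> H" "g \<otimes> h \<in> H" if "h \<in> H" for h
        using that g H by (auto intro: subgroup.m_closed subgroup.m_inv_closed)
    qed (use g sub in \<open>auto simp: m_assoc[symmetric]\<close>)
    finally show ?thesis using i by (simp add: lc_def)
  qed
  define Z where "Z i = (Abs_pfun (\<lambda>w. F i (lc w)) :: ('g, 'k) pfun)" for i
  define B where "B = (Abs_pfun (\<lambda>w. Hd (lc w)) :: ('g, 'k) pfun)"
  have evZ: "ev (Z i) w = F i (lc w)" for i w unfolding Z_def by (rule ev_inverse) (rule polyfun_compose[OF F(1) lc_poly])
  have evB: "ev B w = Hd (lc w)" for w unfolding B_def by (rule ev_inverse) (rule polyfun_compose[OF F(2) lc_poly])
  have "B \<noteq> 0" using evB[of ws] F(3) lc_ws by auto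
  \<comment> \<open>Identities are known only where \<open>Hd (lc w)\<close> is nonzero; they extend
    because there are no zero divisors.\<close>
  have vanish: "P = 0" if "\<And>w. Hd (lc w) \<noteq> 0 \<Longrightarrow> ev P w = 0" for P
  proof -
    have "B * P = 0" by (rule pfun_eqI) (use that evB in auto)
    then show ?thesis using \<open>B \<noteq> 0\<close> by simp
  qed
  show thesis
  proof (rule that[of Z])
    obtain i where "i \<le> n" "F i us \<noteq> 0" using F(4)[OF F(3)] by blast
    then have "ev (Z i) ws \<noteq> 0" by (simp add: evZ lc_ws)
    then have "Z i \<noteq> 0" by auto
    then show "\<exists>i<d. Z i \<noteq> 0" using \<open>i \<le> n\<close> less_d by blast
    show "qf d (\<lambda>i j. pconst (Q i j)) Z = 0"
    proof (rule vanish)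
      fix w assume w: "Hd (lc w) \<noteq> 0"
      have "qf d Q (\<lambda>i. F i (lc w)) = 0" using F(4)[OF w] pt_in_X[of "\<lambda>i. F i (lc w)"] by metis
      then show "ev (qf d (\<lambda>i j. pconst (Q i j)) Z) w = 0" by (simp add: qf_def evZ)
    qed
    show "par_inv H Z"
      unfolding par_inv_def
    proof (intro ballI allI impI)
      fix g i j assume g: "g \<in> H" and i: "i < d" and j: "j < d"
      interpret ps: inj_idom_hom "psubst (tr g) :: ('g, 'k) pfun \<Rightarrow> _" by (rule psubst_hom[OF tr_bij[OF sub[OF g]]])
      let ?P = "pact g Z i * Z j - pact g Z j * Z i"
      \<comment> \<open>Equivariance compares \<open>w\<close> with its translate, so both must lie
        in the domain; the extra factor handles the translate.\<close>
      have "psubst (tr g) B * ?P = 0"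
      proof (rule vanish)
        fix w assume w: "Hd (lc w) \<noteq> 0"
        let ?w' = "\<lambda>x. w (tr g x)"
        have ep: "ev (pact g Z i) w = mv d (a g) (\<lambda>j. F j (lc ?w')) i" for i
          by (simp add: pact_def mv_def evZ)
        show "ev (psubst (tr g) B * ?P) w = 0"
        proof (cases "Hd (lc ?w') = 0")
          case False
          note A = F(4)[OF w] and A' = F(4)[OF False]
          have p: "(\<lambda>v. \<sigma> g *\<^sub>v v) ` pt r (lc ?w') = pt r (lc w)"
            unfolding act_pt[OF g] by (rule pt_cong) (rule lc_equiv[OF g], simp add: R_def)
          have "f (pt r (lc w)) = (case f (pt r (lc ?w')) of (x, y) \<Rightarrow> (\<phi> g x, y))"
            using equ g A A' p unfolding rationally_equivariant_def by fastforce
          then have "fst (f (pt r (lc w))) = \<phi> g (fst (f (pt r (lc ?w'))))" by (simp add: split_beta)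
          then have "pt n (\<lambda>i. F i (lc w)) = pt n (mv d (a g) (\<lambda>i. F i (lc ?w')))"
            using A A' \<phi>[OF sub[OF g]] by simp
          then obtain c where c: "\<forall>i\<le>n. F i (lc w) = c * mv d (a g) (\<lambda>i. F i (lc ?w')) i"
            using pt_eq_iff[of n "\<lambda>i. F i (lc w)"] A by blast
          then show ?thesis using i j by (simp add: ep evZ less_d mult_ac)
        qed (simp add: evB)
      qed
      then show "pact g Z i * Z j = pact g Z j * Z i" using \<open>B \<noteq> 0\<close> by simp
    qed
  qed
qed

end

theorem (in projective_lift) stably_linearizable_descent:
  assumes quad: "quadric d Q" and H: "subgroup H G" "odd (card (lcosets H))"
    and gf: "generically_free G (proj_variety n X) \<phi>"
    and lin: "stably_linearizable (G\<lparr>carrier := H\<rparr>) (proj_variety n X) \<phi>"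
  shows "stably_linearizable G (proj_variety n X) \<phi>"
proof -
  obtain Y where "\<exists>i<d. Y i \<noteq> 0" "qf d (\<lambda>i j. pconst (Q i j)) Y = 0" "par_inv H Y"
    by (rule linearizable_point[OF H(1) lin])
  from descent_pfun[OF H this] obtain Z where
    Z: "\<exists>i<d. Z i \<noteq> 0" "qf d (\<lambda>i j. pconst (Q i j)) Z = 0" "par_inv (carrier G) Z" .
  then obtain k0 where k0: "k0 < d" "Z k0 \<noteq> 0" by blast
  \<comment> \<open>One point \<open>ws\<close> has to keep \<open>Z k0\<close> nonzero at all its
    translates and have distinct coordinates on \<open>G\<close>; both are the nonvanishing of this
    product.\<close>
  define P where "P = (\<Prod>g\<in>carrier G. psubst (tr g) (Z k0)) *
    (\<Prod>p\<in>carrier G \<times> carrier G - Id. pvar (fst p) - pvar (snd p))"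
  have "psubst (tr g) (Z k0) \<noteq> 0" if "g \<in> carrier G" for g
  proof -
    interpret inj_idom_hom "psubst (tr g) :: ('g, 'k) pfun \<Rightarrow> _" by (rule psubst_hom[OF tr_bij[OF that]])
    show ?thesis using k0(2) by simp
  qed
  moreover have "pvar g - pvar h \<noteq> (0 :: ('g, 'k) pfun)" if "g \<noteq> h" for g h
  proof
    assume "pvar g - pvar h = (0 :: ('g, 'k) pfun)"
    then have "ev (pvar g - pvar h) (\<lambda>x. if x = g then 1 else 0) = (0 :: 'k)" by simp
    then show False using that by (auto split: if_splits)
  qed
  ultimately have "P \<noteq> 0" using fin by (auto simp: P_def)
  then obtain ws where ws: "ev P ws \<noteq> 0" using pfun_nonzero by blast
  have ws_Z: "ev (Z k0) (\<lambda>x. ws (tr g x)) \<noteq> 0" if "g \<in> carrier G" for g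
    using ws fin that by (auto simp: P_def)
  have "ws g \<noteq> ws h" if "g \<in> carrier G" "h \<in> carrier G" "g \<noteq> h" for g h
  proof -
    have "(g, h) \<in> carrier G \<times> carrier G - Id" "finite (carrier G \<times> carrier G - Id)" using that fin by auto
    moreover have "\<forall>p\<in>carrier G \<times> carrier G - Id. ws (fst p) - ws (snd p) \<noteq> 0"
      using ws calculation(2) by (simp add: P_def prod_zero_iff)
    ultimately have "ws (fst (g, h)) - ws (snd (g, h)) \<noteq> 0" by blast
    then show ?thesis by simp
  qed
  then have ws_inj: "inj_on ws (carrier G)" unfolding inj_on_def by blast
  obtain \<psi> where \<psi>: "\<And>x. x \<in> carrier G \<Longrightarrow> poly \<psi> (ws x) = (if x = \<one> then 1 else 0)"
    using poly_interpolation_ex[OF fin ws_inj, of "\<lambda>x. if x = \<one> then 1 else 0"] by blast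
  \<comment> \<open>\<open>Z(ws)\<close> is a point of \<open>X\<close>, so the dense open set of
    points with trivial stabilizer is nonempty and supplies \<open>u0\<close>.\<close>
  define u where "u i = ev (Z i) ws" for i
  have "u k0 \<noteq> 0" using ws_Z[OF one_closed] by (simp add: u_def tr_one)
  moreover have "qf d Q u = ev (qf d (\<lambda>i j. pconst (Q i j)) Z) ws" by (simp add: qf_def u_def)
  ultimately have "pt n u \<in> X" using k0(1) pt_in_X[of u] Z(2) less_d by auto
  obtain V where V: "dense_open (proj_variety n X) V" "\<And>x. x \<in> V \<Longrightarrow> stabilizer G \<phi> x = {\<one>}"
    using gf unfolding generically_free_def by blast
  have "openin (topol (proj_variety n X)) V" using V(1) by (simp add: dense_open_def)
  from openin_subset[OF this] have "V \<subseteq> X" by (simp add: topspace_proj_variety[OF X_sub])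
  moreover have "V \<noteq> {}"
    using dense_open_meets[OF V(1) openin_topspace] \<open>pt n u \<in> X\<close> by (auto simp: topspace_proj_variety[OF X_sub])
  ultimately obtain u0 where u0: "\<exists>i\<le>n. u0 i \<noteq> 0" "qf d Q u0 = 0" "stabilizer G \<phi> (pt n u0) = {\<one>}"
    using V(2) unfolding X_eq by blast
  then obtain j0 where j0: "j0 \<le> n" "u0 j0 \<noteq> 0" by blast
  obtain \<theta> where \<theta>: "\<forall>j. \<theta> j \<in> polyfun"
    "\<forall>j\<in>carrier G. \<forall>c u. \<theta> j (\<lambda>i. c * u i) = c ^ (2 * (card (carrier G) - 1)) * \<theta> j u"
    "\<forall>j\<in>carrier G. \<forall>u u'. (\<forall>i<d. u i = u' i) \<longrightarrow> \<theta> j u = \<theta> j u'"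
    "\<forall>j\<in>carrier G. \<forall>h\<in>carrier G. \<theta> j (mv d (a (inv h)) u0) \<noteq> 0 \<longleftrightarrow> h = j"
    by (rule separating_forms[OF fin, of d "\<lambda>h. mv d (a (inv h)) u0", OF orbit_separated[OF u0(1,3)]])
  obtain en where en: "bij_betw en {..<card (carrier G)} (carrier G)"
    using ex_bij_betw_nat_finite[OF fin] by (auto simp: atLeast0LessThan)
  interpret quadric d Q by (rule quad)
  interpret stable_map G d Q a Z k0 ws \<psi> \<theta> "2 * (card (carrier G) - 1)" en u0 n X \<phi> j0
  proof unfold_locales
    show "\<exists>i<d. u0 i \<noteq> 0" using u0(1) less_d by auto
    show "\<theta> j u = \<theta> j u'" if "j \<in> carrier G" "\<And>i. i < d \<Longrightarrow> u i = u' i" for j u u'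
      using \<theta>(3) that by blast
  qed (use k0 Z ws_Z \<psi> \<theta> en u0 j0 d_n X_eq \<phi> in auto)
  show ?thesis unfolding stably_linearizable_def by (rule exI, rule linearizable_product)
qed

text \<open>By Lagrange's theorem an even index would put one more factor 2 into the order than its
  multiplicity allows.\<close>

lemma sylow_odd_index:
  assumes "group G" "finite (carrier G)" "sylow_subgroup 2 H G"
  shows "odd (card (lcosets\<^bsub>G\<^esub> H))"
proof -
  interpret group G by (rule assms(1))
  have H: "subgroup H G" "card H = 2 ^ multiplicity 2 (order G)" using assms(3) by (auto simp: sylow_subgroup_def)
  have l: "card (lcosets\<^bsub>G\<^esub> H) * card H = order G" by (rule l_lagrange[OF assms(2) H(1)])
  have "order G \<noteq> 0" using assms(2) by (auto simp: order_def)
  then have "\<not> 2 ^ Suc (multiplicity 2 (order G)) dvd order G"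
    by (subst power_dvd_iff_le_multiplicity) auto
  moreover have "2 ^ Suc (multiplicity 2 (order G)) dvd order G" if "even (card (lcosets\<^bsub>G\<^esub> H))"
    using mult_dvd_mono[OF that dvd_refl[of "card H"]] unfolding l by (simp add: H(2))
  ultimately show ?thesis by blast
qed

lemma stably_linearizable_subgroup:
  assumes "stably_linearizable G X \<phi>" "H \<subseteq> carrier G"
  shows "stably_linearizable (G\<lparr>carrier := H\<rparr>) X \<phi>"
proof -
  obtain m r \<sigma> U f where \<sigma>: "\<sigma> \<in> hom G (GL (r + 1))"
    and bir: "birational_map (proj_space r) (product_space X (proj_space m)) U f"
    and equ: "rationally_equivariant G (\<lambda>g p. (\<lambda>v. \<sigma> g *\<^sub>v v) ` p) (\<lambda>g (x, y). (\<phi> g x, y)) U f"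
    using assms(1) unfolding stably_linearizable_def linearizable_def by (elim exE conjE) (rule that)
  have "\<sigma> \<in> hom (G\<lparr>carrier := H\<rparr>) (GL (r + 1))"
    using \<sigma> assms(2) by (auto simp: hom_def)
  moreover have "rationally_equivariant (G\<lparr>carrier := H\<rparr>) (\<lambda>g p. (\<lambda>v. \<sigma> g *\<^sub>v v) ` p) (\<lambda>g (x, y). (\<phi> g x, y)) U f"
    using equ assms(2) unfolding rationally_equivariant_def by auto
  ultimately show ?thesis using bir unfolding stably_linearizable_def linearizable_def by blast
qed

theorem proposition5p3:
  fixes G :: "('g, 'a) monoid_scheme"
    and X :: "'k::{alg_closed_field, field_char_0} vec set set"
    and \<rho> :: "'g \<Rightarrow> 'k mat set"
    and n :: nat
  assumes "group G" and "finite (carrier G)"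
    and "n \<ge> 2" and "smooth_quadric_hypersurface n X"
    and "proj_action G n X \<rho>"
    and "generically_free G (proj_variety n X) (\<lambda>g. pgl_act (\<rho> g))"
    and "sylow_subgroup 2 G\<^sub>2 G"
  shows "stably_linearizable G (proj_variety n X) (\<lambda>g. pgl_act (\<rho> g)) \<longleftrightarrow>
    stably_linearizable (G\<lparr>carrier := G\<^sub>2\<rparr>) (proj_variety n X) (\<lambda>g. pgl_act (\<rho> g))"
proof
  have sub: "subgroup G\<^sub>2 G" using assms(7) by (simp add: sylow_subgroup_def)
  show "stably_linearizable (G\<lparr>carrier := G\<^sub>2\<rparr>) (proj_variety n X) (\<lambda>g. pgl_act (\<rho> g))"
    if "stably_linearizable G (proj_variety n X) (\<lambda>g. pgl_act (\<rho> g))"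
    using that subgroup.subset[OF sub] by (rule stably_linearizable_subgroup)
  assume lin: "stably_linearizable (G\<lparr>carrier := G\<^sub>2\<rparr>) (proj_variety n X) (\<lambda>g. pgl_act (\<rho> g))"
  obtain Q where Q: "quadric (n + 1) Q" and X: "X = {pt n u | u. (\<exists>i\<le>n. u i \<noteq> 0) \<and> qf (n + 1) Q u = 0}"
    by (rule smooth_quadric[OF assms(4,3)])
  show "stably_linearizable G (proj_variety n X) (\<lambda>g. pgl_act (\<rho> g))"
  proof (rule isometric_lifts[OF assms(1,5) Q X])
    fix a
    assume a: "\<And>g. g \<in> carrier G \<Longrightarrow> isometry (n + 1) Q (a g)"
      "\<And>g h. g \<in> carrier G \<Longrightarrow> h \<in> carrier G \<Longrightarrow>
        \<exists>\<epsilon>\<in>{1,-1}. \<forall>i<n + 1. \<forall>l<n + 1. (\<Sum>j<n + 1. a g i j * a h j l) = \<epsilon> * a (g \<otimes>\<^bsub>G\<^esub> h) i l"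
      "\<And>i l. i < n + 1 \<Longrightarrow> l < n + 1 \<Longrightarrow> a \<one>\<^bsub>G\<^esub> i l = (if i = l then 1 else 0)"
      "\<And>g u. g \<in> carrier G \<Longrightarrow> pgl_act (\<rho> g) (pt n u) = pt n (mv (n + 1) (a g) u)"
    interpret group G by (rule assms(1))
    interpret projective_lift G "n + 1" Q a n X "\<lambda>g. pgl_act (\<rho> g)"
      by unfold_locales (fact assms(2) a X refl)+
    show ?thesis
      by (rule stably_linearizable_descent[OF Q sub sylow_odd_index[OF assms(1,2,7)] assms(6) lin])
  qed
qed

end
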